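(* Let $\varphi,\psi:\mathbb{R}^d\to\mathbb{C}$ be measurable functions such that, for some constants $C,\varepsilon>0$, both $\gamma=\varphi$ and $\gamma=\psi$ satisfy $|\gamma(x)|\le C(1+|x|)^{-d-\varepsilon}$ for every $x\in\mathbb{R}^d$. Let $(h_k)$ be a scale, let $(u_k)$ be a bounded sequence in $L^2(\mathbb{R}^d)$, and suppose that $\mu$ is its Wigner measure at scale $(h_k)$. Suppose moreover that the measures $|\widehat\varphi(\xi+2\pi n)|^2\mu(x,\xi+2\pi n)$, $n\in\mathbb{Z}^d$, are mutually singular. Then the Wigner measure at scale $(h_k)$ of the sequence $(T_\psi^{h_k}S_\varphi^{h_k}u_k)$ is given by $$\mu_{\varphi,\psi}(x,\xi)=|\widehat\psi(\xi)|^2\sum_{n\in\mathbb{Z}^d}|\widehat\varphi(\xi+2\pi n)|^2\mu(x,\xi+2\pi n).$$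
   Context: A scale is a sequence of positive numbers tending to $0$. Fourier transform: $\widehat u(\xi)=\int_{\mathbb{R}^d}u(x)e^{-ix\cdot\xi}dx$. For $u\in\mathcal{S}'(\mathbb{R}^d)$ and $\varepsilon>0$, $m^\varepsilon[u]\in\mathcal{S}'(\mathbb{R}^d\times\mathbb{R}^d)$ is $$m^\varepsilon[u](x,\xi)=\frac{1}{(2\pi\varepsilon)^d}\overline{u(x)}\,\widehat u(\xi/\varepsilon)e^{ix\cdot\xi/\varepsilon}.$$ A positive Radon measure $\mu$ on $\mathbb{R}^d\times\mathbb{R}^d$ is the Wigner measure at scale $(\varepsilon_k)$ of $(u_k)$ if $m^{\varepsilon_k}[u_k]\to\mu$ weakly in $\mathcal{S}'(\mathbb{R}^d\times\mathbb{R}^d)$, i.e. $\langle m^{\varepsilon_k}[u_k],a\rangle\to\int a\,d\mu$ for all $a\in\mathcal{S}(\mathbb{R}^d\times\mathbb{R}^d)$. Sampling operator: $S_\varphi^hu(n)=h^{-d}\int_{\mathbb{R}^d}u(x)\overline{\varphi(x/h-n)}\,dx$, $n\in\mathbb{Z}^d$. Reconstruction operator: for $U=(U_n)_{n\in\mathbb{Z}^d}$ square-summable, $T_\psi^hU(x)=\sum_{n\in\mathbb{Z}^d}U_n\psi(x/h-n)$. $\mu(x,\xi+2\pi n)$ denotes the image of $\mu$ under $(x,\xi)\mapsto(x,\xi-2\pi n)$; thus $\int a(x,\xi)\,|f(\xi+2\pi n)|^2\,d\mu(x,\xi+2\pi n)=\int a(x,\xi-2\pi n)|f(\xi)|^2\,d\mu(x,\xi)$.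 "Mutually singular" means pairwise mutually singular. *)

theory Defs
  imports "HOL-Analysis.Analysis"
begin

section \<open>Schwartz functions and tempered distributions\<close>

primrec iterated_deriv ::
  "('a::real_normed_vector \<Rightarrow> 'b::real_normed_vector) \<Rightarrow> 'a list \<Rightarrow> 'a \<Rightarrow> 'b" where
  "iterated_deriv f [] = f"
| "iterated_deriv f (v # vs) = (\<lambda>x. frechet_derivative (iterated_deriv f vs) (at x) v)"

text \<open>Multi-indices are replaced by lists of basis vectors, and the monomial weights by powers of
  \<open>1 + \<bar>x\<bar>\<close>. Differentiability of all iterated partial derivatives makes the
  function smooth.\<close>

definition schwartz :: "('a::euclidean_space \<Rightarrow> complex) \<Rightarrow> bool" where
  "schwartz a \<longleftrightarrow> (\<forall>vs. set vs \<subseteq> Basis \<longrightarrow>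
     (\<forall>x. iterated_deriv a vs differentiable (at x)) \<and>
     (\<forall>N::nat. bounded (range (\<lambda>x. (1 + norm x) ^ N *\<^sub>R iterated_deriv a vs x))))"

definition schwartz_seminorm :: "nat \<Rightarrow> ('a::euclidean_space \<Rightarrow> complex) \<Rightarrow> real" where
  "schwartz_seminorm N a = (\<Sum>vs | set vs \<subseteq> Basis \<and> length vs \<le> N.
     SUP x. (1 + norm x) ^ N * norm (iterated_deriv a vs x))"

text \<open>A distribution is a functional on functions of which only the values on Schwartz
  functions are relevant.\<close>

type_synonym 'a functional = "('a \<Rightarrow> complex) \<Rightarrow> complex"

definition tempered_distribution :: "'a::euclidean_space functional \<Rightarrow> bool" where
  "tempered_distribution T \<longleftrightarrow>
     (\<forall>a b. schwartz a \<longrightarrow> schwartz b \<longrightarrow> T (\<lambda>x. a x + b x) = T a + T b) \<and>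
     (\<forall>a c. schwartz a \<longrightarrow> T (\<lambda>x. c * a x) = c * T a) \<and>
     (\<exists>C N. \<forall>a. schwartz a \<longrightarrow> norm (T a) \<le> C * schwartz_seminorm N a)"

definition distribution_of :: "('a::euclidean_space \<Rightarrow> complex) \<Rightarrow> 'a functional" where
  "distribution_of u a = (LINT x|lebesgue. u x * a x)"

text \<open>The integrability requirement excludes the convention that the integral of a
  non-integrable function is zero.\<close>

definition tempered_function :: "('a::euclidean_space \<Rightarrow> complex) \<Rightarrow> bool" where
  "tempered_function u \<longleftrightarrow>
     (\<forall>a. schwartz a \<longrightarrow> integrable lebesgue (\<lambda>x. u x * a x)) \<and>
     tempered_distribution (distribution_of u)"

definition fourier :: "('a::euclidean_space \<Rightarrow> complex) \<Rightarrow> 'a \<Rightarrow> complex" where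
  "fourier u \<xi> = (LINT x|lebesgue. u x * cis (- (x \<bullet> \<xi>)))"

definition fourier_dist :: "'a::euclidean_space functional \<Rightarrow> 'a functional" where
  "fourier_dist T a = T (fourier a)"

definition cnj_dist :: "'a functional \<Rightarrow> 'a functional" where
  "cnj_dist T a = cnj (T (\<lambda>x. cnj (a x)))"

text \<open>The distribution written \<open>T(\<xi> / \<epsilon>)\<close>.\<close>

definition dilate_dist :: "real \<Rightarrow> 'a::euclidean_space functional \<Rightarrow> 'a functional" where
  "dilate_dist \<epsilon> T a = of_real (\<epsilon> ^ DIM('a)) * T (\<lambda>\<xi>. a (\<epsilon> *\<^sub>R \<xi>))"

definition tensor_dist :: "'a functional \<Rightarrow> 'b functional \<Rightarrow> ('a \<times> 'b) functional" where
  "tensor_dist S T a = S (\<lambda>x. T (\<lambda>y. a (x, y)))"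

definition mult_dist :: "('a \<Rightarrow> complex) \<Rightarrow> 'a functional \<Rightarrow> 'a functional" where
  "mult_dist f T a = T (\<lambda>x. f x * a x)"

section \<open>Wigner measures\<close>

definition wigner_dist :: "real \<Rightarrow> 'a::euclidean_space functional \<Rightarrow> ('a \<times> 'a) functional" where
  "wigner_dist \<epsilon> T a = of_real (1 / (2 * pi * \<epsilon>) ^ DIM('a)) *
     mult_dist (\<lambda>(x, \<xi>). cis ((x \<bullet> \<xi>) / \<epsilon>))
       (tensor_dist (cnj_dist T) (dilate_dist \<epsilon> (fourier_dist T))) a"

definition is_scale :: "(nat \<Rightarrow> real) \<Rightarrow> bool" where
  "is_scale h \<longleftrightarrow> (\<forall>k. h k > 0) \<and> h \<longlonglongrightarrow> 0"

text \<open>On a Euclidean space, regularity of a locally finite Borel measure is automatic.\<close>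

definition radon_measure :: "'a::euclidean_space measure \<Rightarrow> bool" where
  "radon_measure M \<longleftrightarrow> sets M = sets borel \<and> (\<forall>K. compact K \<longrightarrow> emeasure M K < \<infinity>)"

text \<open>Convergence in the space of tempered distributions presupposes that the limit measure is
  tempered, i.e. that it integrates every Schwartz function.\<close>

definition is_wigner_measure ::
  "(nat \<Rightarrow> real) \<Rightarrow> (nat \<Rightarrow> 'a::euclidean_space \<Rightarrow> complex) \<Rightarrow> ('a \<times> 'a) measure \<Rightarrow> bool" where
  "is_wigner_measure h u M \<longleftrightarrow> radon_measure M \<and> (\<forall>k. tempered_function (u k)) \<and>
     (\<forall>a. schwartz a \<longrightarrow> integrable M a \<and>
        (\<lambda>k. wigner_dist (h k) (distribution_of (u k)) a) \<longlonglongrightarrow> (LINT z|M. a z))"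

section \<open>Square-integrable functions, sampling and reconstruction\<close>

definition square_integrable :: "('a::euclidean_space \<Rightarrow> complex) \<Rightarrow> bool" where
  "square_integrable u \<longleftrightarrow>
     u \<in> borel_measurable lebesgue \<and> integrable lebesgue (\<lambda>x. (norm (u x))\<^sup>2)"

definition L2_norm :: "('a::euclidean_space \<Rightarrow> complex) \<Rightarrow> real" where
  "L2_norm u = sqrt (LINT x|lebesgue. (norm (u x))\<^sup>2)"

definition bounded_in_L2 :: "(nat \<Rightarrow> 'a::euclidean_space \<Rightarrow> complex) \<Rightarrow> bool" where
  "bounded_in_L2 u \<longleftrightarrow> (\<forall>k. square_integrable (u k)) \<and> (\<exists>B. \<forall>k. L2_norm (u k) \<le> B)"

definition of_ivec :: "int ^ 'n \<Rightarrow> real ^ 'n" where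
  "of_ivec n = (\<chi> i. of_int (n $ i))"

definition sampling ::
  "(real ^ 'n \<Rightarrow> complex) \<Rightarrow> real \<Rightarrow> (real ^ 'n \<Rightarrow> complex) \<Rightarrow> int ^ 'n \<Rightarrow> complex" where
  "sampling \<phi> h u n =
     of_real (1 / h ^ CARD('n)) * (LINT x|lebesgue. u x * cnj (\<phi> (x /\<^sub>R h - of_ivec n)))"

definition reconstruction ::
  "(real ^ 'n \<Rightarrow> complex) \<Rightarrow> real \<Rightarrow> (int ^ 'n \<Rightarrow> complex) \<Rightarrow> real ^ 'n \<Rightarrow> complex" where
  "reconstruction \<psi> h U x = (\<Sum>\<^sub>\<infinity>n. U n * \<psi> (x /\<^sub>R h - of_ivec n))"

section \<open>Operations on measures\<close>

definition mutually_singular :: "'a measure \<Rightarrow> 'a measure \<Rightarrow> bool" where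
  "mutually_singular M N \<longleftrightarrow> sets M = sets N \<and>
     (\<exists>A\<in>sets M. emeasure M A = 0 \<and> emeasure N (space N - A) = 0)"

definition sum_measure :: "('i \<Rightarrow> 'a::topological_space measure) \<Rightarrow> 'a measure" where
  "sum_measure M =
     measure_of UNIV (sets borel) (\<lambda>A. \<integral>\<^sup>+i. emeasure (M i) A \<partial>count_space UNIV)"

lemma sets_sum_measure [simp, measurable_cong]:
  fixes M :: "'i \<Rightarrow> 'a::topological_space measure"
  shows "sets (sum_measure M) = sets borel"
  unfolding sum_measure_def using sets.sets_measure_of_eq[of "borel :: 'a measure"] by simp

lemma emeasure_sum_measure:
  fixes M :: "'i \<Rightarrow> 'a::topological_space measure"
  assumes "\<And>i. sets (M i) = sets borel" and "A \<in> sets borel"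
  shows "emeasure (sum_measure M) A = (\<integral>\<^sup>+i. emeasure (M i) A \<partial>count_space UNIV)"
proof (rule emeasure_measure_of[OF sum_measure_def])
  show "countably_additive (sets (sum_measure M))
      (\<lambda>A. \<integral>\<^sup>+i. emeasure (M i) A \<partial>count_space UNIV)"
  proof (rule countably_additiveI)
    fix B :: "nat \<Rightarrow> 'a set"
    assume B: "range B \<subseteq> sets (sum_measure M)" "disjoint_family B"
    have "(\<Sum>j. \<integral>\<^sup>+i. emeasure (M i) (B j) \<partial>count_space UNIV)
        = (\<integral>\<^sup>+i. (\<Sum>j. emeasure (M i) (B j)) \<partial>count_space UNIV)"
      by (rule nn_integral_suminf[symmetric]) simp
    also have "\<dots> = (\<integral>\<^sup>+i. emeasure (M i) (\<Union>j. B j) \<partial>count_space UNIV)"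
      using B assms(1) by (intro nn_integral_cong suminf_emeasure) auto
    finally show "(\<Sum>j. \<integral>\<^sup>+i. emeasure (M i) (B j) \<partial>count_space UNIV)
        = (\<integral>\<^sup>+i. emeasure (M i) (\<Union>j. B j) \<partial>count_space UNIV)" .
  qed
qed (use assms in \<open>auto simp: positive_def\<close>)

text \<open>The measure written \<open>\<mu>(x, \<xi> + 2\<pi>n)\<close>.\<close>

definition shift_measure ::
  "((real ^ 'n) \<times> (real ^ 'n)) measure \<Rightarrow> int ^ 'n \<Rightarrow> ((real ^ 'n) \<times> (real ^ 'n)) measure" where
  "shift_measure \<mu> n = distr \<mu> borel (\<lambda>(x, \<xi>). (x, \<xi> - (2 * pi) *\<^sub>R of_ivec n))"

text \<open>The measure written \<open>\<bar>F\<phi>(\<xi> + 2\<pi>n)\<bar>\<^sup>2 \<mu>(x, \<xi> + 2\<pi>n)\<close>, where \<open>F\<close> is the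
  Fourier transform.\<close>

definition weighted_shift ::
  "(real ^ 'n \<Rightarrow> complex) \<Rightarrow> ((real ^ 'n) \<times> (real ^ 'n)) measure \<Rightarrow> int ^ 'n \<Rightarrow>
     ((real ^ 'n) \<times> (real ^ 'n)) measure" where
  "weighted_shift \<phi> \<mu> n = density (shift_measure \<mu> n)
     (\<lambda>(x, \<xi>). ennreal ((norm (fourier \<phi> (\<xi> + (2 * pi) *\<^sub>R of_ivec n)))\<^sup>2))"

definition sampled_wigner_measure ::
  "(real ^ 'n \<Rightarrow> complex) \<Rightarrow> (real ^ 'n \<Rightarrow> complex) \<Rightarrow> ((real ^ 'n) \<times> (real ^ 'n)) measure \<Rightarrow>
     ((real ^ 'n) \<times> (real ^ 'n)) measure" where
  "sampled_wigner_measure \<phi> \<psi> \<mu> =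
     density (sum_measure (weighted_shift \<phi> \<mu>)) (\<lambda>(x, \<xi>). ennreal ((norm (fourier \<psi> \<xi>))\<^sup>2))"

end

theory Submission
  imports Defs
begin

text \<open>With \<open>T S\<close> for reconstruction after sampling: in the microscopic variable \<open>y = x / h\<close> the operator \<open>T S\<close> becomes a fixed operator \<open>A\<close>, bounded on
  \<open>L\<^sup>2\<close>, while the Wigner distribution tested on a Schwartz function differs by \<open>o(1)\<close> from the integral
  of that function against \<open>\<bar>V U\<bar>\<^sup>2\<close>, where \<open>V U\<close> is the short-time Fourier transform of \<open>U\<close> with
  a window of width \<open>h\<close> to the power \<open>-1/2\<close>. Averaging \<open>A\<close> over translated lattices against a Fejer kernel
  approximates it in operator norm by operators \<open>A\<^sub>M\<close> that multiply a convolution by a trigonometric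
  polynomial and convolve again; since \<open>V\<close> almost intertwines convolutions with multiplication by
  the Fourier transform of the kernel and turns modulations into frequency shifts, \<open>V (A\<^sub>M U)\<close> is,
  up to \<open>o(1)\<close>, the Fourier transform of \<open>\<psi>\<close> times a finite sum of frequency-shifted copies of \<open>V U\<close>, each
  weighted by the conjugate Fourier transform of \<open>\<phi>\<close>. Mutual singularity of the
  limits of the squared moduli of these copies makes all cross terms vanish, the coefficients of the
  Fejer kernel tend to 1, and dominated convergence gives the series.\<close>

section \<open>Integration tools\<close>

text \<open>The Wigner distribution has no sign. The squared modulus of a short-time transform is a
  density of bounded mass, and this extends convergence from Schwartz functions to all continuous
  functions vanishing at infinity. The larger class is forced: the squared Fourier transforms of
  \<phi> and \<psi> multiply the test function and are only continuous and bounded. The window width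
  lies between two microscopic lengths. The kernels live at length 1, where the window must be
  almost constant; the symbol, evaluated at h x, varies at length 1/h, where the window must be
  narrow. Sampling multiplies by a Dirac comb, whose Fourier coefficients all have the same size,
  and the Fourier transforms of \<phi> and \<psi> may decay too slowly for truncations to converge
  in norm. A nonnegative kernel of mass one turns the error into an average of differences between
  the operator and its copies for shifted lattices. These are small near the lattice, because
  translations are continuous in L1 while all lattice sums stay bounded.\<close>

lemma nn_integral_lborel_affine:
  fixes f :: "'a::euclidean_space \<Rightarrow> ennreal"
  assumes [measurable]: "f \<in> borel_measurable borel" and c: "c \<noteq> 0"
  shows "(\<integral>\<^sup>+x. f x \<partial>lborel) = ennreal (\<bar>c\<bar> ^ DIM('a)) * (\<integral>\<^sup>+x. f (t + c *\<^sub>R x) \<partial>lborel)"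
  by (subst lborel_affine[OF c, of t])
     (simp add: nn_integral_density nn_integral_distr nn_integral_cmult)

lemma integral_lborel_affine:
  fixes f :: "'a::euclidean_space \<Rightarrow> complex"
  assumes [measurable]: "f \<in> borel_measurable borel" and c: "c \<noteq> 0"
  shows "(LINT x|lborel. f x) = of_real (\<bar>c\<bar> ^ DIM('a)) * (LINT x|lborel. f (t + c *\<^sub>R x))"
proof -
  have "(LINT x|lborel. f x) = (LINT x|lborel. \<bar>c\<bar> ^ DIM('a) *\<^sub>R f (t + c *\<^sub>R x))"
    by (subst lborel_affine[OF c, of t])
       (simp add: integral_density integral_distr)
  then show ?thesis by (simp add: scaleR_conv_of_real)
qed

lemma nn_integral_lborel_shift:
  fixes f :: "'a::euclidean_space \<Rightarrow> ennreal"
  assumes "f \<in> borel_measurable borel"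
  shows "(\<integral>\<^sup>+x. f (x + t) \<partial>lborel) = (\<integral>\<^sup>+x. f x \<partial>lborel)"
    and "(\<integral>\<^sup>+x. f (x - t) \<partial>lborel) = (\<integral>\<^sup>+x. f x \<partial>lborel)"
    and "(\<integral>\<^sup>+x. f (t - x) \<partial>lborel) = (\<integral>\<^sup>+x. f x \<partial>lborel)"
  using nn_integral_lborel_affine[OF assms, of 1 t] nn_integral_lborel_affine[OF assms, of 1 "-t"]
    nn_integral_lborel_affine[OF assms, of "-1" t]
  by (simp_all add: add.commute)

lemma integral_lborel_shift:
  fixes f :: "'a::euclidean_space \<Rightarrow> complex"
  assumes "f \<in> borel_measurable borel"
  shows "(LINT x|lborel. f (x + t)) = (LINT x|lborel. f x)"
    and "(LINT x|lborel. f (x - t)) = (LINT x|lborel. f x)"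
    and "(LINT x|lborel. f (t - x)) = (LINT x|lborel. f x)"
  using integral_lborel_affine[OF assms, of 1 t] integral_lborel_affine[OF assms, of 1 "-t"]
    integral_lborel_affine[OF assms, of "-1" t]
  by (simp_all add: add.commute)

text \<open>Integrability is not a side condition: the integral of a non-integrable function is 0,
  which makes the inequality trivial in that case.\<close>

lemma norm_integral_le_nn_integral:
  fixes f :: "'a \<Rightarrow> 'b::{banach, second_countable_topology}"
  shows "ennreal (norm (LINT x|M. f x)) \<le> (\<integral>\<^sup>+x. ennreal (norm (f x)) \<partial>M)"
  by (cases "integrable M f") (auto simp: integral_norm_bound_ennreal not_integrable_integral_eq)

text \<open>Cauchy-Schwarz for \<open>f\<close> against the constant 1, with the weight
  \<open>k\<close> absorbed into the measure as a density.\<close>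

lemma Cauchy_Schwarz_weighted:
  fixes f k :: "'a \<Rightarrow> ennreal"
  assumes [measurable]: "f \<in> borel_measurable M" "k \<in> borel_measurable M"
  shows "(\<integral>\<^sup>+x. k x * f x \<partial>M)\<^sup>2 \<le> (\<integral>\<^sup>+x. k x \<partial>M) * (\<integral>\<^sup>+x. k x * (f x)\<^sup>2 \<partial>M)"
proof -
  have "(\<integral>\<^sup>+x. 1\<^sup>2 \<partial>density M k) = (\<integral>\<^sup>+x. k x \<partial>M)"
    by (subst nn_integral_density) auto
  then show ?thesis
    using Cauchy_Schwarz_nn_integral[of "\<lambda>_. 1" "density M k" f]
    by (simp add: nn_integral_density del: nn_integral_const)
qed

lemma norm_integral_square_le:
  fixes f g :: "'a \<Rightarrow> complex"
  assumes [measurable]: "f \<in> borel_measurable M" "g \<in> borel_measurable M"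
  shows "ennreal ((norm (LINT x|M. f x * g x))\<^sup>2)
    \<le> (\<integral>\<^sup>+x. ennreal ((norm (f x))\<^sup>2) \<partial>M) * (\<integral>\<^sup>+x. ennreal ((norm (g x))\<^sup>2) \<partial>M)"
proof -
  have "ennreal ((norm (LINT x|M. f x * g x))\<^sup>2) = (ennreal (norm (LINT x|M. f x * g x)))\<^sup>2"
    by (simp add: ennreal_power)
  also have "\<dots> \<le> (\<integral>\<^sup>+x. ennreal (norm (f x)) * ennreal (norm (g x)) \<partial>M)\<^sup>2"
    using norm_integral_le_nn_integral[of M "\<lambda>x. f x * g x"]
    by (intro power_mono) (auto simp: norm_mult ennreal_mult)
  also have "\<dots> \<le> (\<integral>\<^sup>+x. (ennreal (norm (f x)))\<^sup>2 \<partial>M) * (\<integral>\<^sup>+x. (ennreal (norm (g x)))\<^sup>2 \<partial>M)"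
    by (rule Cauchy_Schwarz_nn_integral) auto
  finally show ?thesis by (simp add: ennreal_power)
qed

lemma norm_integral_square_le_weighted:
  fixes f k :: "'a \<Rightarrow> complex"
  assumes [measurable]: "f \<in> borel_measurable M" "k \<in> borel_measurable M"
  shows "ennreal ((norm (LINT x|M. k x * f x))\<^sup>2)
    \<le> (\<integral>\<^sup>+x. ennreal (norm (k x)) \<partial>M) * (\<integral>\<^sup>+x. ennreal (norm (k x)) * ennreal ((norm (f x))\<^sup>2) \<partial>M)"
proof -
  have "ennreal ((norm (LINT x|M. k x * f x))\<^sup>2) = (ennreal (norm (LINT x|M. k x * f x)))\<^sup>2"
    by (simp add: ennreal_power)
  also have "\<dots> \<le> (\<integral>\<^sup>+x. ennreal (norm (k x)) * ennreal (norm (f x)) \<partial>M)\<^sup>2"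
    using norm_integral_le_nn_integral[of M "\<lambda>x. k x * f x"]
    by (intro power_mono) (auto simp: norm_mult ennreal_mult)
  also have "\<dots> \<le> (\<integral>\<^sup>+x. ennreal (norm (k x)) \<partial>M) * (\<integral>\<^sup>+x. ennreal (norm (k x)) * (ennreal (norm (f x)))\<^sup>2 \<partial>M)"
    by (rule Cauchy_Schwarz_weighted) auto
  finally show ?thesis by (simp add: ennreal_power)
qed

text \<open>The weighted Cauchy-Schwarz inequality spends one half of the modulus of
  \<open>k\<close> on the row sum; Tonelli's theorem then exposes the column sum. The two measures
  may differ, because sampling maps functions on space to sequences on the lattice and
  reconstruction maps them back.\<close>

lemma schur_test:
  fixes k :: "'a \<Rightarrow> 'b \<Rightarrow> complex" and f :: "'b \<Rightarrow> complex"
  assumes "sigma_finite_measure M" "sigma_finite_measure N"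
    and k[measurable]: "case_prod k \<in> borel_measurable (M \<Otimes>\<^sub>M N)"
    and f[measurable]: "f \<in> borel_measurable N"
    and \<alpha>: "\<And>x. (\<integral>\<^sup>+y. ennreal (norm (k x y)) \<partial>N) \<le> \<alpha>"
    and \<beta>: "\<And>y. (\<integral>\<^sup>+x. ennreal (norm (k x y)) \<partial>M) \<le> \<beta>"
  shows "(\<integral>\<^sup>+x. ennreal ((norm (LINT y|N. k x y * f y))\<^sup>2) \<partial>M)
    \<le> \<alpha> * \<beta> * (\<integral>\<^sup>+y. ennreal ((norm (f y))\<^sup>2) \<partial>N)"
proof -
  interpret M: sigma_finite_measure M by fact
  interpret N: sigma_finite_measure N by fact
  interpret pair_sigma_finite M N ..
  have "(\<integral>\<^sup>+x. ennreal ((norm (LINT y|N. k x y * f y))\<^sup>2) \<partial>M)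
      \<le> (\<integral>\<^sup>+x. \<alpha> * (\<integral>\<^sup>+y. ennreal (norm (k x y)) * ennreal ((norm (f y))\<^sup>2) \<partial>N) \<partial>M)"
    using \<alpha> by (intro nn_integral_mono order_trans[OF norm_integral_square_le_weighted] mult_right_mono) auto
  also have "\<dots> = \<alpha> * (\<integral>\<^sup>+x. (\<integral>\<^sup>+y. ennreal (norm (k x y)) * ennreal ((norm (f y))\<^sup>2) \<partial>N) \<partial>M)"
    by (rule nn_integral_cmult) measurable
  also have "(\<integral>\<^sup>+x. (\<integral>\<^sup>+y. ennreal (norm (k x y)) * ennreal ((norm (f y))\<^sup>2) \<partial>N) \<partial>M)
     = (\<integral>\<^sup>+y. (\<integral>\<^sup>+x. ennreal (norm (k x y)) * ennreal ((norm (f y))\<^sup>2) \<partial>M) \<partial>N)"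
    by (rule Fubini'[symmetric]) measurable
  also have "\<dots> = (\<integral>\<^sup>+y. (\<integral>\<^sup>+x. ennreal (norm (k x y)) \<partial>M) * ennreal ((norm (f y))\<^sup>2) \<partial>N)"
    by (intro nn_integral_cong nn_integral_multc) measurable
  also have "\<dots> \<le> (\<integral>\<^sup>+y. \<beta> * ennreal ((norm (f y))\<^sup>2) \<partial>N)"
    using \<beta> by (intro nn_integral_mono mult_right_mono) auto
  also have "\<dots> = \<beta> * (\<integral>\<^sup>+y. ennreal ((norm (f y))\<^sup>2) \<partial>N)"
    by (rule nn_integral_cmult) measurable
  finally show ?thesis by (simp add: mult_left_mono mult.assoc)
qed

text \<open>The square of the L2 norm. With values in \<open>ennreal\<close>, estimates can be
  chained first and finiteness is read off at the end.\<close>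

definition l2 :: "('a::euclidean_space \<Rightarrow> complex) \<Rightarrow> ennreal" where
  "l2 f = (\<integral>\<^sup>+x. ennreal ((norm (f x))\<^sup>2) \<partial>lborel)"

lemma norm_add_square_le:
  fixes a b :: "'a::real_normed_vector"
  shows "(norm (a + b))\<^sup>2 \<le> 2 * (norm a)\<^sup>2 + 2 * (norm b)\<^sup>2"
proof -
  have "(norm (a + b))\<^sup>2 \<le> (norm a + norm b)\<^sup>2"
    by (intro power_mono norm_triangle_ineq) auto
  also have "\<dots> \<le> 2 * (norm a)\<^sup>2 + 2 * (norm b)\<^sup>2"
    using sum_squares_bound[of "norm a" "norm b"] by (simp add: power2_sum)
  finally show ?thesis .
qed

lemma nn_integral_norm_add_square_le:
  fixes f g :: "'a \<Rightarrow> complex"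
  assumes [measurable]: "f \<in> borel_measurable M" "g \<in> borel_measurable M"
  shows "(\<integral>\<^sup>+x. ennreal ((norm (f x + g x))\<^sup>2) \<partial>M)
    \<le> 2 * (\<integral>\<^sup>+x. ennreal ((norm (f x))\<^sup>2) \<partial>M) + 2 * (\<integral>\<^sup>+x. ennreal ((norm (g x))\<^sup>2) \<partial>M)"
proof -
  have "(\<integral>\<^sup>+x. ennreal ((norm (f x + g x))\<^sup>2) \<partial>M)
    \<le> (\<integral>\<^sup>+x. 2 * ennreal ((norm (f x))\<^sup>2) + 2 * ennreal ((norm (g x))\<^sup>2) \<partial>M)"
  proof (rule nn_integral_mono)
    fix x
    have "ennreal ((norm (f x + g x))\<^sup>2) \<le> ennreal (2 * (norm (f x))\<^sup>2 + 2 * (norm (g x))\<^sup>2)"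
      by (intro ennreal_leI norm_add_square_le)
    then show "ennreal ((norm (f x + g x))\<^sup>2) \<le> 2 * ennreal ((norm (f x))\<^sup>2) + 2 * ennreal ((norm (g x))\<^sup>2)"
      by (simp add: ennreal_plus ennreal_mult)
  qed
  also have "\<dots> = 2 * (\<integral>\<^sup>+x. ennreal ((norm (f x))\<^sup>2) \<partial>M) + 2 * (\<integral>\<^sup>+x. ennreal ((norm (g x))\<^sup>2) \<partial>M)"
    by (simp add: nn_integral_add nn_integral_cmult)
  finally show ?thesis .
qed

lemma nn_integral_mult_integrable:
  fixes f g :: "'a \<Rightarrow> complex"
  assumes [measurable]: "f \<in> borel_measurable M" "g \<in> borel_measurable M"
    and "(\<integral>\<^sup>+x. ennreal ((norm (f x))\<^sup>2) \<partial>M) < \<infinity>" "(\<integral>\<^sup>+x. ennreal ((norm (g x))\<^sup>2) \<partial>M) < \<infinity>"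
  shows "integrable M (\<lambda>x. f x * g x)"
proof (rule integrableI_bounded)
  have "(\<integral>\<^sup>+x. ennreal (norm (f x)) * ennreal (norm (g x)) \<partial>M)\<^sup>2
    \<le> (\<integral>\<^sup>+x. (ennreal (norm (f x)))\<^sup>2 \<partial>M) * (\<integral>\<^sup>+x. (ennreal (norm (g x)))\<^sup>2 \<partial>M)"
    by (rule Cauchy_Schwarz_nn_integral) auto
  also have "\<dots> < \<infinity>" using assms by (simp add: ennreal_power ennreal_mult_less_top)
  finally show "(\<integral>\<^sup>+x. ennreal (norm (f x * g x)) \<partial>M) < \<infinity>"
    by (simp add: norm_mult ennreal_mult power_less_top_ennreal)
qed measurable

lemma integral_prod_lborel:
  fixes f :: "'a::euclidean_space \<times> 'b::euclidean_space \<Rightarrow> complex"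
  assumes "integrable lborel f"
  shows "(LINT z|lborel. f z) = (LINT x|lborel. LINT y|lborel. f (x, y))"
    and "(LINT z|lborel. f z) = (LINT y|lborel. LINT x|lborel. f (x, y))"
  using lborel_pair.integral_fst'[of f] lborel_pair.integral_snd[of "\<lambda>x y. f (x, y)"] assms
  by (simp_all add: lborel_prod split_beta')

lemma nn_integral_prod_lborel:
  fixes f :: "'a::euclidean_space \<times> 'b::euclidean_space \<Rightarrow> ennreal"
  assumes "f \<in> borel_measurable borel"
  shows "(\<integral>\<^sup>+z. f z \<partial>lborel) = (\<integral>\<^sup>+x. \<integral>\<^sup>+y. f (x, y) \<partial>lborel \<partial>lborel)"
    and "(\<integral>\<^sup>+z. f z \<partial>lborel) = (\<integral>\<^sup>+y. \<integral>\<^sup>+x. f (x, y) \<partial>lborel \<partial>lborel)"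
proof -
  have f: "f \<in> borel_measurable (lborel \<Otimes>\<^sub>M lborel)" using assms by (simp add: lborel_prod)
  show "(\<integral>\<^sup>+z. f z \<partial>lborel) = (\<integral>\<^sup>+x. \<integral>\<^sup>+y. f (x, y) \<partial>lborel \<partial>lborel)"
    using lborel.nn_integral_fst[OF f] by (simp add: lborel_prod)
  show "(\<integral>\<^sup>+z. f z \<partial>lborel) = (\<integral>\<^sup>+y. \<integral>\<^sup>+x. f (x, y) \<partial>lborel \<partial>lborel)"
    using lborel_pair.nn_integral_snd[OF f] by (simp add: lborel_prod)
qed

section \<open>Polynomially decaying weights\<close>

definition wt :: "real \<Rightarrow> 'a::real_normed_vector \<Rightarrow> real" where
  "wt p x = (1 + norm x) powr (- p)"

lemma wt_nonneg [simp]: "0 \<le> wt p x"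
  by (simp add: wt_def)

lemma wt_le_1: "0 \<le> p \<Longrightarrow> wt p x \<le> 1"
  unfolding wt_def using powr_mono2'[of "-p" 1 "1 + norm x"] by simp

lemma wt_measurable [measurable]: "wt p \<in> borel_measurable (borel :: 'a::euclidean_space measure)"
  unfolding wt_def[abs_def] by measurable

lemma wt_nat: "wt (real N) x = inverse ((1 + norm x) ^ N)"
  unfolding wt_def by (simp add: powr_minus powr_realpow add_pos_nonneg)

text \<open>Peetre's inequality: 1 + |x - y| is at most (1 + |x|)(1 + |y|), so moving the weight by
  \<open>y\<close> costs a factor that depends on \<open>y\<close> only.\<close>

lemma wt_shift_le:
  assumes "0 \<le> p"
  shows "wt p x \<le> (1 + norm y) powr p * wt p (x - y)"
proof -
  have "1 + norm (x - y) \<le> 1 + (norm x + norm y)"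
    using norm_triangle_ineq4[of x y] by simp
  also have "\<dots> \<le> (1 + norm x) * (1 + norm y)" by (simp add: algebra_simps)
  finally have *: "(1 + norm (x - y)) powr p \<le> (1 + norm x) powr p * (1 + norm y) powr p"
    using assms by (subst powr_mult[symmetric]) (auto intro!: powr_mono2)
  have pos: "0 < (1 + norm z) powr p" for z :: 'a
    by (metis add_pos_nonneg norm_ge_zero powr_gt_zero zero_less_one less_irrefl)
  show ?thesis
    unfolding wt_def powr_minus using * pos[of x] pos[of "x - y"]
    by (simp add: field_simps)
qed

text \<open>Dyadic decomposition: where 1 + |x| lies between 2^k and 2^(k+1), the weight is at most
  2^(-pk) and x lies in a ball of radius 2^(k+1), of volume proportional to 2^(dk). The resulting
  series is geometric with ratio \<open>q\<close>, which is below 1 exactly because \<open>p\<close>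
  exceeds the dimension.\<close>

lemma wt_integrable:
  fixes p :: real
  assumes p: "real DIM('a::euclidean_space) < p"
  shows "(\<integral>\<^sup>+(x::'a). ennreal (wt p x) \<partial>lborel) < \<infinity>"
proof -
  let ?d = "DIM('a)"
  define v where "v = unit_ball_vol (real ?d)"
  define q where "q = 2 powr (real ?d - p)"
  have q: "0 < q" "q < 1" using p unfolding q_def by (auto simp: powr_less_one)
  have v: "0 \<le> v" by (simp add: v_def)
  have "(\<integral>\<^sup>+(x::'a). ennreal (wt p x) \<partial>lborel)
    \<le> (\<integral>\<^sup>+(x::'a). (\<Sum>k. ennreal ((2 powr (-p)) ^ k) * indicator (ball 0 (2 ^ Suc k)) x) \<partial>lborel)"
  proof (rule nn_integral_mono)
    fix x :: 'a
    define k where "k = nat \<lfloor>log 2 (1 + norm x)\<rfloor>"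
    have l0: "0 \<le> log 2 (1 + norm x)"
      by (subst zero_le_log_cancel_iff) (auto simp: add_pos_nonneg)
    have k: "real k \<le> log 2 (1 + norm x)" "log 2 (1 + norm x) < real k + 1"
      unfolding k_def using l0 by linarith+
    have "2 powr (real k) \<le> 1 + norm x" 
      using k(1) by (subst (asm) le_log_iff) (auto simp: add_pos_nonneg)
    then have "wt p x \<le> (2 powr real k) powr (-p)"
      unfolding wt_def using p by (intro powr_mono2') auto
    also have "\<dots> = (2 powr (-p)) ^ k" by (simp add: powr_powr powr_realpow[symmetric] mult.commute)
    finally have 1: "wt p x \<le> (2 powr (-p)) ^ k" .
    have "1 + norm x < 2 powr (real k + 1)"
      using k(2) by (subst (asm) log_less_iff) (auto simp: add_pos_nonneg)
    also have "\<dots> = 2 ^ Suc k" by (subst powr_realpow[symmetric]) (auto simp: algebra_simps)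
    finally have 2: "x \<in> ball 0 (2 ^ Suc k)" by simp
    have "ennreal (wt p x) \<le> ennreal ((2 powr (-p)) ^ k) * indicator (ball 0 (2 ^ Suc k)) x"
      using 1 2 by (simp add: ennreal_leI)
    also have "\<dots> \<le> (\<Sum>k. ennreal ((2 powr (-p)) ^ k) * indicator (ball 0 (2 ^ Suc k)) x)"
      (is "?f k \<le> _")
    proof -
      define f where "f = ?f"
      have "sum f {k} \<le> suminf f" by (rule sum_le_suminf) auto
      then have "f k \<le> suminf f" by simp
      then show ?thesis unfolding f_def .
    qed
    finally show "ennreal (wt p x) \<le> (\<Sum>k. ennreal ((2 powr (-p)) ^ k) * indicator (ball 0 (2 ^ Suc k)) x)" .
  qed
  also have "\<dots> = (\<Sum>k. ennreal ((2 powr (-p)) ^ k) * emeasure lborel (ball (0::'a) (2 ^ Suc k)))"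
  proof -
    define A c where "A k = ball (0::'a) (2 ^ Suc k)" and "c k = ennreal ((2 powr (-p)) ^ k)" for k
    have A: "A k \<in> sets lborel" for k by (simp add: A_def)
    have "(\<integral>\<^sup>+x. (\<Sum>k. c k * indicator (A k) x) \<partial>lborel) = (\<Sum>k. \<integral>\<^sup>+x. c k * indicator (A k) x \<partial>lborel)"
      by (rule nn_integral_suminf) (use A in measurable)
    also have "\<dots> = (\<Sum>k. c k * emeasure lborel (A k))"
      by (simp only: nn_integral_cmult_indicator[OF A])
    finally show ?thesis unfolding A_def c_def .
  qed
  also have "\<dots> = (\<Sum>k. ennreal (v * 2 ^ ?d * q ^ k))"
  proof (rule arg_cong[where f = suminf], rule ext)
    fix k
    have "(2 powr (-p)) ^ k * (2 ^ Suc k) ^ ?d = 2 ^ ?d * q ^ k"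
    proof -
      have "q = 2 powr (-p) * 2 ^ ?d"
        unfolding q_def by (simp add: powr_diff powr_minus powr_realpow divide_simps)
      then show ?thesis by (simp add: power_mult_distrib power_mult[symmetric] mult.commute mult.left_commute)
    qed
    then show "ennreal ((2 powr (-p)) ^ k) * emeasure lborel (ball (0::'a) (2 ^ Suc k)) = ennreal (v * 2 ^ ?d * q ^ k)"
      using v by (subst emeasure_ball) (auto simp: v_def ennreal_mult[symmetric] mult_ac)
  qed
  also have "\<dots> < \<infinity>"
  proof -
    have "summable (\<lambda>k. v * 2 ^ ?d * q ^ k)"
      using q by (intro summable_mult summable_geometric) auto
    then show ?thesis using q v by (subst suminf_ennreal2) auto
  qed
  finally show ?thesis .
qed

lemma wt_integrable_real:
  assumes "real DIM('a::euclidean_space) < p"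
  shows "integrable lborel (wt p :: 'a \<Rightarrow> real)"
  using wt_integrable[OF assms] by (intro integrableI_bounded) auto

section \<open>Schwartz functions\<close>

text \<open>The head of the list is the outermost derivative, so differentiating \<open>f\<close>
  before everything else appends its direction at the end.\<close>

lemma iterated_deriv_snoc:
  "iterated_deriv f (vs @ [v]) = iterated_deriv (\<lambda>x. frechet_derivative f (at x) v) vs"
  by (induction vs) auto

lemma schwartz_deriv:
  assumes "schwartz a" "v \<in> Basis"
  shows "schwartz (\<lambda>x. frechet_derivative a (at x) v)"
  unfolding schwartz_def
proof (intro allI impI)
  fix vs :: "'a list" assume "set vs \<subseteq> Basis"
  then have "set (vs @ [v]) \<subseteq> Basis" using assms by simp
  with assms(1) show "(\<forall>x. iterated_deriv (\<lambda>x. frechet_derivative a (at x) v) vs differentiable (at x)) \<and>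
     (\<forall>N. bounded (range (\<lambda>x. (1 + norm x) ^ N *\<^sub>R iterated_deriv (\<lambda>x. frechet_derivative a (at x) v) vs x)))"
    unfolding schwartz_def iterated_deriv_snoc[symmetric] by blast
qed

lemma schwartz_differentiable: "schwartz a \<Longrightarrow> a differentiable (at x)"
  unfolding schwartz_def by (metis empty_set empty_subsetI iterated_deriv.simps(1))

lemma schwartz_has_derivative: "schwartz a \<Longrightarrow> (a has_derivative frechet_derivative a (at x)) (at x)"
  using schwartz_differentiable frechet_derivative_works by blast

lemma schwartz_continuous: "schwartz a \<Longrightarrow> continuous_on UNIV a"
  by (simp add: continuous_at_imp_continuous_on differentiable_imp_continuous_within schwartz_differentiable)

lemma schwartz_measurable: "schwartz a \<Longrightarrow> a \<in> borel_measurable borel"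
  by (intro borel_measurable_continuous_onI schwartz_continuous)

lemma schwartz_decay:
  assumes "schwartz a"
  obtains C where "0 \<le> C" "\<And>x. norm (a x) \<le> C * wt (real N) x"
proof -
  have "bounded (range (\<lambda>x. (1 + norm x) ^ N *\<^sub>R iterated_deriv a [] x))"
    using assms unfolding schwartz_def by (metis empty_set empty_subsetI)
  then obtain C where C: "norm ((1 + norm x) ^ N *\<^sub>R a x) \<le> C" for x
    unfolding bounded_iff by auto
  have "norm (a x) \<le> C * wt (real N) x" for x
    using C[of x] by (simp add: wt_nat field_simps add_pos_nonneg)
  moreover have "0 \<le> C" using C[of 0] norm_ge_zero order_trans by blast
  ultimately show ?thesis using that by blast
qed

lemma schwartz_bounded:
  assumes "schwartz a"
  obtains C where "0 \<le> C" "\<And>x. norm (a x) \<le> C"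
proof -
  obtain C where C: "0 \<le> C" "\<And>x. norm (a x) \<le> C * wt (real 0) x"
    using schwartz_decay[OF assms] by metis
  have "norm (a x) \<le> C" for x using C(2)[of x] unfolding wt_nat by simp
  with C(1) show ?thesis using that by blast
qed

lemma wt_Pair_le: "0 \<le> p \<Longrightarrow> wt p (x, \<xi>) \<le> wt p \<xi>"
  unfolding wt_def using norm_snd_le[of \<xi> x] by (intro powr_mono2') (auto simp: add_pos_nonneg)

lemma schwartz_derivative_bound:
  assumes "schwartz a"
  obtains C where "0 \<le> C" "\<And>x v. norm (frechet_derivative a (at x) v) \<le> C * wt (real N) x * norm v"
proof -
  have "\<forall>b\<in>Basis. \<exists>C. 0 \<le> C \<and> (\<forall>x. norm (frechet_derivative a (at x) b) \<le> C * wt (real N) x)"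
    using schwartz_decay[OF schwartz_deriv[OF assms]] by metis
  then obtain C where C: "\<And>b. b \<in> Basis \<Longrightarrow> 0 \<le> C b"
    "\<And>b x. b \<in> Basis \<Longrightarrow> norm (frechet_derivative a (at x) b) \<le> C b * wt (real N) x" by metis
  have "norm (frechet_derivative a (at x) v) \<le> (\<Sum>b\<in>Basis. C b) * wt (real N) x * norm v" for x v
  proof -
    have lin: "linear (frechet_derivative a (at x))"
      using schwartz_differentiable[OF assms] linear_frechet_derivative by blast
    have "frechet_derivative a (at x) v = frechet_derivative a (at x) (\<Sum>b\<in>Basis. (v \<bullet> b) *\<^sub>R b)"
      by (simp add: euclidean_representation)
    also have "\<dots> = (\<Sum>b\<in>Basis. (v \<bullet> b) *\<^sub>R frechet_derivative a (at x) b)"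
      by (simp add: linear_sum[OF lin] linear_scale[OF lin])
    finally have "norm (frechet_derivative a (at x) v) \<le> (\<Sum>b\<in>Basis. norm ((v \<bullet> b) *\<^sub>R frechet_derivative a (at x) b))"
      by (metis norm_sum)
    also have "\<dots> \<le> (\<Sum>b\<in>Basis. norm v * (C b * wt (real N) x))"
      using C by (intro sum_mono) (auto intro!: mult_mono Basis_le_norm)
    finally show ?thesis by (simp add: sum_distrib_left sum_distrib_right mult_ac)
  qed
  moreover have "0 \<le> (\<Sum>b\<in>Basis. C b)" using C by (intro sum_nonneg) auto
  ultimately show ?thesis using that by blast
qed

text \<open>Along the segment from (x', \<xi>) to (x, \<xi>) the weight in \<xi> is constant, so the
  mean value inequality keeps it. This makes the difference integrable in \<xi>, with a bound
  proportional to the distance of the base points.\<close>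

lemma schwartz_lipschitz_fst:
  fixes a :: "'a::euclidean_space \<times> 'b::euclidean_space \<Rightarrow> complex"
  assumes "schwartz a"
  obtains C where "0 \<le> C" "\<And>x x' \<xi>. norm (a (x, \<xi>) - a (x', \<xi>)) \<le> C * wt (real N) \<xi> * norm (x - x')"
proof -
  obtain C where C: "0 \<le> C" "\<And>z v. norm (frechet_derivative a (at z) v) \<le> C * wt (real N) z * norm v"
    using schwartz_derivative_bound[OF assms] by metis
  have "norm (a (x, \<xi>) - a (x', \<xi>)) \<le> C * wt (real N) \<xi> * norm (x - x')" for x x' \<xi>
  proof (rule differentiable_bound[of UNIV "\<lambda>x. a (x, \<xi>)" "\<lambda>x v. frechet_derivative a (at (x, \<xi>)) (v, 0)"])
    fix x :: 'a
    show "((\<lambda>x. a (x, \<xi>)) has_derivative (\<lambda>v. frechet_derivative a (at (x, \<xi>)) (v, 0))) (at x within UNIV)"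
      by (rule has_derivative_compose[OF _ schwartz_has_derivative[OF assms], of "\<lambda>x. (x, \<xi>)" "\<lambda>v. (v, 0)"])
         (auto intro!: derivative_eq_intros)
    show "onorm (\<lambda>v. frechet_derivative a (at (x, \<xi>)) (v, 0)) \<le> C * wt (real N) \<xi>"
    proof (rule onorm_bound)
      show "norm (frechet_derivative a (at (x, \<xi>)) (v, 0)) \<le> C * wt (real N) \<xi> * norm v" for v :: 'a
      proof -
        have "norm (frechet_derivative a (at (x, \<xi>)) (v, 0)) \<le> C * wt (real N) (x, \<xi>) * norm v"
          using C(2)[of "(x, \<xi>)" "(v, 0)"] by simp
        also have "\<dots> \<le> C * wt (real N) \<xi> * norm v"
          using C(1) wt_Pair_le[of "real N" x \<xi>] by (intro mult_right_mono mult_left_mono) auto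
        finally show ?thesis .
      qed
    qed (use C in auto)
  qed auto
  with C(1) show ?thesis using that by blast
qed

section \<open>Partial Fourier transforms of Schwartz functions\<close>

text \<open>Fourier transform in the second variable only. In microscopic variables the Wigner
  distribution tests \<open>a\<close> through the kernel
  \<open>pft a (h *\<^sub>R x) (y - x)\<close>.\<close>

definition pft :: "('a::euclidean_space \<times> 'a \<Rightarrow> complex) \<Rightarrow> 'a \<Rightarrow> 'a \<Rightarrow> complex" where
  "pft a x z = (LINT \<xi>|lborel. a (x, \<xi>) * cis (- (\<xi> \<bullet> z)))"

lemma cis_measurable [measurable (raw)]: "f \<in> borel_measurable M \<Longrightarrow> (\<lambda>x. cis (f x)) \<in> borel_measurable M"
  unfolding cis_conv_exp by measurable

lemma pft_measurable [measurable (raw)]: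
  assumes [measurable]: "a \<in> borel_measurable borel" "f \<in> measurable M borel" "g \<in> measurable M borel"
  shows "(\<lambda>w. pft a (f w) (g w)) \<in> borel_measurable M"
  unfolding pft_def by measurable

lemma schwartz_section_integrable:
  fixes a :: "'a::euclidean_space \<times> 'b::euclidean_space \<Rightarrow> complex"
  assumes "schwartz a"
  shows "integrable lborel (\<lambda>\<xi>. a (x, \<xi>))"
proof -
  obtain C where C: "0 \<le> C" "\<And>z. norm (a z) \<le> C * wt (real (Suc DIM('b))) z"
    using schwartz_decay[OF assms] by metis
  note [measurable] = schwartz_measurable[OF assms]
  show ?thesis
  proof (rule Bochner_Integration.integrable_bound)
    show "integrable lborel (\<lambda>\<xi>::'b. C * wt (real (Suc DIM('b))) \<xi>)"
      by (intro integrable_mult_right wt_integrable_real) simp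
    show "AE \<xi> in lborel. norm (a (x, \<xi>)) \<le> norm (C * wt (real (Suc DIM('b))) \<xi>)"
    proof (rule AE_I2)
      fix \<xi> :: 'b
      have "norm (a (x, \<xi>)) \<le> C * wt (real (Suc DIM('b))) (x, \<xi>)" by (rule C)
      also have "\<dots> \<le> C * wt (real (Suc DIM('b))) \<xi>"
        using C(1) by (intro mult_left_mono wt_Pair_le) auto
      finally show "norm (a (x, \<xi>)) \<le> norm (C * wt (real (Suc DIM('b))) \<xi>)" by (simp add: abs_of_nonneg C(1))
    qed
  qed measurable
qed

lemma integrable_mult_cis:
  fixes f :: "'a \<Rightarrow> complex"
  assumes "integrable M f" and [measurable]: "g \<in> borel_measurable M"
  shows "integrable M (\<lambda>x. f x * cis (g x))"
  using assms(1) by (rule Bochner_Integration.integrable_bound) (use assms in \<open>auto simp: norm_mult\<close>)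

text \<open>The dominating function for differentiation under the integral. Steps are at most 1 and
  \<open>b\<close> is a unit vector, so Peetre's inequality shifts the weight back at the price of
  2^N.\<close>

lemma schwartz_directional_quotient:
  fixes a :: "'a::euclidean_space \<times> 'b::euclidean_space \<Rightarrow> complex"
  assumes "schwartz a" "b \<in> Basis"
  obtains C where "0 \<le> C"
    "\<And>x \<xi> t. 0 < t \<Longrightarrow> t \<le> 1 \<Longrightarrow> norm ((a (x, \<xi> + t *\<^sub>R b) - a (x, \<xi>)) / of_real t) \<le> C * wt (real N) \<xi>"
proof -
  obtain C where C: "0 \<le> C" "\<And>z v. norm (frechet_derivative a (at z) v) \<le> C * wt (real N) z * norm v"
    using schwartz_derivative_bound[OF assms(1)] by metis
  have "norm ((a (x, \<xi> + t *\<^sub>R b) - a (x, \<xi>)) / of_real t) \<le> C * 2 ^ N * wt (real N) \<xi>"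
    if t: "0 < t" "t \<le> 1" for x \<xi> t
  proof -
    have "norm (a (x, \<xi> + t *\<^sub>R b) - a (x, \<xi> + 0 *\<^sub>R b)) \<le> C * 2 ^ N * wt (real N) \<xi> * norm (t - 0)"
    proof (rule differentiable_bound[of "{0..t}" "\<lambda>s. a (x, \<xi> + s *\<^sub>R b)"
          "\<lambda>s r. frechet_derivative a (at (x, \<xi> + s *\<^sub>R b)) (0, r *\<^sub>R b)"])
      fix s assume s: "s \<in> {0..t}"
      show "((\<lambda>s. a (x, \<xi> + s *\<^sub>R b)) has_derivative
          (\<lambda>r. frechet_derivative a (at (x, \<xi> + s *\<^sub>R b)) (0, r *\<^sub>R b))) (at s within {0..t})"
        by (rule has_derivative_compose[OF _ schwartz_has_derivative[OF assms(1)],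
              of "\<lambda>s. (x, \<xi> + s *\<^sub>R b)" "\<lambda>r. (0, r *\<^sub>R b)"]) (auto intro!: derivative_eq_intros)
      show "onorm (\<lambda>r. frechet_derivative a (at (x, \<xi> + s *\<^sub>R b)) (0, r *\<^sub>R b)) \<le> C * 2 ^ N * wt (real N) \<xi>"
      proof (rule onorm_bound)
        fix r :: real
        have "wt (real N) (x, \<xi> + s *\<^sub>R b) \<le> wt (real N) (\<xi> + s *\<^sub>R b)" by (rule wt_Pair_le) simp
        also have "\<dots> \<le> (1 + norm (s *\<^sub>R b)) powr (real N) * wt (real N) (\<xi> + s *\<^sub>R b - s *\<^sub>R b)"
          by (rule wt_shift_le) simp
        also have "\<dots> \<le> 2 powr (real N) * wt (real N) \<xi>"
          using s t assms(2) by (auto intro!: mult_mono powr_mono2)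
        also have "2 powr (real N) = 2 ^ N" by (simp add: powr_realpow)
        finally have *: "wt (real N) (x, \<xi> + s *\<^sub>R b) \<le> 2 ^ N * wt (real N) \<xi>" .
        have "norm (frechet_derivative a (at (x, \<xi> + s *\<^sub>R b)) (0, r *\<^sub>R b))
            \<le> C * wt (real N) (x, \<xi> + s *\<^sub>R b) * norm r"
          using C(2)[of "(x, \<xi> + s *\<^sub>R b)" "(0, r *\<^sub>R b)"] assms(2) by (simp add: norm_Pair)
        also have "\<dots> \<le> C * (2 ^ N * wt (real N) \<xi>) * norm r"
          using C * by (intro mult_right_mono mult_left_mono) auto
        finally show "norm (frechet_derivative a (at (x, \<xi> + s *\<^sub>R b)) (0, r *\<^sub>R b))
            \<le> C * 2 ^ N * wt (real N) \<xi> * norm r" by (simp add: mult_ac)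
      qed (use C in auto)
    qed (use t in auto)
    then show ?thesis using t by (simp add: norm_divide field_simps)
  qed
  moreover have "0 \<le> C * 2 ^ N" using C by simp
  ultimately show ?thesis using that by blast
qed

text \<open>Shifting \<xi> by t b multiplies the partial transform by a phase. The difference
  quotient therefore has transform (phase - 1)/t times \<open>pft a x z\<close>; as t tends to 0,
  dominated convergence identifies one side and the derivative of the exponential the other.\<close>

lemma pft_deriv:
  fixes a :: "'a::euclidean_space \<times> 'a \<Rightarrow> complex"
  assumes a: "schwartz a" and b: "b \<in> Basis"
  shows "pft (\<lambda>z. frechet_derivative a (at z) (0, b)) x z = \<i> * of_real (z \<bullet> b) * pft a x z"
proof -
  note [measurable] = schwartz_measurable[OF a]
  have b': "(0, b) \<in> Basis" using b by (simp add: Basis_prod_def)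
  have [measurable]: "(\<lambda>z. frechet_derivative a (at z) (0, b)) \<in> borel_measurable borel"
    using schwartz_measurable[OF schwartz_deriv[OF a b']] .
  define t where "t n = inverse (real (Suc n))" for n
  have t: "0 < t n" "t n \<le> 1" for n by (auto simp: t_def inverse_le_1_iff)
  have t0: "t \<longlonglongrightarrow> 0" unfolding t_def using LIMSEQ_inverse_real_of_nat .
  define q where "q n \<xi> = (a (x, \<xi> + t n *\<^sub>R b) - a (x, \<xi>)) / of_real (t n)" for n \<xi>
  obtain C where C: "0 \<le> C"
    "\<And>x \<xi> t. 0 < t \<Longrightarrow> t \<le> 1 \<Longrightarrow> norm ((a (x, \<xi> + t *\<^sub>R b) - a (x, \<xi>)) / of_real t) \<le> C * wt (real (Suc DIM('a))) \<xi>"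
    using schwartz_directional_quotient[OF a b] by metis
  have "(\<lambda>n. LINT \<xi>|lborel. q n \<xi> * cis (- (\<xi> \<bullet> z))) \<longlonglongrightarrow> pft (\<lambda>z. frechet_derivative a (at z) (0, b)) x z"
    unfolding pft_def
  proof (rule integral_dominated_convergence[where w = "\<lambda>\<xi>. C * wt (real (Suc DIM('a))) \<xi>"])
    show "integrable lborel (\<lambda>\<xi>::'a. C * wt (real (Suc DIM('a))) \<xi>)"
      by (intro integrable_mult_right wt_integrable_real) simp
    show "AE \<xi> in lborel. (\<lambda>n. q n \<xi> * cis (- (\<xi> \<bullet> z))) \<longlonglongrightarrow> frechet_derivative a (at (x, \<xi>)) (0, b) * cis (- (\<xi> \<bullet> z))"
    proof (intro AE_I2 tendsto_mult_right)
      fix \<xi>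
      let ?D = "frechet_derivative a (at (x, \<xi>))"
      have lin: "linear ?D" using schwartz_differentiable[OF a] linear_frechet_derivative by blast
      have "((\<lambda>h. norm (a ((x, \<xi>) + h) - a (x, \<xi>) - ?D h) / norm h) \<longlongrightarrow> 0) (at 0)"
        using schwartz_has_derivative[OF a, of "(x, \<xi>)"] unfolding has_derivative_at by blast
      moreover have "filterlim (\<lambda>n. t n *\<^sub>R (0, b)) (at (0::'a \<times> 'a)) sequentially"
        unfolding filterlim_at using t t0 b
        by (auto intro!: tendsto_eq_intros simp: zero_prod_def nonzero_Basis less_imp_neq[symmetric] intro: always_eventually)
      ultimately have "(\<lambda>n. norm (a ((x, \<xi>) + t n *\<^sub>R (0, b)) - a (x, \<xi>) - ?D (t n *\<^sub>R (0, b))) / norm (t n *\<^sub>R (0::'a, b))) \<longlonglongrightarrow> 0"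
        by (rule filterlim_compose)
      moreover have "norm (a ((x, \<xi>) + t n *\<^sub>R (0, b)) - a (x, \<xi>) - ?D (t n *\<^sub>R (0, b))) / norm (t n *\<^sub>R (0::'a, b))
          = norm (q n \<xi> - ?D (0, b))" for n
      proof -
        have "q n \<xi> - ?D (0, b) = (a ((x, \<xi>) + t n *\<^sub>R (0, b)) - a (x, \<xi>) - ?D (t n *\<^sub>R (0, b))) / of_real (t n)"
          unfolding linear_scale[OF lin] q_def using t[of n] by (simp add: scaleR_conv_of_real field_simps)
        then show ?thesis using t[of n] b by (simp add: norm_divide norm_Pair)
      qed
      ultimately show "(\<lambda>n. q n \<xi>) \<longlonglongrightarrow> ?D (0, b)"
        using tendsto_norm_zero_iff LIM_zero_cancel by fastforce
    qed
    show "\<And>n. AE \<xi> in lborel. norm (q n \<xi> * cis (- (\<xi> \<bullet> z))) \<le> C * wt (real (Suc DIM('a))) \<xi>"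
      unfolding q_def norm_mult norm_cis mult_1_right by (intro AE_I2 C(2) t)
  qed (unfold q_def, measurable)
  moreover have "(LINT \<xi>|lborel. q n \<xi> * cis (- (\<xi> \<bullet> z))) = (cis (t n * (z \<bullet> b)) - 1) / of_real (t n) * pft a x z" for n
  proof -
    have i1: "integrable lborel (\<lambda>\<xi>. a (x, \<xi>) * cis (- (\<xi> \<bullet> z)))"
      by (intro integrable_mult_cis schwartz_section_integrable[OF a]) measurable
    have eq: "a (x, \<xi> + t n *\<^sub>R b) * cis (- (\<xi> \<bullet> z)) = cis (t n * (z \<bullet> b)) * (a (x, \<xi> + t n *\<^sub>R b) * cis (- ((\<xi> + t n *\<^sub>R b) \<bullet> z)))" for \<xi>
    proof -
      have "cis (- (\<xi> \<bullet> z)) = cis (t n * (z \<bullet> b)) * cis (- ((\<xi> + t n *\<^sub>R b) \<bullet> z))"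
        unfolding cis_mult by (simp add: inner_add_left inner_commute[of b z])
      then show ?thesis by simp
    qed
    have i2': "integrable lborel (\<lambda>\<xi>. a (x, \<xi> + t n *\<^sub>R b) * cis (- ((\<xi> + t n *\<^sub>R b) \<bullet> z)))"
      using i1 by (subst (asm) integrable_iff_bounded, subst integrable_iff_bounded)
        (use nn_integral_lborel_shift(1)[of "\<lambda>\<xi>. ennreal (norm (a (x, \<xi>) * cis (- (\<xi> \<bullet> z))))" "t n *\<^sub>R b"] in auto)
    have "(LINT \<xi>|lborel. a (x, \<xi> + t n *\<^sub>R b) * cis (- (\<xi> \<bullet> z))) = cis (t n * (z \<bullet> b)) * pft a x z"
      unfolding eq pft_def using integral_lborel_shift(1)[of "\<lambda>\<xi>. a (x, \<xi>) * cis (- (\<xi> \<bullet> z))" "t n *\<^sub>R b"]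
      by simp
    moreover have "integrable lborel (\<lambda>\<xi>. a (x, \<xi> + t n *\<^sub>R b) * cis (- (\<xi> \<bullet> z)))"
      unfolding eq using i2' by (rule integrable_mult_right)
    ultimately have "(LINT \<xi>|lborel. (a (x, \<xi> + t n *\<^sub>R b) * cis (- (\<xi> \<bullet> z)) - a (x, \<xi>) * cis (- (\<xi> \<bullet> z))) / of_real (t n))
        = (cis (t n * (z \<bullet> b)) * pft a x z - pft a x z) / of_real (t n)"
      using i1 by (simp add: pft_def)
    then show ?thesis unfolding q_def by (simp add: field_simps)
  qed
  moreover have "(\<lambda>n. (cis (t n * (z \<bullet> b)) - 1) / of_real (t n) * pft a x z) \<longlonglongrightarrow> \<i> * of_real (z \<bullet> b) * pft a x z"
  proof (rule tendsto_mult_right)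
    have "((\<lambda>s. exp (\<i> * of_real (z \<bullet> b) * s)) has_field_derivative \<i> * of_real (z \<bullet> b)) (at 0)"
      by (auto intro!: derivative_eq_intros)
    then have "((\<lambda>s. (exp (\<i> * of_real (z \<bullet> b) * s) - 1) / s) \<longlongrightarrow> \<i> * of_real (z \<bullet> b)) (at 0)"
      unfolding has_field_derivative_iff by simp
    moreover have "filterlim (\<lambda>n. complex_of_real (t n)) (at 0) sequentially"
      unfolding filterlim_at using t by (auto intro!: tendsto_eq_intros t0 simp: less_imp_neq[symmetric])
    ultimately have "(\<lambda>n. (exp (\<i> * of_real (z \<bullet> b) * of_real (t n)) - 1) / of_real (t n)) \<longlonglongrightarrow> \<i> * of_real (z \<bullet> b)"
      by (rule filterlim_compose)
    then show "(\<lambda>n. (cis (t n * (z \<bullet> b)) - 1) / of_real (t n)) \<longlonglongrightarrow> \<i> * of_real (z \<bullet> b)"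
      by (simp add: cis_conv_exp mult_ac)
  qed
  ultimately show ?thesis using LIMSEQ_unique by fastforce
qed

text \<open>Each power of |z| is bounded by the sum of the coordinates of z, and each coordinate is
  traded for a derivative of the symbol. The induction hypothesis is applied to these derivatives,
  hence the generalisation over \<open>a\<close>.\<close>

lemma pft_decay_aux:
  fixes a :: "'a::euclidean_space \<times> 'a \<Rightarrow> complex"
  shows "schwartz a \<Longrightarrow> \<exists>C\<ge>0. \<forall>x z. (1 + norm z) ^ N * norm (pft a x z) \<le> C"
proof (induction N arbitrary: a)
  case 0
  then obtain C where C: "0 \<le> C" "\<And>z. norm (a z) \<le> C * wt (real (Suc DIM('a))) z"
    using schwartz_decay[OF 0] by metis
  have "norm (pft a x z) \<le> (LINT \<xi>::'a|lborel. C * wt (real (Suc DIM('a))) \<xi>)" for x z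
    unfolding pft_def
  proof (rule order_trans[OF integral_norm_bound integral_mono])
    show "integrable lborel (\<lambda>\<xi>. norm (a (x, \<xi>) * cis (- (\<xi> \<bullet> z))))"
      by (intro integrable_norm integrable_mult_cis schwartz_section_integrable[OF 0]) measurable
    show "integrable lborel (\<lambda>\<xi>::'a. C * wt (real (Suc DIM('a))) \<xi>)"
      by (intro integrable_mult_right wt_integrable_real) simp
    fix \<xi> :: 'a
    show "norm (a (x, \<xi>) * cis (- (\<xi> \<bullet> z))) \<le> C * wt (real (Suc DIM('a))) \<xi>"
      using C order_trans[OF C(2)[of "(x,\<xi>)"] mult_left_mono[OF wt_Pair_le C(1)]] by (simp add: norm_mult)
  qed
  then show ?case using C(1) by (intro exI[of _ "LINT \<xi>::'a|lborel. C * wt (real (Suc DIM('a))) \<xi>"]) (auto intro!: integral_nonneg)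
next
  case (Suc N)
  have D: "schwartz (\<lambda>z. frechet_derivative a (at z) (0, b))" if "b \<in> Basis" for b
    using that by (intro schwartz_deriv Suc.prems) (simp add: Basis_prod_def)
  have "\<forall>b\<in>Basis. \<exists>C\<ge>0. \<forall>x z. (1 + norm z) ^ N * norm (pft (\<lambda>z. frechet_derivative a (at z) (0, b)) x z) \<le> C"
    using Suc.IH[OF D] by blast
  then obtain C where C: "\<And>b. b \<in> Basis \<Longrightarrow> 0 \<le> C b"
    "\<And>b x z. b \<in> Basis \<Longrightarrow> (1 + norm z) ^ N * norm (pft (\<lambda>z. frechet_derivative a (at z) (0, b)) x z) \<le> C b"
    by metis
  obtain C0 where C0: "C0 \<ge> 0" "\<And>x z. (1 + norm z) ^ N * norm (pft a x z) \<le> C0"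
    using Suc.IH[OF Suc.prems] by blast
  have "(1 + norm z) ^ Suc N * norm (pft a x z) \<le> C0 + (\<Sum>b\<in>Basis. C b)" for x z
  proof -
    have "(1 + norm z) ^ Suc N * norm (pft a x z) = (1 + norm z) ^ N * norm (pft a x z) + (1 + norm z) ^ N * (norm z * norm (pft a x z))"
      by (simp add: algebra_simps)
    also have "\<dots> \<le> C0 + (1 + norm z) ^ N * ((\<Sum>b\<in>Basis. \<bar>z \<bullet> b\<bar>) * norm (pft a x z))"
      using C0 by (intro add_mono mult_left_mono mult_right_mono norm_le_l1) auto
    also have "(1 + norm z) ^ N * ((\<Sum>b\<in>Basis. \<bar>z \<bullet> b\<bar>) * norm (pft a x z))
        = (\<Sum>b\<in>Basis. (1 + norm z) ^ N * norm (pft (\<lambda>z. frechet_derivative a (at z) (0, b)) x z))"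
      unfolding sum_distrib_left sum_distrib_right by (intro sum.cong refl) (simp add: pft_deriv[OF Suc.prems] norm_mult)
    also have "\<dots> \<le> (\<Sum>b\<in>Basis. C b)" using C by (intro sum_mono) auto
    finally show ?thesis by simp
  qed
  moreover have "0 \<le> C0 + (\<Sum>b\<in>Basis. C b)" using C0 C by (auto intro!: add_nonneg_nonneg sum_nonneg)
  ultimately show ?case by blast
qed

lemma pft_decay:
  fixes a :: "'a::euclidean_space \<times> 'a \<Rightarrow> complex"
  assumes "schwartz a"
  obtains C where "0 \<le> C" "\<And>x z. norm (pft a x z) \<le> C * wt (real N) z"
proof -
  obtain C where C: "0 \<le> C" "\<And>x z. (1 + norm z) ^ N * norm (pft a x z) \<le> C"
    using pft_decay_aux[OF assms] by metis
  have "norm (pft a x z) \<le> C * wt (real N) z" for x z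
    using C(2)[of z x] by (simp add: wt_nat field_simps add_pos_nonneg)
  with C(1) show ?thesis using that by blast
qed

lemma pft_lipschitz:
  fixes a :: "'a::euclidean_space \<times> 'a \<Rightarrow> complex"
  assumes a: "schwartz a"
  obtains C where "0 \<le> C" "\<And>x x' z. norm (pft a x z - pft a x' z) \<le> C * norm (x - x')"
proof -
  obtain C where C: "0 \<le> C" "\<And>x x' \<xi>. norm (a (x, \<xi>) - a (x', \<xi>)) \<le> C * wt (real (Suc DIM('a))) \<xi> * norm (x - x')"
    using schwartz_lipschitz_fst[OF a] by metis
  let ?J = "LINT \<xi>::'a|lborel. wt (real (Suc DIM('a))) \<xi>"
  have "norm (pft a x z - pft a x' z) \<le> C * ?J * norm (x - x')" for x x' z
  proof -
    note [measurable] = schwartz_measurable[OF a]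
    have i: "integrable lborel (\<lambda>\<xi>. a (x, \<xi>) * cis (- (\<xi> \<bullet> z)))" for x
      by (intro integrable_mult_cis schwartz_section_integrable[OF a]) measurable
    have "pft a x z - pft a x' z = (LINT \<xi>|lborel. a (x, \<xi>) * cis (- (\<xi> \<bullet> z)) - a (x', \<xi>) * cis (- (\<xi> \<bullet> z)))"
      unfolding pft_def using i by simp
    also have "norm \<dots> \<le> (LINT \<xi>::'a|lborel. C * wt (real (Suc DIM('a))) \<xi> * norm (x - x'))"
    proof (rule order_trans[OF integral_norm_bound integral_mono])
      show "integrable lborel (\<lambda>\<xi>. norm (a (x, \<xi>) * cis (- (\<xi> \<bullet> z)) - a (x', \<xi>) * cis (- (\<xi> \<bullet> z))))"
        using i by auto
      show "integrable lborel (\<lambda>\<xi>::'a. C * wt (real (Suc DIM('a))) \<xi> * norm (x - x'))"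
        by (intro integrable_mult_right integrable_mult_left wt_integrable_real) simp
      show "norm (a (x, \<xi>) * cis (- (\<xi> \<bullet> z)) - a (x', \<xi>) * cis (- (\<xi> \<bullet> z))) \<le> C * wt (real (Suc DIM('a))) \<xi> * norm (x - x')" for \<xi>
        using C(2)[of x \<xi> x'] by (simp add: left_diff_distrib[symmetric] norm_mult)
    qed
    finally show ?thesis by simp
  qed
  moreover have "0 \<le> C * ?J" using C(1) by (auto intro!: integral_nonneg)
  ultimately show ?thesis using that by blast
qed

text \<open>The geometric mean of the two preceding bounds: continuity and decay at the same time.\<close>

lemma pft_hoelder:
  fixes a :: "'a::euclidean_space \<times> 'a \<Rightarrow> complex"
  assumes a: "schwartz a"
  obtains C where "0 \<le> C" "\<And>x x' z. norm (pft a x z - pft a x' z) \<le> C * sqrt (norm (x - x')) * wt (real N) z"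
proof -
  obtain C1 where C1: "0 \<le> C1" "\<And>x x' z. norm (pft a x z - pft a x' z) \<le> C1 * norm (x - x')"
    using pft_lipschitz[OF a] by metis
  obtain C2 where C2: "0 \<le> C2" "\<And>x z. norm (pft a x z) \<le> C2 * wt (real (2 * N)) z"
    using pft_decay[OF a] by metis
  have "norm (pft a x z - pft a x' z) \<le> sqrt (C1 * (2 * C2)) * sqrt (norm (x - x')) * wt (real N) z" for x x' z
  proof (rule power2_le_imp_le)
    have "norm (pft a x z - pft a x' z) \<le> 2 * C2 * wt (real (2 * N)) z"
      using norm_triangle_ineq4[of "pft a x z" "pft a x' z"] C2(2)[of x z] C2(2)[of x' z] by simp
    with C1(2)[of x z x'] have "(norm (pft a x z - pft a x' z))\<^sup>2 \<le> (C1 * norm (x - x')) * (2 * C2 * wt (real (2 * N)) z)"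
      unfolding power2_eq_square using C1(1) by (intro mult_mono) auto
    also have "wt (real (2 * N)) z = (wt (real N) z)\<^sup>2"
      unfolding wt_nat by (simp add: power_mult power_inverse mult.commute[of 2])
    finally show "(norm (pft a x z - pft a x' z))\<^sup>2 \<le> (sqrt (C1 * (2 * C2)) * sqrt (norm (x - x')) * wt (real N) z)\<^sup>2"
      using C1(1) C2(1) by (simp add: power_mult_distrib mult_ac)
  qed (use C1 C2 in auto)
  moreover have "0 \<le> sqrt (C1 * (2 * C2))" using C1 C2 by simp
  ultimately show ?thesis using that by blast
qed

section \<open>Gaussians are Schwartz functions\<close>

definition gauss :: "real \<Rightarrow> 'a::euclidean_space \<Rightarrow> real" where
  "gauss c x = exp (- c * (norm x)\<^sup>2)"

text \<open>Polynomials in z - y times a Gaussian centred at y. The class is closed under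
  directional derivatives, so smoothness and decay of all derivatives follow by rule induction,
  without any explicit polynomial.\<close>

inductive poly_gauss :: "real \<Rightarrow> 'a::euclidean_space \<Rightarrow> ('a \<Rightarrow> complex) \<Rightarrow> bool" for c y where
  base: "poly_gauss c y (\<lambda>z. of_real (gauss c (z - y)))"
| times: "poly_gauss c y f \<Longrightarrow> poly_gauss c y (\<lambda>z. of_real ((z - y) \<bullet> e) * f z)"
| add: "poly_gauss c y f \<Longrightarrow> poly_gauss c y g \<Longrightarrow> poly_gauss c y (\<lambda>z. f z + g z)"
| scale: "poly_gauss c y f \<Longrightarrow> poly_gauss c y (\<lambda>z. of_real r * f z)"

lemma poly_gauss_derivative:
  assumes "poly_gauss c y f"
  shows "\<exists>f'. (\<forall>z. (f has_derivative f' z) (at z)) \<and> (\<forall>v. poly_gauss c y (\<lambda>z. f' z v))"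
  using assms
proof induction
  case base
  let ?f' = "\<lambda>z v. of_real (- 2 * c) * (of_real ((z - y) \<bullet> v) * of_real (gauss c (z - y))) :: complex"
  have "((\<lambda>z. of_real (gauss c (z - y)) :: complex) has_derivative ?f' z) (at z)" for z
    unfolding gauss_def power2_norm_eq_inner
    by (auto intro!: derivative_eq_intros ext simp: inner_commute algebra_simps)
  moreover have "poly_gauss c y (\<lambda>z. ?f' z v)" for v
    by (intro poly_gauss.intros)
  ultimately show ?case by (intro exI[of _ ?f']) auto
next
  case (times f e)
  then obtain f' where f': "\<And>z. (f has_derivative f' z) (at z)" "\<And>v. poly_gauss c y (\<lambda>z. f' z v)" by blast
  let ?g = "\<lambda>z v. of_real ((z - y) \<bullet> e) * f' z v + of_real (v \<bullet> e) * f z"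
  have "((\<lambda>z. of_real ((z - y) \<bullet> e) * f z) has_derivative ?g z) (at z)" for z
    by (auto intro!: derivative_eq_intros f' simp: algebra_simps)
  moreover have "poly_gauss c y (\<lambda>z. ?g z v)" for v
    by (intro poly_gauss.intros f' times)
  ultimately show ?case by (intro exI[of _ ?g]) auto
next
  case (add f g)
  then obtain f' g' where "\<And>z. (f has_derivative f' z) (at z)" "\<And>v. poly_gauss c y (\<lambda>z. f' z v)"
    "\<And>z. (g has_derivative g' z) (at z)" "\<And>v. poly_gauss c y (\<lambda>z. g' z v)" by blast
  then show ?case
    by (intro exI[of _ "\<lambda>z v. f' z v + g' z v"]) (auto intro!: derivative_eq_intros poly_gauss.intros)
next
  case (scale f r)
  then obtain f' where "\<And>z. (f has_derivative f' z) (at z)" "\<And>v. poly_gauss c y (\<lambda>z. f' z v)" by blast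
  then show ?case
    by (intro exI[of _ "\<lambda>z v. of_real r * f' z v"]) (auto intro!: derivative_eq_intros poly_gauss.intros)
qed

text \<open>The exponent \<open>N\<close> is generalised because a linear factor is paid for with
  the bound for one more power of 1 + |z|.\<close>

lemma poly_gauss_bounded:
  assumes "poly_gauss c y f" "0 < c"
  shows "\<exists>B. \<forall>z. (1 + norm z) ^ N * norm (f z) \<le> B"
  using assms(1)
proof (induction arbitrary: N)
  case base
  have "(1 + norm z) ^ N * norm (of_real (gauss c (z - y)) :: complex) \<le> (1 + norm y) ^ N * (fact N * exp (1 + 1 / (4 * c)))" for z
  proof -
    let ?r = "norm (z - y)"
    have "norm z \<le> norm (z - y) + norm y" using norm_triangle_ineq[of "z - y" y] by simp
    then have "1 + norm z \<le> 1 + norm y + ?r" by simp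
    also have "\<dots> \<le> (1 + norm y) * (1 + ?r)" by (simp add: algebra_simps)
    finally have "(1 + norm z) ^ N \<le> (1 + norm y) ^ N * (1 + ?r) ^ N"
      unfolding power_mult_distrib[symmetric] by (intro power_mono) auto
    \<comment> \<open>A single term of the exponential series dominates the power.\<close>
    also have "(1 + ?r) ^ N \<le> fact N * exp (1 + ?r)"
    proof -
      have "(1 + ?r) ^ N /\<^sub>R fact N \<le> exp (1 + ?r)"
        using summable_exp_generic[of "1 + ?r"] sum_le_suminf[of "\<lambda>n. (1 + ?r) ^ n /\<^sub>R fact n" "{N}"]
        unfolding exp_def by simp
      then show ?thesis by (simp add: field_simps)
    qed
    finally have "(1 + norm z) ^ N * gauss c (z - y) \<le> (1 + norm y) ^ N * (fact N * exp (1 + ?r)) * gauss c (z - y)"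
      by (intro mult_right_mono) (auto simp: gauss_def mult_left_mono)
    also have "\<dots> = (1 + norm y) ^ N * (fact N * exp (1 + ?r - c * ?r\<^sup>2))"
      by (simp add: gauss_def exp_diff exp_minus divide_simps)
    also have "\<dots> \<le> (1 + norm y) ^ N * (fact N * exp (1 + 1 / (4 * c)))"
    proof -
      \<comment> \<open>Completing the square: r - c r^2 has maximum 1/(4c).\<close>
      have "0 \<le> (2 * c * ?r - 1)\<^sup>2 / (4 * c)" using assms(2) by simp
      then have "?r - c * ?r\<^sup>2 \<le> 1 / (4 * c)" using assms(2) by (simp add: power2_eq_square field_simps)
      then show ?thesis by (intro mult_left_mono) auto
    qed
    finally show ?thesis by (simp add: gauss_def)
  qed
  then show ?case by blast
next
  case (times f e)
  obtain B where B: "\<And>z. (1 + norm z) ^ Suc N * norm (f z) \<le> B" using times.IH by blast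
  have "(1 + norm z) ^ N * norm (of_real ((z - y) \<bullet> e) * f z) \<le> (1 + norm y) * norm e * B" for z
  proof -
    have "\<bar>(z - y) \<bullet> e\<bar> \<le> norm (z - y) * norm e" by (rule Cauchy_Schwarz_ineq2)
    also have "\<dots> \<le> ((1 + norm y) * (1 + norm z)) * norm e"
    proof (intro mult_right_mono)
      have "0 \<le> norm y * norm z" by simp
      then show "norm (z - y) \<le> (1 + norm y) * (1 + norm z)"
        using norm_triangle_ineq4[of z y] unfolding distrib_left distrib_right mult_1_left mult_1_right by linarith
    qed simp
    finally have "(1 + norm z) ^ N * norm (of_real ((z - y) \<bullet> e) * f z)
        \<le> (1 + norm z) ^ N * (((1 + norm y) * (1 + norm z)) * norm e * norm (f z))"
      by (auto simp: norm_mult intro!: mult_left_mono mult_right_mono)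
    also have "\<dots> = (1 + norm y) * norm e * ((1 + norm z) ^ Suc N * norm (f z))" by (simp add: mult_ac)
    also have "\<dots> \<le> (1 + norm y) * norm e * B" by (intro mult_left_mono B) auto
    finally show ?thesis .
  qed
  then show ?case by blast
next
  case (add f g)
  obtain B B' where "\<And>z. (1 + norm z) ^ N * norm (f z) \<le> B" "\<And>z. (1 + norm z) ^ N * norm (g z) \<le> B'" 
    using add.IH by metis
  then have "(1 + norm z) ^ N * norm (f z + g z) \<le> B + B'" for z
    using mult_left_mono[OF norm_triangle_ineq[of "f z" "g z"], of "(1 + norm z) ^ N"] 
    by (smt (verit, best) distrib_left norm_ge_zero zero_le_power)
  then show ?case by blast
next
  case (scale f r)
  obtain B where "\<And>z. (1 + norm z) ^ N * norm (f z) \<le> B" using scale.IH by metis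
  then have "(1 + norm z) ^ N * norm (of_real r * f z) \<le> \<bar>r\<bar> * B" for z
    using mult_left_mono[of "(1 + norm z) ^ N * norm (f z)" B "\<bar>r\<bar>"] by (simp add: norm_mult mult_ac)
  then show ?case by blast
qed

lemma schwartz_poly_gauss:
  assumes "poly_gauss c y f" "0 < c"
  shows "schwartz f"
proof -
  have pg: "poly_gauss c y (iterated_deriv f vs)" for vs
  proof (induction vs)
    case (Cons v vs)
    obtain f' where f': "\<And>z. (iterated_deriv f vs has_derivative f' z) (at z)" "\<And>v. poly_gauss c y (\<lambda>z. f' z v)"
      using poly_gauss_derivative[OF Cons] by blast
    have "iterated_deriv f (v # vs) = (\<lambda>z. f' z v)"
      using frechet_derivative_at[OF f'(1)] by auto
    with f' show ?case by simp
  qed (use assms in simp)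
  show ?thesis
    unfolding schwartz_def
  proof (intro allI impI conjI)
    fix vs :: "'a list" and x
    show "iterated_deriv f vs differentiable at x"
      using poly_gauss_derivative[OF pg] unfolding differentiable_def by blast
    fix N
    obtain B where "\<And>z. (1 + norm z) ^ N * norm (iterated_deriv f vs z) \<le> B"
      using poly_gauss_bounded[OF pg assms(2)] by blast
    then show "bounded (range (\<lambda>x. (1 + norm x) ^ N *\<^sub>R iterated_deriv f vs x))"
      unfolding bounded_iff by (intro exI[of _ B]) auto
  qed
qed

lemma schwartz_gauss: "0 < c \<Longrightarrow> schwartz (\<lambda>z. of_real (gauss c (z - y)))"
  by (rule schwartz_poly_gauss[OF poly_gauss.base])

section \<open>Measurability of conjugates and of projections\<close>

lemma cnj_measurable [measurable (raw)]: "f \<in> borel_measurable M \<Longrightarrow> (\<lambda>x. cnj (f x)) \<in> borel_measurable M"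
  by (rule measurable_compose[OF _ borel_measurable_continuous_onI]) (auto intro: continuous_intros)

lemma fst_borel_measurable [measurable (raw)]:
  fixes f :: "'a \<Rightarrow> 'b::second_countable_topology \<times> 'c::second_countable_topology"
  shows "f \<in> measurable M borel \<Longrightarrow> (\<lambda>x. fst (f x)) \<in> measurable M borel"
  by (rule measurable_compose[OF _ borel_measurable_continuous_onI]) (auto intro: continuous_intros)

lemma snd_borel_measurable [measurable (raw)]:
  fixes f :: "'a \<Rightarrow> 'b::second_countable_topology \<times> 'c::second_countable_topology"
  shows "f \<in> measurable M borel \<Longrightarrow> (\<lambda>x. snd (f x)) \<in> measurable M borel"
  by (rule measurable_compose[OF _ borel_measurable_continuous_onI]) (auto intro: continuous_intros)

section \<open>The Plancherel inequality\<close>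

text \<open>Fatou's lemma for pointwise limits: a uniform bound on the integrals is inherited, even
  when nothing dominates the sequence.\<close>

lemma nn_integral_limit_le:
  fixes f :: "nat \<Rightarrow> 'a \<Rightarrow> ennreal"
  assumes [measurable]: "\<And>n. f n \<in> borel_measurable M"
    and lim: "\<And>x. x \<in> space M \<Longrightarrow> (\<lambda>n. f n x) \<longlonglongrightarrow> g x"
    and le: "\<And>n. (\<integral>\<^sup>+x. f n x \<partial>M) \<le> B"
  shows "(\<integral>\<^sup>+x. g x \<partial>M) \<le> B"
proof -
  have "(\<integral>\<^sup>+x. g x \<partial>M) = (\<integral>\<^sup>+x. liminf (\<lambda>n. f n x) \<partial>M)"
    using lim by (intro nn_integral_cong lim_imp_Liminf[symmetric]) auto
  also have "\<dots> \<le> liminf (\<lambda>n. \<integral>\<^sup>+x. f n x \<partial>M)"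
    by (rule nn_integral_liminf) measurable
  also have "\<dots> \<le> limsup (\<lambda>n. \<integral>\<^sup>+x. f n x \<partial>M)"
    by (rule Liminf_le_Limsup) simp
  also have "\<dots> \<le> B" by (rule Limsup_bounded) (simp add: le)
  finally show ?thesis .
qed

text \<open>The product of two moduli is at most half the sum of their squares, and in each of the
  two terms the free variable is integrated against \<open>w\<close> alone.\<close>

lemma bilinear_schur:
  fixes U :: "'a::euclidean_space \<Rightarrow> complex" and w :: "'a \<Rightarrow> ennreal"
  assumes [measurable]: "U \<in> borel_measurable borel" "w \<in> borel_measurable borel"
  shows "(\<integral>\<^sup>+p. ennreal (norm (U (fst p)) * norm (U (snd p))) * w (snd p - fst p) \<partial>lborel)
    \<le> (\<integral>\<^sup>+z. w z \<partial>lborel) * l2 U"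
proof -
  let ?q = "\<lambda>x. ennreal ((norm (U x))\<^sup>2)"
  \<comment> \<open>Everything is doubled so that the inequality between a product and a sum of
    squares can be used without dividing in \<open>ennreal\<close>.\<close>
  have "2 * (\<integral>\<^sup>+p. ennreal (norm (U (fst p)) * norm (U (snd p))) * w (snd p - fst p) \<partial>lborel)
     = (\<integral>\<^sup>+p. 2 * (ennreal (norm (U (fst p)) * norm (U (snd p))) * w (snd p - fst p)) \<partial>lborel)"
    by (rule nn_integral_cmult[symmetric]) measurable
  also have "\<dots> \<le> (\<integral>\<^sup>+p. ?q (fst p) * w (snd p - fst p) + ?q (snd p) * w (snd p - fst p) \<partial>lborel)"
  proof (rule nn_integral_mono)
    fix p
    have "2 * ennreal (norm (U (fst p)) * norm (U (snd p))) = ennreal (2 * (norm (U (fst p)) * norm (U (snd p))))"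
      by (simp add: ennreal_mult)
    also have "\<dots> \<le> ennreal ((norm (U (fst p)))\<^sup>2 + (norm (U (snd p)))\<^sup>2)"
      using sum_squares_bound[of "norm (U (fst p))" "norm (U (snd p))"] by (intro ennreal_leI) simp
    finally have "2 * ennreal (norm (U (fst p)) * norm (U (snd p))) * w (snd p - fst p)
        \<le> (?q (fst p) + ?q (snd p)) * w (snd p - fst p)"
      by (intro mult_right_mono) auto
    then show "2 * (ennreal (norm (U (fst p)) * norm (U (snd p))) * w (snd p - fst p))
        \<le> ?q (fst p) * w (snd p - fst p) + ?q (snd p) * w (snd p - fst p)"
      by (simp add: distrib_right mult.assoc)
  qed
  also have "\<dots> = (\<integral>\<^sup>+p. ?q (fst p) * w (snd p - fst p) \<partial>lborel) + (\<integral>\<^sup>+p. ?q (snd p) * w (snd p - fst p) \<partial>lborel)"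
    by (rule nn_integral_add) measurable
  also have "(\<integral>\<^sup>+p. ?q (fst p) * w (snd p - fst p) \<partial>lborel) = (\<integral>\<^sup>+x. ?q x * (\<integral>\<^sup>+y. w (y - x) \<partial>lborel) \<partial>lborel)"
    by (subst nn_integral_prod_lborel(1)) (simp_all add: nn_integral_cmult)
  also have "(\<integral>\<^sup>+x. ?q x * (\<integral>\<^sup>+y. w (y - x) \<partial>lborel) \<partial>lborel) = l2 U * (\<integral>\<^sup>+z. w z \<partial>lborel)"
    unfolding nn_integral_lborel_shift(2)[OF assms(2)] l2_def by (rule nn_integral_multc) measurable
  also have "(\<integral>\<^sup>+p. ?q (snd p) * w (snd p - fst p) \<partial>lborel) = (\<integral>\<^sup>+y. ?q y * (\<integral>\<^sup>+x. w (y - x) \<partial>lborel) \<partial>lborel)"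
    by (subst nn_integral_prod_lborel(2)) (simp_all add: nn_integral_cmult)
  also have "(\<integral>\<^sup>+y. ?q y * (\<integral>\<^sup>+x. w (y - x) \<partial>lborel) \<partial>lborel) = l2 U * (\<integral>\<^sup>+z. w z \<partial>lborel)"
    unfolding nn_integral_lborel_shift(3)[OF assms(2)] l2_def by (rule nn_integral_multc) measurable
  finally have "2 * (\<integral>\<^sup>+p. ennreal (norm (U (fst p)) * norm (U (snd p))) * w (snd p - fst p) \<partial>lborel)
    \<le> 2 * (l2 U * (\<integral>\<^sup>+z. w z \<partial>lborel))" by (simp add: mult_2)
  then show ?thesis by (subst (asm) ennreal_mult_le_mult_iff) (auto simp: mult.commute)
qed

text \<open>The integral of \<open>fourier\<close> taken over \<open>lborel\<close>, where product
  measurability and Tonelli's theorem apply directly. Both agree on Borel functions.\<close>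

definition ft :: "('a::euclidean_space \<Rightarrow> complex) \<Rightarrow> 'a \<Rightarrow> complex" where
  "ft F \<xi> = (LINT x|lborel. F x * cis (- (x \<bullet> \<xi>)))"

lemma ft_measurable [measurable (raw)]:
  assumes [measurable]: "F \<in> borel_measurable borel" "f \<in> measurable M borel"
  shows "(\<lambda>w. ft F (f w)) \<in> borel_measurable M"
  unfolding ft_def by measurable

lemma integrable_prod_lborel:
  fixes f :: "'a::euclidean_space \<Rightarrow> complex" and g :: "'b::euclidean_space \<Rightarrow> complex"
  assumes f: "integrable lborel f" and g: "integrable lborel g"
  shows "integrable lborel (\<lambda>p. f (fst p) * g (snd p))"
proof (rule integrableI_bounded)
  have [measurable]: "f \<in> borel_measurable borel" "g \<in> borel_measurable borel"
    using f g by (auto simp: borel_measurable_integrable)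
  show "(\<lambda>p. f (fst p) * g (snd p)) \<in> borel_measurable lborel" by measurable
  have "(\<integral>\<^sup>+p. ennreal (norm (f (fst p) * g (snd p))) \<partial>lborel) = (\<integral>\<^sup>+x. ennreal (norm (f x)) \<partial>lborel) * (\<integral>\<^sup>+y. ennreal (norm (g y)) \<partial>lborel)"
    by (subst nn_integral_prod_lborel(1)) (simp_all add: norm_mult ennreal_mult nn_integral_cmult nn_integral_multc)
  also have "\<dots> < \<infinity>" using f g by (simp add: integrable_iff_bounded ennreal_mult_less_top)
  finally show "(\<integral>\<^sup>+p. ennreal (norm (f (fst p) * g (snd p))) \<partial>lborel) < \<infinity>" .
qed

text \<open>The squared modulus is a double integral over p; Fubini's theorem integrates \<xi> first
  and leaves the Fourier transform of \<open>b\<close> at the difference of the two points. It is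
  used with a Gaussian for \<open>b\<close> to bound the transform and with a section of the symbol
  to compare Husimi and Wigner functions.\<close>

lemma ft_quadratic:
  fixes F b :: "'a::euclidean_space \<Rightarrow> complex"
  assumes F: "integrable lborel F" and b: "integrable lborel b"
  shows "(LINT \<xi>|lborel. b \<xi> * of_real ((norm (ft F \<xi>))\<^sup>2)) =
    (LINT p|lborel. cnj (F (fst p)) * F (snd p) * (LINT \<xi>|lborel. b \<xi> * cis (- (\<xi> \<bullet> (snd p - fst p)))))"
proof -
  have [measurable]: "F \<in> borel_measurable borel" "b \<in> borel_measurable borel"
    using F b by (auto simp: borel_measurable_integrable)
  have F': "integrable lborel (\<lambda>x. F x * cis (- (x \<bullet> \<xi>)))" for \<xi>
    by (intro integrable_mult_cis F) measurable
  have sq: "of_real ((norm (ft F \<xi>))\<^sup>2) = (LINT p|lborel. cnj (F (fst p)) * F (snd p) * cis (- (\<xi> \<bullet> (snd p - fst p))))" for \<xi>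
  proof -
    have Fc: "integrable lborel (\<lambda>x. cnj (F x * cis (- (x \<bullet> \<xi>))))"
      using F' by (subst complex_integrable_cnj)
    have "of_real ((norm (ft F \<xi>))\<^sup>2) = cnj (ft F \<xi>) * ft F \<xi>"
      using complex_norm_square[of "ft F \<xi>"] by (simp add: mult.commute)
    also have "cnj (ft F \<xi>) = (LINT x|lborel. cnj (F x * cis (- (x \<bullet> \<xi>))))"
      unfolding ft_def by (rule Bochner_Integration.integral_cnj[symmetric])
    also have "\<dots> * ft F \<xi> = (LINT x|lborel. LINT y|lborel. cnj (F x * cis (- (x \<bullet> \<xi>))) * (F y * cis (- (y \<bullet> \<xi>))))"
      unfolding ft_def using F' Fc by simp
    also have "\<dots> = (LINT p|lborel. cnj (F (fst p) * cis (- (fst p \<bullet> \<xi>))) * (F (snd p) * cis (- (snd p \<bullet> \<xi>))))"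
      by (subst integral_prod_lborel(1)[OF integrable_prod_lborel[OF Fc F']]) simp
    also have "\<dots> = (LINT p|lborel. cnj (F (fst p)) * F (snd p) * cis (- (\<xi> \<bullet> (snd p - fst p))))"
    proof (rule Bochner_Integration.integral_cong[OF refl])
      fix p :: "'a \<times> 'a"
      have "cnj (cis (- (fst p \<bullet> \<xi>))) * cis (- (snd p \<bullet> \<xi>)) = cis (- (\<xi> \<bullet> (snd p - fst p)))"
        by (simp add: cis_cnj cis_mult inner_diff_right inner_commute)
      then show "cnj (F (fst p) * cis (- (fst p \<bullet> \<xi>))) * (F (snd p) * cis (- (snd p \<bullet> \<xi>))) = cnj (F (fst p)) * F (snd p) * cis (- (\<xi> \<bullet> (snd p - fst p)))"
        by (simp add: mult_ac)
    qed
    finally show ?thesis .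
  qed
  let ?H = "\<lambda>z. b (fst z) * (cnj (F (fst (snd z))) * F (snd (snd z)) * cis (- (fst z \<bullet> (snd (snd z) - fst (snd z)))))"
  have FF: "integrable lborel (\<lambda>p. cnj (F (fst p)) * F (snd p))"
    using integrable_prod_lborel[of "\<lambda>x. cnj (F x)" F] F by simp
  have "integrable lborel (\<lambda>z. b (fst z) * (\<lambda>p. cnj (F (fst p)) * F (snd p)) (snd z))"
    by (rule integrable_prod_lborel[OF b FF])
  then have H: "integrable lborel ?H"
  proof (rule Bochner_Integration.integrable_bound)
    show "?H \<in> borel_measurable lborel" by measurable
  qed (simp add: norm_mult)
  have "(LINT \<xi>|lborel. b \<xi> * of_real ((norm (ft F \<xi>))\<^sup>2)) = (LINT \<xi>|lborel. LINT p|lborel. ?H (\<xi>, p))"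
    unfolding sq by (simp add: integrable_mult_cis[OF FF])
  also have "\<dots> = (LINT p|lborel. LINT \<xi>|lborel. ?H (\<xi>, p))"
    using integral_prod_lborel[OF H] by simp
  also have "\<dots> = (LINT p|lborel. cnj (F (fst p)) * F (snd p) * (LINT \<xi>|lborel. b \<xi> * cis (- (\<xi> \<bullet> (snd p - fst p)))))"
  proof (rule Bochner_Integration.integral_cong[OF refl])
    fix p :: "'a \<times> 'a"
    have "integrable lborel (\<lambda>\<xi>. b \<xi> * cis (- (\<xi> \<bullet> (snd p - fst p))))"
      by (intro integrable_mult_cis b) measurable
    then show "(LINT \<xi>|lborel. ?H (\<xi>, p)) = cnj (F (fst p)) * F (snd p) * (LINT \<xi>|lborel. b \<xi> * cis (- (\<xi> \<bullet> (snd p - fst p))))"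
      by (simp add: mult_ac integral_mult_right_zero[symmetric] del: integral_mult_right_zero integral_mult_left_zero)
  qed
  finally show ?thesis .
qed

lemma gauss_pos: "0 < gauss c x" by (simp add: gauss_def)

lemma gauss_measurable [measurable]: "gauss c \<in> borel_measurable borel"
  unfolding gauss_def[abs_def] by measurable

text \<open>Weight the squared transform with a Gaussian of width m. By \<open>ft_quadratic\<close>
  this is a bilinear form whose kernel is m^d \<Gamma>(m z), and its L1 norm \<open>I\<close> does
  not depend on m by scaling. So the bilinear Schur bound holds uniformly in m, and Fatou's lemma
  removes the Gaussian as m grows.\<close>

lemma plancherel_inequality:
  obtains C :: real where "0 \<le> C"
    "\<And>F::'a::euclidean_space \<Rightarrow> complex. integrable lborel F \<Longrightarrow>
       (\<integral>\<^sup>+\<xi>. ennreal ((norm (ft F \<xi>))\<^sup>2) \<partial>lborel) \<le> ennreal C * l2 F"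
proof -
  \<comment> \<open>A Gaussian on the product space, so that \<open>pft_decay\<close> yields decay
    of its transform; the section at 0 is the Gaussian in \<xi> itself.\<close>
  define a :: "'a \<times> 'a \<Rightarrow> complex" where "a = (\<lambda>z. of_real (gauss 1 (z - 0)))"
  have a: "schwartz a" unfolding a_def by (rule schwartz_gauss) simp
  have a0: "a (0, \<xi>) = of_real (gauss 1 \<xi>)" for \<xi> by (simp add: a_def gauss_def norm_Pair)
  define \<Gamma> where "\<Gamma> = pft a 0"
  have [measurable]: "\<Gamma> \<in> borel_measurable borel"
    unfolding \<Gamma>_def using schwartz_measurable[OF a] by measurable
  obtain C where C: "0 \<le> C" "\<And>z. norm (\<Gamma> z) \<le> C * wt (real (Suc DIM('a))) z"
    using pft_decay[OF a] unfolding \<Gamma>_def by metis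
  define I where "I = (\<integral>\<^sup>+z. ennreal (norm (\<Gamma> z)) \<partial>lborel)"
  have "I \<le> (\<integral>\<^sup>+(z::'a). ennreal C * ennreal (wt (real (Suc DIM('a))) z) \<partial>lborel)"
    unfolding I_def
  proof (rule nn_integral_mono)
    fix z
    show "ennreal (norm (\<Gamma> z)) \<le> ennreal C * ennreal (wt (real (Suc DIM('a))) z)"
      using C(2)[of z] C(1) by (simp only: ennreal_mult[symmetric] wt_nonneg ennreal_leI)
  qed
  also have "\<dots> = ennreal C * (\<integral>\<^sup>+(z::'a). ennreal (wt (real (Suc DIM('a))) z) \<partial>lborel)"
    by (rule nn_integral_cmult) measurable
  also have "\<dots> < \<infinity>" using wt_integrable[where 'a='a, of "real (Suc DIM('a))"] by (simp add: ennreal_mult_less_top)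
  finally have I: "I < \<infinity>" .
  have "(\<integral>\<^sup>+\<xi>. ennreal ((norm (ft F \<xi>))\<^sup>2) \<partial>lborel) \<le> I * l2 F" if F: "integrable lborel F" for F :: "'a \<Rightarrow> complex"
  proof (rule nn_integral_limit_le[where f = "\<lambda>n \<xi>. ennreal (gauss 1 (\<xi> /\<^sub>R real (Suc n)) * (norm (ft F \<xi>))\<^sup>2)"])
    have [measurable]: "F \<in> borel_measurable borel" using F by (auto simp: borel_measurable_integrable)
    show "(\<lambda>\<xi>. ennreal (gauss 1 (\<xi> /\<^sub>R real (Suc n)) * (norm (ft F \<xi>))\<^sup>2)) \<in> borel_measurable lborel" for n
      by measurable
    show "(\<lambda>n. ennreal (gauss 1 (\<xi> /\<^sub>R real (Suc n)) * (norm (ft F \<xi>))\<^sup>2)) \<longlonglongrightarrow> ennreal ((norm (ft F \<xi>))\<^sup>2)" for \<xi>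
    proof -
      have "(\<lambda>n. gauss 1 (inverse (real (Suc n)) *\<^sub>R \<xi>) * (norm (ft F \<xi>))\<^sup>2) \<longlonglongrightarrow> exp (- 1 * (norm (0 *\<^sub>R \<xi>))\<^sup>2) * (norm (ft F \<xi>))\<^sup>2"
        unfolding gauss_def by (intro tendsto_intros LIMSEQ_inverse_real_of_nat)
      then show ?thesis by (intro tendsto_ennrealI) simp
    qed
    fix n
    define m where "m = real (Suc n)"
    have m: "0 < m" by (simp add: m_def)
    define b where "b \<xi> = complex_of_real (gauss 1 (\<xi> /\<^sub>R m))" for \<xi> :: 'a
    have [measurable]: "b \<in> borel_measurable borel" unfolding b_def[abs_def] by measurable
    have bh: "(LINT \<xi>|lborel. b \<xi> * cis (- (\<xi> \<bullet> z))) = of_real (m ^ DIM('a)) * \<Gamma> (m *\<^sub>R z)" for z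
    proof -
      have "(LINT \<xi>|lborel. b \<xi> * cis (- (\<xi> \<bullet> z))) = of_real (m ^ DIM('a)) * (LINT \<xi>|lborel. b (m *\<^sub>R \<xi>) * cis (- ((m *\<^sub>R \<xi>) \<bullet> z)))"
        using integral_lborel_affine[of "\<lambda>\<xi>. b \<xi> * cis (- (\<xi> \<bullet> z))" m 0] m by simp
      then show ?thesis unfolding \<Gamma>_def pft_def a0 b_def using m by simp
    qed
    have "(\<integral>\<^sup>+\<xi>. ennreal (norm (b \<xi>)) \<partial>lborel) = ennreal (m ^ DIM('a)) * (\<integral>\<^sup>+\<xi>. ennreal (norm (b (m *\<^sub>R \<xi>))) \<partial>lborel)"
      using nn_integral_lborel_affine[of "\<lambda>\<xi>. ennreal (norm (b \<xi>))" m 0] m by simp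
    also have "(\<integral>\<^sup>+\<xi>. ennreal (norm (b (m *\<^sub>R \<xi>))) \<partial>lborel) = (\<integral>\<^sup>+\<xi>. ennreal (norm (a (0, \<xi>))) \<partial>lborel)"
      unfolding a0 b_def using m by simp
    also have "ennreal (m ^ DIM('a)) * \<dots> < \<infinity>"
      using schwartz_section_integrable[OF a, of 0] by (simp add: integrable_iff_bounded ennreal_mult_less_top)
    finally have b: "integrable lborel b" by (intro integrableI_bounded) auto
    have "(\<integral>\<^sup>+\<xi>. ennreal (gauss 1 (\<xi> /\<^sub>R m) * (norm (ft F \<xi>))\<^sup>2) \<partial>lborel) = ennreal (norm (LINT \<xi>|lborel. b \<xi> * of_real ((norm (ft F \<xi>))\<^sup>2)))"
    proof -
      have bd: "norm (ft F \<xi>) \<le> (LINT x|lborel. norm (F x))" for \<xi>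
        unfolding ft_def by (rule order_trans[OF integral_norm_bound]) (simp add: norm_mult)
      have "integrable lborel (\<lambda>\<xi>. b \<xi> * of_real ((norm (ft F \<xi>))\<^sup>2))"
      proof (rule Bochner_Integration.integrable_bound[OF integrable_mult_left[OF b]])
        show "AE \<xi> in lborel. norm (b \<xi> * of_real ((norm (ft F \<xi>))\<^sup>2)) \<le> norm (b \<xi> * of_real ((LINT x|lborel. norm (F x))\<^sup>2))"
          using bd by (auto simp: norm_mult norm_power intro!: mult_left_mono power_mono order_trans[OF bd])
      qed measurable
      then have i: "integrable lborel (\<lambda>\<xi>. gauss 1 (\<xi> /\<^sub>R m) * (norm (ft F \<xi>))\<^sup>2)"
        unfolding b_def of_real_mult[symmetric] by (simp only: complex_of_real_integrable_eq)
      have "(LINT \<xi>|lborel. b \<xi> * of_real ((norm (ft F \<xi>))\<^sup>2)) = of_real (LINT \<xi>|lborel. gauss 1 (\<xi> /\<^sub>R m) * (norm (ft F \<xi>))\<^sup>2)"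
        unfolding b_def of_real_mult[symmetric] by (rule integral_complex_of_real)
      then show ?thesis
        using i by (simp add: nn_integral_eq_integral less_imp_le[OF gauss_pos] integral_nonneg)
    qed
    also have "\<dots> \<le> (\<integral>\<^sup>+p. ennreal (norm (cnj (F (fst p)) * F (snd p) * (of_real (m ^ DIM('a)) * \<Gamma> (m *\<^sub>R (snd p - fst p))))) \<partial>lborel)"
      unfolding ft_quadratic[OF F b] bh by (rule norm_integral_le_nn_integral)
    also have "\<dots> = (\<integral>\<^sup>+p. ennreal (norm (F (fst p)) * norm (F (snd p))) * ennreal (norm (of_real (m ^ DIM('a)) * \<Gamma> (m *\<^sub>R (snd p - fst p)))) \<partial>lborel)"
      by (simp add: norm_mult ennreal_mult)
    also have "\<dots> \<le> (\<integral>\<^sup>+z. ennreal (norm (of_real (m ^ DIM('a)) * \<Gamma> (m *\<^sub>R z))) \<partial>lborel) * l2 F"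
      by (rule bilinear_schur) measurable
    also have "(\<integral>\<^sup>+z. ennreal (norm (of_real (m ^ DIM('a)) * \<Gamma> (m *\<^sub>R z))) \<partial>lborel) = I"
      unfolding I_def using nn_integral_lborel_affine[of "\<lambda>z. ennreal (norm (\<Gamma> z))" m 0] m
      by (simp add: norm_mult ennreal_mult nn_integral_cmult norm_power)
    finally show "(\<integral>\<^sup>+\<xi>. ennreal (gauss 1 (\<xi> /\<^sub>R real (Suc n)) * (norm (ft F \<xi>))\<^sup>2) \<partial>lborel) \<le> I * l2 F"
      unfolding m_def .
  qed
  then show ?thesis using that[of "enn2real I"] I by (simp add: less_top)
qed

section \<open>The short-time Fourier transform\<close>

definition stft :: "('a::euclidean_space \<Rightarrow> real) \<Rightarrow> ('a \<Rightarrow> complex) \<Rightarrow> 'a \<times> 'a \<Rightarrow> complex" where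
  "stft \<gamma> U z = (LINT y|lborel. U y * of_real (\<gamma> (y - fst z)) * cis (- (y \<bullet> snd z)))"

lemma stft_eq_ft: "stft \<gamma> U (Y, \<xi>) = ft (\<lambda>y. U y * of_real (\<gamma> (y - Y))) \<xi>"
  by (simp add: stft_def ft_def)

lemma stft_measurable [measurable (raw)]:
  assumes [measurable]: "U \<in> borel_measurable borel" "\<gamma> \<in> borel_measurable borel" "f \<in> measurable M borel"
  shows "(\<lambda>w. stft \<gamma> U (f w)) \<in> borel_measurable M"
  unfolding stft_def by measurable

lemma stft_integrable:
  fixes U :: "'a::euclidean_space \<Rightarrow> complex"
  assumes [measurable]: "U \<in> borel_measurable borel" "\<gamma> \<in> borel_measurable borel"
    and "l2 U < \<infinity>" "(\<integral>\<^sup>+y. ennreal ((\<gamma> y)\<^sup>2) \<partial>lborel) < \<infinity>"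
  shows "integrable lborel (\<lambda>y. U y * of_real (\<gamma> (y - Y)))"
    and "integrable lborel (\<lambda>y. U y * of_real (\<gamma> (y - Y)) * cis (- (y \<bullet> \<xi>)))"
proof -
  show *: "integrable lborel (\<lambda>y. U y * of_real (\<gamma> (y - Y)))"
    using assms(3,4) nn_integral_lborel_shift(2)[of "\<lambda>y. ennreal ((\<gamma> y)\<^sup>2)" Y]
    by (intro nn_integral_mult_integrable) (auto simp: l2_def)
  show "integrable lborel (\<lambda>y. U y * of_real (\<gamma> (y - Y)) * cis (- (y \<bullet> \<xi>)))"
    by (intro integrable_mult_cis *) measurable
qed

text \<open>For a fixed centre this is the Plancherel bound in frequency; integrating over the
  centre then separates window and function. The window is arbitrary, because the bound is later
  applied to differences of translated windows.\<close>

lemma stft_l2_bound: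
  "\<exists>C::real. 0 \<le> C \<and> (\<forall>(\<gamma>::'a::euclidean_space \<Rightarrow> real) U. \<gamma> \<in> borel_measurable borel \<longrightarrow> U \<in> borel_measurable borel \<longrightarrow>
      l2 U < \<infinity> \<longrightarrow> (\<integral>\<^sup>+y. ennreal ((\<gamma> y)\<^sup>2) \<partial>lborel) < \<infinity> \<longrightarrow>
       l2 (stft \<gamma> U) \<le> ennreal C * (\<integral>\<^sup>+y. ennreal ((\<gamma> y)\<^sup>2) \<partial>lborel) * l2 U)"
proof -
  obtain C where C: "0 \<le> C" "\<And>F::'a \<Rightarrow> complex. integrable lborel F \<Longrightarrow>
       (\<integral>\<^sup>+\<xi>. ennreal ((norm (ft F \<xi>))\<^sup>2) \<partial>lborel) \<le> ennreal C * l2 F"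
    using plancherel_inequality[where 'a='a] by metis
  have "l2 (stft \<gamma> U) \<le> ennreal C * (\<integral>\<^sup>+y. ennreal ((\<gamma> y)\<^sup>2) \<partial>lborel) * l2 U"
    if [measurable]: "\<gamma> \<in> borel_measurable borel" "U \<in> borel_measurable borel"
      and f: "l2 U < \<infinity>" "(\<integral>\<^sup>+y. ennreal ((\<gamma> y)\<^sup>2) \<partial>lborel) < \<infinity>" for \<gamma> :: "'a \<Rightarrow> real" and U
  proof -
    have "l2 (stft \<gamma> U) = (\<integral>\<^sup>+Y. \<integral>\<^sup>+\<xi>. ennreal ((norm (stft \<gamma> U (Y, \<xi>)))\<^sup>2) \<partial>lborel \<partial>lborel)"
      unfolding l2_def by (rule nn_integral_prod_lborel) measurable
    also have "\<dots> \<le> (\<integral>\<^sup>+Y. ennreal C * l2 (\<lambda>y. U y * of_real (\<gamma> (y - Y))) \<partial>lborel)"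
      unfolding stft_eq_ft using stft_integrable(1)[OF that(2,1) f] by (intro nn_integral_mono C)
    also have "\<dots> = ennreal C * (\<integral>\<^sup>+Y. l2 (\<lambda>y. U y * of_real (\<gamma> (y - Y))) \<partial>lborel)"
      unfolding l2_def by (rule nn_integral_cmult) measurable
    also have "(\<integral>\<^sup>+Y. l2 (\<lambda>y. U y * of_real (\<gamma> (y - Y))) \<partial>lborel)
       = (\<integral>\<^sup>+Y. \<integral>\<^sup>+y. ennreal ((norm (U y))\<^sup>2) * ennreal ((\<gamma> (y - Y))\<^sup>2) \<partial>lborel \<partial>lborel)"
      unfolding l2_def by (simp add: norm_mult power_mult_distrib ennreal_mult)
    also have "\<dots> = (\<integral>\<^sup>+y. \<integral>\<^sup>+Y. ennreal ((norm (U y))\<^sup>2) * ennreal ((\<gamma> (y - Y))\<^sup>2) \<partial>lborel \<partial>lborel)"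
      by (rule lborel_pair.Fubini') measurable
    also have "\<dots> = (\<integral>\<^sup>+y. ennreal ((norm (U y))\<^sup>2) * (\<integral>\<^sup>+Y. ennreal ((\<gamma> (y - Y))\<^sup>2) \<partial>lborel) \<partial>lborel)"
      by (intro nn_integral_cong nn_integral_cmult) measurable
    also have "\<dots> = l2 U * (\<integral>\<^sup>+y. ennreal ((\<gamma> y)\<^sup>2) \<partial>lborel)"
      unfolding l2_def using nn_integral_lborel_shift(3)[of "\<lambda>y. ennreal ((\<gamma> y)\<^sup>2)"]
      by (simp add: nn_integral_multc)
    finally show ?thesis by (simp add: mult_ac)
  qed
  with C(1) show ?thesis by blast
qed

section \<open>The window and the anti-Wick approximation\<close>

definition tent :: "'a::euclidean_space \<Rightarrow> real" where
  "tent t = max 0 (1 - norm t)"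

definition tent_l2 :: "'a::euclidean_space itself \<Rightarrow> real" where
  "tent_l2 _ = enn2real (\<integral>\<^sup>+(t::'a). ennreal ((tent t)\<^sup>2) \<partial>lborel)"

text \<open>Supported in the ball of radius 1/s and normalised to L2 norm 1 for every positive
  \<open>s\<close>. Compact support confines the centre to distance 1/s, and the Lipschitz profile
  limits the effect of a translation by v to order s |v|.\<close>

definition win :: "real \<Rightarrow> 'a::euclidean_space \<Rightarrow> real" where
  "win s t = sqrt (s ^ DIM('a) / tent_l2 TYPE('a)) * tent (s *\<^sub>R t)"

lemma tent_measurable [measurable]: "tent \<in> borel_measurable borel"
  unfolding tent_def[abs_def] by measurable

lemma win_measurable [measurable]: "win s \<in> borel_measurable borel"
  unfolding win_def[abs_def] by measurable

lemma tent_bounds: "0 \<le> tent t" "tent t \<le> 1" "1 \<le> norm t \<Longrightarrow> tent t = 0"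
  by (auto simp: tent_def)

lemma tent_le_indicator: "tent t \<le> indicator (cball 0 1) t"
  using tent_bounds[of t] by (auto split: split_indicator)

lemma tent_lipschitz: "\<bar>tent t - tent t'\<bar> \<le> norm (t - t')"
proof -
  have "\<bar>norm t - norm t'\<bar> \<le> norm (t - t')" by (rule norm_triangle_ineq3)
  then show ?thesis unfolding tent_def max_def by (smt (verit))
qed

lemma cball_finite: "emeasure lborel (cball (0::'a::euclidean_space) r) < \<infinity>"
  by (rule emeasure_bounded_finite) simp

lemma tent_l1_finite: "(\<integral>\<^sup>+(t::'a::euclidean_space). ennreal (tent t) \<partial>lborel) < \<infinity>"
proof -
  have "(\<integral>\<^sup>+(t::'a). ennreal (tent t) \<partial>lborel) \<le> (\<integral>\<^sup>+(t::'a). indicator (cball 0 1) t \<partial>lborel)"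
    by (intro nn_integral_mono) (metis ennreal_indicator ennreal_leI tent_le_indicator)
  also have "\<dots> < \<infinity>" using cball_finite by simp
  finally show ?thesis .
qed

lemma tent_l2:
  "(\<integral>\<^sup>+(t::'a::euclidean_space). ennreal ((tent t)\<^sup>2) \<partial>lborel) = ennreal (tent_l2 TYPE('a))"
  "0 < tent_l2 TYPE('a)"
proof -
  have "(\<integral>\<^sup>+(t::'a). ennreal ((tent t)\<^sup>2) \<partial>lborel) \<le> (\<integral>\<^sup>+(t::'a). ennreal (tent t) \<partial>lborel)"
    by (intro nn_integral_mono ennreal_leI) (auto simp: power2_eq_square intro!: mult_left_le tent_bounds)
  then have fin: "(\<integral>\<^sup>+(t::'a). ennreal ((tent t)\<^sup>2) \<partial>lborel) < \<infinity>"
    using tent_l1_finite order_le_less_trans by blast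
  then show eq: "(\<integral>\<^sup>+(t::'a). ennreal ((tent t)\<^sup>2) \<partial>lborel) = ennreal (tent_l2 TYPE('a))"
    unfolding tent_l2_def by (simp add: less_top)
  have "(\<integral>\<^sup>+(t::'a). ennreal ((tent t)\<^sup>2) \<partial>lborel) \<noteq> 0"
  proof
    assume "(\<integral>\<^sup>+(t::'a). ennreal ((tent t)\<^sup>2) \<partial>lborel) = 0"
    then have "AE t in lborel. tent (t::'a) = 0"
      by (subst (asm) nn_integral_0_iff_AE) auto
    then have "AE t in lborel. (t::'a) \<notin> ball 0 1"
      by (auto simp: tent_def max_def)
    then have "emeasure lborel (ball (0::'a) 1) = 0"
      by (subst (asm) AE_iff_measurable[of "ball 0 1"]) auto
    then show False by (simp add: emeasure_ball unit_ball_vol_pos less_imp_neq[symmetric])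
  qed
  then show "0 < tent_l2 TYPE('a)" unfolding eq by (metis ennreal_neg not_less)
qed

lemma win_nonneg: "0 < s \<Longrightarrow> 0 \<le> win s (t::'a::euclidean_space)"
  unfolding win_def using tent_l2(2)[where 'a='a]
  by (intro mult_nonneg_nonneg real_sqrt_ge_zero divide_nonneg_nonneg tent_bounds) auto

lemma win_sq: "0 < s \<Longrightarrow> (win s (t::'a::euclidean_space))\<^sup>2 = s ^ DIM('a) / tent_l2 TYPE('a) * (tent (s *\<^sub>R t))\<^sup>2"
  using tent_l2(2)[where 'a='a] by (simp add: win_def power_mult_distrib)

lemma nn_integral_scaled:
  fixes f :: "'a::euclidean_space \<Rightarrow> ennreal"
  assumes "f \<in> borel_measurable borel" "0 < s"
  shows "ennreal (s ^ DIM('a)) * (\<integral>\<^sup>+t. f (s *\<^sub>R t) \<partial>lborel) = (\<integral>\<^sup>+t. f t \<partial>lborel)"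
  using nn_integral_lborel_affine[OF assms(1), of s 0] assms(2) by simp

lemma win_l2: "0 < s \<Longrightarrow> (\<integral>\<^sup>+(t::'a::euclidean_space). ennreal ((win s t)\<^sup>2) \<partial>lborel) = 1"
proof -
  assume s: "0 < s"
  have "(\<integral>\<^sup>+(t::'a). ennreal ((win s t)\<^sup>2) \<partial>lborel)
    = (\<integral>\<^sup>+(t::'a). ennreal (1 / tent_l2 TYPE('a)) * (ennreal (s ^ DIM('a)) * ennreal ((tent (s *\<^sub>R t))\<^sup>2)) \<partial>lborel)"
    using s tent_l2(2)[where 'a='a] by (simp add: win_sq ennreal_mult[symmetric])
  also have "\<dots> = ennreal (1 / tent_l2 TYPE('a)) * (ennreal (s ^ DIM('a)) * (\<integral>\<^sup>+(t::'a). ennreal ((tent (s *\<^sub>R t))\<^sup>2) \<partial>lborel))"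
    by (simp add: nn_integral_cmult)
  also have "ennreal (s ^ DIM('a)) * (\<integral>\<^sup>+(t::'a). ennreal ((tent (s *\<^sub>R t))\<^sup>2) \<partial>lborel) = ennreal (tent_l2 TYPE('a))"
    using nn_integral_scaled[of "\<lambda>t::'a. ennreal ((tent t)\<^sup>2)" s] s by (simp add: tent_l2(1))
  also have "ennreal (1 / tent_l2 TYPE('a)) * \<dots> = 1"
    using tent_l2(2)[where 'a='a] by (simp add: ennreal_mult[symmetric])
  finally show ?thesis .
qed

text \<open>After rescaling, the difference lives on two unit balls, which gives the factor 2 times
  the ball volume, and it is bounded by both 1 and s |v|. The minimum keeps both uses: smallness for
  fixed v as s tends to 0, and boundedness for large v.\<close>

lemma win_translate_l2:
  fixes v :: "'a::euclidean_space"
  assumes s: "0 < s"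
  shows "(\<integral>\<^sup>+t. ennreal ((win s (t + v) - win s t)\<^sup>2) \<partial>lborel)
    \<le> ennreal (2 * measure lborel (cball (0::'a) 1) / tent_l2 TYPE('a) * min 1 ((s * norm v)\<^sup>2))"
proof -
  let ?W = "tent_l2 TYPE('a)" and ?m = "min 1 ((s * norm v)\<^sup>2)" and ?V = "measure lborel (cball (0::'a) 1)"
  have W: "0 < ?W" by (rule tent_l2)
  have sq: "(win s (t + v) - win s t)\<^sup>2 = 1 / ?W * (s ^ DIM('a) * (tent (s *\<^sub>R t + s *\<^sub>R v) - tent (s *\<^sub>R t))\<^sup>2)" for t
    using s W by (simp add: win_def right_diff_distrib[symmetric] power_mult_distrib scaleR_add_right)
  have "(\<integral>\<^sup>+t. ennreal ((win s (t + v) - win s t)\<^sup>2) \<partial>lborel)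
     = (\<integral>\<^sup>+t. ennreal (1 / ?W) * (ennreal (s ^ DIM('a)) * ennreal ((tent (s *\<^sub>R t + s *\<^sub>R v) - tent (s *\<^sub>R t))\<^sup>2)) \<partial>lborel)"
    unfolding sq using W s by (simp add: ennreal_mult[symmetric])
  also have "\<dots> = ennreal (1 / ?W) * (ennreal (s ^ DIM('a)) * (\<integral>\<^sup>+t. ennreal ((tent (s *\<^sub>R t + s *\<^sub>R v) - tent (s *\<^sub>R t))\<^sup>2) \<partial>lborel))"
    by (simp add: nn_integral_cmult)
  also have "ennreal (s ^ DIM('a)) * (\<integral>\<^sup>+t. ennreal ((tent (s *\<^sub>R t + s *\<^sub>R v) - tent (s *\<^sub>R t))\<^sup>2) \<partial>lborel)
     = (\<integral>\<^sup>+t. ennreal ((tent (t + s *\<^sub>R v) - tent t)\<^sup>2) \<partial>lborel)"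
    using nn_integral_scaled[of "\<lambda>t. ennreal ((tent (t + s *\<^sub>R v) - tent t)\<^sup>2)" s] s by simp
  also have "\<dots> \<le> (\<integral>\<^sup>+t. ennreal ?m * (indicator (cball 0 1) (t + s *\<^sub>R v) + indicator (cball 0 1) t) \<partial>lborel)"
  proof (rule nn_integral_mono)
    fix t :: 'a
    let ?d = "tent (t + s *\<^sub>R v) - tent t"
    show "ennreal (?d\<^sup>2) \<le> ennreal ?m * (indicator (cball 0 1) (t + s *\<^sub>R v) + indicator (cball 0 1) t)"
    proof (cases "t + s *\<^sub>R v \<in> cball 0 1 \<or> t \<in> cball 0 1")
      case True
      have "\<bar>?d\<bar> \<le> 1" using tent_bounds[of t] tent_bounds[of "t + s *\<^sub>R v"] by linarith
      moreover have "\<bar>?d\<bar> \<le> s * norm v" using tent_lipschitz[of "t + s *\<^sub>R v" t] s by simp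
      ultimately have "?d\<^sup>2 \<le> ?m"
        using abs_le_square_iff[of ?d 1] abs_le_square_iff[of ?d "s * norm v"] s by (simp add: abs_mult)
      then have "ennreal (?d\<^sup>2) \<le> ennreal ?m * 1" by (simp add: ennreal_leI)
      also have "\<dots> \<le> ennreal ?m * (indicator (cball 0 1) (t + s *\<^sub>R v) + indicator (cball 0 1) t)"
        using True by (intro mult_left_mono) (auto simp: indicator_def)
      finally show ?thesis .
    next
      case False
      then have "?d = 0" by (auto simp: tent_def)
      then show ?thesis by simp
    qed
  qed
  also have "\<dots> = ennreal ?m * ((\<integral>\<^sup>+t. indicator (cball (0::'a) 1) (t + s *\<^sub>R v) \<partial>lborel) + (\<integral>\<^sup>+t. indicator (cball (0::'a) 1) t \<partial>lborel))"
  proof -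
    have i: "(indicator (cball (0::'a) 1) :: 'a \<Rightarrow> ennreal) \<in> borel_measurable borel"
      by (rule borel_measurable_indicator) simp
    have "(\<lambda>t. indicator (cball (0::'a) 1) (t + s *\<^sub>R v) :: ennreal) \<in> borel_measurable borel"
      by (rule measurable_compose[OF _ i]) measurable
    with i show ?thesis by (subst nn_integral_cmult) (auto simp: nn_integral_add simp del: nn_integral_indicator)
  qed
  also have "\<dots> = ennreal ?m * (2 * ennreal ?V)"
    using nn_integral_lborel_shift(1)[OF borel_measurable_indicator, of "cball (0::'a) 1" "s *\<^sub>R v"] cball_finite[where 'a='a, of 1]
    by (simp add: emeasure_eq_ennreal_measure mult_2)
  finally have "(\<integral>\<^sup>+t. ennreal ((win s (t + v) - win s t)\<^sup>2) \<partial>lborel) \<le> ennreal (1 / ?W) * (ennreal ?m * (2 * ennreal ?V))"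
    by (simp add: mult_left_mono)
  also have "\<dots> = ennreal (2 * ?V / ?W * ?m)"
  proof -
    have "2 = ennreal 2" by simp
    then show ?thesis using W by (simp only: ennreal_mult[symmetric] measure_nonneg mult_nonneg_nonneg divide_nonneg_nonneg less_imp_le zero_le_one zero_le_numeral) 
        (simp add: ennreal_mult[symmetric] mult_ac)
  qed
  finally show ?thesis .
qed

lemma win_product_l1:
  fixes x y :: "'a::euclidean_space"
  assumes s: "0 < s"
  shows "(\<integral>\<^sup>+Y. ennreal (win s (x - Y) * win s (y - Y)) \<partial>lborel) \<le> 1"
proof -
  have "2 * (\<integral>\<^sup>+Y. ennreal (win s (x - Y) * win s (y - Y)) \<partial>lborel) = (\<integral>\<^sup>+Y. 2 * ennreal (win s (x - Y) * win s (y - Y)) \<partial>lborel)"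
    by (rule nn_integral_cmult[symmetric]) measurable
  also have "\<dots> \<le> (\<integral>\<^sup>+Y. ennreal ((win s (x - Y))\<^sup>2) + ennreal ((win s (y - Y))\<^sup>2) \<partial>lborel)"
  proof (rule nn_integral_mono)
    fix Y
    have "2 * ennreal (win s (x - Y) * win s (y - Y)) = ennreal (2 * (win s (x - Y) * win s (y - Y)))"
      by (simp add: ennreal_mult win_nonneg s)
    also have "\<dots> \<le> ennreal ((win s (x - Y))\<^sup>2 + (win s (y - Y))\<^sup>2)"
      using sum_squares_bound[of "win s (x - Y)" "win s (y - Y)"] by (intro ennreal_leI) simp
    finally show "2 * ennreal (win s (x - Y) * win s (y - Y)) \<le> ennreal ((win s (x - Y))\<^sup>2) + ennreal ((win s (y - Y))\<^sup>2)"
      by simp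
  qed
  also have "\<dots> = 1 + 1"
    using nn_integral_lborel_shift(3)[of "\<lambda>t::'a. ennreal ((win s t)\<^sup>2)"] win_l2[OF s, where 'a='a]
    by (simp add: nn_integral_add)
  finally have "2 * (\<integral>\<^sup>+Y. ennreal (win s (x - Y) * win s (y - Y)) \<partial>lborel) \<le> 2 * 1" by simp
  then show ?thesis by (subst (asm) ennreal_mult_le_mult_iff) auto
qed

lemma win_sq_integral:
  fixes x :: "'a::euclidean_space"
  assumes s: "0 < s"
  shows "integrable lborel (\<lambda>Y. (win s (x - Y))\<^sup>2)" "(LINT Y|lborel. (win s (x - Y))\<^sup>2) = 1"
proof -
  have 1: "(\<integral>\<^sup>+Y. ennreal ((win s (x - Y))\<^sup>2) \<partial>lborel) = 1"
    using nn_integral_lborel_shift(3)[of "\<lambda>t::'a. ennreal ((win s t)\<^sup>2)"] win_l2[OF s, where 'a='a] by simp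
  then show "integrable lborel (\<lambda>Y. (win s (x - Y))\<^sup>2)"
    by (intro integrableI_bounded) auto
  show "(LINT Y|lborel. (win s (x - Y))\<^sup>2) = 1"
    using 1 by (subst integral_eq_nn_integral) auto
qed

text \<open>Averaging over the window centre Y should return the kernel at Y = x. Replacing the
  second window by the first costs s |y - x|, absorbed by one more power of decay. Moving the base
  point from s^2 Y to s^2 x is a move by at most s on the support of the window, and the Hoelder
  bound with exponent 1/2 turns this into sqrt s without losing decay in y - x.\<close>

lemma anti_wick_kernel:
  fixes a :: "'a::euclidean_space \<times> 'a \<Rightarrow> complex"
  assumes a: "schwartz a"
  shows "\<exists>C\<ge>0. \<forall>s x y. 0 < s \<longrightarrow> s \<le> 1 \<longrightarrow>
    norm ((LINT Y|lborel. of_real (win s (x - Y) * win s (y - Y)) * pft a (s\<^sup>2 *\<^sub>R Y) (y - x)) - pft a (s\<^sup>2 *\<^sub>R x) (y - x))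
      \<le> C * sqrt s * wt (real N) (y - x)"
proof -
  note [measurable] = schwartz_measurable[OF a]
  obtain C1 where C1: "0 \<le> C1" "\<And>x z. norm (pft a x z) \<le> C1 * wt (real (Suc N)) z"
    using pft_decay[OF a] by metis
  obtain C2 where C2: "0 \<le> C2" "\<And>x x' z. norm (pft a x z - pft a x' z) \<le> C2 * sqrt (norm (x - x')) * wt (real N) z"
    using pft_hoelder[OF a] by metis
  define W W1 where "W = tent_l2 TYPE('a)" and "W1 = enn2real (\<integral>\<^sup>+(t::'a). ennreal (tent t) \<partial>lborel)"
  have W: "0 < W" "0 \<le> W1" using tent_l2(2)[where 'a='a] by (auto simp: W_def W1_def)
  have W1: "ennreal W1 = (\<integral>\<^sup>+(t::'a). ennreal (tent t) \<partial>lborel)"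
    unfolding W1_def using tent_l1_finite[where 'a='a] by (simp add: less_top)
  define C where "C = C1 * (W1 / W) + C2"
  have nn: "0 \<le> C1 * s * wt (real N) z / W" "0 \<le> C2 * sqrt s * wt (real N) z" "0 \<le> s ^ DIM('a)"
    if "0 < s" for s and z :: 'a
    using C1(1) C2(1) W that by auto
  have "norm ((LINT Y|lborel. of_real (win s (x - Y) * win s (y - Y)) * pft a (s\<^sup>2 *\<^sub>R Y) (y - x)) - pft a (s\<^sup>2 *\<^sub>R x) (y - x))
      \<le> C * sqrt s * wt (real N) (y - x)" if s: "0 < s" "s \<le> 1" for s x y
  proof -
    define z where "z = y - x"
    let ?w = "wt (real N) z"
    let ?f = "\<lambda>Y. of_real (win s (x - Y) * win s (y - Y)) * pft a (s\<^sup>2 *\<^sub>R Y) z"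
    let ?g = "\<lambda>Y. of_real ((win s (x - Y))\<^sup>2) * pft a (s\<^sup>2 *\<^sub>R x) z"
    have f: "integrable lborel ?f"
    proof (rule Bochner_Integration.integrable_bound)
      show "integrable lborel (\<lambda>Y. win s (x - Y) * win s (y - Y) * (C1 * wt (real (Suc N)) z))"
        using order_le_less_trans[OF win_product_l1[OF s(1), of x y], of \<infinity>] s
        by (intro integrable_mult_left integrableI_bounded) (auto simp: abs_mult win_nonneg)
      show "AE Y in lborel. norm (?f Y) \<le> norm (win s (x - Y) * win s (y - Y) * (C1 * wt (real (Suc N)) z))"
        using C1 by (auto simp: norm_mult abs_mult win_nonneg s abs_of_nonneg intro!: mult_left_mono mult_nonneg_nonneg simp del: of_nat_Suc)
    qed measurable
    have g: "integrable lborel ?g" "(LINT Y|lborel. ?g Y) = pft a (s\<^sup>2 *\<^sub>R x) z"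
    proof -
      have "integrable lborel (\<lambda>Y. complex_of_real ((win s (x - Y))\<^sup>2))"
        using win_sq_integral(1)[OF s(1)] by (subst complex_of_real_integrable_eq)
      then show "integrable lborel ?g" by (rule integrable_mult_left)
      have "(LINT Y|lborel. ?g Y) = (LINT Y|lborel. complex_of_real ((win s (x - Y))\<^sup>2)) * pft a (s\<^sup>2 *\<^sub>R x) z"
        by (rule integral_mult_left_zero)
      then show "(LINT Y|lborel. ?g Y) = pft a (s\<^sup>2 *\<^sub>R x) z"
        unfolding integral_complex_of_real win_sq_integral(2)[OF s(1)] by simp
    qed
    have "ennreal (norm ((LINT Y|lborel. ?f Y) - pft a (s\<^sup>2 *\<^sub>R x) z)) = ennreal (norm (LINT Y|lborel. ?f Y - ?g Y))"
      by (subst Bochner_Integration.integral_diff[OF f g(1)]) (simp only: g(2))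
    also have "\<dots> \<le> (\<integral>\<^sup>+Y. ennreal (norm (?f Y - ?g Y)) \<partial>lborel)"
      by (rule norm_integral_le_nn_integral)
    also have "\<dots> \<le> (\<integral>\<^sup>+Y. ennreal (C1 * s * ?w / W) * (ennreal (s ^ DIM('a)) * ennreal (tent (s *\<^sub>R (x - Y)))) + ennreal (C2 * sqrt s * ?w) * ennreal ((win s (x - Y))\<^sup>2) \<partial>lborel)"
    proof (rule nn_integral_mono)
      fix Y
      let ?u = "win s (x - Y)" and ?v = "win s (y - Y)" and ?P = "pft a (s\<^sup>2 *\<^sub>R Y) z"
      \<comment> \<open>First the second window is exchanged, then the base point is moved.\<close>
      have "?f Y - ?g Y = of_real (?u * (?v - ?u)) * ?P + of_real (?u\<^sup>2) * (?P - pft a (s\<^sup>2 *\<^sub>R x) z)"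
        by (simp add: algebra_simps power2_eq_square)
      also have "norm \<dots> \<le> \<bar>?u * (?v - ?u)\<bar> * norm ?P + ?u\<^sup>2 * norm (?P - pft a (s\<^sup>2 *\<^sub>R x) z)"
        by (rule order_trans[OF norm_triangle_ineq]) (simp only: norm_mult norm_of_real abs_power2 order_refl)
      also have "\<bar>?u * (?v - ?u)\<bar> * norm ?P \<le> C1 * s * ?w / W * (s ^ DIM('a) * tent (s *\<^sub>R (x - Y)))"
      proof -
        have "\<bar>tent (s *\<^sub>R (y - Y)) - tent (s *\<^sub>R (x - Y))\<bar> \<le> s * norm z"
          using tent_lipschitz[of "s *\<^sub>R (y - Y)" "s *\<^sub>R (x - Y)"] s
          by (simp add: scaleR_diff_right[symmetric] z_def)
        then have "s ^ DIM('a) / W * tent (s *\<^sub>R (x - Y)) * \<bar>tent (s *\<^sub>R (y - Y)) - tent (s *\<^sub>R (x - Y))\<bar>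
            \<le> s ^ DIM('a) / W * tent (s *\<^sub>R (x - Y)) * (s * norm z)"
          using s W by (intro mult_left_mono mult_nonneg_nonneg divide_nonneg_nonneg zero_le_power tent_bounds) auto
        moreover have "?u * (?v - ?u) = s ^ DIM('a) / W * tent (s *\<^sub>R (x - Y)) * (tent (s *\<^sub>R (y - Y)) - tent (s *\<^sub>R (x - Y)))"
        proof -
          define c where "c = sqrt (s ^ DIM('a) / W)"
          have "c * c = s ^ DIM('a) / W" unfolding c_def using s W by simp
          moreover have "?u * (?v - ?u) = (c * c) * tent (s *\<^sub>R (x - Y)) * (tent (s *\<^sub>R (y - Y)) - tent (s *\<^sub>R (x - Y)))"
            unfolding win_def c_def[symmetric] W_def[symmetric] by (simp add: algebra_simps)
          ultimately show ?thesis by simp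
        qed
        ultimately have "\<bar>?u * (?v - ?u)\<bar> \<le> s ^ DIM('a) / W * tent (s *\<^sub>R (x - Y)) * (s * norm z)"
          using s W by (simp add: abs_mult abs_of_nonneg[OF tent_bounds(1)])
        then have "\<bar>?u * (?v - ?u)\<bar> * norm ?P \<le> (s ^ DIM('a) / W * tent (s *\<^sub>R (x - Y)) * (s * norm z)) * (C1 * wt (real (Suc N)) z)"
          using C1 s W tent_bounds by (intro mult_mono) (auto simp del: of_nat_Suc)
        also have "\<dots> = C1 * s * (norm z * wt (real (Suc N)) z) / W * (s ^ DIM('a) * tent (s *\<^sub>R (x - Y)))"
          by (simp add: algebra_simps del: of_nat_Suc)
        also have "\<dots> \<le> C1 * s * ?w / W * (s ^ DIM('a) * tent (s *\<^sub>R (x - Y)))"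
        proof -
          \<comment> \<open>Here the extra power in the bound for \<open>pft a\<close> pays for the
            factor |z| from the Lipschitz estimate.\<close>
          have "norm z * wt (real (Suc N)) z \<le> ?w"
            unfolding wt_nat by (simp add: field_simps add_pos_nonneg)
          then show ?thesis using C1(1) s W by (intro mult_right_mono divide_right_mono mult_left_mono mult_nonneg_nonneg zero_le_power tent_bounds) auto
        qed
        finally show ?thesis .
      qed
      also have "?u\<^sup>2 * norm (?P - pft a (s\<^sup>2 *\<^sub>R x) z) \<le> C2 * sqrt s * ?w * ?u\<^sup>2"
      proof (cases "?u = 0")
        case False
        then have "tent (s *\<^sub>R (x - Y)) \<noteq> 0" by (auto simp: win_def)
        \<comment> \<open>Where the window does not vanish, Y is within 1/s of x, so s^2 Y is within
          s of s^2 x.\<close>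
        then have "s * norm (x - Y) \<le> 1" using tent_bounds(3)[of "s *\<^sub>R (x - Y)"] s by force
        then have "norm (s\<^sup>2 *\<^sub>R Y - s\<^sup>2 *\<^sub>R x) \<le> s"
          using s mult_left_mono[of "s * norm (x - Y)" 1 s]
          by (simp add: scaleR_diff_right[symmetric] norm_minus_commute power2_eq_square mult_ac)
        then have "norm (?P - pft a (s\<^sup>2 *\<^sub>R x) z) \<le> C2 * sqrt s * ?w"
          using C2 by (intro order_trans[OF C2(2)] mult_right_mono mult_left_mono) auto
        then show ?thesis by (subst mult.commute) (rule mult_right_mono, auto)
      qed simp
      finally have "ennreal (norm (?f Y - ?g Y)) \<le> ennreal (C1 * s * ?w / W * (s ^ DIM('a) * tent (s *\<^sub>R (x - Y))) + C2 * sqrt s * ?w * ?u\<^sup>2)"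
        by (intro ennreal_leI) simp
      also have "\<dots> = ennreal (C1 * s * ?w / W) * (ennreal (s ^ DIM('a)) * ennreal (tent (s *\<^sub>R (x - Y)))) + ennreal (C2 * sqrt s * ?w) * ennreal (?u\<^sup>2)"
        by (simp only: ennreal_plus ennreal_mult nn(1)[OF s(1)] nn(2)[OF s(1)] nn(3)[OF s(1)] tent_bounds(1) mult_nonneg_nonneg zero_le_power2)
      finally show "ennreal (norm (?f Y - ?g Y)) \<le> ennreal (C1 * s * ?w / W) * (ennreal (s ^ DIM('a)) * ennreal (tent (s *\<^sub>R (x - Y)))) + ennreal (C2 * sqrt s * ?w) * ennreal (?u\<^sup>2)" .
    qed
    also have "\<dots> = ennreal (C1 * s * ?w / W) * (ennreal (s ^ DIM('a)) * (\<integral>\<^sup>+Y. ennreal (tent (s *\<^sub>R (x - Y))) \<partial>lborel)) + ennreal (C2 * sqrt s * ?w) * (\<integral>\<^sup>+Y. ennreal ((win s (x - Y))\<^sup>2) \<partial>lborel)"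
      by (simp add: nn_integral_add nn_integral_cmult)
    also have "(\<integral>\<^sup>+Y. ennreal (tent (s *\<^sub>R (x - Y))) \<partial>lborel) = (\<integral>\<^sup>+(t::'a). ennreal (tent (s *\<^sub>R t)) \<partial>lborel)"
      by (rule nn_integral_lborel_shift(3)[of "\<lambda>t. ennreal (tent (s *\<^sub>R t))" x]) measurable
    also have "ennreal (s ^ DIM('a)) * (\<integral>\<^sup>+(t::'a). ennreal (tent (s *\<^sub>R t)) \<partial>lborel) = ennreal W1"
      unfolding W1 by (rule nn_integral_scaled[OF _ s(1)]) measurable
    also have "(\<integral>\<^sup>+Y. ennreal ((win s (x - Y))\<^sup>2) \<partial>lborel) = 1"
      using nn_integral_lborel_shift(3)[of "\<lambda>t::'a. ennreal ((win s t)\<^sup>2)"] win_l2[OF s(1), where 'a='a] by simp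
    also have "ennreal (C1 * s * ?w / W) * ennreal W1 + ennreal (C2 * sqrt s * ?w) * 1 = ennreal (C1 * s * ?w / W * W1 + C2 * sqrt s * ?w)"
      by (simp only: ennreal_plus ennreal_mult nn(1)[OF s(1)] nn(2)[OF s(1)] W(2) mult_nonneg_nonneg mult_1_right)
    finally have "norm ((LINT Y|lborel. ?f Y) - pft a (s\<^sup>2 *\<^sub>R x) z) \<le> C1 * s * ?w / W * W1 + C2 * sqrt s * ?w"
      using C1(1) C2(1) s W by (subst (asm) ennreal_le_iff) auto
    also have "\<dots> \<le> C1 * sqrt s * ?w / W * W1 + C2 * sqrt s * ?w"
    proof -
      have "s \<le> sqrt s" using s by (metis less_eq_real_def mult_left_le real_sqrt_ge_zero real_sqrt_le_1_iff real_sqrt_mult_self abs_of_pos)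
      then show ?thesis using C1(1) W s by (intro add_mono mult_right_mono divide_right_mono mult_left_mono) auto
    qed
    also have "\<dots> = C * sqrt s * ?w" unfolding C_def by (simp add: algebra_simps)
    finally show ?thesis unfolding z_def .
  qed
  moreover have "0 \<le> C" unfolding C_def using C1 C2 W by simp
  ultimately show ?thesis by blast
qed

text \<open>For fixed window centre, \<open>ft_quadratic\<close> expands the squared transform over
  pairs of points. Integrating the centre first yields the averaged kernel, which
  \<open>anti_wick_kernel\<close> compares with the Wigner kernel; its error decays in the
  difference of the two points, so the bilinear Schur bound finishes. The parameter \<open>s\<close>
  stands for sqrt h, and s^2 for h.\<close>

lemma anti_wick:
  fixes a :: "'a::euclidean_space \<times> 'a \<Rightarrow> complex"
  assumes a: "schwartz a"
  obtains C where "0 \<le> C" "\<And>s U. 0 < s \<Longrightarrow> s \<le> 1 \<Longrightarrow> U \<in> borel_measurable borel \<Longrightarrow> l2 U < \<infinity> \<Longrightarrow>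
    norm ((LINT z|lborel. a (s\<^sup>2 *\<^sub>R fst z, snd z) * of_real ((norm (stft (win s) U z))\<^sup>2))
       - (LINT p|lborel. cnj (U (fst p)) * U (snd p) * pft a (s\<^sup>2 *\<^sub>R fst p) (snd p - fst p)))
      \<le> C * sqrt s * enn2real (l2 U)"
proof -
  let ?N = "Suc DIM('a)"
  note a_meas[measurable] = schwartz_measurable[OF a]
  obtain B where B: "0 \<le> B" "\<And>z. norm (a z) \<le> B" using schwartz_bounded[OF a] by metis
  obtain P where P: "0 \<le> P" "\<And>x z. norm (pft a x z) \<le> P * wt (real ?N) z" using pft_decay[OF a] by metis
  obtain K where K: "0 \<le> K" "\<And>s x y. 0 < s \<Longrightarrow> s \<le> 1 \<Longrightarrow>
    norm ((LINT Y|lborel. of_real (win s (x - Y) * win s (y - Y)) * pft a (s\<^sup>2 *\<^sub>R Y) (y - x)) - pft a (s\<^sup>2 *\<^sub>R x) (y - x))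
      \<le> K * sqrt s * wt (real ?N) (y - x)"
    using anti_wick_kernel[OF a, of ?N] by (elim exE conjE) blast
  obtain Q where Q: "0 \<le> Q"
    "\<And>(\<gamma>::'a \<Rightarrow> real) U. \<gamma> \<in> borel_measurable borel \<Longrightarrow> U \<in> borel_measurable borel \<Longrightarrow>
      l2 U < \<infinity> \<Longrightarrow> (\<integral>\<^sup>+y. ennreal ((\<gamma> y)\<^sup>2) \<partial>lborel) < \<infinity> \<Longrightarrow>
       l2 (stft \<gamma> U) \<le> ennreal Q * (\<integral>\<^sup>+y. ennreal ((\<gamma> y)\<^sup>2) \<partial>lborel) * l2 U"
    using stft_l2_bound[where 'a='a] by (elim exE conjE) blast
  define I where "I = (\<integral>\<^sup>+(z::'a). ennreal (wt (real ?N) z) \<partial>lborel)"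
  have I: "I < \<infinity>" unfolding I_def by (rule wt_integrable) simp
  have "norm ((LINT z|lborel. a (s\<^sup>2 *\<^sub>R fst z, snd z) * of_real ((norm (stft (win s) U z))\<^sup>2))
       - (LINT p|lborel. cnj (U (fst p)) * U (snd p) * pft a (s\<^sup>2 *\<^sub>R fst p) (snd p - fst p)))
      \<le> K * enn2real I * sqrt s * enn2real (l2 U)"
    if s: "0 < s" "s \<le> 1" and U[measurable]: "U \<in> borel_measurable borel" and fin: "l2 U < \<infinity>" for s U
  proof -
    let ?w = "\<lambda>x Y. win s (x - Y)"
    let ?F = "\<lambda>Y y. U y * of_real (?w y Y)"
    have w2: "(\<integral>\<^sup>+(y::'a). ennreal ((win s y)\<^sup>2) \<partial>lborel) < \<infinity>" using win_l2[OF s(1), where 'a='a] by simp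
    have F: "integrable lborel (?F Y)" for Y
      by (rule stft_integrable(1)[OF U win_measurable fin w2])
    let ?G = "\<lambda>z. a (s\<^sup>2 *\<^sub>R fst z, snd z) * of_real ((norm (stft (win s) U z))\<^sup>2)"
    have G: "integrable lborel ?G"
    proof (rule Bochner_Integration.integrable_bound)
      have "l2 (stft (win s) U) < \<infinity>"
        using Q(2)[OF win_measurable[of s] U fin w2] fin w2 by (auto simp: ennreal_mult_less_top intro: order_le_less_trans)
      then show "integrable lborel (\<lambda>z. B * (norm (stft (win s) U z))\<^sup>2)"
        unfolding l2_def by (intro integrable_mult_right integrableI_bounded) auto
      show "AE z in lborel. norm (?G z) \<le> norm (B * (norm (stft (win s) U z))\<^sup>2)"
        using B by (auto simp: norm_mult norm_power intro!: mult_right_mono)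
    qed measurable
    let ?H = "\<lambda>q. cnj (U (fst (snd q))) * U (snd (snd q)) *
      (of_real (?w (fst (snd q)) (fst q) * ?w (snd (snd q)) (fst q)) * pft a (s\<^sup>2 *\<^sub>R fst q) (snd (snd q) - fst (snd q)))"
    have 1: "(LINT z|lborel. ?G z) = (LINT Y|lborel. LINT p|lborel. ?H (Y, p))"
    proof -
      have "(LINT z|lborel. ?G z) = (LINT Y|lborel. LINT \<xi>|lborel. a (s\<^sup>2 *\<^sub>R Y, \<xi>) * of_real ((norm (ft (?F Y) \<xi>))\<^sup>2))"
        using integral_prod_lborel(1)[OF G] by (simp add: stft_eq_ft)
      also have "\<dots> = (LINT Y|lborel. LINT p|lborel. cnj (?F Y (fst p)) * ?F Y (snd p) * pft a (s\<^sup>2 *\<^sub>R Y) (snd p - fst p))"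
        unfolding ft_quadratic[OF F schwartz_section_integrable[OF a]] pft_def ..
      also have "\<dots> = (LINT Y|lborel. LINT p|lborel. ?H (Y, p))"
        by (intro Bochner_Integration.integral_cong refl) (simp add: mult_ac)
      finally show ?thesis .
    qed
    \<comment> \<open>Fubini in three variables: the product of the windows has integral at most 1
      in Y, which leaves a bilinear form with an integrable weight.\<close>
    have H: "integrable lborel ?H"
    proof (rule integrableI_bounded)
      show "?H \<in> borel_measurable lborel" by measurable
      have "(\<integral>\<^sup>+q. ennreal (norm (?H q)) \<partial>lborel) \<le> (\<integral>\<^sup>+q. ennreal (norm (U (fst (snd q))) * norm (U (snd (snd q)))) * (ennreal P * ennreal (wt (real ?N) (snd (snd q) - fst (snd q)))) *
          ennreal (?w (fst (snd q)) (fst q) * ?w (snd (snd q)) (fst q)) \<partial>lborel)"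
      proof (rule nn_integral_mono)
        fix q :: "'a \<times> 'a \<times> 'a"
        have "norm (?H q) \<le> norm (U (fst (snd q))) * norm (U (snd (snd q))) * (P * wt (real ?N) (snd (snd q) - fst (snd q))) * (?w (fst (snd q)) (fst q) * ?w (snd (snd q)) (fst q))"
          using mult_left_mono[OF P(2)[of "s\<^sup>2 *\<^sub>R fst q" "snd (snd q) - fst (snd q)"], of "norm (U (fst (snd q))) * norm (U (snd (snd q))) * (?w (fst (snd q)) (fst q) * ?w (snd (snd q)) (fst q))"] s
          by (simp add: norm_mult abs_mult win_nonneg mult_ac del: of_nat_Suc)
        then show "ennreal (norm (?H q)) \<le> ennreal (norm (U (fst (snd q))) * norm (U (snd (snd q)))) * (ennreal P * ennreal (wt (real ?N) (snd (snd q) - fst (snd q)))) *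
          ennreal (?w (fst (snd q)) (fst q) * ?w (snd (snd q)) (fst q))"
          using P(1) s by (simp add: ennreal_mult[symmetric] win_nonneg ennreal_leI del: of_nat_Suc)
      qed
      also have "\<dots> = (\<integral>\<^sup>+p. ennreal (norm (U (fst p)) * norm (U (snd p))) * (ennreal P * ennreal (wt (real ?N) (snd p - fst p))) *
          (\<integral>\<^sup>+Y. ennreal (?w (fst p) Y * ?w (snd p) Y) \<partial>lborel) \<partial>lborel)"
        by (subst nn_integral_prod_lborel(2)) (simp_all add: nn_integral_cmult)
      also have "\<dots> \<le> (\<integral>\<^sup>+p. ennreal (norm (U (fst p)) * norm (U (snd p))) * (ennreal P * ennreal (wt (real ?N) (snd p - fst p))) * 1 \<partial>lborel)"
        using win_product_l1[OF s(1)] by (intro nn_integral_mono mult_left_mono) auto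
      also have "\<dots> \<le> (\<integral>\<^sup>+(z::'a). ennreal P * ennreal (wt (real ?N) z) \<partial>lborel) * l2 U"
        unfolding mult_1_right by (rule bilinear_schur) measurable
      also have "\<dots> = ennreal P * I * l2 U" unfolding I_def by (subst nn_integral_cmult) auto
      also have "\<dots> < \<infinity>" using I fin by (simp add: ennreal_mult_less_top)
      finally show "(\<integral>\<^sup>+q. ennreal (norm (?H q)) \<partial>lborel) < \<infinity>" .
    qed
    let ?M = "\<lambda>p. (LINT Y|lborel. of_real (?w (fst p) Y * ?w (snd p) Y) * pft a (s\<^sup>2 *\<^sub>R Y) (snd p - fst p))"
    have 2: "(LINT Y|lborel. LINT p|lborel. ?H (Y, p)) = (LINT p|lborel. cnj (U (fst p)) * U (snd p) * ?M p)"
      using integral_prod_lborel[OF H] by simp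
    have UM: "integrable lborel (\<lambda>p. cnj (U (fst p)) * U (snd p) * ?M p)"
      using lborel_pair.integrable_snd[of "\<lambda>x y. ?H (x, y)"] H by (simp add: lborel_prod split_beta')
    let ?L = "\<lambda>p. pft a (s\<^sup>2 *\<^sub>R fst p) (snd p - fst p)"
    have UL: "integrable lborel (\<lambda>p. cnj (U (fst p)) * U (snd p) * ?L p)"
    proof (rule integrableI_bounded)
      have "(\<integral>\<^sup>+p. ennreal (norm (cnj (U (fst p)) * U (snd p) * ?L p)) \<partial>lborel)
        \<le> (\<integral>\<^sup>+p. ennreal (norm (U (fst p)) * norm (U (snd p))) * (ennreal P * ennreal (wt (real ?N) (snd p - fst p))) \<partial>lborel)"
        using P by (intro nn_integral_mono) (auto simp: norm_mult ennreal_mult[symmetric] simp del: of_nat_Suc intro!: ennreal_leI mult_left_mono)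
      also have "\<dots> \<le> (\<integral>\<^sup>+(z::'a). ennreal P * ennreal (wt (real ?N) z) \<partial>lborel) * l2 U"
        by (rule bilinear_schur) measurable
      also have "\<dots> = ennreal P * I * l2 U" unfolding I_def by (subst nn_integral_cmult) auto
      also have "\<dots> < \<infinity>" using I fin by (simp add: ennreal_mult_less_top)
      finally show "(\<integral>\<^sup>+p. ennreal (norm (cnj (U (fst p)) * U (snd p) * ?L p)) \<partial>lborel) < \<infinity>" .
    qed measurable
    have "ennreal (norm ((LINT z|lborel. ?G z) - (LINT p|lborel. cnj (U (fst p)) * U (snd p) * ?L p)))
       = ennreal (norm (LINT p|lborel. cnj (U (fst p)) * U (snd p) * (?M p - ?L p)))"
      unfolding 1 2 using UM UL by (simp add: right_diff_distrib)
    also have "\<dots> \<le> (\<integral>\<^sup>+p. ennreal (norm (cnj (U (fst p)) * U (snd p) * (?M p - ?L p))) \<partial>lborel)"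
      by (rule norm_integral_le_nn_integral)
    also have "\<dots> \<le> (\<integral>\<^sup>+p. ennreal (norm (U (fst p)) * norm (U (snd p))) * (ennreal (K * sqrt s) * ennreal (wt (real ?N) (snd p - fst p))) \<partial>lborel)"
    proof (rule nn_integral_mono)
      fix p
      have "norm (cnj (U (fst p)) * U (snd p) * (?M p - ?L p)) \<le> norm (U (fst p)) * norm (U (snd p)) * (K * sqrt s * wt (real ?N) (snd p - fst p))"
        unfolding norm_mult complex_mod_cnj by (intro mult_left_mono K(2) s mult_nonneg_nonneg norm_ge_zero)
      then show "ennreal (norm (cnj (U (fst p)) * U (snd p) * (?M p - ?L p))) \<le> ennreal (norm (U (fst p)) * norm (U (snd p))) * (ennreal (K * sqrt s) * ennreal (wt (real ?N) (snd p - fst p)))"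
        using K(1) s by (simp add: ennreal_mult[symmetric] ennreal_leI del: of_nat_Suc)
    qed
    also have "\<dots> \<le> (\<integral>\<^sup>+(z::'a). ennreal (K * sqrt s) * ennreal (wt (real ?N) z) \<partial>lborel) * l2 U"
      by (rule bilinear_schur) measurable
    also have "\<dots> = ennreal (K * sqrt s) * I * l2 U" unfolding I_def by (subst nn_integral_cmult) auto
    also have "\<dots> = ennreal (K * enn2real I * sqrt s * enn2real (l2 U))"
    proof -
      obtain i l where "I = ennreal i" "0 \<le> i" "l2 U = ennreal l" "0 \<le> l"
        using I fin by (cases I; cases "l2 U") auto
      then show ?thesis using K(1) s by (simp add: ennreal_mult[symmetric] mult_ac)
    qed
    finally show ?thesis using K(1) s by (subst (asm) ennreal_le_iff) auto
  qed
  then show ?thesis using that[of "K * enn2real I"] K(1) by (simp add: mult_nonneg_nonneg)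
qed

section \<open>Convolutions and modulations in the time-frequency plane\<close>

definition conv :: "('a::euclidean_space \<Rightarrow> complex) \<Rightarrow> ('a \<Rightarrow> complex) \<Rightarrow> 'a \<Rightarrow> complex" where
  "conv \<rho> U x = (LINT y|lborel. \<rho> (x - y) * U y)"

lemma conv_measurable [measurable]:
  assumes [measurable]: "\<rho> \<in> borel_measurable borel" "U \<in> borel_measurable borel"
  shows "conv \<rho> U \<in> borel_measurable borel"
  unfolding conv_def[abs_def] by measurable

lemma conv_alt:
  assumes [measurable]: "\<rho> \<in> borel_measurable borel" "U \<in> borel_measurable borel"
  shows "conv \<rho> U x = (LINT t|lborel. \<rho> t * U (x - t))"
  unfolding conv_def using integral_lborel_shift(3)[of "\<lambda>t. \<rho> t * U (x - t)" x] by simp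

text \<open>Young's inequality from the Schur test: rows and columns of a convolution kernel both
  sum to its L1 norm.\<close>

lemma l2_conv:
  assumes [measurable]: "\<rho> \<in> borel_measurable borel" "U \<in> borel_measurable borel"
  shows "l2 (conv \<rho> U) \<le> (\<integral>\<^sup>+t. ennreal (norm (\<rho> t)) \<partial>lborel)\<^sup>2 * l2 U"
  unfolding l2_def conv_def power2_eq_square[of "nn_integral _ _"]
proof (rule schur_test)
  show "(\<integral>\<^sup>+y. ennreal (norm (\<rho> (x - y))) \<partial>lborel) \<le> (\<integral>\<^sup>+t. ennreal (norm (\<rho> t)) \<partial>lborel)" for x
    using nn_integral_lborel_shift(3)[of "\<lambda>t. ennreal (norm (\<rho> t))" x] by simp
  show "(\<integral>\<^sup>+x. ennreal (norm (\<rho> (x - y))) \<partial>lborel) \<le> (\<integral>\<^sup>+t. ennreal (norm (\<rho> t)) \<partial>lborel)" for y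
    using nn_integral_lborel_shift(2)[of "\<lambda>t. ennreal (norm (\<rho> t))" y] by simp
qed (auto intro: sigma_finite_lborel, measurable)

lemma stft_modulate: "stft \<gamma> (\<lambda>y. cis (- (y \<bullet> \<theta>)) * U y) z = stft \<gamma> U (fst z, snd z + \<theta>)"
  unfolding stft_def
proof (rule Bochner_Integration.integral_cong[OF refl])
  fix y
  have "cis (- (y \<bullet> \<theta>)) * cis (- (y \<bullet> snd z)) = cis (- (y \<bullet> (snd z + \<theta>)))"
    by (simp add: cis_mult inner_add_right algebra_simps)
  then show "cis (- (y \<bullet> \<theta>)) * U y * of_real (\<gamma> (y - fst z)) * cis (- (y \<bullet> snd z))
    = U y * of_real (\<gamma> (y - fst (fst z, snd z + \<theta>))) * cis (- (y \<bullet> snd (fst z, snd z + \<theta>)))"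
    by (simp add: mult_ac)
qed

text \<open>A convolution averages translates of \<open>U\<close>. Translating by t multiplies the
  transform by a phase and shifts the window by t. The phases alone average to
  \<open>ft \<rho>\<close>, so the commutator is an average of transforms of \<open>U\<close> for
  the window differences.\<close>

lemma stft_conv:
  fixes \<rho> U :: "'a::euclidean_space \<Rightarrow> complex" and \<gamma> :: "'a \<Rightarrow> real"
  assumes \<rho>: "integrable lborel \<rho>" and U[measurable]: "U \<in> borel_measurable borel" and \<gamma>[measurable]: "\<gamma> \<in> borel_measurable borel"
    and fin: "l2 U < \<infinity>" "(\<integral>\<^sup>+y. ennreal ((\<gamma> y)\<^sup>2) \<partial>lborel) < \<infinity>"
  shows "stft \<gamma> (conv \<rho> U) z - ft \<rho> (snd z) * stft \<gamma> U z =
    (LINT t|lborel. \<rho> t * (cis (- (t \<bullet> snd z)) * stft (\<lambda>y. \<gamma> (y + t) - \<gamma> y) U z))"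
proof -
  have [measurable]: "\<rho> \<in> borel_measurable borel" using \<rho> by (auto simp: borel_measurable_integrable)
  obtain Y \<xi> where z: "z = (Y, \<xi>)" by (cases z)
  define e where "e x = cis (- (x \<bullet> \<xi>))" for x
  have [measurable]: "e \<in> borel_measurable borel" unfolding e_def[abs_def] by measurable
  have e_add: "e (x + t) = e x * e t" for x t by (simp add: e_def cis_mult inner_add_left)
  have e_norm[simp]: "norm (e x) = 1" for x by (simp add: e_def)
  let ?H = "\<lambda>q. \<rho> (snd q) * (U (fst q - snd q) * of_real (\<gamma> (fst q - Y)) * e (fst q))"
  have fin_t: "(\<integral>\<^sup>+y. ennreal ((\<gamma> (y + t))\<^sup>2) \<partial>lborel) < \<infinity>" for t
    using fin(2) nn_integral_lborel_shift(1)[of "\<lambda>y. ennreal ((\<gamma> y)\<^sup>2)" t] by simp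
  have it: "integrable lborel (\<lambda>y. U y * of_real (\<gamma> (y + t - Y)) * e y)" for t
  proof -
    have "integrable lborel (\<lambda>y. U y * of_real ((\<lambda>y. \<gamma> (y + t)) (y - Y)) * cis (- (y \<bullet> \<xi>)))"
      by (rule stft_integrable(2)[OF U _ fin(1) fin_t]) measurable
    then show ?thesis unfolding e_def by (simp add: diff_add_eq)
  qed
  have i0: "integrable lborel (\<lambda>y. U y * of_real (\<gamma> (y - Y)) * e y)"
    using it[of 0] by simp
  have H: "integrable lborel ?H"
  proof (rule integrableI_bounded)
    show "?H \<in> borel_measurable lborel" by measurable
    define D where "D = l2 U + (\<integral>\<^sup>+y. ennreal ((\<gamma> y)\<^sup>2) \<partial>lborel)"
    have "(\<integral>\<^sup>+q. ennreal (norm (?H q)) \<partial>lborel) \<le> (\<integral>\<^sup>+t. \<integral>\<^sup>+y. ennreal (norm (\<rho> t)) * (ennreal ((norm (U (y - t)))\<^sup>2) + ennreal ((\<gamma> (y - Y))\<^sup>2)) \<partial>lborel \<partial>lborel)"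
      unfolding nn_integral_prod_lborel(2)[of "\<lambda>q. ennreal (norm (?H q))", simplified]
    proof (intro nn_integral_mono)
      fix t y
      have "norm (U (y - t)) * \<bar>\<gamma> (y - Y)\<bar> \<le> (norm (U (y - t)))\<^sup>2 + (\<gamma> (y - Y))\<^sup>2"
        using sum_squares_bound[of "norm (U (y - t))" "\<bar>\<gamma> (y - Y)\<bar>"] mult_nonneg_nonneg[OF norm_ge_zero[of "U (y - t)"] abs_ge_zero[of "\<gamma> (y - Y)"]]
        unfolding power2_abs by linarith
      then have "norm (\<rho> t) * (norm (U (y - t)) * \<bar>\<gamma> (y - Y)\<bar>) \<le> norm (\<rho> t) * ((norm (U (y - t)))\<^sup>2 + (\<gamma> (y - Y))\<^sup>2)"
        by (rule mult_left_mono) simp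
      then show "ennreal (norm (\<rho> t * (U (y - t) * of_real (\<gamma> (y - Y)) * e y))) \<le> ennreal (norm (\<rho> t)) * (ennreal ((norm (U (y - t)))\<^sup>2) + ennreal ((\<gamma> (y - Y))\<^sup>2))"
        by (simp add: norm_mult ennreal_plus[symmetric] ennreal_mult[symmetric] ennreal_leI del: ennreal_plus)
    qed
    also have "\<dots> = (\<integral>\<^sup>+t. ennreal (norm (\<rho> t)) * D \<partial>lborel)"
      using nn_integral_lborel_shift(2)[of "\<lambda>y. ennreal ((norm (U y))\<^sup>2)"] nn_integral_lborel_shift(2)[of "\<lambda>y. ennreal ((\<gamma> y)\<^sup>2)" Y]
      by (simp add: nn_integral_cmult nn_integral_add D_def l2_def)
    also have "\<dots> = (\<integral>\<^sup>+t. ennreal (norm (\<rho> t)) \<partial>lborel) * D"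
      by (rule nn_integral_multc) measurable
    also have "\<dots> < \<infinity>" using \<rho> fin by (simp add: integrable_iff_bounded ennreal_mult_less_top D_def)
    finally show "(\<integral>\<^sup>+q. ennreal (norm (?H q)) \<partial>lborel) < \<infinity>" .
  qed
  have eqH: "(LINT y|lborel. ?H (y, t)) = \<rho> t * (e t * (LINT y|lborel. U y * of_real (\<gamma> (y + t - Y)) * e y))" for t
  proof -
    have "(LINT y|lborel. ?H (y, t)) = \<rho> t * (LINT y|lborel. U (y - t) * of_real (\<gamma> (y - Y)) * e y)"
      by simp
    also have "(LINT y|lborel. U (y - t) * of_real (\<gamma> (y - Y)) * e y) = (LINT y|lborel. e t * (U y * of_real (\<gamma> (y + t - Y)) * e y))"
      using integral_lborel_shift(2)[of "\<lambda>y. U y * of_real (\<gamma> (y + t - Y)) * e (y + t)" t] by (simp add: e_add mult_ac)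
    also have "\<dots> = e t * (LINT y|lborel. U y * of_real (\<gamma> (y + t - Y)) * e y)"
      by (rule integral_mult_right_zero)
    finally show ?thesis .
  qed
  have "stft \<gamma> (conv \<rho> U) z = (LINT y|lborel. LINT t|lborel. ?H (y, t))"
  proof -
    have "conv \<rho> U y * of_real (\<gamma> (y - Y)) * e y = (LINT t|lborel. ?H (y, t))" for y
    proof -
      have "conv \<rho> U y * of_real (\<gamma> (y - Y)) * e y = (LINT t|lborel. \<rho> t * U (y - t)) * (of_real (\<gamma> (y - Y)) * e y)"
        by (subst conv_alt) (simp_all add: mult_ac)
      also have "\<dots> = (LINT t|lborel. (\<rho> t * U (y - t)) * (of_real (\<gamma> (y - Y)) * e y))"
        by (rule integral_mult_left_zero[symmetric])
      finally show ?thesis by (simp add: mult_ac)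
    qed
    then show ?thesis unfolding stft_def z fst_conv snd_conv e_def[symmetric] by simp
  qed
  also have "\<dots> = (LINT t|lborel. LINT y|lborel. ?H (y, t))"
    using integral_prod_lborel[OF H] by simp
  also have "\<dots> = (LINT t|lborel. \<rho> t * (e t * (LINT y|lborel. U y * of_real (\<gamma> (y + t - Y)) * e y)))"
    unfolding eqH ..
  finally have c: "stft \<gamma> (conv \<rho> U) z = (LINT t|lborel. \<rho> t * (e t * (LINT y|lborel. U y * of_real (\<gamma> (y + t - Y)) * e y)))" .
  have "integrable (lborel \<Otimes>\<^sub>M lborel) (\<lambda>(x, y). ?H (x, y))"
    using H by (simp add: lborel_prod split_beta')
  from lborel_pair.integrable_snd[OF this]
  have ic: "integrable lborel (\<lambda>t. \<rho> t * (e t * (LINT y|lborel. U y * of_real (\<gamma> (y + t - Y)) * e y)))"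
    unfolding eqH .
  have f: "ft \<rho> (snd z) * stft \<gamma> U z = (LINT t|lborel. \<rho> t * (e t * (LINT y|lborel. U y * of_real (\<gamma> (y - Y)) * e y)))"
  proof -
    have "ft \<rho> (snd z) * stft \<gamma> U z = (LINT t|lborel. \<rho> t * e t) * (LINT y|lborel. U y * of_real (\<gamma> (y - Y)) * e y)"
      unfolding stft_def ft_def z e_def by simp
    also have "\<dots> = (LINT t|lborel. (\<rho> t * e t) * (LINT y|lborel. U y * of_real (\<gamma> (y - Y)) * e y))"
      by (rule integral_mult_left_zero[symmetric])
    finally show ?thesis by (simp add: mult.assoc)
  qed
  have "integrable lborel (\<lambda>t. \<rho> t * e t)"
    unfolding e_def by (intro integrable_mult_cis \<rho>) measurable
  then have if': "integrable lborel (\<lambda>t. \<rho> t * (e t * (LINT y|lborel. U y * of_real (\<gamma> (y - Y)) * e y)))"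
    by (auto simp: mult.assoc[symmetric] intro!: integrable_mult_left)
  have d: "stft (\<lambda>y. \<gamma> (y + t) - \<gamma> y) U z = (LINT y|lborel. U y * of_real (\<gamma> (y + t - Y)) * e y) - (LINT y|lborel. U y * of_real (\<gamma> (y - Y)) * e y)" for t
  proof -
    have "stft (\<lambda>y. \<gamma> (y + t) - \<gamma> y) U z = (LINT y|lborel. U y * of_real (\<gamma> (y + t - Y)) * e y - U y * of_real (\<gamma> (y - Y)) * e y)"
      unfolding stft_def z e_def by (simp add: algebra_simps)
    also have "\<dots> = (LINT y|lborel. U y * of_real (\<gamma> (y + t - Y)) * e y) - (LINT y|lborel. U y * of_real (\<gamma> (y - Y)) * e y)"
      by (rule Bochner_Integration.integral_diff[OF it i0])
    finally show ?thesis .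
  qed
  show ?thesis
    unfolding c f Bochner_Integration.integral_diff[OF ic if', symmetric] d
    by (simp add: e_def z right_diff_distrib)
qed

text \<open>Cauchy-Schwarz with weight |\<rho>| reduces the error to the transforms for window
  differences, of squared norm at most a constant times min(1, (s |t|)^2). As \<rho> is merely
  integrable, the bound by 1 supplies the dominating function, and \<open>J\<close>, hence
  \<open>E\<close>, tends to 0 without a rate.\<close>

lemma stft_conv_error:
  fixes \<rho> :: "'a::euclidean_space \<Rightarrow> complex" and s :: "nat \<Rightarrow> real"
  assumes \<rho>: "integrable lborel \<rho>" and s: "\<And>k. 0 < s k" "s \<longlonglongrightarrow> 0"
  obtains E where "\<And>k. 0 \<le> E k" "E \<longlonglongrightarrow> (0::real)"
    "\<And>k U. U \<in> borel_measurable borel \<Longrightarrow> l2 U < \<infinity> \<Longrightarrow>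
      l2 (\<lambda>z. stft (win (s k)) (conv \<rho> U) z - ft \<rho> (snd z) * stft (win (s k)) U z) \<le> ennreal (E k) * l2 U"
proof -
  have \<rho>m[measurable]: "\<rho> \<in> borel_measurable borel" using \<rho> by (auto simp: borel_measurable_integrable)
  obtain Q where Q: "0 \<le> Q"
    "\<And>(\<gamma>::'a \<Rightarrow> real) U. \<gamma> \<in> borel_measurable borel \<Longrightarrow> U \<in> borel_measurable borel \<Longrightarrow>
      l2 U < \<infinity> \<Longrightarrow> (\<integral>\<^sup>+y. ennreal ((\<gamma> y)\<^sup>2) \<partial>lborel) < \<infinity> \<Longrightarrow>
       l2 (stft \<gamma> U) \<le> ennreal Q * (\<integral>\<^sup>+y. ennreal ((\<gamma> y)\<^sup>2) \<partial>lborel) * l2 U"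
    using stft_l2_bound[where 'a='a] by (elim exE conjE) blast
  define V where "V = 2 * measure lborel (cball (0::'a) 1) / tent_l2 TYPE('a)"
  have V: "0 \<le> V" unfolding V_def using tent_l2(2)[where 'a='a] by simp
  define R where "R = (LINT t|lborel. norm (\<rho> t))"
  have R: "0 \<le> R" unfolding R_def by simp
  have R': "(\<integral>\<^sup>+t. ennreal (norm (\<rho> t)) \<partial>lborel) = ennreal R"
    unfolding R_def using \<rho> by (intro nn_integral_eq_integral) auto
  let ?m = "\<lambda>k t::'a. min 1 ((s k * norm t)\<^sup>2)"
  define J where "J k = (LINT t|lborel. norm (\<rho> t) * ?m k t)" for k
  have mi: "integrable lborel (\<lambda>t. norm (\<rho> t) * ?m k t)" for k
    by (rule Bochner_Integration.integrable_bound[OF integrable_norm[OF \<rho>]]) (auto simp: mult_left_le)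
  have J0: "0 \<le> J k" for k unfolding J_def by (intro Bochner_Integration.integral_nonneg) auto
  have "J \<longlonglongrightarrow> (LINT t::'a|lborel. 0)"
    unfolding J_def
  proof (rule integral_dominated_convergence[where w = "\<lambda>t. norm (\<rho> t)"])
    show "AE t in lborel. (\<lambda>k. norm (\<rho> t) * ?m k t) \<longlonglongrightarrow> 0"
    proof (rule AE_I2)
      fix t :: 'a
      have "(\<lambda>k. norm (\<rho> t) * ?m k t) \<longlonglongrightarrow> norm (\<rho> t) * min 1 ((0 * norm t)\<^sup>2)"
        by (intro tendsto_intros s)
      then show "(\<lambda>k. norm (\<rho> t) * ?m k t) \<longlonglongrightarrow> 0" by simp
    qed
    show "\<And>k. AE t in lborel. norm (norm (\<rho> t) * ?m k t) \<le> norm (\<rho> t)"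
      by (auto simp: mult_left_le)
  qed (use \<rho> in \<open>auto\<close>)
  then have J: "J \<longlonglongrightarrow> 0" by simp
  define E where "E k = R * (Q * V * J k)" for k
  have "l2 (\<lambda>z. stft (win (s k)) (conv \<rho> U) z - ft \<rho> (snd z) * stft (win (s k)) U z) \<le> ennreal (E k) * l2 U"
    if U[measurable]: "U \<in> borel_measurable borel" and fin: "l2 U < \<infinity>" for k U
  proof -
    have w2: "(\<integral>\<^sup>+(y::'a). ennreal ((win (s k) y)\<^sup>2) \<partial>lborel) < \<infinity>" using win_l2[OF s(1), where 'a='a] by simp
    let ?g = "\<lambda>t y. win (s k) (y + t) - win (s k) (y::'a)"
    have g2: "(\<integral>\<^sup>+y. ennreal ((?g t y)\<^sup>2) \<partial>lborel) \<le> ennreal (V * ?m k t)" for t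
      using win_translate_l2[OF s(1), where 'a='a] unfolding V_def by simp
    have gl: "l2 (stft (?g t) U) \<le> ennreal (Q * V * ?m k t) * l2 U" for t
    proof -
      have "l2 (stft (?g t) U) \<le> ennreal Q * (\<integral>\<^sup>+y. ennreal ((?g t y)\<^sup>2) \<partial>lborel) * l2 U"
        using g2[of t] by (intro Q(2) fin U) (auto intro: order_le_less_trans)
      also have "\<dots> \<le> ennreal Q * ennreal (V * ?m k t) * l2 U"
        by (intro mult_right_mono mult_left_mono g2) auto
      also have "ennreal Q * ennreal (V * ?m k t) = ennreal (Q * V * ?m k t)"
        using Q(1) V by (simp add: ennreal_mult[symmetric] mult.assoc)
      finally show ?thesis .
    qed
    have tm: "(\<lambda>x. stft (?g (snd x)) U (fst x)) \<in> borel_measurable (lborel \<Otimes>\<^sub>M lborel)"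
      unfolding stft_def by measurable
    have "l2 (\<lambda>z. stft (win (s k)) (conv \<rho> U) z - ft \<rho> (snd z) * stft (win (s k)) U z)
       = (\<integral>\<^sup>+z. ennreal ((norm (LINT t|lborel. \<rho> t * (cis (- (t \<bullet> snd z)) * stft (?g t) U z)))\<^sup>2) \<partial>lborel)"
      unfolding l2_def stft_conv[OF \<rho> U win_measurable fin w2] ..
    also have "\<dots> \<le> (\<integral>\<^sup>+z. ennreal R * (\<integral>\<^sup>+t. ennreal (norm (\<rho> t)) * ennreal ((norm (stft (?g t) U z))\<^sup>2) \<partial>lborel) \<partial>lborel)"
    proof (rule nn_integral_mono)
      fix z :: "'a \<times> 'a"
      have [measurable]: "(\<lambda>t. stft (?g t) U z) \<in> borel_measurable lborel"
        unfolding stft_def by measurable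
      have "ennreal ((norm (LINT t|lborel. \<rho> t * (cis (- (t \<bullet> snd z)) * stft (?g t) U z)))\<^sup>2)
        \<le> (\<integral>\<^sup>+t. ennreal (norm (\<rho> t)) \<partial>lborel) * (\<integral>\<^sup>+t. ennreal (norm (\<rho> t)) * ennreal ((norm (cis (- (t \<bullet> snd z)) * stft (?g t) U z))\<^sup>2) \<partial>lborel)"
        by (rule norm_integral_square_le_weighted) measurable
      then show "ennreal ((norm (LINT t|lborel. \<rho> t * (cis (- (t \<bullet> snd z)) * stft (?g t) U z)))\<^sup>2)
        \<le> ennreal R * (\<integral>\<^sup>+t. ennreal (norm (\<rho> t)) * ennreal ((norm (stft (?g t) U z))\<^sup>2) \<partial>lborel)"
        by (simp add: R' norm_mult)
    qed
    also have "\<dots> = ennreal R * (\<integral>\<^sup>+z. \<integral>\<^sup>+t. ennreal (norm (\<rho> t)) * ennreal ((norm (stft (?g t) U z))\<^sup>2) \<partial>lborel \<partial>lborel)"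
      using tm by (intro nn_integral_cmult lborel.borel_measurable_nn_integral) (simp add: split_beta')
    also have "(\<integral>\<^sup>+z. \<integral>\<^sup>+t. ennreal (norm (\<rho> t)) * ennreal ((norm (stft (?g t) U z))\<^sup>2) \<partial>lborel \<partial>lborel)
       = (\<integral>\<^sup>+t. \<integral>\<^sup>+z. ennreal (norm (\<rho> t)) * ennreal ((norm (stft (?g t) U z))\<^sup>2) \<partial>lborel \<partial>lborel)"
      using tm by (intro lborel_pair.Fubini'[symmetric]) (simp add: split_beta')
    also have "\<dots> = (\<integral>\<^sup>+t. ennreal (norm (\<rho> t)) * l2 (stft (?g t) U) \<partial>lborel)"
      unfolding l2_def by (intro nn_integral_cong nn_integral_cmult) measurable
    also have "\<dots> \<le> (\<integral>\<^sup>+t. ennreal (norm (\<rho> t)) * (ennreal (Q * V * ?m k t) * l2 U) \<partial>lborel)"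
      by (intro nn_integral_mono mult_left_mono gl) auto
    also have "\<dots> = (\<integral>\<^sup>+t. ennreal (Q * V) * l2 U * ennreal (norm (\<rho> t) * ?m k t) \<partial>lborel)"
      using Q(1) V by (intro nn_integral_cong) (simp add: ennreal_mult mult_ac)
    also have "\<dots> = ennreal (Q * V) * l2 U * ennreal (J k)"
    proof -
      have "(\<integral>\<^sup>+t. ennreal (norm (\<rho> t) * ?m k t) \<partial>lborel) = ennreal (J k)"
        unfolding J_def using mi by (intro nn_integral_eq_integral) auto
      then show ?thesis by (subst nn_integral_cmult) auto
    qed
    also have "ennreal R * (ennreal (Q * V) * l2 U * ennreal (J k)) = ennreal (E k) * l2 U"
      unfolding E_def using Q(1) V R J0[of k] by (simp add: ennreal_mult mult_ac)
    finally show ?thesis by (simp add: mult_left_mono)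
  qed
  moreover have "E \<longlonglongrightarrow> 0" unfolding E_def using tendsto_mult_right_zero[OF tendsto_mult_right_zero[OF J]] by simp
  moreover have "0 \<le> E k" for k unfolding E_def using R Q(1) V J0 by simp
  ultimately show ?thesis using that by blast
qed

section \<open>Vague convergence tested on Schwartz functions\<close>

text \<open>The class of test functions for the Husimi densities. Unlike the Schwartz class it is
  stable under multiplication by bounded continuous functions, in particular by the squared Fourier
  transform of an integrable function.\<close>

definition vanishing :: "('a::euclidean_space \<Rightarrow> complex) \<Rightarrow> bool" where
  "vanishing b \<longleftrightarrow> continuous_on UNIV b \<and> (b \<longlongrightarrow> 0) at_infinity"

lemma vanishing_measurable: "vanishing b \<Longrightarrow> b \<in> borel_measurable borel"
  unfolding vanishing_def by (intro borel_measurable_continuous_onI) auto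

lemma vanishing_small:
  assumes "vanishing b" "0 < e"
  obtains R where "0 < R" "\<And>z. R \<le> norm z \<Longrightarrow> norm (b z) \<le> e"
proof -
  have "eventually (\<lambda>z. dist (b z) 0 < e) at_infinity"
    using assms unfolding vanishing_def tendsto_iff by blast
  then obtain R where R: "\<And>z. R \<le> norm z \<Longrightarrow> norm (b z) < e"
    unfolding eventually_at_infinity by auto
  show ?thesis
  proof (rule that[of "max R 1"])
    show "norm (b z) \<le> e" if "max R 1 \<le> norm z" for z
      using R[of z] that by simp
  qed simp
qed

lemma vanishing_bounded:
  assumes "vanishing b"
  obtains M where "0 < M" "\<And>z. norm (b z) \<le> M"
proof -
  obtain R where R: "0 < R" "\<And>z. R \<le> norm z \<Longrightarrow> norm (b z) \<le> 1" 
    using vanishing_small[OF assms, of 1] by auto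
  have "compact (b ` cball 0 R)"
    using assms unfolding vanishing_def by (intro compact_continuous_image) (auto intro: continuous_on_subset)
  then obtain M where M: "\<And>z. z \<in> cball 0 R \<Longrightarrow> norm (b z) \<le> M"
    using compact_imp_bounded bounded_iff by (metis imageI)
  have "norm (b z) \<le> max 1 M" for z
    using R(2)[of z] M[of z] by (cases "R \<le> norm z") (auto simp: le_max_iff_disj)
  then show ?thesis using that[of "max 1 M"] by auto
qed

lemma vanishing_mult:
  assumes "vanishing b" and c: "continuous_on UNIV c" "\<And>z. norm (c z) \<le> M"
  shows "vanishing (\<lambda>z. b z * c z)"
proof -
  have "((\<lambda>z. b z * c z) \<longlongrightarrow> 0) at_infinity"
  proof (rule Lim_null_comparison)
    show "eventually (\<lambda>z. norm (b z * c z) \<le> norm (b z) * M) at_infinity"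
      using c(2) by (auto simp: norm_mult mult_left_mono)
    show "((\<lambda>z. norm (b z) * M) \<longlongrightarrow> 0) at_infinity"
      using assms(1) unfolding vanishing_def by (auto intro!: tendsto_mult_left_zero tendsto_norm_zero)
  qed
  then show ?thesis using assms(1) c(1) unfolding vanishing_def by (auto intro: continuous_intros)
qed

lemma vanishing_compact_support:
  assumes "continuous_on UNIV b" "\<And>z. R \<le> norm z \<Longrightarrow> b z = 0"
  shows "vanishing b"
  unfolding vanishing_def
proof (intro conjI assms)
  have "eventually (\<lambda>z. b z = 0) at_infinity"
    unfolding eventually_at_infinity using assms(2) by blast
  then show "(b \<longlongrightarrow> 0) at_infinity" by (rule tendsto_eventually)
qed

lemma schwartz_vanishing:
  assumes "schwartz a"
  shows "vanishing a"
proof -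
  obtain C where C: "0 \<le> C" "\<And>z. norm (a z) \<le> C * wt (real 1) z"
    using schwartz_decay[OF assms] by metis
  have "(a \<longlongrightarrow> 0) at_infinity"
  proof (rule Lim_null_comparison)
    show "eventually (\<lambda>z. norm (a z) \<le> C * inverse (norm z)) at_infinity"
      unfolding eventually_at_infinity
    proof (intro exI[of _ 1] allI impI)
      fix z :: 'a assume "1 \<le> norm z"
      then have "wt (real 1) z \<le> inverse (norm z)" unfolding wt_nat by (auto intro!: le_imp_inverse_le)
      then show "norm (a z) \<le> C * inverse (norm z)" using C(2)[of z] C(1) by (meson mult_left_mono order_trans)
    qed
    show "((\<lambda>z. C * inverse (norm z)) \<longlongrightarrow> 0) at_infinity"
      by (intro tendsto_mult_right_zero tendsto_inverse_0_at_top filterlim_norm_at_top)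
  qed
  then show ?thesis unfolding vanishing_def using schwartz_continuous[OF assms] by blast
qed

section \<open>Uniformly close integrands against measures of bounded mass\<close>

lemma finite_measureI_le:
  assumes "sets M = sets borel" "emeasure M UNIV \<le> ennreal B"
  shows "finite_measure M"
proof
  have "space M = UNIV" using sets_eq_imp_space_eq[OF assms(1)] by simp
  then show "emeasure M (space M) \<noteq> \<infinity>" using assms(2) by (auto simp: top_unique)
qed

lemma integrable_bounded_borel:
  fixes f :: "'a::topological_space \<Rightarrow> complex"
  assumes "finite_measure M" "sets M = sets borel" "f \<in> borel_measurable borel" "\<And>z. norm (f z) \<le> C"
  shows "integrable M f"
  using assms measurable_cong_sets[OF assms(2) refl]
  by (intro finite_measure.integrable_const_bound[where B = C]) auto

lemma integral_close:
  fixes f g :: "'a::topological_space \<Rightarrow> complex"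
  assumes M: "sets M = sets borel" "emeasure M UNIV \<le> ennreal B" "0 \<le> B"
    and f: "integrable M f" "integrable M g" "\<And>z. norm (f z - g z) \<le> e" "0 \<le> e"
  shows "norm ((LINT z|M. f z) - (LINT z|M. g z)) \<le> e * B"
proof -
  have sp: "space M = UNIV" using sets_eq_imp_space_eq[OF M(1)] by simp
  have "ennreal (norm ((LINT z|M. f z) - (LINT z|M. g z))) = ennreal (norm (LINT z|M. f z - g z))"
    using f by simp
  also have "\<dots> \<le> (\<integral>\<^sup>+z. ennreal (norm (f z - g z)) \<partial>M)" by (rule norm_integral_le_nn_integral)
  also have "\<dots> \<le> (\<integral>\<^sup>+z. ennreal e \<partial>M)" using f by (intro nn_integral_mono ennreal_leI) auto
  also have "\<dots> = ennreal e * emeasure M UNIV" by (simp add: sp)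
  also have "\<dots> \<le> ennreal e * ennreal B" using M by (intro mult_left_mono) auto
  finally show ?thesis using f(4) M(3) by (simp add: ennreal_mult[symmetric])
qed

lemma uniform_approximation_limit:
  fixes \<nu> :: "nat \<Rightarrow> 'a::topological_space measure" and b :: "'a \<Rightarrow> complex"
  assumes \<nu>: "\<And>k. sets (\<nu> k) = sets borel" "\<And>k. emeasure (\<nu> k) UNIV \<le> ennreal B" "0 \<le> B"
    and \<mu>: "sets \<mu> = sets borel" "emeasure \<mu> UNIV \<le> ennreal B"
    and b: "\<And>k. integrable (\<nu> k) b" "integrable \<mu> b"
    and approx: "\<And>e. 0 < e \<Longrightarrow> \<exists>b'. (\<forall>k. integrable (\<nu> k) b') \<and> integrable \<mu> b' \<and> (\<forall>z. norm (b z - b' z) \<le> e)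
       \<and> (\<lambda>k. LINT z|\<nu> k. b' z) \<longlonglongrightarrow> (LINT z|\<mu>. b' z)"
  shows "(\<lambda>k. LINT z|\<nu> k. b z) \<longlonglongrightarrow> (LINT z|\<mu>. b z)"
proof (rule LIMSEQ_I)
  fix r :: real assume r: "0 < r"
  \<comment> \<open>The increment of B by 1 avoids division by zero and still gives e B <
    r/3.\<close>
  define e where "e = r / (3 * (B + 1))"
  have e: "0 < e" "e * B < r / 3" using r \<nu>(3) by (auto simp: e_def field_simps)
  obtain b' where b': "\<And>k. integrable (\<nu> k) b'" "integrable \<mu> b'" "\<And>z. norm (b z - b' z) \<le> e"
       "(\<lambda>k. LINT z|\<nu> k. b' z) \<longlonglongrightarrow> (LINT z|\<mu>. b' z)" using approx[OF e(1)] by blast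
  obtain k0 where k0: "\<And>k. k0 \<le> k \<Longrightarrow> norm ((LINT z|\<nu> k. b' z) - (LINT z|\<mu>. b' z)) < r / 3"
    using LIMSEQ_D[OF b'(4), of "r / 3"] r by auto
  have "norm ((LINT z|\<nu> k. b z) - (LINT z|\<mu>. b z)) < r" if k: "k0 \<le> k" for k
  proof -
    have "norm ((LINT z|\<nu> k. b z) - (LINT z|\<nu> k. b' z)) \<le> e * B"
      by (rule integral_close[OF \<nu>(1) \<nu>(2) \<nu>(3) b(1) b'(1) b'(3)]) (use e in simp)
    moreover have "norm ((LINT z|\<mu>. b z) - (LINT z|\<mu>. b' z)) \<le> e * B"
      by (rule integral_close[OF \<mu>(1) \<mu>(2) \<nu>(3) b(2) b'(2) b'(3)]) (use e in simp)
    ultimately show ?thesis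
      using k0[OF k] e(2) norm_triangle_ineq4[of "(LINT z|\<nu> k. b z) - (LINT z|\<nu> k. b' z)" "(LINT z|\<mu>. b z) - (LINT z|\<mu>. b' z)"]
        norm_triangle_ineq[of "(LINT z|\<nu> k. b z) - (LINT z|\<nu> k. b' z) - ((LINT z|\<mu>. b z) - (LINT z|\<mu>. b' z))" "(LINT z|\<nu> k. b' z) - (LINT z|\<mu>. b' z)"]
      by (simp add: algebra_simps)
  qed
  then show "\<exists>no. \<forall>n\<ge>no. norm ((LINT z|\<nu> n. b z) - (LINT z|\<mu>. b z)) < r" by blast
qed

section \<open>Regularisation by Gaussian averages\<close>

lemma gauss_bounds: "0 \<le> gauss c x" "0 \<le> c \<Longrightarrow> gauss c x \<le> 1"
  by (auto simp: gauss_def)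

lemma wt_step: "(1 + norm t) * wt (real (Suc N)) t = wt (real N) t"
proof -
  define x where "x = 1 + norm t"
  have "0 < x" unfolding x_def by (simp add: add_pos_nonneg)
  then show ?thesis unfolding wt_nat x_def[symmetric] by (simp add: field_simps)
qed

lemma gauss_moment_finite:
  "(\<integral>\<^sup>+(t::'a::euclidean_space). ennreal ((1 + norm t) * gauss 1 t) \<partial>lborel) < \<infinity>"
proof -
  have "schwartz (\<lambda>z::'a. complex_of_real (gauss 1 (z - 0)))" by (rule schwartz_gauss) simp
  then obtain C where C: "0 \<le> C" "\<And>z::'a. norm (complex_of_real (gauss 1 (z - 0))) \<le> C * wt (real (Suc (Suc DIM('a)))) z"
    using schwartz_decay by metis
  have "(\<integral>\<^sup>+(t::'a). ennreal ((1 + norm t) * gauss 1 t) \<partial>lborel) \<le> (\<integral>\<^sup>+(t::'a). ennreal C * ennreal (wt (real (Suc DIM('a))) t) \<partial>lborel)"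
  proof (rule nn_integral_mono)
    fix t :: 'a
    have "(1 + norm t) * gauss 1 t \<le> (1 + norm t) * (C * wt (real (Suc (Suc DIM('a)))) t)"
      using C(2)[of t] by (intro mult_left_mono) (auto simp: gauss_bounds)
    also have "\<dots> = C * wt (real (Suc DIM('a))) t"
      using wt_step[of t "Suc DIM('a)"] by (simp add: mult.left_commute[of _ C] del: of_nat_Suc)
    finally show "ennreal ((1 + norm t) * gauss 1 t) \<le> ennreal C * ennreal (wt (real (Suc DIM('a))) t)"
      using C(1) by (simp only: ennreal_mult[symmetric] wt_nonneg ennreal_leI)
  qed
  also have "\<dots> = ennreal C * (\<integral>\<^sup>+(t::'a). ennreal (wt (real (Suc DIM('a))) t) \<partial>lborel)"
    by (rule nn_integral_cmult) measurable
  also have "\<dots> < \<infinity>" using wt_integrable[where 'a='a, of "real (Suc DIM('a))"] by (simp add: ennreal_mult_less_top)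
  finally show ?thesis .
qed

lemma gauss_integrable:
  "integrable lborel (gauss 1 :: 'a::euclidean_space \<Rightarrow> real)"
  "integrable lborel (\<lambda>t::'a. norm t * gauss 1 t)"
  using gauss_moment_finite[where 'a='a]
  by (auto intro!: integrableI_bounded order_le_less_trans[OF nn_integral_mono gauss_moment_finite[where 'a='a]] ennreal_leI
      simp: gauss_bounds abs_mult algebra_simps)

lemma gauss_integral_pos: "0 < (LINT t::'a::euclidean_space|lborel. gauss 1 t)"
proof -
  have "(LINT t::'a|lborel. gauss 1 t) \<noteq> 0"
  proof
    assume "(LINT t::'a|lborel. gauss 1 t) = 0"
    then have "AE t::'a in lborel. gauss 1 t = 0"
      using integral_nonneg_eq_0_iff_AE[OF gauss_integrable(1)[where 'a='a]] by (auto simp: gauss_bounds)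
    then have "AE t::'a in lborel. False"
      by eventually_elim (metis gauss_pos less_irrefl)
    then show False
      using AE_iff_measurable[of UNIV lborel "\<lambda>_::'a. False"] by (simp add: emeasure_lborel_UNIV)
  qed
  moreover have "0 \<le> (LINT t::'a|lborel. gauss 1 t)"
    by (intro Bochner_Integration.integral_nonneg) (simp add: gauss_bounds)
  ultimately show ?thesis by simp
qed

text \<open>Uniform continuity as a global affine bound: at distances beyond \<open>r\<close> the
  crude difference 2 M is at most (2 M / r) times the distance. An affine bound can be integrated
  against a Gaussian, whose first moment is finite.\<close>

lemma compact_support_modulus:
  fixes b :: "'a::euclidean_space \<Rightarrow> complex"
  assumes b: "continuous_on UNIV b" "\<And>z. R \<le> norm z \<Longrightarrow> b z = 0" and e: "0 < e"
  obtains L where "0 \<le> L" "\<And>z y. norm (b z - b y) \<le> e + L * norm (z - y)"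
proof -
  obtain M where M: "0 < M" "\<And>z. norm (b z) \<le> M"
    using vanishing_bounded[OF vanishing_compact_support[OF b]] by metis
  have "uniformly_continuous_on (cball 0 (R + 1)) b"
    by (intro compact_uniformly_continuous continuous_on_subset[OF b(1)]) auto
  then obtain d where d: "0 < d" "\<And>y z. y \<in> cball 0 (R + 1) \<Longrightarrow> z \<in> cball 0 (R + 1) \<Longrightarrow> dist z y < d \<Longrightarrow> dist (b z) (b y) < e"
    unfolding uniformly_continuous_on_def using e by metis
  \<comment> \<open>With \<open>r\<close> at most 1, if one of two points at distance below
    \<open>r\<close> leaves the ball of radius R + 1, then \<open>b\<close> vanishes at
    both.\<close>
  define r where "r = min d 1"
  have r: "0 < r" using d(1) by (simp add: r_def)
  have "norm (b z - b y) \<le> e + (2 * M / r) * norm (z - y)" for z y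
  proof (cases "norm (z - y) < r")
    case True
    have "norm (b z - b y) \<le> e"
    proof (cases "z \<in> cball 0 (R + 1) \<and> y \<in> cball 0 (R + 1)")
      case T: True
      then show ?thesis using d(2)[of y z] True by (auto simp: dist_norm r_def)
    next
      case False
      then have "R \<le> norm z \<and> R \<le> norm y"
        using True norm_triangle_sub[of z y] norm_triangle_sub[of y z] by (auto simp: r_def norm_minus_commute)
      then show ?thesis using b(2)[of z] b(2)[of y] e by simp
    qed
    moreover have "0 \<le> (2 * M / r) * norm (z - y)" using M r by simp
    ultimately show ?thesis by simp
  next
    case False
    then have "2 * M \<le> (2 * M / r) * norm (z - y)" using M r by (simp add: field_simps)
    moreover have "norm (b z - b y) \<le> 2 * M"
      using norm_triangle_ineq4[of "b z" "b y"] M(2)[of z] M(2)[of y] by simp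
    ultimately show ?thesis using e by simp
  qed
  moreover have "0 \<le> 2 * M / r" using M r by simp
  ultimately show ?thesis using that by blast
qed

lemma integral_scaled:
  fixes f :: "'a::euclidean_space \<Rightarrow> complex"
  assumes "f \<in> borel_measurable borel" "0 < s"
  shows "(LINT t|lborel. f (s *\<^sub>R t)) = of_real (1 / s ^ DIM('a)) * (LINT t|lborel. f t)"
  using integral_lborel_affine[OF assms(1), of s 0] assms(2) by simp

text \<open>Convolution with a normalised Gaussian of width 1/m. As an integral over y of multiples
  of translated Gaussians, it is a superposition of Schwartz functions, so convergence on Schwartz
  functions passes to it under the integral in y.\<close>

definition gauss_average :: "real \<Rightarrow> ('a::euclidean_space \<Rightarrow> complex) \<Rightarrow> 'a \<Rightarrow> complex" where
  "gauss_average m b z = of_real (m ^ DIM('a) / (LINT t::'a|lborel. gauss 1 t)) * (LINT y|lborel. b y * of_real (gauss (m\<^sup>2) (z - y)))"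

lemma gauss_scale: "gauss (m\<^sup>2) t = gauss 1 (m *\<^sub>R t)"
  by (simp add: gauss_def power_mult_distrib)

lemma gauss_average_close:
  fixes b :: "'a::euclidean_space \<Rightarrow> complex"
  assumes b: "continuous_on UNIV b" "\<And>z. R \<le> norm z \<Longrightarrow> b z = 0" and e: "0 < e"
  obtains m where "0 < m" "\<And>z. norm (b z - gauss_average m b z) \<le> e"
proof -
  obtain L where L: "0 \<le> L" "\<And>z y. norm (b z - b y) \<le> e / 2 + L * norm (z - y)"
    using compact_support_modulus[OF b half_gt_zero[OF e]] by metis
  have [measurable]: "b \<in> borel_measurable borel" by (rule borel_measurable_continuous_onI[OF b(1)])
  obtain M where M: "0 < M" "\<And>z. norm (b z) \<le> M"
    using vanishing_bounded[OF vanishing_compact_support[OF b]] by metis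
  define \<kappa> J where "\<kappa> = (LINT t::'a|lborel. gauss 1 t)" and "J = (LINT t::'a|lborel. norm t * gauss 1 t)"
  have \<kappa>: "0 < \<kappa>" unfolding \<kappa>_def by (rule gauss_integral_pos)
  have J: "0 \<le> J" unfolding J_def by (intro Bochner_Integration.integral_nonneg) (simp add: gauss_bounds)
  \<comment> \<open>The error will be e/2 + (L J / \<kappa>)/m; this \<open>m\<close> makes the
    second term at most e/2, and the summand 1 keeps \<open>m\<close> positive when L J is
    0.\<close>
  define m where "m = 2 * (L * J / \<kappa> + 1) / e"
  have m: "0 < m" using L(1) J \<kappa> e by (simp add: m_def add_nonneg_pos)
  have "norm (b z - gauss_average m b z) \<le> e" for z
  proof -
    have g: "complex_integrable lborel (\<lambda>t::'a. complex_of_real (gauss 1 t))"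
      using gauss_integrable(1)[where 'a='a] by (simp only: complex_of_real_integrable_eq)
    have 1: "(LINT y|lborel. b y * of_real (gauss (m\<^sup>2) (z - y))) = of_real (1 / m ^ DIM('a)) * (LINT t|lborel. b (z - t /\<^sub>R m) * of_real (gauss 1 t))"
    proof -
      have "(LINT y|lborel. b y * of_real (gauss (m\<^sup>2) (z - y))) = (LINT t|lborel. b (z - t) * of_real (gauss 1 (m *\<^sub>R t)))"
        using integral_lborel_shift(3)[of "\<lambda>y. b y * of_real (gauss (m\<^sup>2) (z - y))" z] by (simp add: gauss_scale)
      also have "\<dots> = (LINT t|lborel. (\<lambda>t. b (z - t /\<^sub>R m) * of_real (gauss 1 t)) (m *\<^sub>R t))"
        using m by simp
      finally show ?thesis by (subst (asm) integral_scaled) (use m in auto)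
    qed
    have i1: "integrable lborel (\<lambda>t. b (z - t /\<^sub>R m) * of_real (gauss 1 t))"
    proof (rule Bochner_Integration.integrable_bound)
      show "integrable lborel (\<lambda>t::'a. M * gauss 1 t)" using gauss_integrable(1) by (rule integrable_mult_right)
      show "AE t in lborel. norm (b (z - t /\<^sub>R m) * of_real (gauss 1 t)) \<le> norm (M * gauss 1 t)"
        using M by (auto simp: norm_mult gauss_bounds abs_mult intro!: mult_right_mono)
    qed measurable
    have "b z * of_real \<kappa> = (LINT t::'a|lborel. b z * of_real (gauss 1 t))"
      unfolding \<kappa>_def by (simp only: integral_mult_right_zero integral_complex_of_real)
    moreover have "gauss_average m b z = of_real (1 / \<kappa>) * (LINT t|lborel. b (z - t /\<^sub>R m) * of_real (gauss 1 t))"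
      unfolding gauss_average_def 1 \<kappa>_def[symmetric] using m by simp
    ultimately have "b z - gauss_average m b z = of_real (1 / \<kappa>) * ((LINT t::'a|lborel. b z * of_real (gauss 1 t)) - (LINT t|lborel. b (z - t /\<^sub>R m) * of_real (gauss 1 t)))"
      using \<kappa> by (simp add: field_simps)
    also have "\<dots> = of_real (1 / \<kappa>) * (LINT t|lborel. (b z - b (z - t /\<^sub>R m)) * of_real (gauss 1 t))"
      using i1 integrable_mult_right[OF g, of "b z"] by (simp add: left_diff_distrib)
    finally have "norm (b z - gauss_average m b z) = 1 / \<kappa> * norm (LINT t|lborel. (b z - b (z - t /\<^sub>R m)) * of_real (gauss 1 t))"
      using \<kappa> by (simp add: norm_mult norm_divide)
    also have "norm (LINT t|lborel. (b z - b (z - t /\<^sub>R m)) * of_real (gauss 1 t)) \<le> (LINT t::'a|lborel. (e / 2) * gauss 1 t + (L / m) * (norm t * gauss 1 t))"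
    proof (rule order_trans[OF integral_norm_bound integral_mono])
      show "integrable lborel (\<lambda>t. norm ((b z - b (z - t /\<^sub>R m)) * of_real (gauss 1 t)))"
        using i1 integrable_mult_right[OF g, of "b z"] by (simp add: left_diff_distrib)
      show "integrable lborel (\<lambda>t::'a. (e / 2) * gauss 1 t + (L / m) * (norm t * gauss 1 t))"
        by (intro Bochner_Integration.integrable_add integrable_mult_right gauss_integrable)
      fix t :: 'a
      have "norm (b z - b (z - t /\<^sub>R m)) \<le> e / 2 + L / m * norm t"
        using L(2)[of z "z - t /\<^sub>R m"] m by (simp add: field_simps)
      then have "norm (b z - b (z - t /\<^sub>R m)) * gauss 1 t \<le> (e / 2 + L / m * norm t) * gauss 1 t"
        by (intro mult_right_mono) (simp_all add: gauss_bounds)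
      then show "norm ((b z - b (z - t /\<^sub>R m)) * of_real (gauss 1 t)) \<le> (e / 2) * gauss 1 t + (L / m) * (norm t * gauss 1 t)"
        by (simp add: norm_mult gauss_bounds distrib_right mult.assoc)
    qed
    also have "(LINT t::'a|lborel. (e / 2) * gauss 1 t + (L / m) * (norm t * gauss 1 t)) = e / 2 * \<kappa> + L / m * J"
      unfolding \<kappa>_def J_def
      by (subst Bochner_Integration.integral_add[OF integrable_mult_right[OF gauss_integrable(1)] integrable_mult_right[OF gauss_integrable(2)]]) simp
    finally have "norm (b z - gauss_average m b z) \<le> 1 / \<kappa> * (e / 2 * \<kappa> + L / m * J)"
      using \<kappa> by (simp add: divide_right_mono)
    also have "\<dots> = e / 2 + (L * J / \<kappa>) / m" using \<kappa> m by (simp add: field_simps)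
    also have "(L * J / \<kappa>) / m \<le> e / 2"
    proof -
      have "e / 2 * m = L * J / \<kappa> + 1" using e by (simp add: m_def)
      then show ?thesis unfolding pos_divide_le_eq[OF m] by linarith
    qed
    finally show ?thesis by simp
  qed
  with m show ?thesis using that by blast
qed

lemma compact_support_l1:
  fixes b :: "'a::euclidean_space \<Rightarrow> complex"
  assumes b: "continuous_on UNIV b" "\<And>z. R \<le> norm z \<Longrightarrow> b z = 0"
  shows "integrable lborel b"
proof -
  obtain M where M: "0 < M" "\<And>z. norm (b z) \<le> M"
    using vanishing_bounded[OF vanishing_compact_support[OF b]] by metis
  have [measurable]: "b \<in> borel_measurable borel" by (rule borel_measurable_continuous_onI[OF b(1)])
  show ?thesis
  proof (rule integrableI_bounded)
    have "(\<integral>\<^sup>+z. ennreal (norm (b z)) \<partial>lborel) \<le> (\<integral>\<^sup>+(z::'a). ennreal M * indicator (cball 0 R) z \<partial>lborel)"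
    proof (rule nn_integral_mono)
      fix z
      show "ennreal (norm (b z)) \<le> ennreal M * indicator (cball 0 R) z"
        using M(2)[of z] b(2)[of z] by (cases "R \<le> norm z") (auto simp: indicator_def ennreal_leI)
    qed
    also have "\<dots> < \<infinity>" using cball_finite[where 'a='a, of R] by (subst nn_integral_cmult_indicator) (auto simp: ennreal_mult_less_top)
    finally show "(\<integral>\<^sup>+z. ennreal (norm (b z)) \<partial>lborel) < \<infinity>" .
  qed measurable
qed

lemma gauss_average_integral:
  fixes b :: "'a::euclidean_space \<Rightarrow> complex" and \<mu> :: "'a measure"
  assumes \<mu>: "sets \<mu> = sets borel" "finite_measure \<mu>" and b: "integrable lborel b"
  shows "integrable \<mu> (gauss_average m b)"
    and "(LINT z|\<mu>. gauss_average m b z) = of_real (m ^ DIM('a) / (LINT t::'a|lborel. gauss 1 t)) *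
      (LINT y|lborel. b y * (LINT z|\<mu>. of_real (gauss (m\<^sup>2) (z - y))))"
proof -
  interpret finite_measure \<mu> by fact
  interpret P: pair_sigma_finite \<mu> lborel ..
  note [measurable_cong] = \<mu>(1)
  have [measurable]: "b \<in> borel_measurable borel" using b by (auto simp: borel_measurable_integrable)
  let ?f = "\<lambda>(z, y). b y * of_real (gauss (m\<^sup>2) (z - y))"
  have i: "integrable (\<mu> \<Otimes>\<^sub>M lborel) ?f"
  proof (rule integrableI_bounded)
    show "?f \<in> borel_measurable (\<mu> \<Otimes>\<^sub>M lborel)" by measurable
    have "(\<integral>\<^sup>+p. ennreal (norm (?f p)) \<partial>(\<mu> \<Otimes>\<^sub>M lborel)) = (\<integral>\<^sup>+z. \<integral>\<^sup>+y. ennreal (norm (?f (z, y))) \<partial>lborel \<partial>\<mu>)"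
      by (rule lborel.nn_integral_fst[symmetric]) measurable
    also have "\<dots> \<le> (\<integral>\<^sup>+z. \<integral>\<^sup>+y. ennreal (norm (b y)) \<partial>lborel \<partial>\<mu>)"
      by (intro nn_integral_mono ennreal_leI) (auto simp: norm_mult gauss_bounds mult_left_le)
    also have "\<dots> = (\<integral>\<^sup>+y. ennreal (norm (b y)) \<partial>lborel) * emeasure \<mu> (space \<mu>)" by simp
    also have "\<dots> < \<infinity>" using b order_le_less_trans[OF order_refl emeasure_finite[of "space \<mu>", unfolded infinity_ennreal_def top.not_eq_extremum]]
      by (simp add: integrable_iff_bounded ennreal_mult_less_top)
    finally show "(\<integral>\<^sup>+p. ennreal (norm (?f p)) \<partial>(\<mu> \<Otimes>\<^sub>M lborel)) < \<infinity>" .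
  qed
  show "integrable \<mu> (gauss_average m b)"
    unfolding gauss_average_def[abs_def] using P.integrable_fst'[OF i] by (intro integrable_mult_right) simp
  have "(LINT z|\<mu>. LINT y|lborel. b y * of_real (gauss (m\<^sup>2) (z - y))) = (LINT y|lborel. LINT z|\<mu>. b y * of_real (gauss (m\<^sup>2) (z - y)))"
    using P.Fubini_integral[of "\<lambda>z y. b y * of_real (gauss (m\<^sup>2) (z - y))"] i by simp
  then show "(LINT z|\<mu>. gauss_average m b z) = of_real (m ^ DIM('a) / (LINT t::'a|lborel. gauss 1 t)) *
      (LINT y|lborel. b y * (LINT z|\<mu>. of_real (gauss (m\<^sup>2) (z - y))))"
    unfolding gauss_average_def by simp
qed

text \<open>Testing with ever wider Gaussians and Fatou's lemma bound the mass of the limit; this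
  comes first, as uniform approximation and Fubini both need a finite limit measure. Compactly
  supported functions are then approximated uniformly by their Gaussian averages, and functions
  vanishing at infinity by cut-offs.\<close>

lemma vague_extension:
  fixes \<nu> :: "nat \<Rightarrow> 'a::euclidean_space measure"
  assumes \<nu>: "\<And>k. sets (\<nu> k) = sets borel" "\<And>k. emeasure (\<nu> k) UNIV \<le> ennreal B" "0 \<le> B"
    and \<mu>: "sets \<mu> = sets borel"
    and conv: "\<And>g. schwartz g \<Longrightarrow> integrable \<mu> g \<and> (\<lambda>k. LINT z|\<nu> k. g z) \<longlonglongrightarrow> (LINT z|\<mu>. g z)"
  shows "emeasure \<mu> UNIV \<le> ennreal B"
    and "vanishing b \<Longrightarrow> (\<lambda>k. LINT z|\<nu> k. b z) \<longlonglongrightarrow> (LINT z|\<mu>. b z)"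
proof -
  note [measurable_cong] = \<mu>
  have sp: "space \<mu> = UNIV" "\<And>k. space (\<nu> k) = UNIV" using sets_eq_imp_space_eq[OF \<mu>] sets_eq_imp_space_eq[OF \<nu>(1)] by simp_all
  have fin\<nu>: "finite_measure (\<nu> k)" for k by (rule finite_measureI_le[OF \<nu>(1,2)])
  have "(\<integral>\<^sup>+z. 1 \<partial>\<mu>) \<le> ennreal B"
  proof (rule nn_integral_limit_le[where f = "\<lambda>n z. ennreal (gauss ((inverse (real (Suc n)))\<^sup>2) z)"])
    show "(\<lambda>z. ennreal (gauss ((inverse (real (Suc n)))\<^sup>2) z)) \<in> borel_measurable \<mu>" for n by measurable
    show "(\<lambda>n. ennreal (gauss ((inverse (real (Suc n)))\<^sup>2) z)) \<longlonglongrightarrow> 1" for z :: 'a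
    proof -
      have "(\<lambda>n. gauss ((inverse (real (Suc n)))\<^sup>2) z) \<longlonglongrightarrow> exp (- (0\<^sup>2) * (norm z)\<^sup>2)"
        unfolding gauss_def by (intro tendsto_intros LIMSEQ_inverse_real_of_nat)
      then show ?thesis using tendsto_ennrealI by fastforce
    qed
    fix n
    define c where "c = (inverse (real (Suc n)))\<^sup>2"
    have c: "0 < c" by (simp add: c_def)
    have cv: "integrable \<mu> (\<lambda>z. complex_of_real (gauss c z))" "(\<lambda>k. LINT z|\<nu> k. complex_of_real (gauss c z)) \<longlonglongrightarrow> (LINT z|\<mu>. complex_of_real (gauss c z))"
      using conv[OF schwartz_gauss[OF c, of 0]] by auto
    have "norm (LINT z|\<mu>. complex_of_real (gauss c z)) \<le> B"
    proof (rule LIMSEQ_le_const2[OF tendsto_norm[OF cv(2)]], intro exI[of _ 0] allI impI)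
      fix k
      have "ennreal (norm (LINT z|\<nu> k. complex_of_real (gauss c z))) \<le> (\<integral>\<^sup>+z. 1 \<partial>\<nu> k)"
        using c by (intro order_trans[OF norm_integral_le_nn_integral] nn_integral_mono) (auto simp: gauss_bounds)
      also have "\<dots> \<le> ennreal B" using \<nu>(2)[of k] by (simp add: sp)
      finally show "norm (LINT z|\<nu> k. complex_of_real (gauss c z)) \<le> B" using \<nu>(3) by simp
    qed
    then have "\<bar>LINT z|\<mu>. gauss c z\<bar> \<le> B" by (simp only: integral_complex_of_real norm_of_real)
    moreover have "(\<integral>\<^sup>+z. ennreal (gauss c z) \<partial>\<mu>) = ennreal (LINT z|\<mu>. gauss c z)"
      using cv(1) by (intro nn_integral_eq_integral) (auto simp: gauss_bounds complex_of_real_integrable_eq)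
    ultimately show "(\<integral>\<^sup>+z. ennreal (gauss ((inverse (real (Suc n)))\<^sup>2) z) \<partial>\<mu>) \<le> ennreal B"
      unfolding c_def by (simp add: ennreal_leI)
  qed
  then show mass: "emeasure \<mu> UNIV \<le> ennreal B" by (simp add: sp)
  have fin\<mu>: "finite_measure \<mu>" by (rule finite_measureI_le[OF \<mu> mass])
  assume b: "vanishing b"
  have cpt: "(\<lambda>k. LINT z|\<nu> k. c z) \<longlonglongrightarrow> (LINT z|\<mu>. c z)"
    if c: "continuous_on UNIV c" "\<And>z. R \<le> norm z \<Longrightarrow> c z = 0" for c :: "'a \<Rightarrow> complex" and R
  proof (rule uniform_approximation_limit[OF \<nu> \<mu> mass])
    note vc = vanishing_compact_support[OF c]
    obtain M where M: "0 < M" "\<And>z. norm (c z) \<le> M" using vanishing_bounded[OF vc] by metis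
    show "integrable (\<nu> k) c" for k by (rule integrable_bounded_borel[OF fin\<nu> \<nu>(1) vanishing_measurable[OF vc] M(2)])
    show "integrable \<mu> c" by (rule integrable_bounded_borel[OF fin\<mu> \<mu> vanishing_measurable[OF vc] M(2)])
    have [measurable]: "c \<in> borel_measurable borel" by (rule vanishing_measurable[OF vc])
    fix e :: real assume e: "0 < e"
    obtain m where m: "0 < m" "\<And>z. norm (c z - gauss_average m c z) \<le> e"
      using gauss_average_close[OF c e] by metis
    have cl: "integrable lborel c" by (rule compact_support_l1[OF c])
    have "(\<lambda>k. LINT z|\<nu> k. gauss_average m c z) \<longlonglongrightarrow> (LINT z|\<mu>. gauss_average m c z)"
      unfolding gauss_average_integral(2)[OF \<nu>(1) fin\<nu> cl] gauss_average_integral(2)[OF \<mu> fin\<mu> cl]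
    \<comment> \<open>For each y the inner integral tests a translated Gaussian and converges by
      hypothesis; the common mass bound \<open>B\<close> dominates it.\<close>
    proof (intro tendsto_mult_left integral_dominated_convergence[where w = "\<lambda>y. norm (c y) * B"])
      have meas: "(\<lambda>y. LINT z|N. complex_of_real (gauss (m\<^sup>2) (z - y))) \<in> borel_measurable lborel"
        if N: "finite_measure N" "sets N = sets borel" for N :: "'a measure"
      proof -
        interpret finite_measure N by fact
        note [measurable_cong] = N(2)
        show ?thesis by measurable
      qed
      show "(\<lambda>y. c y * (LINT z|\<mu>. complex_of_real (gauss (m\<^sup>2) (z - y)))) \<in> borel_measurable lborel"
        using meas[OF fin\<mu> \<mu>] by measurable
      show "(\<lambda>y. c y * (LINT z|\<nu> k. complex_of_real (gauss (m\<^sup>2) (z - y)))) \<in> borel_measurable lborel" for k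
        using meas[OF fin\<nu> \<nu>(1), of k] by measurable
      show "integrable lborel (\<lambda>y. norm (c y) * B)" using cl by (intro integrable_mult_left integrable_norm)
      show "AE y in lborel. (\<lambda>k. c y * (LINT z|\<nu> k. complex_of_real (gauss (m\<^sup>2) (z - y)))) \<longlonglongrightarrow> c y * (LINT z|\<mu>. complex_of_real (gauss (m\<^sup>2) (z - y)))"
        using conv[OF schwartz_gauss[of "m\<^sup>2"]] m(1) by (intro AE_I2 tendsto_mult_left) auto
      fix k
      show "AE y in lborel. norm (c y * (LINT z|\<nu> k. complex_of_real (gauss (m\<^sup>2) (z - y)))) \<le> norm (c y) * B"
      proof (rule AE_I2)
        fix y
        have "ennreal (norm (LINT z|\<nu> k. complex_of_real (gauss (m\<^sup>2) (z - y)))) \<le> (\<integral>\<^sup>+z. 1 \<partial>\<nu> k)"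
          by (intro order_trans[OF norm_integral_le_nn_integral] nn_integral_mono) (auto simp: gauss_bounds)
        also have "\<dots> \<le> ennreal B" using \<nu>(2)[of k] by (simp add: sp)
        finally show "norm (c y * (LINT z|\<nu> k. complex_of_real (gauss (m\<^sup>2) (z - y)))) \<le> norm (c y) * B"
          using \<nu>(3) by (auto simp: norm_mult intro!: mult_left_mono)
      qed
    qed
    then show "\<exists>b'. (\<forall>k. integrable (\<nu> k) b') \<and> integrable \<mu> b' \<and> (\<forall>z. norm (c z - b' z) \<le> e)
       \<and> (\<lambda>k. LINT z|\<nu> k. b' z) \<longlonglongrightarrow> (LINT z|\<mu>. b' z)"
      using m(2) gauss_average_integral(1)[OF \<nu>(1) fin\<nu> cl] gauss_average_integral(1)[OF \<mu> fin\<mu> cl]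
      by (intro exI[of _ "gauss_average m c"]) auto
  qed
  show "(\<lambda>k. LINT z|\<nu> k. b z) \<longlonglongrightarrow> (LINT z|\<mu>. b z)"
  proof (rule uniform_approximation_limit[OF \<nu> \<mu> mass])
    obtain M where M: "0 < M" "\<And>z. norm (b z) \<le> M" using vanishing_bounded[OF b] by metis
    show "integrable (\<nu> k) b" for k by (rule integrable_bounded_borel[OF fin\<nu> \<nu>(1) vanishing_measurable[OF b] M(2)])
    show "integrable \<mu> b" by (rule integrable_bounded_borel[OF fin\<mu> \<mu> vanishing_measurable[OF b] M(2)])
    fix e :: real assume e: "0 < e"
    obtain R where R: "0 < R" "\<And>z. R \<le> norm z \<Longrightarrow> norm (b z) \<le> e"
      using vanishing_small[OF b e] by metis
    \<comment> \<open>A continuous cut-off, 1 on the ball of radius R and 0 outside the ball of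
      radius R + 1.\<close>
    define q where "q z = min 1 (max 0 (R + 1 - norm z))" for z :: 'a
    define c where "c z = b z * of_real (q z)" for z
    have q: "0 \<le> q z" "q z \<le> 1" "norm z \<le> R \<Longrightarrow> q z = 1" "R + 1 \<le> norm z \<Longrightarrow> q z = 0" for z
      by (auto simp: q_def)
    have c1: "continuous_on UNIV c"
      using b unfolding c_def q_def vanishing_def by (auto intro!: continuous_intros)
    have c2: "c z = 0" if "R + 1 \<le> norm z" for z using q(4)[OF that] by (simp add: c_def)
    have c3: "norm (b z - c z) \<le> e" for z
    proof (cases "norm z \<le> R")
      case False
      have "b z - c z = b z * of_real (1 - q z)" by (simp add: c_def right_diff_distrib)
      then have "norm (b z - c z) = norm (b z) * (1 - q z)" using q(2)[of z] by (simp only: norm_mult norm_of_real)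
      also have "\<dots> \<le> norm (b z) * 1" using q[of z] by (intro mult_left_mono) auto
      finally show ?thesis using R(2)[of z] False by simp
    qed (use q(3)[of z] e in \<open>simp add: c_def\<close>)
    note vc = vanishing_compact_support[OF c1 c2]
    obtain M' where M': "0 < M'" "\<And>z. norm (c z) \<le> M'" using vanishing_bounded[OF vc] by metis
    show "\<exists>b'. (\<forall>k. integrable (\<nu> k) b') \<and> integrable \<mu> b' \<and> (\<forall>z. norm (b z - b' z) \<le> e)
       \<and> (\<lambda>k. LINT z|\<nu> k. b' z) \<longlonglongrightarrow> (LINT z|\<mu>. b' z)"
      using c3 cpt[OF c1 c2] integrable_bounded_borel[OF fin\<nu> \<nu>(1) vanishing_measurable[OF vc] M'(2)]
        integrable_bounded_borel[OF fin\<mu> \<mu> vanishing_measurable[OF vc] M'(2)]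
      by (intro exI[of _ c]) auto
  qed
qed

section \<open>Mutual singularity kills the cross terms\<close>

lemma norm_integral_product_le:
  fixes f g :: "'a::euclidean_space \<Rightarrow> complex"
  assumes [measurable]: "f \<in> borel_measurable borel" "g \<in> borel_measurable borel"
    and "l2 f \<le> ennreal A" "l2 g \<le> ennreal B" "0 \<le> A" "0 \<le> B"
  shows "norm (LINT x|lborel. f x * g x) \<le> sqrt (A * B)"
proof (rule real_le_rsqrt)
  have "ennreal ((norm (LINT x|lborel. f x * g x))\<^sup>2) \<le> l2 f * l2 g"
    unfolding l2_def by (rule norm_integral_square_le) measurable
  also have "\<dots> \<le> ennreal A * ennreal B" using assms by (intro mult_mono) auto
  finally show "(norm (LINT x|lborel. f x * g x))\<^sup>2 \<le> A * B"
    using assms by (simp add: ennreal_mult[symmetric])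
qed

text \<open>Let A be null for \<alpha> and carry \<beta>. Inner regularity gives a compact K in A
  with almost all of the mass of \<beta>. As K is null for \<alpha>, outer regularity gives an open
  set around K of small \<alpha> mass. Intersecting it with a ball makes the Urysohn function
  compactly supported, hence an admissible test function.\<close>

lemma singular_separation:
  fixes \<alpha> \<beta> :: "'a::euclidean_space measure"
  assumes \<alpha>: "sets \<alpha> = sets borel" "finite_measure \<alpha>" and \<beta>: "sets \<beta> = sets borel" "finite_measure \<beta>"
    and sing: "mutually_singular \<alpha> \<beta>" and d: "0 < d"
  obtains \<omega> :: "'a \<Rightarrow> real" where "continuous_on UNIV \<omega>" "\<And>z. 0 \<le> \<omega> z" "\<And>z. \<omega> z \<le> 1"
    "vanishing (\<lambda>z. complex_of_real (\<omega> z))"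
    "(\<integral>\<^sup>+z. ennreal (\<omega> z) \<partial>\<alpha>) < ennreal d" "(\<integral>\<^sup>+z. ennreal (1 - \<omega> z) \<partial>\<beta>) < ennreal d"
proof -
  interpret \<alpha>: finite_measure \<alpha> by fact
  interpret \<beta>: finite_measure \<beta> by fact
  have sp: "space \<alpha> = UNIV" "space \<beta> = UNIV" using sets_eq_imp_space_eq[OF \<alpha>(1)] sets_eq_imp_space_eq[OF \<beta>(1)] by simp_all
  obtain A where A: "A \<in> sets borel" "emeasure \<alpha> A = 0" "emeasure \<beta> (- A) = 0"
    using sing \<alpha>(1) sp unfolding mutually_singular_def by (auto simp: Compl_eq_Diff_UNIV)
  have eq: "emeasure \<beta> A = (SUP K \<in> {K. K \<subseteq> A \<and> compact K}. emeasure \<beta> K)"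
    by (rule inner_regular[OF \<beta>(1) _ A(1)]) (simp add: \<beta>.emeasure_finite)
  have ne: "{K. K \<subseteq> A \<and> compact K} \<noteq> {}" using compact_empty by blast
  have "\<exists>K \<in> {K. K \<subseteq> A \<and> compact K}. emeasure \<beta> A < emeasure \<beta> K + ennreal d"
    by (rule SUP_approx_ennreal[OF d ne eq]) (simp add: \<beta>.emeasure_finite)
  then obtain K where "K \<in> {K. K \<subseteq> A \<and> compact K}" "emeasure \<beta> A < emeasure \<beta> K + ennreal d" ..
  then have K: "K \<subseteq> A" "compact K" "emeasure \<beta> A < emeasure \<beta> K + ennreal d" by auto
  have "emeasure \<alpha> K = (INF U \<in> {U. K \<subseteq> U \<and> open U}. emeasure \<alpha> U)"
    by (rule outer_regular[OF \<alpha>(1) _ borel_compact[OF K(2)]]) (simp add: \<alpha>.emeasure_finite)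
  moreover have "emeasure \<alpha> K \<le> emeasure \<alpha> A" using K A \<alpha>(1) by (intro emeasure_mono) auto
  then have "emeasure \<alpha> K = 0" using A(2) by simp
  ultimately have "(INF U \<in> {U. K \<subseteq> U \<and> open U}. emeasure \<alpha> U) < ennreal d" using d by simp
  then obtain U where U: "K \<subseteq> U" "open U" "emeasure \<alpha> U < ennreal d" by (auto simp: INF_less_iff)
  obtain R where R: "K \<subseteq> ball 0 R" using compact_imp_bounded[OF K(2)] bounded_subset_ballD by blast
  define V where "V = U \<inter> ball 0 R"
  have V: "K \<subseteq> V" "open V" "emeasure \<alpha> V < ennreal d"
    using U R emeasure_mono[of V U \<alpha>] \<alpha>(1) unfolding V_def by (auto intro: order_le_less_trans)
  obtain \<omega> :: "'a \<Rightarrow> real" where \<omega>: "continuous_on UNIV \<omega>" "\<And>x. \<omega> x \<in> closed_segment 1 0" "\<And>x. x \<in> K \<Longrightarrow> \<omega> x = 1" "\<And>x. x \<in> - V \<Longrightarrow> \<omega> x = 0"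
    using Urysohn[of K "- V" "1::real" 0] compact_imp_closed[OF K(2)] V by (metis closed_Compl disjoint_eq_subset_Compl double_complement)
  have \<omega>01: "0 \<le> \<omega> z" "\<omega> z \<le> 1" for z using \<omega>(2)[of z] by (auto simp: closed_segment_eq_real_ivl)
  have [measurable]: "\<omega> \<in> borel_measurable borel" by (rule borel_measurable_continuous_onI[OF \<omega>(1)])
  have "vanishing (\<lambda>z. complex_of_real (\<omega> z))"
  proof (rule vanishing_compact_support[where R = R])
    show "continuous_on UNIV (\<lambda>z. complex_of_real (\<omega> z))" using \<omega>(1) by (intro continuous_intros)
    show "complex_of_real (\<omega> z) = 0" if "R \<le> norm z" for z using that \<omega>(4)[of z] by (auto simp: V_def)
  qed
  moreover have "(\<integral>\<^sup>+z. ennreal (\<omega> z) \<partial>\<alpha>) \<le> (\<integral>\<^sup>+z. indicator V z \<partial>\<alpha>)"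
    using \<omega>01 \<omega>(4) by (intro nn_integral_mono) (auto simp: indicator_def)
  then have "(\<integral>\<^sup>+z. ennreal (\<omega> z) \<partial>\<alpha>) < ennreal d" using V \<alpha>(1) by simp
  moreover have "(\<integral>\<^sup>+z. ennreal (1 - \<omega> z) \<partial>\<beta>) < ennreal d"
  proof -
    have KA: "K \<in> sets \<beta>" "A \<in> sets \<beta>" using K(2) A(1) \<beta>(1) by (auto intro: borel_compact)
    have "(\<integral>\<^sup>+z. ennreal (1 - \<omega> z) \<partial>\<beta>) \<le> (\<integral>\<^sup>+z. indicator (- K) z \<partial>\<beta>)"
      using \<omega>01 \<omega>(3) by (intro nn_integral_mono) (auto simp: indicator_def)
    also have "\<dots> = emeasure \<beta> (- K)" using borel_comp[OF borel_compact[OF K(2)]] \<beta>(1) by (intro nn_integral_indicator) simp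
    also have "\<dots> \<le> emeasure \<beta> (- A \<union> (A - K))" using KA \<beta>(1) A(1) by (intro emeasure_mono) auto
    also have "\<dots> \<le> emeasure \<beta> (- A) + emeasure \<beta> (A - K)" using KA \<beta>(1) A(1) by (intro emeasure_subadditive) auto
    also have "\<dots> = emeasure \<beta> A - emeasure \<beta> K" 
      using KA K(1) A(3) \<beta>.emeasure_finite by (simp add: emeasure_Diff)
    also have "\<dots> < ennreal d"
      using K(3) d \<beta>.emeasure_finite[of A] \<beta>.emeasure_finite[of K] emeasure_mono[OF K(1) KA(2)]
      by (cases "emeasure \<beta> A"; cases "emeasure \<beta> K")
         (auto simp: ennreal_minus ennreal_less_iff ennreal_plus[symmetric] simp del: ennreal_plus)
    finally show ?thesis .
  qed
  ultimately show ?thesis using that \<omega>(1) \<omega>01 by blast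
qed

text \<open>Here \<open>F k\<close> and \<open>G k\<close> live on the time-frequency plane in microscopic variables, which \<open>p k\<close>
  maps to phase space; the squared moduli converge to \<open>\<alpha>\<close> and \<open>\<beta>\<close>.\<close>

lemma singular_cross_term:
  fixes F G :: "nat \<Rightarrow> 'b::euclidean_space \<Rightarrow> complex" and p :: "nat \<Rightarrow> 'b \<Rightarrow> 'a::euclidean_space"
  assumes F[measurable]: "\<And>k. F k \<in> borel_measurable borel" and G[measurable]: "\<And>k. G k \<in> borel_measurable borel"
    and p[measurable]: "\<And>k. p k \<in> measurable borel borel"
    and bd: "\<And>k. l2 (F k) \<le> ennreal B" "\<And>k. l2 (G k) \<le> ennreal B" "0 \<le> B"
    and \<alpha>: "sets \<alpha> = sets borel" "finite_measure \<alpha>" and \<beta>: "sets \<beta> = sets borel" "finite_measure \<beta>"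
    and cF: "\<And>b. vanishing b \<Longrightarrow> (\<lambda>k. LINT w|lborel. b (p k w) * of_real ((norm (F k w))\<^sup>2)) \<longlonglongrightarrow> (LINT z|\<alpha>. b z)"
    and cG: "\<And>b. vanishing b \<Longrightarrow> (\<lambda>k. LINT w|lborel. b (p k w) * of_real ((norm (G k w))\<^sup>2)) \<longlonglongrightarrow> (LINT z|\<beta>. b z)"
    and sing: "mutually_singular \<alpha> \<beta>" and a: "vanishing a"
  shows "(\<lambda>k. LINT w|lborel. a (p k w) * (cnj (F k w) * G k w)) \<longlonglongrightarrow> 0"
proof (rule LIMSEQ_I)
  fix r :: real assume r: "0 < r"
  obtain M where M: "0 < M" "\<And>z. norm (a z) \<le> M" using vanishing_bounded[OF a] by metis
  have [measurable]: "a \<in> borel_measurable borel" by (rule vanishing_measurable[OF a])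
  \<comment> \<open>Chosen so that M^2 d (B + 1) = (r/3)^2: each of the two cross terms below is
    then at most r/3.\<close>
  define d where "d = r\<^sup>2 / (9 * (M\<^sup>2 * (B + 1)))"
  have d: "0 < d" using r M bd(3) by (simp add: d_def)
  have small: "2 * sqrt (M\<^sup>2 * d * B) < r"
  proof -
    have "M\<^sup>2 * d * B \<le> M\<^sup>2 * d * (B + 1)" using d by (intro mult_left_mono) auto
    also have "\<dots> = (r / 3)\<^sup>2"     proof -
      define X where "X = M\<^sup>2 * (B + 1)"
      have "0 < X" using M bd(3) by (simp add: X_def)
      moreover have "M\<^sup>2 * d * (B + 1) = X * d" by (simp add: X_def mult_ac)
      ultimately show ?thesis unfolding d_def X_def[symmetric] by (simp add: power_divide)
    qed
    finally have "sqrt (M\<^sup>2 * d * B) \<le> r / 3" using r by (intro real_le_lsqrt) auto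
    then show ?thesis using r by simp
  qed
  obtain \<omega> where \<omega>: "continuous_on UNIV \<omega>" "\<And>z. 0 \<le> \<omega> z" "\<And>z. \<omega> z \<le> 1"
    "vanishing (\<lambda>z. complex_of_real (\<omega> z))"
    "(\<integral>\<^sup>+z. ennreal (\<omega> z) \<partial>\<alpha>) < ennreal d" "(\<integral>\<^sup>+z. ennreal (1 - \<omega> z) \<partial>\<beta>) < ennreal d"
    using singular_separation[OF \<alpha> \<beta> sing d] by metis
  have [measurable]: "\<omega> \<in> borel_measurable borel" by (rule borel_measurable_continuous_onI[OF \<omega>(1)])
  \<comment> \<open>Stated once for both uses: the squared norm of the localised sequence converges
    to the integral of |c|^2, which is at most M^2 times the integral of the localiser and hence
    below M^2 d.\<close>
  have weight: "eventually (\<lambda>k. l2 (\<lambda>w. c (p k w) * H k w) < ennreal (M\<^sup>2 * d)) sequentially"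
    if H: "\<And>k. H k \<in> borel_measurable borel" "\<And>k. l2 (H k) \<le> ennreal B"
      and cH: "\<And>b. vanishing b \<Longrightarrow> (\<lambda>k. LINT w|lborel. b (p k w) * of_real ((norm (H k w))\<^sup>2)) \<longlonglongrightarrow> (LINT z|\<gamma>. b z)"
      and \<gamma>: "sets \<gamma> = sets borel" "finite_measure \<gamma>"
      and q: "continuous_on UNIV q" "\<And>z. 0 \<le> q z" "\<And>z. q z \<le> 1" "(\<integral>\<^sup>+z. ennreal (q z) \<partial>\<gamma>) < ennreal d"
      and c: "continuous_on UNIV c" "\<And>z. norm (c z) \<le> M * q z" "vanishing (\<lambda>z. cnj (c z) * c z)" 
    for H \<gamma> q and c :: "'a \<Rightarrow> complex"
  proof -
    note [measurable] = H(1) borel_measurable_continuous_onI[OF c(1)] borel_measurable_continuous_onI[OF q(1)]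
    note [measurable_cong] = \<gamma>(1)
    interpret \<gamma>: finite_measure \<gamma> by fact
    have cM: "norm (c z) \<le> M" for z using order_trans[OF c(2) mult_left_le[OF q(3)]] M(1) by simp
    have sq: "of_real ((norm (c z * h))\<^sup>2) = (cnj (c z) * c z) * of_real ((norm h)\<^sup>2)" for z h
      using complex_norm_square[of "c z"] by (simp add: norm_mult power_mult_distrib mult_ac)
    have i: "integrable lborel (\<lambda>w. (norm (c (p k w) * H k w))\<^sup>2)" for k
    proof (rule Bochner_Integration.integrable_bound)
      show "integrable lborel (\<lambda>w. M\<^sup>2 * (norm (H k w))\<^sup>2)"
        using H(2)[of k] unfolding l2_def by (intro integrable_mult_right integrableI_bounded) (auto simp: order_le_less_trans)
      show "AE w in lborel. norm ((norm (c (p k w) * H k w))\<^sup>2) \<le> norm (M\<^sup>2 * (norm (H k w))\<^sup>2)"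
        using cM by (auto simp: norm_mult power_mult_distrib intro!: mult_right_mono power_mono)
    qed measurable
    define L where "L k = (LINT w|lborel. (norm (c (p k w) * H k w))\<^sup>2)" for k
    have l2L: "l2 (\<lambda>w. c (p k w) * H k w) = ennreal (L k)" for k
      unfolding l2_def L_def using i by (intro nn_integral_eq_integral) auto
    have L0: "0 \<le> L k" for k unfolding L_def by (intro Bochner_Integration.integral_nonneg) auto
    have "(\<lambda>k. complex_of_real (L k)) \<longlonglongrightarrow> (LINT z|\<gamma>. cnj (c z) * c z)"
      using cH[OF c(3)] unfolding L_def integral_complex_of_real[symmetric] sq .
    then have "(\<lambda>k. norm (complex_of_real (L k))) \<longlonglongrightarrow> norm (LINT z|\<gamma>. cnj (c z) * c z)" by (rule tendsto_norm)
    then have lim: "L \<longlonglongrightarrow> norm (LINT z|\<gamma>. cnj (c z) * c z)" using L0 by simp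
    have "ennreal (norm (LINT z|\<gamma>. cnj (c z) * c z)) \<le> (\<integral>\<^sup>+z. ennreal (norm (cnj (c z) * c z)) \<partial>\<gamma>)"
      by (rule norm_integral_le_nn_integral)
    also have "\<dots> \<le> (\<integral>\<^sup>+z. ennreal (M\<^sup>2) * ennreal (q z) \<partial>\<gamma>)"
    proof (rule nn_integral_mono)
      fix z
      have "norm (c z) * norm (c z) \<le> (M * q z) * M"
        using c(2)[of z] cM[of z] M(1) q(2)[of z] by (intro mult_mono) auto
      then show "ennreal (norm (cnj (c z) * c z)) \<le> ennreal (M\<^sup>2) * ennreal (q z)"
        using q(2)[of z] by (simp add: norm_mult ennreal_mult[symmetric] power2_eq_square mult_ac ennreal_leI)
    qed
    also have "\<dots> = ennreal (M\<^sup>2) * (\<integral>\<^sup>+z. ennreal (q z) \<partial>\<gamma>)" by (rule nn_integral_cmult) measurable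
    also have "\<dots> < ennreal (M\<^sup>2) * ennreal d"
      using q(4) M(1) by (intro ennreal_mult_strict_left_mono) auto
    finally have "norm (LINT z|\<gamma>. cnj (c z) * c z) < M\<^sup>2 * d"
      using d by (simp add: ennreal_mult[symmetric] ennreal_less_iff)
    with lim have "eventually (\<lambda>k. L k < M\<^sup>2 * d) sequentially" by (rule order_tendstoD)
    then show ?thesis unfolding l2L by eventually_elim (use L0 in \<open>simp add: ennreal_less_iff\<close>)
  qed
  \<comment> \<open>The symbol is split so that each factor meets the localiser that makes it small:
    \<open>c1\<close> goes with \<open>F\<close>, since \<omega> has small integral against
    \<alpha>, and \<open>c2\<close> with \<open>G\<close>, since 1 - \<omega> has small integral
    against \<beta>.\<close>
  define c1 where "c1 z = a z * of_real (\<omega> z)" for z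
  define c2 where "c2 z = a z * of_real (1 - \<omega> z)" for z
  have ca: "continuous_on UNIV a" using a by (simp add: vanishing_def)
  have c1c: "continuous_on UNIV c1" and c2c: "continuous_on UNIV c2"
    unfolding c1_def[abs_def] c2_def[abs_def] using ca \<omega>(1) by (auto intro!: continuous_intros)
  note [measurable] = borel_measurable_continuous_onI[OF c1c] borel_measurable_continuous_onI[OF c2c]
  have c1n: "norm (c1 z) \<le> M * \<omega> z" for z
    unfolding c1_def norm_mult norm_of_real using M(1) M(2)[of z] \<omega>(2,3)[of z] by (intro mult_mono) auto
  have c2n: "norm (c2 z) \<le> M * (1 - \<omega> z)" for z
    unfolding c2_def norm_mult norm_of_real using M(1) M(2)[of z] \<omega>(2,3)[of z] by (intro mult_mono) auto
  have c1M: "norm (c1 z) \<le> M" for z using order_trans[OF c1n mult_left_le[OF \<omega>(3)]] M(1) by simp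
  have c2M: "norm (c2 z) \<le> M" for z using order_trans[OF c2n[of z] mult_left_le[of "1 - \<omega> z" M]] \<omega>(2)[of z] M(1) by simp
  \<comment> \<open>The factor \<open>a\<close> must stay inside \<open>c1\<close> and
    \<open>c2\<close>: the function 1 - \<omega> alone does not vanish at infinity.\<close>
  have v: "vanishing (\<lambda>z. cnj (c z) * c z)" if "continuous_on UNIV c" "\<And>z. norm (c z) \<le> M" "\<And>z. c z = a z * g z" "\<And>z. norm (g z) \<le> 1" "continuous_on UNIV g" for c g
  proof -
    have "norm (g z * cnj (c z)) \<le> 1 * M" for z
      unfolding norm_mult complex_mod_cnj using that(2,4) by (intro mult_mono) auto
    then have "vanishing (\<lambda>z. a z * (g z * cnj (c z)))"
      by (intro vanishing_mult[OF a, of _ M] continuous_on_mult continuous_on_cnj that(1,5)) auto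
    then show ?thesis using that(3) by (simp add: mult_ac)
  qed
  have w2: "norm (complex_of_real (1 - \<omega> z)) \<le> 1" for z
    unfolding norm_of_real using \<omega>(2,3)[of z] by auto
  have e1: "eventually (\<lambda>k. l2 (\<lambda>w. c1 (p k w) * F k w) < ennreal (M\<^sup>2 * d)) sequentially"
    by (rule weight[OF F bd(1) cF \<alpha> \<omega>(1,2,3,5) c1c c1n v[OF c1c c1M, of "\<lambda>z. of_real (\<omega> z)"]])
       (use \<omega> in \<open>auto simp: c1_def intro!: continuous_intros\<close>)
  have e2: "eventually (\<lambda>k. l2 (\<lambda>w. c2 (p k w) * G k w) < ennreal (M\<^sup>2 * d)) sequentially"
    by (rule weight[OF G bd(2) cG \<beta> _ _ _ \<omega>(6) c2c c2n v[OF c2c c2M, of "\<lambda>z. of_real (1 - \<omega> z)"]])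
       (use \<omega> w2 in \<open>auto simp: c2_def intro!: continuous_intros\<close>)
  have "eventually (\<lambda>k. norm (LINT w|lborel. a (p k w) * (cnj (F k w) * G k w)) < r) sequentially"
    using e1 e2
  proof eventually_elim
    fix k
    assume k: "l2 (\<lambda>w. c1 (p k w) * F k w) < ennreal (M\<^sup>2 * d)" "l2 (\<lambda>w. c2 (p k w) * G k w) < ennreal (M\<^sup>2 * d)"
    have l1: "l2 (\<lambda>w. c1 (p k w) * cnj (F k w)) \<le> ennreal (M\<^sup>2 * d)" and l2': "l2 (\<lambda>w. c2 (p k w) * G k w) \<le> ennreal (M\<^sup>2 * d)"
      and l3: "l2 (\<lambda>w. cnj (F k w)) \<le> ennreal B"
      using k bd(1)[of k] by (simp_all add: l2_def norm_mult less_imp_le)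
    have n1: "norm (LINT w|lborel. (c1 (p k w) * cnj (F k w)) * G k w) \<le> sqrt (M\<^sup>2 * d * B)"
      using d bd(3) by (intro norm_integral_product_le l1 bd(2)) measurable
    have n2: "norm (LINT w|lborel. cnj (F k w) * (c2 (p k w) * G k w)) \<le> sqrt (B * (M\<^sup>2 * d))"
      using d bd(3) by (intro norm_integral_product_le l2' l3) measurable
    have fin: "l2 (G k) < \<infinity>" "l2 (\<lambda>w. cnj (F k w)) < \<infinity>" "l2 (\<lambda>w. c1 (p k w) * cnj (F k w)) < \<infinity>" "l2 (\<lambda>w. c2 (p k w) * G k w) < \<infinity>"
      using bd(2)[of k] l1 l2' l3 by (auto intro: order_le_less_trans)
    have i1: "integrable lborel (\<lambda>w. (c1 (p k w) * cnj (F k w)) * G k w)"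
      by (rule nn_integral_mult_integrable[OF _ _ fin(3)[unfolded l2_def] fin(1)[unfolded l2_def]]) measurable
    have i2: "integrable lborel (\<lambda>w. cnj (F k w) * (c2 (p k w) * G k w))"
      by (rule nn_integral_mult_integrable[OF _ _ fin(2)[unfolded l2_def] fin(4)[unfolded l2_def]]) measurable
    have "(LINT w|lborel. a (p k w) * (cnj (F k w) * G k w)) = (LINT w|lborel. (c1 (p k w) * cnj (F k w)) * G k w + cnj (F k w) * (c2 (p k w) * G k w))"
      by (intro Bochner_Integration.integral_cong refl) (simp add: c1_def c2_def algebra_simps)
    also have "\<dots> = (LINT w|lborel. (c1 (p k w) * cnj (F k w)) * G k w) + (LINT w|lborel. cnj (F k w) * (c2 (p k w) * G k w))"
      by (rule Bochner_Integration.integral_add[OF i1 i2])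
    also have "norm \<dots> \<le> sqrt (M\<^sup>2 * d * B) + sqrt (B * (M\<^sup>2 * d))"
      by (intro order_trans[OF norm_triangle_ineq] add_mono n1 n2)
    also have "\<dots> = 2 * sqrt (M\<^sup>2 * d * B)" by (simp add: mult_ac)
    also have "\<dots> < r" by (rule small)
    finally show "norm (LINT w|lborel. a (p k w) * (cnj (F k w) * G k w)) < r" .
  qed
  then show "\<exists>no. \<forall>k\<ge>no. norm ((LINT w|lborel. a (p k w) * (cnj (F k w) * G k w)) - 0) < r"
    by (simp add: eventually_sequentially)
qed

section \<open>Integration over the unit cube and the integer lattice\<close>

text \<open>Half open, so that the integer translates tile space exactly and each point lies in one
  of them. Centred at 0, so that its points have small coordinates and the distance to the lattice
  is controlled by the norm.\<close>

definition cube :: "(real ^ 'n) set" where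
  "cube = {x. \<forall>i. - 1/2 \<le> x $ i \<and> x $ i < 1/2}"

definition nint :: "real ^ 'n \<Rightarrow> int ^ 'n" where
  "nint y = vec_lambda (\<lambda>i. \<lfloor>y $ i + 1/2\<rfloor>)"

lemma vec_nth_measurable [measurable (raw)]:
  "f \<in> measurable M borel \<Longrightarrow> (\<lambda>x. (f x :: real ^ 'n) $ i) \<in> borel_measurable M"
  by (rule measurable_compose[OF _ borel_measurable_continuous_onI]) (auto intro: continuous_intros)

lemma cube_sets [measurable]: "cube \<in> sets borel"
proof -
  have "cube = {x \<in> space borel. \<forall>i. - 1/2 \<le> x $ i \<and> x $ i < (1/2 :: real)}" by (simp add: cube_def)
  also have "\<dots> \<in> sets borel" by measurable
  finally show ?thesis .
qed

lemma of_ivec_nth [simp]: "of_ivec n $ i = of_int (n $ i)"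
  by (simp add: of_ivec_def)

lemma of_ivec_diff: "of_ivec (m - n) = of_ivec m - of_ivec n"
  by (simp add: vec_eq_iff)

lemma of_ivec_0 [simp]: "of_ivec 0 = 0"
  by (simp add: vec_eq_iff)

lemma cube_iff_nint: "y - of_ivec n \<in> cube \<longleftrightarrow> n = nint y"
proof -
  have "- 1/2 \<le> y $ i - of_int (n $ i) \<and> y $ i - of_int (n $ i) < 1/2 \<longleftrightarrow> n $ i = \<lfloor>y $ i + 1/2\<rfloor>" for i
    by linarith
  then show ?thesis by (simp add: cube_def nint_def vec_eq_iff)
qed

section \<open>Exchanging lattice sums and integrals\<close>

lemma lborel_count_measurable:
  fixes f :: "'a \<Rightarrow> 'i::countable \<Rightarrow> 'b"
  assumes "\<And>n. (\<lambda>x. f x n) \<in> measurable M K"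
  shows "case_prod f \<in> measurable (M \<Otimes>\<^sub>M count_space UNIV) K"
    and "(\<lambda>(n, x). f x n) \<in> measurable (count_space UNIV \<Otimes>\<^sub>M M) K"
proof -
  show *: "(\<lambda>(n, x). f x n) \<in> measurable (count_space UNIV \<Otimes>\<^sub>M M) K"
    using assms by (intro measurable_pair_measure_countable1) auto
  then show "case_prod f \<in> measurable (M \<Otimes>\<^sub>M count_space UNIV) K"
    by (subst measurable_pair_swap_iff) (simp add: split_beta')
qed

lemma sigma_finite_count_space: "sigma_finite_measure (count_space (UNIV :: 'i::countable set))"
  by (rule sigma_finite_measure_count_space)

lemma Fubini_lborel_count:
  fixes f :: "'a::euclidean_space \<Rightarrow> 'i::countable \<Rightarrow> ennreal"
  assumes "\<And>n. (\<lambda>x. f x n) \<in> borel_measurable lborel"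
  shows "(\<integral>\<^sup>+x. \<integral>\<^sup>+n. f x n \<partial>count_space UNIV \<partial>lborel) = (\<integral>\<^sup>+n. \<integral>\<^sup>+x. f x n \<partial>lborel \<partial>count_space UNIV)"
proof -
  interpret C: sigma_finite_measure "count_space (UNIV :: 'i set)" by (rule sigma_finite_count_space)
  interpret pair_sigma_finite lborel "count_space (UNIV :: 'i set)" ..
  show ?thesis by (rule Fubini'[symmetric]) (rule lborel_count_measurable(1)[OF assms])
qed

lemma nn_integral_count_nint:
  "(\<integral>\<^sup>+n. g n * indicator cube (y - of_ivec n) \<partial>count_space UNIV) = (g (nint y) :: ennreal)"
  by (subst nn_integral_count_space'[where A = "{nint y}"]) (auto simp: cube_iff_nint indicator_def)

lemma nn_integral_count_nint_const:
  "(\<integral>\<^sup>+n. c * indicator cube (y - of_ivec n) \<partial>count_space UNIV) = (c :: ennreal)"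
  by (rule nn_integral_count_nint)

text \<open>The indicators of the translated cubes sum to 1. Inserting this sum, exchanging it with
  the integral and translating each term back to the cube folds the integral.\<close>

lemma nn_integral_unfold:
  fixes f :: "real ^ 'n \<Rightarrow> ennreal"
  assumes [measurable]: "f \<in> borel_measurable borel"
  shows "(\<integral>\<^sup>+y. f y \<partial>lborel) = (\<integral>\<^sup>+\<theta>. indicator cube \<theta> * (\<integral>\<^sup>+n. f (\<theta> + of_ivec n) \<partial>count_space UNIV) \<partial>lborel)"
proof -
  have "(\<integral>\<^sup>+y. f y \<partial>lborel) = (\<integral>\<^sup>+y. \<integral>\<^sup>+n. f y * indicator cube (y - of_ivec n) \<partial>count_space UNIV \<partial>lborel)"
    by (simp only: nn_integral_count_nint_const)
  also have "\<dots> = (\<integral>\<^sup>+n. \<integral>\<^sup>+y. f y * indicator cube (y - of_ivec n) \<partial>lborel \<partial>count_space UNIV)"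
    by (rule Fubini_lborel_count) measurable
  also have "\<dots> = (\<integral>\<^sup>+n. \<integral>\<^sup>+\<theta>. indicator cube \<theta> * f (\<theta> + of_ivec n) \<partial>lborel \<partial>count_space UNIV)"
  proof (rule nn_integral_cong)
    fix n :: "int ^ 'n"
    show "(\<integral>\<^sup>+y. f y * indicator cube (y - of_ivec n) \<partial>lborel) = (\<integral>\<^sup>+\<theta>. indicator cube \<theta> * f (\<theta> + of_ivec n) \<partial>lborel)"
      using nn_integral_lborel_shift(1)[of "\<lambda>y. f y * indicator cube (y - of_ivec n)" "of_ivec n"] by (simp add: mult.commute)
  qed
  also have "\<dots> = (\<integral>\<^sup>+\<theta>. \<integral>\<^sup>+n. indicator cube \<theta> * f (\<theta> + of_ivec n) \<partial>count_space UNIV \<partial>lborel)"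
    by (rule Fubini_lborel_count[symmetric]) measurable
  also have "\<dots> = (\<integral>\<^sup>+\<theta>. indicator cube \<theta> * (\<integral>\<^sup>+n. f (\<theta> + of_ivec n) \<partial>count_space UNIV) \<partial>lborel)"
    by (simp add: nn_integral_cmult)
  finally show ?thesis .
qed

lemma integral_unfold:
  fixes f :: "real ^ 'n \<Rightarrow> complex"
  assumes f: "integrable lborel f"
  shows "(LINT y|lborel. f y) = (LINT \<theta>|lborel. indicator cube \<theta> * (LINT n|count_space UNIV. f (\<theta> + of_ivec n)))"
    and "integrable lborel (\<lambda>\<theta>. indicator cube \<theta> * (LINT n|count_space UNIV. f (\<theta> + of_ivec n)))"
proof -
  interpret C: sigma_finite_measure "count_space (UNIV :: (int ^ 'n) set)" by (rule sigma_finite_count_space)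
  interpret P: pair_sigma_finite lborel "count_space (UNIV :: (int ^ 'n) set)" ..
  have [measurable]: "f \<in> borel_measurable borel" using f by (auto simp: borel_measurable_integrable)
  let ?H = "\<lambda>y n. f y * indicator cube (y - of_ivec n)"
  let ?G = "\<lambda>\<theta> n. indicator cube \<theta> * f (\<theta> + of_ivec n)"
  have ind: "norm (indicator A x :: complex) = indicator A x" for A and x :: "real ^ 'n" by (simp add: indicator_def)
  have H: "integrable (lborel \<Otimes>\<^sub>M count_space UNIV) (case_prod ?H)"
  proof (rule integrableI_bounded)
    show m: "case_prod ?H \<in> borel_measurable (lborel \<Otimes>\<^sub>M count_space UNIV)"
      by (rule lborel_count_measurable(1)) measurable
    have "(\<integral>\<^sup>+q. ennreal (norm (case_prod ?H q)) \<partial>(lborel \<Otimes>\<^sub>M count_space UNIV)) = (\<integral>\<^sup>+y. \<integral>\<^sup>+n. ennreal (norm (?H y n)) \<partial>count_space UNIV \<partial>lborel)"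
      using m by (subst C.nn_integral_fst[symmetric]) auto
    also have "\<dots> = (\<integral>\<^sup>+y. \<integral>\<^sup>+n. ennreal (norm (f y)) * indicator cube (y - of_ivec n) \<partial>count_space UNIV \<partial>lborel)"
      by (simp add: norm_mult ind ennreal_mult ennreal_indicator)
    also have "\<dots> < \<infinity>" using f unfolding nn_integral_count_nint_const by (simp add: integrable_iff_bounded)
    finally show "(\<integral>\<^sup>+q. ennreal (norm (case_prod ?H q)) \<partial>(lborel \<Otimes>\<^sub>M count_space UNIV)) < \<infinity>" .
  qed
  have G: "integrable (lborel \<Otimes>\<^sub>M count_space UNIV) (case_prod ?G)"
  proof (rule integrableI_bounded)
    show m: "case_prod ?G \<in> borel_measurable (lborel \<Otimes>\<^sub>M count_space UNIV)"
      by (rule lborel_count_measurable(1)) measurable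
    have "(\<integral>\<^sup>+q. ennreal (norm (case_prod ?G q)) \<partial>(lborel \<Otimes>\<^sub>M count_space UNIV)) = (\<integral>\<^sup>+y. \<integral>\<^sup>+n. ennreal (norm (?G y n)) \<partial>count_space UNIV \<partial>lborel)"
      using m by (subst C.nn_integral_fst[symmetric]) auto
    also have "\<dots> = (\<integral>\<^sup>+\<theta>. indicator cube \<theta> * (\<integral>\<^sup>+n. ennreal (norm (f (\<theta> + of_ivec n))) \<partial>count_space UNIV) \<partial>lborel)"
      by (simp add: norm_mult ind ennreal_mult ennreal_indicator nn_integral_cmult)
    also have "\<dots> < \<infinity>" using f nn_integral_unfold[of "\<lambda>y. ennreal (norm (f y))"] by (simp add: integrable_iff_bounded)
    finally show "(\<integral>\<^sup>+q. ennreal (norm (case_prod ?G q)) \<partial>(lborel \<Otimes>\<^sub>M count_space UNIV)) < \<infinity>" .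
  qed
  have fs: "(LINT n|count_space UNIV. ?H y n) = f y" for y
  proof -
    have eq: "{n \<in> UNIV. ?H y n \<noteq> 0} = (if f y = 0 then {} else {nint y})"
      by (auto simp: cube_iff_nint indicator_def)
    have "(LINT n|count_space UNIV. ?H y n) = (\<Sum>n | n \<in> UNIV \<and> ?H y n \<noteq> 0. ?H y n)"
      by (rule lebesgue_integral_count_space_finite_support) (unfold eq, simp)
    also have "\<dots> = (\<Sum>n \<in> (if f y = 0 then {} else {nint y}). ?H y n)"
      by (rule sum.cong[OF _ refl]) (use eq in simp)
    also have "\<dots> = f y"
    proof -
      define g where "g = ?H y"
      have "g (nint y) = f y" using cube_iff_nint[of y "nint y"] by (simp add: g_def)
      then show ?thesis unfolding g_def[symmetric] by simp
    qed
    finally show ?thesis .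
  qed
  have "(LINT y|lborel. f y) = (LINT y|lborel. LINT n|count_space UNIV. ?H y n)" by (simp only: fs)
  also have "\<dots> = (LINT n|count_space UNIV. LINT y|lborel. ?H y n)"
    using P.Fubini_integral[OF H] by simp
  also have "\<dots> = (LINT n|count_space UNIV. LINT \<theta>|lborel. ?G \<theta> n)"
  proof (rule Bochner_Integration.integral_cong[OF refl])
    fix n :: "int ^ 'n"
    show "(LINT y|lborel. ?H y n) = (LINT \<theta>|lborel. ?G \<theta> n)"
      using integral_lborel_shift(1)[of "\<lambda>y. ?H y n" "of_ivec n"] by (simp add: mult.commute)
  qed
  also have "\<dots> = (LINT \<theta>|lborel. LINT n|count_space UNIV. ?G \<theta> n)"
    using P.Fubini_integral[OF G] by simp
  finally show "(LINT y|lborel. f y) = (LINT \<theta>|lborel. indicator cube \<theta> * (LINT n|count_space UNIV. f (\<theta> + of_ivec n)))"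
    by simp
  show "integrable lborel (\<lambda>\<theta>. indicator cube \<theta> * (LINT n|count_space UNIV. f (\<theta> + of_ivec n)))"
    using P.integrable_fst[OF G] by simp
qed

lemma cube_norm_le: "\<theta> \<in> cube \<Longrightarrow> norm (\<theta> :: real ^ 'n) \<le> real CARD('n)"
proof -
  assume "\<theta> \<in> cube"
  then have "\<bar>\<theta> $ i\<bar> \<le> 1" for i unfolding cube_def by (simp add: abs_le_iff) (smt (verit) field_sum_of_halves)
  then have "(\<Sum>i\<in>UNIV. \<bar>\<theta> $ i\<bar>) \<le> (\<Sum>i\<in>(UNIV::'n set). 1)" by (intro sum_mono) auto
  then show ?thesis using norm_le_l1_cart[of \<theta>] by simp
qed

lemma emeasure_cube: "emeasure lborel (cube :: (real ^ 'n) set) = 1"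
proof -
  let ?l = "vec (- 1/2) :: real ^ 'n" and ?u = "vec (1/2) :: real ^ 'n"
  have lu: "?l $ i = - 1/2" "?u $ i = 1/2" for i by simp_all
  have b: "(?u - ?l) \<bullet> b = 1" if "b \<in> Basis" for b
    using axis_inverse[OF that] by (auto simp: inner_axis)
  have lb: "?l \<bullet> b \<le> ?u \<bullet> b" if "b \<in> Basis" for b
    using b[OF that] unfolding inner_diff_left by linarith
  have 1: "box ?l ?u \<subseteq> cube" "cube \<subseteq> cbox ?l ?u"
    using lu by (auto simp: cube_def mem_box_cart less_imp_le)
  have "emeasure lborel (cbox ?l ?u) = 1"
    by (subst emeasure_lborel_cbox) (use b lb in auto)
  moreover have "emeasure lborel (box ?l ?u) = 1"
    by (subst emeasure_lborel_box) (use b lb in auto)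
  ultimately show ?thesis
    using emeasure_mono[OF 1(1), of lborel] emeasure_mono[OF 1(2), of lborel] by simp
qed

text \<open>Comparison of a sum with an integral. Moving the argument by a point of the unit cube
  changes the weight by at most the factor \<open>K\<close>; averaging over the cube, of volume 1,
  and unfolding gives the integral of the weight over space, whatever x is.\<close>

lemma lattice_sum_bound:
  assumes p: "real CARD('n) < p"
  shows "\<exists>C\<ge>0. \<forall>x::real ^ 'n. (\<integral>\<^sup>+n. ennreal (wt p (x - of_ivec n)) \<partial>count_space UNIV) \<le> ennreal C"
proof -
  have p0: "0 \<le> p" using p by simp
  define I where "I = (\<integral>\<^sup>+(y::real ^ 'n). ennreal (wt p y) \<partial>lborel)"
  have I: "I < \<infinity>" unfolding I_def by (rule wt_integrable) (use p in simp)
  define K where "K = (1 + real CARD('n)) powr p"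
  have K: "0 \<le> K" by (simp add: K_def)
  have "(\<integral>\<^sup>+n. ennreal (wt p (x - of_ivec n)) \<partial>count_space UNIV) \<le> ennreal K * I" for x :: "real ^ 'n"
  proof -
    have "(\<integral>\<^sup>+n. ennreal (wt p (x - of_ivec n)) \<partial>count_space UNIV) = (\<integral>\<^sup>+\<theta>. indicator cube \<theta> * (\<integral>\<^sup>+n. ennreal (wt p (x - of_ivec n)) \<partial>count_space UNIV) \<partial>(lborel :: (real ^ 'n) measure))"
      using emeasure_cube[where 'n='n] by (subst nn_integral_multc) auto
    also have "\<dots> \<le> (\<integral>\<^sup>+\<theta>. indicator cube \<theta> * (\<integral>\<^sup>+n. ennreal K * ennreal (wt p (x - (\<theta> + of_ivec n))) \<partial>count_space UNIV) \<partial>lborel)"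
    proof (rule nn_integral_mono)
      fix \<theta> :: "real ^ 'n"
      show "indicator cube \<theta> * (\<integral>\<^sup>+n. ennreal (wt p (x - of_ivec n)) \<partial>count_space UNIV) \<le> indicator cube \<theta> * (\<integral>\<^sup>+n. ennreal K * ennreal (wt p (x - (\<theta> + of_ivec n))) \<partial>count_space UNIV)"
      proof (cases "\<theta> \<in> cube")
        case True
        have "wt p (x - of_ivec n) \<le> K * wt p (x - (\<theta> + of_ivec n))" for n
        proof -
          have "wt p (x - of_ivec n) \<le> (1 + norm \<theta>) powr p * wt p (x - of_ivec n - \<theta>)" by (rule wt_shift_le[OF p0])
          also have "\<dots> \<le> K * wt p (x - of_ivec n - \<theta>)"
            unfolding K_def using cube_norm_le[OF True] p0 by (intro mult_right_mono powr_mono2) auto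
          finally show ?thesis by (simp add: algebra_simps)
        qed
        then show ?thesis using K by (intro mult_left_mono nn_integral_mono) (auto simp: ennreal_mult[symmetric] ennreal_leI)
      qed simp
    qed
    also have "\<dots> = (\<integral>\<^sup>+y. ennreal K * ennreal (wt p (x - y)) \<partial>lborel)"
      by (rule nn_integral_unfold[symmetric]) measurable
    also have "\<dots> = ennreal K * I"
      unfolding I_def using nn_integral_lborel_shift(3)[of "\<lambda>y. ennreal (wt p y)" x] by (simp add: nn_integral_cmult)
    finally show ?thesis .
  qed
  moreover have "ennreal K * I = ennreal (enn2real (ennreal K * I))" using I by (simp add: ennreal_mult_less_top less_top)
  ultimately show ?thesis by (intro exI[of _ "enn2real (ennreal K * I)"]) auto
qed

section \<open>Continuity of translations\<close>

text \<open>The function is only measurable. It is an almost everywhere limit of continuous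
  functions which, cut down to the same weight, converge in L1 by dominated convergence. For one
  good approximant the claim follows from continuity and a dominated sequence argument; translation
  invariance carries the bound back in three parts of e/3.\<close>

lemma weighted_translation_continuous:
  fixes \<phi> :: "'a::euclidean_space \<Rightarrow> complex"
  assumes \<phi>: "\<phi> \<in> borel_measurable borel" "\<And>x. norm (\<phi> x) \<le> C * wt p x" "0 < C" and p: "real DIM('a) < p" and e: "0 < e"
  shows "\<exists>r>0. \<forall>t. norm t < r \<longrightarrow> (\<integral>\<^sup>+x. ennreal (norm (\<phi> x - \<phi> (x - t))) \<partial>lborel) \<le> ennreal e"
proof -
  note [measurable] = \<phi>(1)
  have p0: "0 \<le> p" using p by simp
  have wi: "integrable lborel (wt p :: 'a \<Rightarrow> real)" by (rule wt_integrable_real[OF p])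
  have wpos: "0 < wt p x" for x :: 'a unfolding wt_def by (smt (verit) norm_ge_zero powr_gt_zero)
  have wcont: "continuous_on UNIV (wt p :: 'a \<Rightarrow> real)"
    unfolding wt_def[abs_def] by (intro continuous_intros) (auto simp: add_pos_nonneg less_imp_neq[symmetric])
  have "\<phi> \<in> borel_measurable lebesgue" using \<phi>(1) measurable_completion by (simp add: measurable_completion)
  then have "\<phi> measurable_on UNIV" by (simp add: measurable_on_iff_borel_measurable)
  then obtain N g where N: "negligible N" "\<And>n. continuous_on UNIV (g n)" "\<And>x. x \<notin> N \<Longrightarrow> (\<lambda>n. g n x) \<longlonglongrightarrow> \<phi> x"
    unfolding measurable_on_def by auto
  \<comment> \<open>Values of \<open>g n\<close> above the weight are scaled back to it: this stays
    continuous, is dominated by the weight, and has the same limit because the limit respects the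
    bound. Positivity of \<open>C\<close> keeps the denominator away from 0.\<close>
  define c where "c n x = of_real (C * wt p x) * g n x / of_real (max (C * wt p x) (norm (g n x)))" for n :: nat and x
  have Cw: "0 < C * wt p x" for x :: 'a using wpos \<phi>(3) by simp
  have mx: "max (C * wt p x) (norm (g n x)) \<noteq> 0" for n x
    using Cw[of x] by (metis less_irrefl max.strict_coboundedI1)
  have ccont: "continuous_on UNIV (c n)" for n
    unfolding c_def[abs_def] using mx by (intro continuous_intros wcont N(2)) simp
  have [measurable]: "c n \<in> borel_measurable borel" for n by (rule borel_measurable_continuous_onI[OF ccont])
  have cbd: "norm (c n x) \<le> C * wt p x" for n x
  proof -
    have "norm (c n x) = C * wt p x * (norm (g n x) / max (C * wt p x) (norm (g n x)))"
      using Cw[of x] \<phi>(3) by (simp add: c_def norm_mult norm_divide abs_of_pos less_imp_le max_def)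
    also have "\<dots> \<le> C * wt p x * 1" using Cw[of x] by (intro mult_left_mono) (auto simp: divide_le_eq_1 less_max_iff_disj)
    finally show ?thesis by simp
  qed
  have clim: "(\<lambda>n. c n x) \<longlonglongrightarrow> \<phi> x" if "x \<notin> N" for x
  proof -
    have m: "max (C * wt p x) (norm (\<phi> x)) = C * wt p x" using \<phi>(2)[of x] by simp
    have "(\<lambda>n. c n x) \<longlonglongrightarrow> of_real (C * wt p x) * \<phi> x / of_real (max (C * wt p x) (norm (\<phi> x)))"
      unfolding c_def using Cw[of x] m by (intro tendsto_intros N(3)[OF that]) auto
    then show ?thesis unfolding m using Cw[of x] wpos[of x] \<phi>(3) by simp
  qed
  have AEN: "AE x in lborel. x \<notin> N"
  proof -
    have "N \<in> null_sets lebesgue" using N(1) by (simp add: negligible_iff_null_sets)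
    then have "AE x in lebesgue. x \<notin> N" by (rule AE_not_in)
    then show ?thesis by (simp add: AE_completion_iff)
  qed
  have "(\<lambda>n. LINT x|lborel. norm (\<phi> x - c n x)) \<longlonglongrightarrow> (LINT x::'a|lborel. 0)"
  proof (rule integral_dominated_convergence[where w = "\<lambda>x. 2 * (C * wt p x)"])
    show "integrable lborel (\<lambda>x::'a. 2 * (C * wt p x))" using wi by (intro integrable_mult_right)
    show "AE x in lborel. (\<lambda>n. norm (\<phi> x - c n x)) \<longlonglongrightarrow> 0"
      using AEN
    proof eventually_elim
      fix x assume "x \<notin> N"
      then have "(\<lambda>n. norm (\<phi> x - c n x)) \<longlonglongrightarrow> norm (\<phi> x - \<phi> x)" by (intro tendsto_intros clim)
      then show "(\<lambda>n. norm (\<phi> x - c n x)) \<longlonglongrightarrow> 0" by simp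
    qed
    fix n
    have "norm (norm (\<phi> x - c n x)) \<le> 2 * (C * wt p x)" for x
      using norm_triangle_ineq4[of "\<phi> x" "c n x"] \<phi>(2)[of x] cbd[of n x] by simp
    then show "AE x in lborel. norm (norm (\<phi> x - c n x)) \<le> 2 * (C * wt p x)" by simp
  qed measurable
  then have "(\<lambda>n. LINT x|lborel. norm (\<phi> x - c n x)) \<longlonglongrightarrow> 0" by simp
  then have "eventually (\<lambda>n. (LINT x|lborel. norm (\<phi> x - c n x)) < e / 3) sequentially"
    using e by (intro order_tendstoD) auto
  then obtain n where n: "(LINT x|lborel. norm (\<phi> x - c n x)) < e / 3"
    using eventually_happens by fastforce
  define k where "k = c n"
  have [measurable]: "k \<in> borel_measurable borel" unfolding k_def by measurable
  have kc: "continuous_on UNIV k" and kb: "norm (k x) \<le> C * wt p x" for x using ccont cbd by (auto simp: k_def)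
  have i\<phi>k: "integrable lborel (\<lambda>x. norm (\<phi> x - k x))"
  proof (rule Bochner_Integration.integrable_bound)
    show "integrable lborel (\<lambda>x::'a. 2 * (C * wt p x))" using wi by (intro integrable_mult_right)
    have "norm (norm (\<phi> x - k x)) \<le> norm (2 * (C * wt p x))" for x
      using norm_triangle_ineq4[of "\<phi> x" "k x"] \<phi>(2)[of x] kb[of x] Cw[of x] by simp
    then show "AE x in lborel. norm (norm (\<phi> x - k x)) \<le> norm (2 * (C * wt p x))" by simp
  qed measurable
  have nk: "(\<integral>\<^sup>+x. ennreal (norm (\<phi> x - k x)) \<partial>lborel) \<le> ennreal (e / 3)"
    using i\<phi>k n e by (subst nn_integral_eq_integral) (auto simp: k_def intro!: ennreal_leI)
  have "\<exists>r>0. \<forall>t. norm t < r \<longrightarrow> (\<integral>\<^sup>+x. ennreal (norm (k x - k (x - t))) \<partial>lborel) \<le> ennreal (e / 3)"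
  \<comment> \<open>A counterexample for every radius would give a sequence of translations tending
    to 0, to which dominated convergence applies.\<close>
  proof (rule ccontr)
    assume neg: "\<not> ?thesis"
    have "\<exists>t. norm t < inverse (real (Suc j)) \<and> \<not> (\<integral>\<^sup>+x. ennreal (norm (k x - k (x - t))) \<partial>lborel) \<le> ennreal (e / 3)" for j
      using neg by (metis inverse_positive_iff_positive of_nat_0_less_iff zero_less_Suc)
    then obtain t where t: "\<And>j. norm (t j) < inverse (real (Suc j))" "\<And>j. \<not> (\<integral>\<^sup>+x. ennreal (norm (k x - k (x - t j))) \<partial>lborel) \<le> ennreal (e / 3)"
      by metis
    have t0: "t \<longlonglongrightarrow> 0"
      by (rule Lim_null_comparison[OF always_eventually LIMSEQ_inverse_real_of_nat]) (intro allI less_imp_le t(1))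
    have wtt: "wt p (x - t j) \<le> 2 powr p * wt p x" for x j
    proof -
      have "norm (t j) \<le> 1" using t(1)[of j] by (smt (verit) inverse_le_1_iff of_nat_1 of_nat_le_iff Suc_le_mono le0 One_nat_def)
      have "wt p (x - t j) \<le> (1 + norm (- t j)) powr p * wt p (x - t j - (- t j))" by (rule wt_shift_le[OF p0])
      also have "\<dots> \<le> 2 powr p * wt p x" using \<open>norm (t j) \<le> 1\<close> p0 by (auto intro!: mult_right_mono powr_mono2)
      finally show ?thesis .
    qed
    have dom: "norm (k x - k (x - t j)) \<le> C * wt p x + C * (2 powr p * wt p x)" for x j
    proof -
      have "norm (k (x - t j)) \<le> C * wt p (x - t j)" by (rule kb)
      also have "\<dots> \<le> C * (2 powr p * wt p x)" using \<phi>(3) by (intro mult_left_mono wtt) auto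
      finally show ?thesis using norm_triangle_ineq4[of "k x" "k (x - t j)"] kb[of x] by linarith
    qed
    have wint: "integrable lborel (\<lambda>x::'a. C * wt p x + C * (2 powr p * wt p x))"
      using wi by (intro Bochner_Integration.integrable_add integrable_mult_right)
    have "(\<lambda>j. LINT x|lborel. norm (k x - k (x - t j))) \<longlonglongrightarrow> (LINT x::'a|lborel. 0)"
    proof (rule integral_dominated_convergence[OF _ _ wint])
      show "AE x in lborel. (\<lambda>j. norm (k x - k (x - t j))) \<longlonglongrightarrow> 0"
      proof (rule AE_I2)
        fix x
        have "(\<lambda>j. x - t j) \<longlonglongrightarrow> x - 0" by (intro tendsto_intros t0)
        then have "(\<lambda>j. k (x - t j)) \<longlonglongrightarrow> k (x - 0)"
          using kc by (intro isCont_tendsto_compose[of _ k]) (auto simp: continuous_on_eq_continuous_at)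
        then have "(\<lambda>j. norm (k x - k (x - t j))) \<longlonglongrightarrow> norm (k x - k (x - 0))" by (intro tendsto_intros)
        then show "(\<lambda>j. norm (k x - k (x - t j))) \<longlonglongrightarrow> 0" by simp
      qed
      show "\<And>j. AE x in lborel. norm (norm (k x - k (x - t j))) \<le> C * wt p x + C * (2 powr p * wt p x)"
        using dom by simp
    qed measurable
    then have "(\<lambda>j. LINT x|lborel. norm (k x - k (x - t j))) \<longlonglongrightarrow> 0" by simp
    then have "eventually (\<lambda>j. (LINT x|lborel. norm (k x - k (x - t j))) < e / 3) sequentially"
      using e by (intro order_tendstoD) auto
    then obtain j where j: "(LINT x|lborel. norm (k x - k (x - t j))) < e / 3"
      using eventually_happens by fastforce
    have "integrable lborel (\<lambda>x. norm (k x - k (x - t j)))"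
    proof (rule Bochner_Integration.integrable_bound[OF wint])
      show "AE x in lborel. norm (norm (k x - k (x - t j))) \<le> norm (C * wt p x + C * (2 powr p * wt p x))"
        using dom[of _ j] by (intro AE_I2) (simp add: order_trans[OF dom abs_ge_self])
    qed measurable
    then have "(\<integral>\<^sup>+x. ennreal (norm (k x - k (x - t j))) \<partial>lborel) \<le> ennreal (e / 3)"
      using j e by (subst nn_integral_eq_integral) (auto intro!: ennreal_leI)
    with t(2) show False by blast
  qed
  then obtain r where r: "0 < r" "\<And>t. norm t < r \<Longrightarrow> (\<integral>\<^sup>+x. ennreal (norm (k x - k (x - t))) \<partial>lborel) \<le> ennreal (e / 3)" by blast
  have "(\<integral>\<^sup>+x. ennreal (norm (\<phi> x - \<phi> (x - t))) \<partial>lborel) \<le> ennreal e" if "norm t < r" for t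
  proof -
    have "(\<integral>\<^sup>+x. ennreal (norm (\<phi> x - \<phi> (x - t))) \<partial>lborel)
      \<le> (\<integral>\<^sup>+x. ennreal (norm (\<phi> x - k x)) + (ennreal (norm (k x - k (x - t))) + ennreal (norm (\<phi> (x - t) - k (x - t)))) \<partial>lborel)"
    proof (rule nn_integral_mono)
      fix x
      have "norm (\<phi> x - \<phi> (x - t)) \<le> norm (\<phi> x - k x) + (norm (k x - k (x - t)) + norm (\<phi> (x - t) - k (x - t)))"
        using norm_triangle_ineq[of "\<phi> x - k x" "(k x - k (x - t)) - (\<phi> (x - t) - k (x - t))"]
          norm_triangle_ineq4[of "k x - k (x - t)" "\<phi> (x - t) - k (x - t)"] by (simp add: algebra_simps)
      then show "ennreal (norm (\<phi> x - \<phi> (x - t))) \<le> ennreal (norm (\<phi> x - k x)) + (ennreal (norm (k x - k (x - t))) + ennreal (norm (\<phi> (x - t) - k (x - t))))"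
        by (simp add: ennreal_plus[symmetric] ennreal_leI del: ennreal_plus)
    qed
    also have "\<dots> = (\<integral>\<^sup>+x. ennreal (norm (\<phi> x - k x)) \<partial>lborel) + ((\<integral>\<^sup>+x. ennreal (norm (k x - k (x - t))) \<partial>lborel) + (\<integral>\<^sup>+x. ennreal (norm (\<phi> (x - t) - k (x - t))) \<partial>lborel))"
      by (simp add: nn_integral_add)
    also have "(\<integral>\<^sup>+x. ennreal (norm (\<phi> (x - t) - k (x - t))) \<partial>lborel) = (\<integral>\<^sup>+x. ennreal (norm (\<phi> x - k x)) \<partial>lborel)"
      by (rule nn_integral_lborel_shift(2)[of "\<lambda>x. ennreal (norm (\<phi> x - k x))"]) measurable
    also have "(\<integral>\<^sup>+x. ennreal (norm (\<phi> x - k x)) \<partial>lborel) + ((\<integral>\<^sup>+x. ennreal (norm (k x - k (x - t))) \<partial>lborel) + (\<integral>\<^sup>+x. ennreal (norm (\<phi> x - k x)) \<partial>lborel))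
       \<le> ennreal (e / 3) + (ennreal (e / 3) + ennreal (e / 3))"
      by (intro add_mono nk r(2)[OF that])
    also have "\<dots> = ennreal e" using e by (simp add: ennreal_plus[symmetric] del: ennreal_plus)
    finally show ?thesis .
  qed
  with r(1) show ?thesis by blast
qed

section \<open>The Fejer kernel on the torus\<close>

definition box_ivec :: "nat \<Rightarrow> (int ^ 'n) set" where
  "box_ivec M = {j. \<forall>i. j $ i \<in> {0..<int M}}"

lemma card_ivec:
  fixes I :: "'n::finite \<Rightarrow> int set"
  assumes "\<And>i. finite (I i)"
  shows "finite {j :: int ^ 'n. \<forall>i. j $ i \<in> I i}" "card {j :: int ^ 'n. \<forall>i. j $ i \<in> I i} = (\<Prod>i\<in>UNIV. card (I i))"
proof -
  have b: "bij_betw vec_nth {j :: int ^ 'n. \<forall>i. j $ i \<in> I i} (PiE UNIV I)"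
    by (rule bij_betwI[where g = vec_lambda]) (auto simp: PiE_def Pi_def)
  show "finite {j :: int ^ 'n. \<forall>i. j $ i \<in> I i}"
    using bij_betw_finite[OF b] finite_PiE[of UNIV I] assms by simp
  show "card {j :: int ^ 'n. \<forall>i. j $ i \<in> I i} = (\<Prod>i\<in>UNIV. card (I i))"
    using bij_betw_same_card[OF b] card_PiE[of UNIV I] by simp
qed

lemma box_ivec: "finite (box_ivec M :: (int ^ 'n) set)" "card (box_ivec M :: (int ^ 'n) set) = M ^ CARD('n)"
  unfolding box_ivec_def using card_ivec[of "\<lambda>_::'n. {0..<int M}"] by simp_all

section \<open>Characters of the torus\<close>

definition char_ivec :: "int ^ 'n \<Rightarrow> real ^ 'n \<Rightarrow> complex" where
  "char_ivec n t = cis (2 * pi * (of_ivec n \<bullet> t))"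

lemma char_ivec_add: "char_ivec n (s + t) = char_ivec n s * char_ivec n t"
  by (simp add: char_ivec_def cis_mult inner_add_right algebra_simps)

lemma char_ivec_diff: "char_ivec (m - n) t = char_ivec m t * cnj (char_ivec n t)"
  by (simp add: char_ivec_def cis_mult cis_cnj of_ivec_diff inner_diff_left algebra_simps)

lemma char_ivec_0 [simp]: "char_ivec 0 t = 1"
  by (simp add: char_ivec_def)

lemma norm_char_ivec [simp]: "norm (char_ivec n t) = 1"
  by (simp add: char_ivec_def)

lemma char_ivec_lattice [simp]: "char_ivec n (of_ivec m) = 1"
proof -
  have "of_ivec n \<bullet> of_ivec m = of_int (\<Sum>i\<in>UNIV. n $ i * m $ i)"
    by (simp add: inner_vec_def)
  then show ?thesis unfolding char_ivec_def
    by (metis Ints_of_int cis_multiple_2pi mult.commute)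
qed

lemma char_ivec_measurable [measurable]: "char_ivec n \<in> borel_measurable borel"
  unfolding char_ivec_def[abs_def] by measurable

lemma cube_integrable:
  fixes f :: "real ^ 'n \<Rightarrow> complex"
  assumes [measurable]: "f \<in> borel_measurable borel" and "\<And>t. norm (f t) \<le> C"
  shows "integrable lborel (\<lambda>t. indicator cube t * f t)"
proof (rule integrableI_bounded)
  have C: "0 \<le> C" using assms(2)[of 0] norm_ge_zero order_trans by blast
  have "(\<integral>\<^sup>+t. ennreal (norm (indicator cube t * f t)) \<partial>lborel) \<le> (\<integral>\<^sup>+(t::real ^ 'n). ennreal C * indicator cube t \<partial>lborel)"
    using assms(2) by (intro nn_integral_mono) (auto simp: indicator_def ennreal_leI)
  also have "\<dots> < \<infinity>" by (subst nn_integral_cmult_indicator) (auto simp: emeasure_cube)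
  finally show "(\<integral>\<^sup>+t. ennreal (norm (indicator cube t * f t)) \<partial>lborel) < \<infinity>" .
qed measurable

text \<open>Shifting the cube does not change the integral of a periodic function, so the integral of a
  nontrivial character equals its own multiple by a number different from 1.\<close>

lemma char_ivec_orthogonal:
  fixes n :: "int ^ 'n"
  shows "(LINT t|lborel. indicator cube t * char_ivec n t) = (if n = 0 then 1 else 0)"
proof (cases "n = 0")
  case True
  have "(LINT t|lborel. indicator (cube :: (real ^ 'n) set) t) = (1 :: real)"
    using emeasure_cube[where 'n='n] by (simp add: measure_def)
  then have "(LINT t|lborel. complex_of_real (indicator (cube :: (real ^ 'n) set) t)) = 1"
    unfolding integral_complex_of_real by simp
  then show ?thesis using True by (simp add: of_real_indicator)
next
  case False
  then obtain i where i: "n $ i \<noteq> 0" by (auto simp: vec_eq_iff)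
  \<comment> \<open>Half a period along a coordinate in which \<open>n\<close> does not vanish, so
    that the character takes the value -1.\<close>
  define s :: "real ^ 'n" where "s = axis i (1 / (2 * of_int (n $ i)))"
  have cs: "char_ivec n s = -1"
    using i by (simp add: char_ivec_def s_def inner_axis)
  let ?I = "LINT t|lborel. indicator cube t * char_ivec n t"
  let ?f = "\<lambda>t. indicator cube (t - s) * char_ivec n t"
  have "integrable lborel (\<lambda>t. indicator cube t * (char_ivec n s * char_ivec n t))"
    by (rule cube_integrable[where C = 1]) (measurable, simp add: norm_mult)
  then have "(\<integral>\<^sup>+t. ennreal (norm (?f (t + s))) \<partial>lborel) < \<infinity>"
    by (simp add: integrable_iff_bounded char_ivec_add mult.commute)
  then have f: "integrable lborel ?f"
    using nn_integral_lborel_shift(1)[of "\<lambda>t. ennreal (norm (?f t))" s]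
    by (intro integrableI_bounded) auto
  have "(LINT t|lborel. ?f t) = (LINT t|lborel. ?f (t + s))"
    by (rule integral_lborel_shift(1)[symmetric]) measurable
  also have "\<dots> = (LINT t|lborel. (indicator cube t * char_ivec n t) * char_ivec n s)"
    by (simp add: char_ivec_add mult_ac)
  also have "\<dots> = ?I * char_ivec n s" by (rule integral_mult_left_zero)
  finally have 1: "(LINT t|lborel. ?f t) = - ?I" by (simp add: cs)
  have "(LINT t|lborel. ?f t) = (LINT \<theta>|lborel. indicator cube \<theta> * (LINT m|count_space UNIV. ?f (\<theta> + of_ivec m)))"
    by (rule integral_unfold(1)[OF f])
  also have "\<dots> = ?I"
  proof (rule Bochner_Integration.integral_cong[OF refl])
    fix \<theta> :: "real ^ 'n"
    \<comment> \<open>The shifted cube, like the original one, meets every translate of the lattice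
      in exactly one point.\<close>
    have eq: "indicator cube (\<theta> + of_ivec m - s) = indicator {- nint (\<theta> - s)} m" for m
    proof -
      have "of_ivec (- m) = - of_ivec m" by (simp add: vec_eq_iff)
      then have "\<theta> + of_ivec m - s \<in> cube \<longleftrightarrow> - m = nint (\<theta> - s)"
        using cube_iff_nint[of "\<theta> - s" "- m"] by (simp add: algebra_simps)
      then have "\<theta> + of_ivec m - s \<in> cube \<longleftrightarrow> m = - nint (\<theta> - s)"
        by (metis minus_minus)
      then show ?thesis by (auto simp: indicator_def)
    qed
    have "(LINT m|count_space UNIV. ?f (\<theta> + of_ivec m)) = (LINT m|count_space UNIV. indicator {- nint (\<theta> - s)} m * char_ivec n \<theta>)"
      by (simp add: eq char_ivec_add)
    also have "\<dots> = char_ivec n \<theta>"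
    proof -
      have "char_ivec n \<theta> \<noteq> 0" by (metis norm_char_ivec norm_zero zero_neq_one)
      then show ?thesis
        by (subst lebesgue_integral_count_space_finite_support) (auto simp: indicator_def cong: conj_cong)
    qed
    finally show "indicator cube \<theta> * (LINT m|count_space UNIV. ?f (\<theta> + of_ivec m)) = indicator cube \<theta> * char_ivec n \<theta>" by simp
  qed
  finally have "?I = - ?I" using 1 by simp
  then show ?thesis using False by simp
qed

definition fejer :: "nat \<Rightarrow> real ^ 'n \<Rightarrow> real" where
  "fejer M t = (norm (\<Sum>j\<in>box_ivec M. char_ivec j t))\<^sup>2 / real (M ^ CARD('n))"

text \<open>Counts the representations of \<open>n\<close> as a difference of two box points, as
  multiplying out the square in \<open>fejer\<close> demands. It is defined for all \<open>n\<close>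
  and is 0 outside \<open>fejer_freqs\<close>.\<close>

definition fejer_coeff :: "nat \<Rightarrow> int ^ 'n \<Rightarrow> real" where
  "fejer_coeff M n = real (card {p \<in> box_ivec M \<times> box_ivec M. fst p - snd p = n}) / real (M ^ CARD('n))"

definition fejer_freqs :: "nat \<Rightarrow> (int ^ 'n) set" where
  "fejer_freqs M = (\<lambda>p. fst p - snd p) ` (box_ivec M \<times> box_ivec M)"

lemma fejer_freqs_finite: "finite (fejer_freqs M)"
  unfolding fejer_freqs_def by (simp add: box_ivec(1))

lemma fejer_coeff_outside: "n \<notin> fejer_freqs M \<Longrightarrow> fejer_coeff M n = 0"
proof -
  assume "n \<notin> fejer_freqs M"
  then have e: "{p \<in> box_ivec M \<times> box_ivec M. fst p - snd p = n} = {}" by (force simp: fejer_freqs_def)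
  show ?thesis unfolding fejer_coeff_def e by simp
qed

lemma fejer_nonneg: "0 \<le> fejer M t"
  by (simp add: fejer_def)

lemma fejer_measurable [measurable]: "fejer M \<in> borel_measurable borel"
  unfolding fejer_def[abs_def] by measurable

lemma fejer_periodic: "fejer M (t + of_ivec m) = fejer M t"
  unfolding fejer_def by (simp add: char_ivec_add)

text \<open>Conjugate characters are used so that multiplication by the kernel shifts frequencies by
  +2\<pi>n, the sign convention of \<open>stft_modulate\<close> and of the shifted measures.\<close>

lemma fejer_expand: "complex_of_real (fejer M (t :: real ^ 'n)) = (\<Sum>n\<in>fejer_freqs M. of_real (fejer_coeff M n) * cnj (char_ivec n t))"
proof -
  let ?B = "box_ivec M :: (int ^ 'n) set"
  have fin: "finite (?B \<times> ?B)" by (simp add: box_ivec(1))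
  have "complex_of_real ((norm (\<Sum>j\<in>?B. char_ivec j t))\<^sup>2) = (\<Sum>j\<in>?B. char_ivec j t) * (\<Sum>l\<in>?B. cnj (char_ivec l t))"
    by (simp only: complex_norm_square cnj_sum)
  also have "\<dots> = (\<Sum>(l, j)\<in>?B \<times> ?B. cnj (char_ivec (l - j) t))"
    unfolding sum_product sum.cartesian_product[symmetric] char_ivec_diff
    by (subst sum.swap) (simp add: mult.commute)
  also have "\<dots> = (\<Sum>p\<in>?B \<times> ?B. cnj (char_ivec (fst p - snd p) t))" by (simp add: split_beta')
  also have "\<dots> = (\<Sum>n\<in>fejer_freqs M. \<Sum>p\<in>{p \<in> ?B \<times> ?B. fst p - snd p = n}. cnj (char_ivec (fst p - snd p) t))"
    unfolding fejer_freqs_def by (rule sum.image_gen[OF fin])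
  also have "\<dots> = (\<Sum>n\<in>fejer_freqs M. of_nat (card {p \<in> ?B \<times> ?B. fst p - snd p = n}) * cnj (char_ivec n t))"
    by (intro sum.cong refl) (simp add: sum_constant[symmetric] del: sum_constant)
  finally show ?thesis
    unfolding fejer_def fejer_coeff_def of_real_divide by (simp add: sum_divide_distrib)
qed

text \<open>A pair with difference \<open>n\<close> is determined by its second entry j. The
  condition that both j and j + n lie in the box decouples into one interval per coordinate, of
  length M - |n_i|, or empty.\<close>

lemma fejer_coeff_card:
  fixes n :: "int ^ 'n"
  shows "fejer_coeff M n = real (card {j :: int ^ 'n. \<forall>i. j $ i \<in> {max 0 (- n $ i)..<min (int M) (int M - n $ i)}}) / real (M ^ CARD('n))"
proof -
  have "bij_betw snd {p \<in> box_ivec M \<times> box_ivec M. fst p - snd p = n} {j :: int ^ 'n. \<forall>i. j $ i \<in> {max 0 (- n $ i)..<min (int M) (int M - n $ i)}}"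
  proof (rule bij_betwI[where g = "\<lambda>j. (j + n, j)"])
    show "snd \<in> {p \<in> box_ivec M \<times> box_ivec M. fst p - snd p = n} \<rightarrow> {j. \<forall>i. j $ i \<in> {max 0 (- n $ i)..<min (int M) (int M - n $ i)}}"
    proof (rule Pi_I)
      fix p :: "(int ^ 'n) \<times> (int ^ 'n)" assume p: "p \<in> {p \<in> box_ivec M \<times> box_ivec M. fst p - snd p = n}"
      then have "n $ i = fst p $ i - snd p $ i" "0 \<le> fst p $ i" "fst p $ i < int M" "0 \<le> snd p $ i" "snd p $ i < int M" for i
        by (auto simp: box_ivec_def)
      then show "snd p \<in> {j. \<forall>i. j $ i \<in> {max 0 (- n $ i)..<min (int M) (int M - n $ i)}}" by simp
    qed
    show "(\<lambda>j. (j + n, j)) \<in> {j. \<forall>i. j $ i \<in> {max 0 (- n $ i)..<min (int M) (int M - n $ i)}} \<rightarrow> {p \<in> box_ivec M \<times> box_ivec M. fst p - snd p = n}"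
    proof (rule Pi_I)
      fix j assume "j \<in> {j. \<forall>i. j $ i \<in> {max 0 (- n $ i)..<min (int M) (int M - n $ i)}}"
      then have *: "0 \<le> j $ i" "- n $ i \<le> j $ i" "j $ i < int M" "j $ i < int M - n $ i" for i by auto
      have "0 \<le> j $ i + n $ i" "j $ i + n $ i < int M" for i using *[of i] by simp_all
      with * show "(j + n, j) \<in> {p \<in> box_ivec M \<times> box_ivec M. fst p - snd p = n}" by (simp add: box_ivec_def)
    qed
  qed auto
  then show ?thesis unfolding fejer_coeff_def by (simp add: bij_betw_same_card)
qed

lemma fejer_coeff_prod:
  "fejer_coeff M n = (\<Prod>i\<in>(UNIV :: 'n set). real (nat (int M - \<bar>(n :: int ^ 'n) $ i\<bar>)) / real M)"
proof -
  have "card {max 0 (- n $ i)..<min (int M) (int M - n $ i)} = nat (int M - \<bar>n $ i\<bar>)" for i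
    by simp
  then show ?thesis unfolding fejer_coeff_card
    by (subst card_ivec(2)) (simp_all add: prod_dividef)
qed

lemma fejer_coeff_bounds: "0 \<le> fejer_coeff M n" "fejer_coeff M n \<le> 1"
proof -
  show "0 \<le> fejer_coeff M n" unfolding fejer_coeff_def by simp
  show "fejer_coeff M n \<le> 1" unfolding fejer_coeff_prod
    by (intro prod_le_1) (auto simp: divide_le_eq_1)
qed

lemma fejer_coeff_tendsto:
  fixes n :: "int ^ 'n"
  shows "(\<lambda>M. fejer_coeff M n) \<longlonglongrightarrow> 1"
proof -
  have "(\<lambda>M. real (nat (int M - \<bar>n $ i\<bar>)) / real M) \<longlonglongrightarrow> 1" for i
  proof -
    have "(\<lambda>M. 1 - real_of_int \<bar>n $ i\<bar> * inverse (real M)) \<longlonglongrightarrow> 1 - real_of_int \<bar>n $ i\<bar> * 0"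
      by (intro tendsto_intros lim_inverse_n)
    then have "(\<lambda>M. 1 - real_of_int \<bar>n $ i\<bar> * inverse (real M)) \<longlonglongrightarrow> 1" by simp
    moreover have "eventually (\<lambda>M. 1 - real_of_int \<bar>n $ i\<bar> * inverse (real M) = real (nat (int M - \<bar>n $ i\<bar>)) / real M) sequentially"
      using eventually_ge_at_top[of "nat \<bar>n $ i\<bar> + 1"]
    proof eventually_elim
      case (elim M)
      then have "real (nat (int M - \<bar>n $ i\<bar>)) = real M - real_of_int \<bar>n $ i\<bar>" by linarith
      with elim show ?case by (simp add: left_diff_distrib divide_inverse)
    qed
    ultimately show ?thesis by (rule Lim_transform_eventually)
  qed
  then have "(\<lambda>M. \<Prod>i\<in>UNIV. real (nat (int M - \<bar>n $ i\<bar>)) / real M) \<longlonglongrightarrow> (\<Prod>i\<in>(UNIV :: 'n set). 1)"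
    by (intro tendsto_prod)
  then show ?thesis unfolding fejer_coeff_prod by simp
qed

lemma fejer_bounded: obtains C where "\<And>t. fejer M t \<le> C"
proof -
  have "fejer M t \<le> (real (card (box_ivec M :: (int ^ 'n) set)))\<^sup>2 / real (M ^ CARD('n))" for t :: "real ^ 'n"
  proof -
    have "norm (\<Sum>j\<in>box_ivec M. char_ivec j t) \<le> (\<Sum>j\<in>(box_ivec M :: (int ^ 'n) set). 1)"
      by (rule order_trans[OF norm_sum]) simp
    then show ?thesis unfolding fejer_def by (intro divide_right_mono power_mono) auto
  qed
  then show ?thesis using that by blast
qed

lemma fejer_integral:
  "(LINT t|lborel. indicator cube t * (complex_of_real (fejer M t) * char_ivec n t)) = of_real (fejer_coeff M n)"
proof -
  have i: "integrable lborel (\<lambda>t. indicator cube t * (of_real (fejer_coeff M m) * char_ivec (n - m) t))" for m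
    by (rule cube_integrable[where C = "\<bar>fejer_coeff M m\<bar>"]) (measurable, simp add: norm_mult)
  have "(LINT t|lborel. indicator cube t * (complex_of_real (fejer M t) * char_ivec n t))
    = (LINT t|lborel. (\<Sum>m\<in>fejer_freqs M. indicator cube t * (of_real (fejer_coeff M m) * char_ivec (n - m) t)))"
    unfolding fejer_expand char_ivec_diff by (simp add: sum_distrib_left sum_distrib_right mult_ac)
  also have "\<dots> = (\<Sum>m\<in>fejer_freqs M. (LINT t|lborel. indicator cube t * (of_real (fejer_coeff M m) * char_ivec (n - m) t)))"
    by (rule Bochner_Integration.integral_sum[OF i])
  also have "\<dots> = (\<Sum>m\<in>fejer_freqs M. of_real (fejer_coeff M m) * (if n - m = 0 then 1 else 0))"
  proof (rule sum.cong[OF refl])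
    fix m
    have "(LINT t|lborel. indicator cube t * (of_real (fejer_coeff M m) * char_ivec (n - m) t)) = (LINT t|lborel. of_real (fejer_coeff M m) * (indicator cube t * char_ivec (n - m) t))"
      by (simp add: mult_ac)
    also have "\<dots> = of_real (fejer_coeff M m) * (if n - m = 0 then 1 else 0)"
      unfolding char_ivec_orthogonal[symmetric] by (rule integral_mult_right_zero)
    finally show "(LINT t|lborel. indicator cube t * (of_real (fejer_coeff M m) * char_ivec (n - m) t)) = of_real (fejer_coeff M m) * (if n - m = 0 then 1 else 0)" .
  qed
  also have "\<dots> = (\<Sum>m\<in>fejer_freqs M. if m = n then of_real (fejer_coeff M m) else 0)"
    by (intro sum.cong refl) auto
  also have "\<dots> = of_real (fejer_coeff M n)"
    using fejer_coeff_outside[of n M] by (simp add: sum.delta' fejer_freqs_finite)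
  finally show ?thesis .
qed

lemma fejer_coeff_0: "0 < M \<Longrightarrow> fejer_coeff M 0 = 1"
  by (simp add: fejer_coeff_prod)

lemma fejer_mass:
  assumes "0 < M"
  shows "(\<integral>\<^sup>+(t::real ^ 'n). ennreal (indicator cube t * fejer M t) \<partial>lborel) = 1"
    and "(LINT t|lborel. indicator cube t * complex_of_real (fejer M (t::real ^ 'n))) = 1"
proof -
  show 1: "(LINT t|lborel. indicator cube t * complex_of_real (fejer M (t::real ^ 'n))) = 1"
    using fejer_integral[of M "0 :: int ^ 'n"] by (simp add: fejer_coeff_0[OF assms])
  obtain C where C: "\<And>t::real ^ 'n. fejer M t \<le> C" using fejer_bounded by metis
  have i: "integrable lborel (\<lambda>t::real ^ 'n. indicator cube t * complex_of_real (fejer M t))"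
    by (rule cube_integrable[where C = C]) (measurable, use C in \<open>simp add: fejer_nonneg\<close>)
  then have i': "integrable lborel (\<lambda>t::real ^ 'n. indicator cube t * fejer M t)"
    by (subst complex_of_real_integrable_eq[symmetric]) (simp add: of_real_indicator)
  have "complex_of_real (LINT t|lborel. indicator cube t * fejer M (t::real ^ 'n)) = 1"
    using 1 by (subst integral_complex_of_real[symmetric]) (simp add: of_real_indicator)
  then have "(LINT t|lborel. indicator cube t * fejer M (t::real ^ 'n)) = 1" by simp
  then show "(\<integral>\<^sup>+(t::real ^ 'n). ennreal (indicator cube t * fejer M t) \<partial>lborel) = 1"
    using i' by (subst nn_integral_eq_integral) (auto simp: fejer_nonneg)
qed

text \<open>A periodic substitute for the squared distance to the lattice. Being a trigonometric
  polynomial of degree one, it has a Fejer average that is known exactly from a few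
  coefficients.\<close>

definition torus_dist :: "real ^ 'n \<Rightarrow> real" where
  "torus_dist t = (\<Sum>i\<in>UNIV. 1 - cos (2 * pi * t $ i))"

lemma torus_dist_nonneg: "0 \<le> torus_dist t"
  unfolding torus_dist_def by (intro sum_nonneg) auto

lemma torus_dist_measurable [measurable]: "torus_dist \<in> borel_measurable borel"
  unfolding torus_dist_def[abs_def] by measurable

text \<open>A vector of norm at least r has a coordinate of size at least r/d, since the sum of its
  coordinates dominates the norm. On the cube the argument of the cosine stays in half a period,
  where 1 - cos increases.\<close>

lemma torus_dist_lower:
  assumes "0 < r"
  shows "\<exists>c>0. \<forall>t::real ^ 'n. t \<in> cube \<longrightarrow> r \<le> norm t \<longrightarrow> c \<le> torus_dist t"
proof -
  \<comment> \<open>The minimum with 1/2 keeps 2\<pi>q within the range where the cosine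
    decreases.\<close>
  define q where "q = min (r / real CARD('n)) (1/2)"
  have q: "0 < q" "q \<le> 1/2" using assms by (auto simp: q_def min_def)
  have "1 - cos (2 * pi * q) \<le> torus_dist t" if t: "t \<in> cube" "r \<le> norm t" for t :: "real ^ 'n"
  proof -
    have "\<exists>i. r / real CARD('n) \<le> \<bar>t $ i\<bar>"
    proof (rule ccontr)
      assume "\<not> ?thesis"
      then have "(\<Sum>i\<in>UNIV. \<bar>t $ i\<bar>) < (\<Sum>i\<in>(UNIV::'n set). r / real CARD('n))"
        by (intro sum_strict_mono) (auto simp: not_le)
      then show False using t(2) norm_le_l1_cart[of t] by simp
    qed
    then obtain i where i: "q \<le> \<bar>t $ i\<bar>" unfolding q_def by (auto simp: min_le_iff_disj)
    have ti: "\<bar>t $ i\<bar> \<le> 1/2" 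
    proof -
      have "- 1/2 \<le> t $ i" "t $ i < 1/2" using t(1) by (auto simp: cube_def)
      then show ?thesis by linarith
    qed
    have "cos (2 * pi * t $ i) = cos (2 * pi * \<bar>t $ i\<bar>)" by (cases "0 \<le> t $ i") (auto simp: abs_if)
    also have "\<dots> \<le> cos (2 * pi * q)"
      using i ti q by (intro cos_monotone_0_pi_le) auto
    finally have "1 - cos (2 * pi * q) \<le> 1 - cos (2 * pi * t $ i)" by simp
    also have "\<dots> \<le> torus_dist t"
      unfolding torus_dist_def by (rule member_le_sum) auto
    finally show ?thesis .
  qed
  moreover have "0 < 1 - cos (2 * pi * q)"
  proof -
    have "cos (2 * pi * q) < cos 0" using q by (intro cos_monotone_0_pi) auto
    then show ?thesis by simp
  qed
  ultimately show ?thesis by blast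
qed

text \<open>Each cosine is the real part of a character, so its average is a Fejer coefficient.
  Since these tend to 1, the kernel concentrates at the lattice: its mass far away is controlled by
  this average, as in Chebyshev's inequality.\<close>

lemma fejer_torus_dist:
  assumes M: "0 < M"
  shows "(\<integral>\<^sup>+(t::real ^ 'n). ennreal (indicator cube t * fejer M t) * ennreal (torus_dist t) \<partial>lborel)
    = ennreal (\<Sum>i\<in>(UNIV :: 'n set). 1 - fejer_coeff M (axis i 1 :: int ^ 'n))"
proof -
  obtain C where C: "\<And>t::real ^ 'n. fejer M t \<le> C" using fejer_bounded by metis
  have C0: "0 \<le> C" using C[of 0] fejer_nonneg[of M "0 :: real ^ 'n"] by linarith
  let ?e = "\<lambda>i. axis i 1 :: int ^ 'n"
  have cosre: "cos (2 * pi * t $ i) = Re (char_ivec (?e i) t)" for t :: "real ^ 'n" and i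
  proof -
    have "of_ivec (?e i) = axis i 1" by (simp add: vec_eq_iff axis_def)
    then show ?thesis by (simp add: char_ivec_def inner_axis')
  qed
  let ?g = "\<lambda>i t. indicator cube t * (complex_of_real (fejer M t) * char_ivec (?e i) t)"
  let ?f = "\<lambda>t. indicator cube t * complex_of_real (fejer M (t::real ^ 'n))"
  have ig: "integrable lborel (?g i)" for i
    by (rule cube_integrable[where C = C]) (measurable, use C in \<open>simp add: norm_mult fejer_nonneg\<close>)
  have if': "integrable lborel ?f"
    by (rule cube_integrable[where C = C]) (measurable, use C in \<open>simp add: fejer_nonneg\<close>)
  have eq: "indicator cube t * fejer M t * torus_dist t = (\<Sum>i\<in>UNIV. Re (?f t) - Re (?g i t))" for t
    unfolding torus_dist_def cosre by (cases "t \<in> cube") (simp_all add: sum_distrib_left right_diff_distrib)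
  have ii: "integrable lborel (\<lambda>t. Re (?f t) - Re (?g i t))" for i
    using ig[of i] if' by (intro Bochner_Integration.integrable_diff integrable_Re)
  have "(\<integral>\<^sup>+(t::real ^ 'n). ennreal (indicator cube t * fejer M t) * ennreal (torus_dist t) \<partial>lborel)
    = (\<integral>\<^sup>+(t::real ^ 'n). ennreal (indicator cube t * fejer M t * torus_dist t) \<partial>lborel)"
    by (simp add: ennreal_mult fejer_nonneg torus_dist_nonneg)
  also have "\<dots> = ennreal (LINT t|lborel. indicator cube t * fejer M t * torus_dist (t :: real ^ 'n))"
  proof (rule nn_integral_eq_integral)
    show "integrable lborel (\<lambda>t. indicator cube t * fejer M t * torus_dist (t :: real ^ 'n))"
      unfolding eq by (rule Bochner_Integration.integrable_sum[OF ii])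
  qed (simp add: fejer_nonneg torus_dist_nonneg)
  also have "(LINT t|lborel. indicator cube t * fejer M t * torus_dist (t :: real ^ 'n)) = (\<Sum>i\<in>UNIV. LINT t|lborel. Re (?f t) - Re (?g i t))"
    unfolding eq by (rule Bochner_Integration.integral_sum[OF ii])
  also have "\<dots> = (\<Sum>i\<in>(UNIV :: 'n set). 1 - fejer_coeff M (?e i))"
  proof (rule sum.cong[OF refl])
    fix i
    have "(LINT t|lborel. Re (?f t) - Re (?g i t)) = Re (LINT t|lborel. ?f t) - Re (LINT t|lborel. ?g i t)"
      using ig[of i] if' by (simp only: Bochner_Integration.integral_diff integrable_Re integral_Re)
    then show "(LINT t|lborel. Re (?f t) - Re (?g i t)) = 1 - fejer_coeff M (?e i)"
      unfolding fejer_mass(2)[OF M] fejer_integral by simp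
  qed
  finally show ?thesis .
qed

section \<open>Sampling followed by reconstruction\<close>

text \<open>Convolution with \<open>flip \<phi>\<close> is the inner product with translates of
  \<phi>, so samples are values of a convolution at lattice points.\<close>

definition flip :: "('a::euclidean_space \<Rightarrow> complex) \<Rightarrow> 'a \<Rightarrow> complex" where
  "flip \<phi> t = cnj (\<phi> (- t))"

text \<open>The composition of reconstruction and sampling at \<open>h = 1\<close>.\<close>

definition samp_op :: "(real ^ 'n \<Rightarrow> complex) \<Rightarrow> (real ^ 'n \<Rightarrow> complex) \<Rightarrow> (real ^ 'n \<Rightarrow> complex) \<Rightarrow> real ^ 'n \<Rightarrow> complex" where
  "samp_op \<phi> \<psi> U x = (LINT n|count_space UNIV. \<psi> (x - of_ivec n) * conv (flip \<phi>) U (of_ivec n))"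

definition decaying :: "real \<Rightarrow> real \<Rightarrow> ('a::euclidean_space \<Rightarrow> complex) \<Rightarrow> bool" where
  "decaying C p \<gamma> \<longleftrightarrow> \<gamma> \<in> borel_measurable borel \<and> (\<forall>x. norm (\<gamma> x) \<le> C * wt p x)"

definition translate :: "'a::euclidean_space \<Rightarrow> ('a \<Rightarrow> complex) \<Rightarrow> 'a \<Rightarrow> complex" where
  "translate \<theta> \<gamma> x = \<gamma> (x - \<theta>)"

definition l1_shift :: "('a::euclidean_space \<Rightarrow> complex) \<Rightarrow> 'a \<Rightarrow> ennreal" where
  "l1_shift \<gamma> \<theta> = (\<integral>\<^sup>+x. ennreal (norm (\<gamma> x - \<gamma> (x - \<theta>))) \<partial>lborel)"

text \<open>The L1 norm and the lattice sums are the row and column sums of the Schur test for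
  sampling and reconstruction; the L2 bound makes every sample of an L2 function finite. All of them
  survive translation with the same \<open>K\<close>, in contrast to a pointwise decay
  bound.\<close>

definition lattice_bounded :: "real \<Rightarrow> (real ^ 'n \<Rightarrow> complex) \<Rightarrow> bool" where
  "lattice_bounded K \<gamma> \<longleftrightarrow> \<gamma> \<in> borel_measurable borel \<and> (\<integral>\<^sup>+x. ennreal (norm (\<gamma> x)) \<partial>lborel) \<le> ennreal K \<and>
     (\<forall>x. (\<integral>\<^sup>+n. ennreal (norm (\<gamma> (x - of_ivec n))) \<partial>count_space UNIV) \<le> ennreal K) \<and> l2 \<gamma> \<le> ennreal K"

lemma flip_measurable [measurable]:
  assumes [measurable]: "\<phi> \<in> borel_measurable borel"
  shows "flip \<phi> \<in> borel_measurable borel"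
  unfolding flip_def[abs_def] by measurable

lemma conv_flip: "conv (flip \<phi>) U t = (LINT y|lborel. cnj (\<phi> (y - t)) * U y)"
  unfolding conv_def flip_def by simp

lemma decaying_lattice_bounded:
  assumes p: "real CARD('n) < p" and C: "0 < C"
  shows "\<exists>K>0. \<forall>\<gamma>::real ^ 'n \<Rightarrow> complex. decaying C p \<gamma> \<longrightarrow> lattice_bounded K \<gamma>"
proof -
  obtain S where S: "0 \<le> S" "\<And>x::real ^ 'n. (\<integral>\<^sup>+n. ennreal (wt p (x - of_ivec n)) \<partial>count_space UNIV) \<le> ennreal S"
    using lattice_sum_bound[OF p] by blast
  define N where "N = enn2real (\<integral>\<^sup>+(x::real ^ 'n). ennreal (wt p x) \<partial>lborel)"
  have "(\<integral>\<^sup>+(x::real ^ 'n). ennreal (wt p x) \<partial>lborel) < \<infinity>" by (rule wt_integrable) (use p in simp)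
  then have N: "(\<integral>\<^sup>+(x::real ^ 'n). ennreal (wt p x) \<partial>lborel) = ennreal N" by (simp add: N_def less_top)
  have N0: "0 \<le> N" by (simp add: N_def)
  define K where "K = C * N + C * S + C * (C * N) + 1"
  have K: "0 < K" "C * N \<le> K" "C * S \<le> K" "C * (C * N) \<le> K"
    using C N0 S(1) by (simp_all add: K_def add_nonneg_pos)
  have "lattice_bounded K \<gamma>" if "decaying C p \<gamma>" for \<gamma> :: "real ^ 'n \<Rightarrow> complex"
  proof -
    have [measurable]: "\<gamma> \<in> borel_measurable borel" and bd: "\<And>x. norm (\<gamma> x) \<le> C * wt p x"
      using that by (auto simp: decaying_def)
    have e: "ennreal (norm (\<gamma> x)) \<le> ennreal C * ennreal (wt p x)" for x
      using bd[of x] C by (simp add: ennreal_mult[symmetric] ennreal_leI)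
    have 1: "(\<integral>\<^sup>+x. ennreal (norm (\<gamma> x)) \<partial>lborel) \<le> ennreal (C * N)"
    proof -
      have "(\<integral>\<^sup>+x. ennreal (norm (\<gamma> x)) \<partial>lborel) \<le> (\<integral>\<^sup>+(x::real ^ 'n). ennreal C * ennreal (wt p x) \<partial>lborel)"
        by (intro nn_integral_mono e)
      also have "\<dots> = ennreal C * ennreal N" unfolding N[symmetric] by (rule nn_integral_cmult) measurable
      finally show ?thesis using C N0 by (simp add: ennreal_mult[symmetric])
    qed
    have 2: "(\<integral>\<^sup>+n. ennreal (norm (\<gamma> (x - of_ivec n))) \<partial>count_space UNIV) \<le> ennreal (C * S)" for x
    proof -
      have "(\<integral>\<^sup>+n. ennreal (norm (\<gamma> (x - of_ivec n))) \<partial>count_space UNIV) \<le> (\<integral>\<^sup>+n. ennreal C * ennreal (wt p (x - of_ivec n)) \<partial>count_space UNIV)"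
        by (intro nn_integral_mono e)
      also have "\<dots> = ennreal C * (\<integral>\<^sup>+n. ennreal (wt p (x - of_ivec n)) \<partial>count_space UNIV)" by (rule nn_integral_cmult) simp
      also have "\<dots> \<le> ennreal C * ennreal S" by (intro mult_left_mono S) simp
      finally show ?thesis using C S by (simp add: ennreal_mult[symmetric])
    qed
    have 3: "l2 \<gamma> \<le> ennreal (C * (C * N))"
    proof -
      have "norm (\<gamma> x) \<le> C" for x
        using order_trans[OF bd mult_left_le[OF wt_le_1]] p C by simp
      then have "(norm (\<gamma> x))\<^sup>2 \<le> C * norm (\<gamma> x)" for x unfolding power2_eq_square by (intro mult_right_mono) auto
      then have "l2 \<gamma> \<le> (\<integral>\<^sup>+x. ennreal C * ennreal (norm (\<gamma> x)) \<partial>lborel)"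
        unfolding l2_def using C by (intro nn_integral_mono) (simp add: ennreal_mult[symmetric] ennreal_leI)
      also have "\<dots> = ennreal C * (\<integral>\<^sup>+x. ennreal (norm (\<gamma> x)) \<partial>lborel)" by (rule nn_integral_cmult) measurable
      also have "\<dots> \<le> ennreal C * ennreal (C * N)" by (intro mult_left_mono 1) simp
      finally show ?thesis using C N0 by (simp add: ennreal_mult[symmetric])
    qed
    show ?thesis unfolding lattice_bounded_def
      using 1 2 3 K by (auto intro: order_trans[OF _ ennreal_leI])
  qed
  with K(1) show ?thesis by blast
qed

lemma lattice_bounded_translate:
  assumes "lattice_bounded K \<gamma>"
  shows "lattice_bounded K (translate \<theta> \<gamma>)"
proof -
  have [measurable]: "\<gamma> \<in> borel_measurable borel" using assms by (simp add: lattice_bounded_def)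
  have "translate \<theta> \<gamma> \<in> borel_measurable borel" unfolding translate_def[abs_def] by measurable
  moreover have "(\<integral>\<^sup>+x. ennreal (norm (translate \<theta> \<gamma> x)) \<partial>lborel) = (\<integral>\<^sup>+x. ennreal (norm (\<gamma> x)) \<partial>lborel)"
    unfolding translate_def by (rule nn_integral_lborel_shift(2)[of "\<lambda>x. ennreal (norm (\<gamma> x))"]) measurable
  moreover have "l2 (translate \<theta> \<gamma>) = l2 \<gamma>"
    unfolding translate_def l2_def by (rule nn_integral_lborel_shift(2)[of "\<lambda>x. ennreal ((norm (\<gamma> x))\<^sup>2)"]) measurable
  moreover have "(\<integral>\<^sup>+n. ennreal (norm (translate \<theta> \<gamma> (x - of_ivec n))) \<partial>count_space UNIV) \<le> ennreal K" for x
  proof -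
    have "x - of_ivec n - \<theta> = x - \<theta> - of_ivec n" for n by simp
    then have "translate \<theta> \<gamma> (x - of_ivec n) = \<gamma> (x - \<theta> - of_ivec n)" for n
      unfolding translate_def by metis
    then show ?thesis using assms by (simp add: lattice_bounded_def)
  qed
  ultimately show ?thesis using assms by (simp add: lattice_bounded_def)
qed

lemma lattice_boundedD:
  assumes "lattice_bounded K \<gamma>"
  shows "\<gamma> \<in> borel_measurable borel" "(\<integral>\<^sup>+x. ennreal (norm (\<gamma> x)) \<partial>lborel) \<le> ennreal K"
    "(\<integral>\<^sup>+n. ennreal (norm (\<gamma> (x - of_ivec n))) \<partial>count_space UNIV) \<le> ennreal K" "l2 \<gamma> \<le> ennreal K" "l2 \<gamma> < \<infinity>"
    "integrable lborel \<gamma>"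
proof -
  show 1: "\<gamma> \<in> borel_measurable borel" and 2: "(\<integral>\<^sup>+x. ennreal (norm (\<gamma> x)) \<partial>lborel) \<le> ennreal K"
    and "(\<integral>\<^sup>+n. ennreal (norm (\<gamma> (x - of_ivec n))) \<partial>count_space UNIV) \<le> ennreal K" and "l2 \<gamma> \<le> ennreal K" "l2 \<gamma> < \<infinity>"
    using assms unfolding lattice_bounded_def by (auto intro: order_le_less_trans)
  show "integrable lborel \<gamma>"
    using 1 2 by (intro integrableI_bounded) (auto intro: order_le_less_trans)
qed

text \<open>Two Schur tests, from functions to sequences and back. L1 norms and lattice sums enter
  as separate constants because, for a difference of translates, the L1 norm becomes small while the
  lattice sum only stays bounded.\<close>

lemma samp_op_l2:
  fixes \<phi> \<psi> U :: "real ^ 'n \<Rightarrow> complex"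
  assumes [measurable]: "\<phi> \<in> borel_measurable borel" "\<psi> \<in> borel_measurable borel" "U \<in> borel_measurable borel"
    and \<phi>: "(\<integral>\<^sup>+x. ennreal (norm (\<phi> x)) \<partial>lborel) \<le> N1" "\<And>x. (\<integral>\<^sup>+n. ennreal (norm (\<phi> (x - of_ivec n))) \<partial>count_space UNIV) \<le> S1"
    and \<psi>: "(\<integral>\<^sup>+x. ennreal (norm (\<psi> x)) \<partial>lborel) \<le> N2" "\<And>x. (\<integral>\<^sup>+n. ennreal (norm (\<psi> (x - of_ivec n))) \<partial>count_space UNIV) \<le> S2"
  shows "l2 (samp_op \<phi> \<psi> U) \<le> S2 * N2 * (N1 * S1 * l2 U)"
proof -
  have "l2 (samp_op \<phi> \<psi> U) \<le> S2 * N2 * (\<integral>\<^sup>+n. ennreal ((norm (conv (flip \<phi>) U (of_ivec n)))\<^sup>2) \<partial>count_space UNIV)"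
    unfolding l2_def samp_op_def
  proof (rule schur_test[OF sigma_finite_lborel sigma_finite_count_space])
    show "(\<lambda>(x, n). \<psi> (x - of_ivec n)) \<in> borel_measurable (lborel \<Otimes>\<^sub>M count_space UNIV)"
      by (rule lborel_count_measurable(1)) measurable
    show "(\<integral>\<^sup>+x. ennreal (norm (\<psi> (x - of_ivec n))) \<partial>lborel) \<le> N2" for n
      using \<psi>(1) nn_integral_lborel_shift(2)[of "\<lambda>x. ennreal (norm (\<psi> x))" "of_ivec n"] by simp
  qed (use \<psi> in simp_all)
  also have "(\<integral>\<^sup>+n. ennreal ((norm (conv (flip \<phi>) U (of_ivec n)))\<^sup>2) \<partial>count_space UNIV) \<le> N1 * S1 * l2 U"
    unfolding l2_def conv_flip
  proof (rule schur_test[OF sigma_finite_count_space sigma_finite_lborel])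
    show "(\<lambda>(n, y). cnj (\<phi> (y - of_ivec n))) \<in> borel_measurable (count_space UNIV \<Otimes>\<^sub>M lborel)"
      by (rule lborel_count_measurable(2)) measurable
    show "(\<integral>\<^sup>+y. ennreal (norm (cnj (\<phi> (y - of_ivec n)))) \<partial>lborel) \<le> N1" for n
      using \<phi>(1) nn_integral_lborel_shift(2)[of "\<lambda>x. ennreal (norm (\<phi> x))" "of_ivec n"] by simp
  qed (use \<phi> in simp_all)
  finally show ?thesis by (simp add: mult_left_mono)
qed

lemma conv_flip_bounded:
  fixes \<phi> U :: "'a::euclidean_space \<Rightarrow> complex"
  assumes [measurable]: "\<phi> \<in> borel_measurable borel" "U \<in> borel_measurable borel" and fin: "l2 \<phi> < \<infinity>" "l2 U < \<infinity>"
  shows "norm (conv (flip \<phi>) U t) \<le> sqrt (enn2real (l2 \<phi>) * enn2real (l2 U))"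
    and "integrable lborel (\<lambda>y. cnj (\<phi> (y - t)) * U y)"
proof -
  have s: "l2 (\<lambda>y. cnj (\<phi> (y - t))) = l2 \<phi>"
    unfolding l2_def using nn_integral_lborel_shift(2)[of "\<lambda>x. ennreal ((norm (\<phi> x))\<^sup>2)" t] by simp
  show "norm (conv (flip \<phi>) U t) \<le> sqrt (enn2real (l2 \<phi>) * enn2real (l2 U))"
    unfolding conv_flip by (rule norm_integral_product_le) (measurable, use fin in \<open>simp_all add: s less_top\<close>)
  show "integrable lborel (\<lambda>y. cnj (\<phi> (y - t)) * U y)"
    by (rule nn_integral_mult_integrable) (measurable, use fin s in \<open>simp_all add: l2_def\<close>)
qed

lemma samp_op_summable:
  fixes \<phi> \<psi> U :: "real ^ 'n \<Rightarrow> complex"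
  assumes "\<phi> \<in> borel_measurable borel" "U \<in> borel_measurable borel" "l2 \<phi> < \<infinity>" "l2 U < \<infinity>"
    and S: "(\<integral>\<^sup>+n. ennreal (norm (\<psi> (x - of_ivec n))) \<partial>count_space UNIV) < \<infinity>"
  shows "integrable (count_space UNIV) (\<lambda>n. \<psi> (x - of_ivec n) * conv (flip \<phi>) U (of_ivec n))"
proof (rule integrableI_bounded)
  let ?B = "sqrt (enn2real (l2 \<phi>) * enn2real (l2 U))"
  have "(\<integral>\<^sup>+n. ennreal (norm (\<psi> (x - of_ivec n) * conv (flip \<phi>) U (of_ivec n))) \<partial>count_space UNIV)
    \<le> (\<integral>\<^sup>+n. ennreal (norm (\<psi> (x - of_ivec n))) * ennreal ?B \<partial>count_space UNIV)"
    using conv_flip_bounded(1)[OF assms(1-4)]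
    by (intro nn_integral_mono) (auto simp: norm_mult ennreal_mult[symmetric] intro!: ennreal_leI mult_left_mono)
  also have "\<dots> < \<infinity>" using S by (simp add: nn_integral_multc ennreal_mult_less_top)
  finally show "(\<integral>\<^sup>+n. ennreal (norm (\<psi> (x - of_ivec n) * conv (flip \<phi>) U (of_ivec n))) \<partial>count_space UNIV) < \<infinity>" .
qed simp

lemma samp_op_measurable [measurable]:
  assumes [measurable]: "\<psi> \<in> borel_measurable borel"
  shows "samp_op \<phi> \<psi> U \<in> borel_measurable borel"
proof -
  interpret C: sigma_finite_measure "count_space (UNIV :: (int ^ 'a) set)" by (rule sigma_finite_count_space)
  have "(\<lambda>x. LINT n|count_space UNIV. \<psi> (x - of_ivec n) * conv (flip \<phi>) U (of_ivec n)) \<in> borel_measurable borel"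
    by (rule C.borel_measurable_lebesgue_integral, rule lborel_count_measurable(1)) measurable
  then show ?thesis unfolding samp_op_def[abs_def] .
qed

lemma samp_op_diff:
  fixes \<phi> \<psi> \<phi>' \<psi>' U :: "real ^ 'n \<Rightarrow> complex"
  assumes b: "lattice_bounded K \<phi>" "lattice_bounded K \<psi>" "lattice_bounded K \<phi>'" "lattice_bounded K \<psi>'"
    and U: "U \<in> borel_measurable borel" "l2 U < \<infinity>"
  shows "samp_op \<phi> \<psi> U x - samp_op \<phi>' \<psi>' U x = samp_op \<phi> (\<lambda>x. \<psi> x - \<psi>' x) U x + samp_op (\<lambda>x. \<phi> x - \<phi>' x) \<psi>' U x"
proof -
  have s: "(\<integral>\<^sup>+n. ennreal (norm (\<gamma> (x - of_ivec n))) \<partial>count_space UNIV) < \<infinity>" if "lattice_bounded K \<gamma>" for \<gamma>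
    using lattice_boundedD(3)[OF that, of x] by (auto intro: order_le_less_trans)
  have c: "conv (flip (\<lambda>x. \<phi> x - \<phi>' x)) U t = conv (flip \<phi>) U t - conv (flip \<phi>') U t" for t
    unfolding conv_flip
    using conv_flip_bounded(2)[OF lattice_boundedD(1)[OF b(1)] U(1) lattice_boundedD(5)[OF b(1)] U(2), of t]
      conv_flip_bounded(2)[OF lattice_boundedD(1)[OF b(3)] U(1) lattice_boundedD(5)[OF b(3)] U(2), of t]
    by (simp add: left_diff_distrib)
  have i: "integrable (count_space UNIV) (\<lambda>n. \<psi> (x - of_ivec n) * conv (flip \<phi>) U (of_ivec n))"
    "integrable (count_space UNIV) (\<lambda>n. \<psi>' (x - of_ivec n) * conv (flip \<phi>) U (of_ivec n))"
    "integrable (count_space UNIV) (\<lambda>n. \<psi>' (x - of_ivec n) * conv (flip \<phi>') U (of_ivec n))"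
    by (intro samp_op_summable lattice_boundedD(1)[OF b(1)] lattice_boundedD(1)[OF b(3)] U lattice_boundedD(5)[OF b(1)] lattice_boundedD(5)[OF b(3)] s[OF b(2)] s[OF b(4)])+
  show ?thesis
    unfolding samp_op_def c left_diff_distrib right_diff_distrib
    by (simp add: i)
qed

text \<open>Sesquilinearity splits the difference into a change of \<psi> and a change of \<phi>. In
  each, the L1 shift multiplies a lattice sum of at most 2 K, so the squared norm is linear in the
  shifts; the sum of the two squares contributes another factor 2, whence 4 K^3.\<close>

lemma samp_op_translate_close:
  assumes K: "0 < K"
  assumes b: "lattice_bounded K \<phi>" "lattice_bounded K \<psi>"
    and U: "U \<in> borel_measurable borel" "l2 U < \<infinity>"
  shows "l2 (\<lambda>x. samp_op \<phi> \<psi> U x - samp_op (translate \<theta> \<phi>) (translate \<theta> \<psi>) U x)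
    \<le> ennreal (4 * K ^ 3) * (l1_shift \<phi> \<theta> + l1_shift \<psi> \<theta>) * l2 U"
proof -
  note bt = lattice_bounded_translate[OF b(1), of \<theta>] lattice_bounded_translate[OF b(2), of \<theta>]
  note [measurable] = lattice_boundedD(1)[OF b(1)] lattice_boundedD(1)[OF b(2)] lattice_boundedD(1)[OF bt(1)] lattice_boundedD(1)[OF bt(2)] U(1)
  have S: "(\<integral>\<^sup>+n. ennreal (norm (\<gamma> (x - of_ivec n) - translate \<theta> \<gamma> (x - of_ivec n))) \<partial>count_space UNIV) \<le> ennreal (2 * K)"
    if "lattice_bounded K \<gamma>" for \<gamma> and x :: "real ^ 'a"
  proof -
    have "(\<integral>\<^sup>+n. ennreal (norm (\<gamma> (x - of_ivec n) - translate \<theta> \<gamma> (x - of_ivec n))) \<partial>count_space UNIV)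
      \<le> (\<integral>\<^sup>+n. ennreal (norm (\<gamma> (x - of_ivec n))) + ennreal (norm (translate \<theta> \<gamma> (x - of_ivec n))) \<partial>count_space UNIV)"
      by (intro nn_integral_mono) (simp add: ennreal_plus[symmetric] ennreal_leI norm_triangle_ineq4 del: ennreal_plus)
    also have "\<dots> = (\<integral>\<^sup>+n. ennreal (norm (\<gamma> (x - of_ivec n))) \<partial>count_space UNIV) + (\<integral>\<^sup>+n. ennreal (norm (translate \<theta> \<gamma> (x - of_ivec n))) \<partial>count_space UNIV)"
      by (rule nn_integral_add) auto
    also have "\<dots> \<le> ennreal K + ennreal K"
      by (intro add_mono lattice_boundedD(3) that lattice_bounded_translate)
    finally show ?thesis using K by (simp add: ennreal_plus[symmetric] del: ennreal_plus)
  qed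
  have L: "(\<integral>\<^sup>+x. ennreal (norm (\<gamma> x - translate \<theta> \<gamma> x)) \<partial>lborel) = l1_shift \<gamma> \<theta>" for \<gamma> :: "real ^ 'a \<Rightarrow> complex"
    by (simp add: l1_shift_def translate_def)
  have 1: "l2 (samp_op \<phi> (\<lambda>x. \<psi> x - translate \<theta> \<psi> x) U) \<le> ennreal (2 * K) * l1_shift \<psi> \<theta> * (ennreal K * ennreal K * l2 U)"
    by (rule samp_op_l2) (measurable, auto intro: lattice_boundedD b S simp: L)
  have 2: "l2 (samp_op (\<lambda>x. \<phi> x - translate \<theta> \<phi> x) (translate \<theta> \<psi>) U) \<le> ennreal K * ennreal K * (l1_shift \<phi> \<theta> * ennreal (2 * K) * l2 U)"
    by (rule samp_op_l2) (measurable, auto intro: lattice_boundedD bt b S simp: L)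
  have "l2 (\<lambda>x. samp_op \<phi> \<psi> U x - samp_op (translate \<theta> \<phi>) (translate \<theta> \<psi>) U x)
    \<le> 2 * l2 (samp_op \<phi> (\<lambda>x. \<psi> x - translate \<theta> \<psi> x) U) + 2 * l2 (samp_op (\<lambda>x. \<phi> x - translate \<theta> \<phi> x) (translate \<theta> \<psi>) U)"
    unfolding samp_op_diff[OF b bt U] l2_def by (rule nn_integral_norm_add_square_le) measurable
  also have "\<dots> \<le> 2 * (ennreal (2 * K) * l1_shift \<psi> \<theta> * (ennreal K * ennreal K * l2 U)) + 2 * (ennreal K * ennreal K * (l1_shift \<phi> \<theta> * ennreal (2 * K) * l2 U))"
    by (intro add_mono mult_left_mono 1 2) auto
  also have "\<dots> = ennreal (4 * K ^ 3) * (l1_shift \<phi> \<theta> + l1_shift \<psi> \<theta>) * l2 U"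
  proof -
    have "2 = ennreal 2" by simp
    then have "2 * (ennreal (2 * K) * ennreal K * ennreal K) = ennreal (4 * K ^ 3)"
      using K by (simp only: ennreal_mult[symmetric] mult_nonneg_nonneg less_imp_le zero_le_numeral) (simp add: power3_eq_cube mult_ac)
    then have "ennreal (4 * K ^ 3) * (l1_shift \<phi> \<theta> + l1_shift \<psi> \<theta>) * l2 U = 2 * (ennreal (2 * K) * ennreal K * ennreal K) * (l1_shift \<phi> \<theta> + l1_shift \<psi> \<theta>) * l2 U"
      by simp
    then show ?thesis by (simp add: algebra_simps)
  qed
  finally show ?thesis .
qed

definition fejer_op :: "nat \<Rightarrow> (real ^ 'n \<Rightarrow> complex) \<Rightarrow> (real ^ 'n \<Rightarrow> complex) \<Rightarrow> (real ^ 'n \<Rightarrow> complex) \<Rightarrow> real ^ 'n \<Rightarrow> complex" where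
  "fejer_op M \<phi> \<psi> U = conv \<psi> (\<lambda>t. of_real (fejer M t) * conv (flip \<phi>) U t)"

text \<open>Averaging the translated lattices against the Fejer kernel replaces the Dirac comb of the
  sampling operator by a trigonometric polynomial.\<close>

lemma fejer_op_average:
  fixes \<phi> \<psi> U :: "real ^ 'n \<Rightarrow> complex"
  assumes b: "lattice_bounded K \<phi>" "lattice_bounded K \<psi>"
    and U: "U \<in> borel_measurable borel" "l2 U < \<infinity>"
  shows "fejer_op M \<phi> \<psi> U x = (LINT \<theta>|lborel. indicator cube \<theta> * (of_real (fejer M \<theta>) * samp_op (translate \<theta> \<phi>) (translate \<theta> \<psi>) U x))"
    and "integrable lborel (\<lambda>\<theta>. indicator cube \<theta> * (of_real (fejer M \<theta>) * samp_op (translate \<theta> \<phi>) (translate \<theta> \<psi>) U x))"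
proof -
  note [measurable] = lattice_boundedD(1)[OF b(1)] lattice_boundedD(1)[OF b(2)] U(1)
  let ?w = "conv (flip \<phi>) U"
  define f where "f t = \<psi> (x - t) * (of_real (fejer M t) * ?w t)" for t
  have [measurable]: "f \<in> borel_measurable borel" unfolding f_def[abs_def] by measurable
  obtain C where C: "\<And>t::real ^ 'n. fejer M t \<le> C" using fejer_bounded by metis
  have C0: "0 \<le> C" using C[of 0] fejer_nonneg[of M "0 :: real ^ 'n"] by linarith
  let ?B = "sqrt (enn2real (l2 \<phi>) * enn2real (l2 U))"
  have f: "integrable lborel f"
  proof (rule integrableI_bounded)
    have "(\<integral>\<^sup>+t. ennreal (norm (f t)) \<partial>lborel) \<le> (\<integral>\<^sup>+t. ennreal (norm (\<psi> (x - t))) * ennreal (C * ?B) \<partial>lborel)"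
    proof (rule nn_integral_mono)
      fix t
      have "norm (of_real (fejer M t) * ?w t) \<le> C * ?B"
        unfolding norm_mult norm_of_real using C[of t] fejer_nonneg[of M t] C0
          conv_flip_bounded(1)[OF lattice_boundedD(1)[OF b(1)] U(1) lattice_boundedD(5)[OF b(1)] U(2), of t]
        by (intro mult_mono) auto
      then show "ennreal (norm (f t)) \<le> ennreal (norm (\<psi> (x - t))) * ennreal (C * ?B)"
        using C0 unfolding f_def norm_mult[of "\<psi> _"] by (simp add: ennreal_mult[symmetric] ennreal_leI mult_left_mono)
    qed
    also have "\<dots> = (\<integral>\<^sup>+t. ennreal (norm (\<psi> (x - t))) \<partial>lborel) * ennreal (C * ?B)" by (rule nn_integral_multc) measurable
    also have "(\<integral>\<^sup>+t. ennreal (norm (\<psi> (x - t))) \<partial>lborel) = (\<integral>\<^sup>+t. ennreal (norm (\<psi> t)) \<partial>lborel)"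
      by (rule nn_integral_lborel_shift(3)[of "\<lambda>t. ennreal (norm (\<psi> t))"]) measurable
    also have "\<dots> * ennreal (C * ?B) < \<infinity>"
      using order_le_less_trans[OF lattice_boundedD(2)[OF b(2)] ennreal_less_top] by (simp add: ennreal_mult_less_top)
    finally show "(\<integral>\<^sup>+t. ennreal (norm (f t)) \<partial>lborel) < \<infinity>" .
  qed measurable
  \<comment> \<open>Translating \<phi> by \<theta> samples at the shifted lattice; together with the
    periodicity of the kernel this makes the lattice sum of \<open>f\<close> one averaged
    operator.\<close>
  have w: "conv (flip (translate \<theta> \<phi>)) U (of_ivec n) = ?w (\<theta> + of_ivec n)" for \<theta> n
    unfolding conv_flip translate_def by (simp add: diff_diff_eq add.commute)
  have s: "(LINT n|count_space UNIV. f (\<theta> + of_ivec n)) = of_real (fejer M \<theta>) * samp_op (translate \<theta> \<phi>) (translate \<theta> \<psi>) U x" for \<theta>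
  proof -
    have "samp_op (translate \<theta> \<phi>) (translate \<theta> \<psi>) U x = (LINT n|count_space UNIV. \<psi> (x - (\<theta> + of_ivec n)) * ?w (\<theta> + of_ivec n))"
      unfolding samp_op_def w translate_def by (simp add: diff_diff_eq add.commute)
    moreover have "(LINT n|count_space UNIV. f (\<theta> + of_ivec n)) = (LINT n|count_space UNIV. of_real (fejer M \<theta>) * (\<psi> (x - (\<theta> + of_ivec n)) * ?w (\<theta> + of_ivec n)))"
      unfolding f_def fejer_periodic by (simp add: mult_ac)
    ultimately show ?thesis by (simp only: integral_mult_right_zero)
  qed
  show "fejer_op M \<phi> \<psi> U x = (LINT \<theta>|lborel. indicator cube \<theta> * (of_real (fejer M \<theta>) * samp_op (translate \<theta> \<phi>) (translate \<theta> \<psi>) U x))"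
    using integral_unfold(1)[OF f] unfolding s by (simp add: fejer_op_def conv_def f_def)
  show "integrable lborel (\<lambda>\<theta>. indicator cube \<theta> * (of_real (fejer M \<theta>) * samp_op (translate \<theta> \<phi>) (translate \<theta> \<psi>) U x))"
    using integral_unfold(2)[OF f] unfolding s .
qed

text \<open>The error is the Fejer average of the differences between the operator and its versions
  for shifted lattices. For shifts near 0 continuity of translations makes them small. For the
  others the shifts are merely bounded, and the bound is charged to a multiple of
  \<open>torus_dist\<close>, whose average tends to 0. The estimate is linear in
  \<open>l2 U\<close>, hence uniform in the function and later in h.\<close>

lemma fejer_op_close:
  fixes \<phi> \<psi> :: "real ^ 'n \<Rightarrow> complex"
  assumes d: "decaying C p \<phi>" "decaying C p \<psi>" and C: "0 < C" and p: "real CARD('n) < p" and \<eta>: "0 < \<eta>"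
  shows "\<exists>M0>0. \<forall>M\<ge>M0. \<forall>U. U \<in> borel_measurable borel \<longrightarrow> l2 U < \<infinity> \<longrightarrow>
    l2 (\<lambda>x. samp_op \<phi> \<psi> U x - fejer_op M \<phi> \<psi> U x) \<le> ennreal \<eta> * l2 U"
proof -
  obtain K where K: "0 < K" and lb: "\<And>\<gamma>::real ^ 'n \<Rightarrow> complex. decaying C p \<gamma> \<Longrightarrow> lattice_bounded K \<gamma>"
    using decaying_lattice_bounded[OF p C] by blast
  note b = lb[OF d(1)] lb[OF d(2)]
  have \<phi>m[measurable]: "\<phi> \<in> borel_measurable borel" and \<psi>m[measurable]: "\<psi> \<in> borel_measurable borel"
    using d by (auto simp: decaying_def)
  \<comment> \<open>Near and far shifts will each contribute 2 e times 4 K^3, which adds up to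
    \<eta>.\<close>
  define e where "e = \<eta> / (4 * (4 * K ^ 3))"
  have e: "0 < e" using \<eta> K by (simp add: e_def)
  have shift: "\<exists>r>0. \<forall>t. norm t < r \<longrightarrow> l1_shift \<gamma> t \<le> ennreal e" if "decaying C p \<gamma>" for \<gamma> :: "real ^ 'n \<Rightarrow> complex"
    unfolding l1_shift_def using that p
    by (intro weighted_translation_continuous[of \<gamma> C p e] C e) (auto simp: decaying_def)
  obtain r1 r2 where r: "0 < r1" "0 < r2" "\<And>t. norm t < r1 \<Longrightarrow> l1_shift \<phi> t \<le> ennreal e" "\<And>t. norm t < r2 \<Longrightarrow> l1_shift \<psi> t \<le> ennreal e"
    using shift[OF d(1)] shift[OF d(2)] by blast
  have sup: "l1_shift \<gamma> t \<le> ennreal (2 * K)" if "lattice_bounded K \<gamma>" for \<gamma> :: "real ^ 'n \<Rightarrow> complex" and t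
  proof -
    note [measurable] = lattice_boundedD(1)[OF that]
    have "l1_shift \<gamma> t \<le> (\<integral>\<^sup>+x. ennreal (norm (\<gamma> x)) + ennreal (norm (\<gamma> (x - t))) \<partial>lborel)"
      unfolding l1_shift_def by (intro nn_integral_mono) (simp add: ennreal_plus[symmetric] ennreal_leI norm_triangle_ineq4 del: ennreal_plus)
    also have "\<dots> = (\<integral>\<^sup>+x. ennreal (norm (\<gamma> x)) \<partial>lborel) + (\<integral>\<^sup>+x. ennreal (norm (\<gamma> (x - t))) \<partial>lborel)"
      by (rule nn_integral_add) measurable
    also have "(\<integral>\<^sup>+x. ennreal (norm (\<gamma> (x - t))) \<partial>lborel) = (\<integral>\<^sup>+x. ennreal (norm (\<gamma> x)) \<partial>lborel)"
      by (rule nn_integral_lborel_shift(2)[of "\<lambda>x. ennreal (norm (\<gamma> x))"]) measurable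
    also have "(\<integral>\<^sup>+x. ennreal (norm (\<gamma> x)) \<partial>lborel) + \<dots> \<le> ennreal K + ennreal K"
      by (intro add_mono lattice_boundedD(2) that)
    finally show ?thesis using K by (simp add: ennreal_plus[symmetric] del: ennreal_plus)
  qed
  define r where "r = min r1 r2"
  have r0: "0 < r" using r by (simp add: r_def)
  obtain c where c: "0 < c" "\<And>t::real ^ 'n. t \<in> cube \<Longrightarrow> r \<le> norm t \<Longrightarrow> c \<le> torus_dist t"
    using torus_dist_lower[OF r0, where 'n='n] by blast
  \<comment> \<open>Each of the two shifts is at most 2 K, and \<open>torus_dist\<close> is at least
    c on the far part, so T c = 4 K bounds their sum.\<close>
  define T where "T = 4 * K / c"
  have T: "0 < T" using K c by (simp add: T_def)
  have tau: "l1_shift \<phi> t + l1_shift \<psi> t \<le> ennreal (2 * e) + ennreal T * ennreal (torus_dist t)" if t: "t \<in> cube" for t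
  proof (cases "norm t < r")
    case True
    then have "l1_shift \<phi> t + l1_shift \<psi> t \<le> ennreal e + ennreal e" using r by (intro add_mono) (auto simp: r_def)
    also have "\<dots> = ennreal (2 * e)" using e by (simp add: ennreal_plus[symmetric] del: ennreal_plus)
    also have "\<dots> \<le> ennreal (2 * e) + ennreal T * ennreal (torus_dist t)" by simp
    finally show ?thesis .
  next
    case False
    have "l1_shift \<phi> t + l1_shift \<psi> t \<le> ennreal (2 * K) + ennreal (2 * K)" by (intro add_mono sup b)
    also have "\<dots> = ennreal (T * c)" using K c by (simp add: ennreal_plus[symmetric] T_def del: ennreal_plus)
    also have "\<dots> \<le> ennreal (T * torus_dist t)" using c(2)[OF t] False T by (intro ennreal_leI mult_left_mono) auto
    also have "\<dots> = ennreal T * ennreal (torus_dist t)" using T by (simp add: ennreal_mult torus_dist_nonneg)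
    also have "\<dots> \<le> ennreal (2 * e) + ennreal T * ennreal (torus_dist t)" by simp
    finally show ?thesis .
  qed
  let ?s = "\<lambda>M. \<Sum>i\<in>(UNIV :: 'n set). 1 - fejer_coeff M (axis i 1 :: int ^ 'n)"
  have "(\<lambda>M. T * ?s M) \<longlonglongrightarrow> T * (\<Sum>i\<in>(UNIV :: 'n set). 1 - 1)"
    by (intro tendsto_intros fejer_coeff_tendsto)
  then have "(\<lambda>M. T * ?s M) \<longlonglongrightarrow> 0" by simp
  then have "eventually (\<lambda>M. T * ?s M < 2 * e) sequentially" using e by (intro order_tendstoD) auto
  then obtain M0 where M0: "\<And>M. M0 \<le> M \<Longrightarrow> T * ?s M < 2 * e" by (auto simp: eventually_sequentially)
  have "l2 (\<lambda>x. samp_op \<phi> \<psi> U x - fejer_op M \<phi> \<psi> U x) \<le> ennreal \<eta> * l2 U"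
    if M: "max 1 M0 \<le> M" and U[measurable]: "U \<in> borel_measurable borel" and fin: "l2 U < \<infinity>" for M U
  proof -
    have Mp: "0 < M" using M by simp
    let ?k = "\<lambda>\<theta>::real ^ 'n. complex_of_real (indicator cube \<theta> * fejer M \<theta>)"
    let ?D = "\<lambda>\<theta> x. samp_op \<phi> \<psi> U x - samp_op (translate \<theta> \<phi>) (translate \<theta> \<psi>) U x"
    have kn: "ennreal (norm (?k \<theta>)) = ennreal (indicator cube \<theta> * fejer M \<theta>)" for \<theta> :: "real ^ 'n"
      unfolding norm_of_real using fejer_nonneg[of M \<theta>] by simp
    interpret Cs: sigma_finite_measure "count_space (UNIV :: (int ^ 'n) set)" by (rule sigma_finite_count_space)
    have "(\<lambda>q. LINT n|count_space UNIV. \<psi> (fst q - of_ivec n - snd q) * conv (flip \<phi>) U (of_ivec n + snd q)) \<in> borel_measurable (lborel \<Otimes>\<^sub>M lborel)"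
      by (rule Cs.borel_measurable_lebesgue_integral, rule lborel_count_measurable(1)) measurable
    moreover have "samp_op (translate \<theta> \<phi>) (translate \<theta> \<psi>) U x = (LINT n|count_space UNIV. \<psi> (x - of_ivec n - \<theta>) * conv (flip \<phi>) U (of_ivec n + \<theta>))" for \<theta> x
      unfolding samp_op_def translate_def conv_flip by (simp add: diff_diff_eq)
    ultimately have sm[measurable]: "(\<lambda>q. samp_op (translate (snd q) \<phi>) (translate (snd q) \<psi>) U (fst q)) \<in> borel_measurable (lborel \<Otimes>\<^sub>M lborel)"
      by simp
    have Dm[measurable]: "(\<lambda>q. ?D (snd q) (fst q)) \<in> borel_measurable (lborel \<Otimes>\<^sub>M lborel)" by measurable
    have Dx: "(\<lambda>\<theta>. ?D \<theta> x) \<in> borel_measurable lborel" for x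
      using measurable_compose[OF measurable_Pair1'[of x lborel lborel] Dm] by simp
    \<comment> \<open>The kernel has mass one, so the operator itself can be written under the same
      average.\<close>
    have eq: "samp_op \<phi> \<psi> U x - fejer_op M \<phi> \<psi> U x = (LINT \<theta>|lborel. ?k \<theta> * ?D \<theta> x)" for x
    proof -
      have i1: "integrable lborel (\<lambda>\<theta>::real ^ 'n. ?k \<theta>)"
      proof (rule integrableI_bounded)
        show "(\<integral>\<^sup>+(\<theta>::real ^ 'n). ennreal (norm (?k \<theta>)) \<partial>lborel) < \<infinity>"
          unfolding kn fejer_mass(1)[OF Mp] by simp
      qed measurable
      have k1: "(LINT \<theta>::real ^ 'n|lborel. ?k \<theta>) = 1"
        using fejer_mass(2)[OF Mp, where 'n='n] by (simp add: of_real_indicator)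
      have i2: "integrable lborel (\<lambda>\<theta>. ?k \<theta> * samp_op (translate \<theta> \<phi>) (translate \<theta> \<psi>) U x)"
        and e2: "fejer_op M \<phi> \<psi> U x = (LINT \<theta>|lborel. ?k \<theta> * samp_op (translate \<theta> \<phi>) (translate \<theta> \<psi>) U x)"
        using fejer_op_average[OF b U fin, of M x] by (simp_all add: of_real_indicator mult.assoc)
      have "(LINT \<theta>::real ^ 'n|lborel. ?k \<theta> * samp_op \<phi> \<psi> U x) = samp_op \<phi> \<psi> U x"
        by (simp only: integral_mult_left_zero k1 mult_1_left)
      then have "samp_op \<phi> \<psi> U x - fejer_op M \<phi> \<psi> U x = (LINT \<theta>::real ^ 'n|lborel. ?k \<theta> * samp_op \<phi> \<psi> U x) - (LINT \<theta>|lborel. ?k \<theta> * samp_op (translate \<theta> \<phi>) (translate \<theta> \<psi>) U x)"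
        unfolding e2 by simp
      also have "\<dots> = (LINT \<theta>|lborel. ?k \<theta> * samp_op \<phi> \<psi> U x - ?k \<theta> * samp_op (translate \<theta> \<phi>) (translate \<theta> \<psi>) U x)"
        by (rule Bochner_Integration.integral_diff[OF integrable_mult_left[OF i1] i2, symmetric])
      finally show ?thesis by (simp only: right_diff_distrib)
    qed
    have "l2 (\<lambda>x. samp_op \<phi> \<psi> U x - fejer_op M \<phi> \<psi> U x)
      \<le> (\<integral>\<^sup>+x. \<integral>\<^sup>+(\<theta>::real ^ 'n). ennreal (indicator cube \<theta> * fejer M \<theta>) * ennreal ((norm (?D \<theta> x))\<^sup>2) \<partial>lborel \<partial>lborel)"
      unfolding l2_def eq
    proof (rule nn_integral_mono)
      fix x
      have "ennreal ((norm (LINT \<theta>|lborel. ?k \<theta> * ?D \<theta> x))\<^sup>2) \<le> (\<integral>\<^sup>+(\<theta>::real ^ 'n). ennreal (norm (?k \<theta>)) \<partial>lborel) * (\<integral>\<^sup>+(\<theta>::real ^ 'n). ennreal (norm (?k \<theta>)) * ennreal ((norm (?D \<theta> x))\<^sup>2) \<partial>lborel)"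
        by (rule norm_integral_square_le_weighted[OF Dx]) measurable
      then show "ennreal ((norm (LINT \<theta>|lborel. ?k \<theta> * ?D \<theta> x))\<^sup>2) \<le> (\<integral>\<^sup>+(\<theta>::real ^ 'n). ennreal (indicator cube \<theta> * fejer M \<theta>) * ennreal ((norm (?D \<theta> x))\<^sup>2) \<partial>lborel)"
        unfolding kn fejer_mass(1)[OF Mp] by simp
    qed
    also have "\<dots> = (\<integral>\<^sup>+(\<theta>::real ^ 'n). \<integral>\<^sup>+x. ennreal (indicator cube \<theta> * fejer M \<theta>) * ennreal ((norm (?D \<theta> x))\<^sup>2) \<partial>lborel \<partial>lborel)"
      using Dm by (intro lborel_pair.Fubini'[symmetric]) (simp add: split_beta')
    also have "\<dots> = (\<integral>\<^sup>+(\<theta>::real ^ 'n). ennreal (indicator cube \<theta> * fejer M \<theta>) * l2 (?D \<theta>) \<partial>lborel)"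
    proof (rule nn_integral_cong)
      fix \<theta> :: "real ^ 'n"
      have [measurable]: "translate \<theta> \<psi> \<in> borel_measurable borel" unfolding translate_def[abs_def] by measurable
      show "(\<integral>\<^sup>+x. ennreal (indicator cube \<theta> * fejer M \<theta>) * ennreal ((norm (?D \<theta> x))\<^sup>2) \<partial>lborel) = ennreal (indicator cube \<theta> * fejer M \<theta>) * l2 (?D \<theta>)"
        unfolding l2_def by (rule nn_integral_cmult) measurable
    qed
    also have "\<dots> \<le> (\<integral>\<^sup>+(\<theta>::real ^ 'n). (ennreal (4 * K ^ 3) * l2 U) * (ennreal (2 * e) * ennreal (indicator cube \<theta> * fejer M \<theta>) + ennreal T * (ennreal (indicator cube \<theta> * fejer M \<theta>) * ennreal (torus_dist \<theta>))) \<partial>lborel)"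
    proof (rule nn_integral_mono)
      fix \<theta> :: "real ^ 'n"
      let ?f = "ennreal (indicator cube \<theta> * fejer M \<theta>)"
      show "?f * l2 (?D \<theta>) \<le> (ennreal (4 * K ^ 3) * l2 U) * (ennreal (2 * e) * ?f + ennreal T * (?f * ennreal (torus_dist \<theta>)))"
      proof (cases "\<theta> \<in> cube")
        case True
        have "?f * l2 (?D \<theta>) \<le> ?f * (ennreal (4 * K ^ 3) * (l1_shift \<phi> \<theta> + l1_shift \<psi> \<theta>) * l2 U)"
          by (intro mult_left_mono samp_op_translate_close K b U fin) auto
        also have "\<dots> \<le> ?f * (ennreal (4 * K ^ 3) * (ennreal (2 * e) + ennreal T * ennreal (torus_dist \<theta>)) * l2 U)"
          by (intro mult_left_mono mult_right_mono tau True) auto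
        also have "\<dots> = (ennreal (4 * K ^ 3) * l2 U) * (ennreal (2 * e) * ?f + ennreal T * (?f * ennreal (torus_dist \<theta>)))"
          by (simp add: algebra_simps)
        finally show ?thesis .
      qed simp
    qed
    also have "\<dots> = (ennreal (4 * K ^ 3) * l2 U) * (ennreal (2 * e) * (\<integral>\<^sup>+(\<theta>::real ^ 'n). ennreal (indicator cube \<theta> * fejer M \<theta>) \<partial>lborel)
        + ennreal T * (\<integral>\<^sup>+(\<theta>::real ^ 'n). ennreal (indicator cube \<theta> * fejer M \<theta>) * ennreal (torus_dist \<theta>) \<partial>lborel))"
      by (subst nn_integral_cmult, measurable) (subst nn_integral_add, measurable, simp add: nn_integral_cmult)
    also have "\<dots> = (ennreal (4 * K ^ 3) * l2 U) * (ennreal (2 * e) + ennreal T * ennreal (?s M))"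
      unfolding fejer_mass(1)[OF Mp] fejer_torus_dist[OF Mp] by simp
    also have "\<dots> \<le> (ennreal (4 * K ^ 3) * l2 U) * (ennreal (2 * e) + ennreal (2 * e))"
    proof -
      have "0 \<le> ?s M" using fejer_coeff_bounds(2) by (intro sum_nonneg) (simp add: algebra_simps)
      then have "ennreal T * ennreal (?s M) = ennreal (T * ?s M)" using T by (simp add: ennreal_mult)
      also have "\<dots> \<le> ennreal (2 * e)" using M0[of M] M by (intro ennreal_leI) auto
      finally show ?thesis by (intro mult_left_mono add_mono) auto
    qed
    also have "\<dots> = ennreal \<eta> * l2 U"
    proof -
      have "ennreal (2 * e) + ennreal (2 * e) = ennreal (4 * e)" using e by (simp add: ennreal_plus[symmetric] del: ennreal_plus)
      moreover have "ennreal (4 * K ^ 3) * ennreal (4 * e) = ennreal \<eta>"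
        using K e by (simp add: ennreal_mult[symmetric] e_def)
      ultimately show ?thesis by (metis mult.assoc mult.commute)
    qed
    finally show ?thesis .
  qed
  then show ?thesis by (intro exI[of _ "max 1 M0"]) auto
qed

section \<open>The Wigner distribution in microscopic variables\<close>

text \<open>An L2 isometry which turns sampling followed by reconstruction at scale h into
  \<open>samp_op\<close>, an operator that does not depend on h.\<close>

definition micro :: "real \<Rightarrow> ('a::euclidean_space \<Rightarrow> complex) \<Rightarrow> 'a \<Rightarrow> complex" where
  "micro h u y = of_real (sqrt (h ^ DIM('a))) * u (h *\<^sub>R y)"

lemma micro_measurable [measurable]:
  assumes [measurable]: "u \<in> borel_measurable borel"
  shows "micro h u \<in> borel_measurable borel"
  unfolding micro_def[abs_def] by measurable

lemma l2_micro:
  fixes u :: "'a::euclidean_space \<Rightarrow> complex"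
  assumes [measurable]: "u \<in> borel_measurable borel" and h: "0 < h"
  shows "l2 (micro h u) = l2 u"
proof -
  have "l2 (micro h u) = (\<integral>\<^sup>+y. ennreal (h ^ DIM('a)) * ennreal ((norm (u (h *\<^sub>R y)))\<^sup>2) \<partial>lborel)"
    unfolding l2_def micro_def using h by (simp add: norm_mult power_mult_distrib ennreal_mult)
  also have "\<dots> = ennreal (h ^ DIM('a)) * (\<integral>\<^sup>+y. ennreal ((norm (u (h *\<^sub>R y)))\<^sup>2) \<partial>lborel)"
    by (rule nn_integral_cmult) measurable
  also have "\<dots> = l2 u" unfolding l2_def by (rule nn_integral_scaled[OF _ h]) measurable
  finally show ?thesis .
qed

lemma integral_lebesgue_borel:
  fixes f :: "'a::euclidean_space \<Rightarrow> complex"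
  assumes "f \<in> borel_measurable borel"
  shows "(LINT x|lebesgue. f x) = (LINT x|lborel. f x)"
  using assms by (intro integral_completion) simp

lemma fourier_eq_ft:
  fixes f :: "'a::euclidean_space \<Rightarrow> complex"
  assumes [measurable]: "f \<in> borel_measurable borel"
  shows "fourier f = ft f"
  unfolding fourier_def[abs_def] ft_def[abs_def] by (intro ext integral_lebesgue_borel) measurable

lemma wigner_kernel_integrable:
  fixes a :: "'a::euclidean_space \<times> 'a \<Rightarrow> complex"
  assumes a: "schwartz a" and U[measurable]: "U \<in> borel_measurable borel" and fin: "l2 U < \<infinity>"
  shows "integrable lborel (\<lambda>p. cnj (U (fst p)) * U (snd p) * pft a (h *\<^sub>R fst p) (snd p - fst p))"
proof (rule integrableI_bounded)
  let ?N = "Suc DIM('a)"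
  note [measurable] = schwartz_measurable[OF a]
  obtain P where P: "0 \<le> P" "\<And>x z. norm (pft a x z) \<le> P * wt (real ?N) z" using pft_decay[OF a] by metis
  have "(\<integral>\<^sup>+p. ennreal (norm (cnj (U (fst p)) * U (snd p) * pft a (h *\<^sub>R fst p) (snd p - fst p))) \<partial>lborel)
    \<le> (\<integral>\<^sup>+p. ennreal (norm (U (fst p)) * norm (U (snd p))) * (ennreal P * ennreal (wt (real ?N) (snd p - fst p))) \<partial>lborel)"
    using P by (intro nn_integral_mono) (auto simp: norm_mult ennreal_mult[symmetric] simp del: of_nat_Suc intro!: ennreal_leI mult_left_mono)
  also have "\<dots> \<le> (\<integral>\<^sup>+(z::'a). ennreal P * ennreal (wt (real ?N) z) \<partial>lborel) * l2 U"
    by (rule bilinear_schur) measurable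
  also have "\<dots> = ennreal P * (\<integral>\<^sup>+(z::'a). ennreal (wt (real ?N) z) \<partial>lborel) * l2 U"
    by (subst nn_integral_cmult) auto
  also have "\<dots> < \<infinity>" using wt_integrable[where 'a='a, of "real ?N"] fin by (simp add: ennreal_mult_less_top)
  finally show "(\<integral>\<^sup>+p. ennreal (norm (cnj (U (fst p)) * U (snd p) * pft a (h *\<^sub>R fst p) (snd p - fst p))) \<partial>lborel) < \<infinity>" .
  show "(\<lambda>p. cnj (U (fst p)) * U (snd p) * pft a (h *\<^sub>R fst p) (snd p - fst p)) \<in> borel_measurable lborel"
    by measurable
qed

text \<open>The Fourier transform of the distribution is moved to the test function, where the
  oscillating phase becomes a translation and produces the partial transform at the difference of
  the points. The powers of h from dilation, change of variables and normalisation combine into the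
  two factors of \<open>micro\<close>.\<close>

lemma wigner_dist_eq:
  fixes a :: "'a::euclidean_space \<times> 'a \<Rightarrow> complex"
  assumes a: "schwartz a" and u[measurable]: "u \<in> borel_measurable borel" and fin: "l2 u < \<infinity>" and h: "0 < h"
  shows "wigner_dist h (distribution_of u) a = of_real (1 / (2 * pi) ^ DIM('a)) *
    (LINT p|lborel. cnj (micro h u (fst p)) * micro h u (snd p) * pft a (h *\<^sub>R fst p) (snd p - fst p))"
proof -
  note am[measurable] = schwartz_measurable[OF a]
  let ?d = "DIM('a)" and ?U = "micro h u"
  \<comment> \<open>The phase and the Fourier kernel combine to an exponential in y - x. The factor
    1 / h^d cancels against the one in \<open>dilate_dist\<close>.\<close>
  have F: "fourier (\<lambda>\<xi>. (case (x, h *\<^sub>R \<xi>) of (x, \<xi>) \<Rightarrow> cis ((x \<bullet> \<xi>) / h)) * a (x, h *\<^sub>R \<xi>)) y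
      = of_real (1 / h ^ ?d) * pft a x ((y - x) /\<^sub>R h)" for x y
  proof -
    have "fourier (\<lambda>\<xi>. (case (x, h *\<^sub>R \<xi>) of (x, \<xi>) \<Rightarrow> cis ((x \<bullet> \<xi>) / h)) * a (x, h *\<^sub>R \<xi>)) y
        = (LINT \<xi>|lborel. cis (x \<bullet> \<xi>) * a (x, h *\<^sub>R \<xi>) * cis (- (\<xi> \<bullet> y)))"
      unfolding fourier_def using h by (subst integral_lebesgue_borel) auto
    also have "\<dots> = (LINT \<xi>|lborel. (\<lambda>\<xi>. a (x, \<xi>) * cis (- (\<xi> \<bullet> ((y - x) /\<^sub>R h)))) (h *\<^sub>R \<xi>))"
    proof (rule Bochner_Integration.integral_cong[OF refl])
      fix \<xi>
      have "cis (x \<bullet> \<xi>) * cis (- (\<xi> \<bullet> y)) = cis (- ((h *\<^sub>R \<xi>) \<bullet> ((y - x) /\<^sub>R h)))"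
      proof -
        have "(h *\<^sub>R \<xi>) \<bullet> ((y - x) /\<^sub>R h) = \<xi> \<bullet> (y - x)" using h by simp
        then show ?thesis by (simp only: cis_mult) (simp add: inner_diff_right inner_commute)
      qed
      then show "cis (x \<bullet> \<xi>) * a (x, h *\<^sub>R \<xi>) * cis (- (\<xi> \<bullet> y)) = (\<lambda>\<xi>. a (x, \<xi>) * cis (- (\<xi> \<bullet> ((y - x) /\<^sub>R h)))) (h *\<^sub>R \<xi>)"
        by (simp add: mult_ac)
    qed
    also have "\<dots> = of_real (1 / h ^ ?d) * pft a x ((y - x) /\<^sub>R h)"
      unfolding pft_def by (rule integral_scaled[OF _ h]) measurable
    finally show ?thesis .
  qed
  define inner where "inner x = (LINT y|lborel. u y * pft a x ((y - x) /\<^sub>R h))" for x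
  have im[measurable]: "inner \<in> borel_measurable borel" unfolding inner_def[abs_def] by measurable
  have in1: "dilate_dist h (fourier_dist (distribution_of u)) (\<lambda>y. (case (x, y) of (x, \<xi>) \<Rightarrow> cis ((x \<bullet> \<xi>) / h)) * a (x, y)) = inner x" for x
  proof -
    have "dilate_dist h (fourier_dist (distribution_of u)) (\<lambda>y. (case (x, y) of (x, \<xi>) \<Rightarrow> cis ((x \<bullet> \<xi>) / h)) * a (x, y))
      = of_real (h ^ ?d) * (LINT y|lebesgue. u y * (of_real (1 / h ^ ?d) * pft a x ((y - x) /\<^sub>R h)))"
      unfolding dilate_dist_def fourier_dist_def distribution_of_def F ..
    also have "\<dots> = of_real (h ^ ?d) * (LINT y|lborel. u y * (of_real (1 / h ^ ?d) * pft a x ((y - x) /\<^sub>R h)))"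
      by (subst integral_lebesgue_borel) measurable
    also have "(LINT y|lborel. u y * (of_real (1 / h ^ ?d) * pft a x ((y - x) /\<^sub>R h))) = (LINT y|lborel. of_real (1 / h ^ ?d) * (u y * pft a x ((y - x) /\<^sub>R h)))"
      by (simp only: mult.left_commute)
    also have "\<dots> = of_real (1 / h ^ ?d) * inner x" unfolding inner_def by (rule integral_mult_right_zero)
    finally show ?thesis using h by simp
  qed
  have "wigner_dist h (distribution_of u) a = of_real (1 / (2 * pi * h) ^ ?d) * cnj (LINT x|lebesgue. u x * cnj (inner x))"
    unfolding wigner_dist_def mult_dist_def tensor_dist_def cnj_dist_def in1 distribution_of_def[of u "\<lambda>x. cnj (inner x)"] ..
  also have "(LINT x|lebesgue. u x * cnj (inner x)) = (LINT x|lborel. u x * cnj (inner x))"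
    by (rule integral_lebesgue_borel) measurable
  also have "cnj \<dots> = (LINT x|lborel. cnj (u x) * inner x)"
    unfolding Bochner_Integration.integral_cnj[symmetric] by simp
  also have "\<dots> = of_real (h ^ ?d) * (LINT x|lborel. cnj (u (h *\<^sub>R x)) * inner (h *\<^sub>R x))"
    using integral_lborel_affine[of "\<lambda>x. cnj (u x) * inner x" h 0] h by simp
  also have "(LINT x|lborel. cnj (u (h *\<^sub>R x)) * inner (h *\<^sub>R x)) = (LINT x|lborel. LINT y|lborel. cnj (?U x) * ?U y * pft a (h *\<^sub>R x) (y - x))"
  proof (rule Bochner_Integration.integral_cong[OF refl])
    fix x
    \<comment> \<open>The remaining factor h^d is shared equally by the two copies of
      \<open>micro\<close>.\<close>
    have sq: "complex_of_real (sqrt (h ^ ?d)) * of_real (sqrt (h ^ ?d)) = of_real (h ^ ?d)"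
      using h by (simp flip: of_real_mult)
    have "inner (h *\<^sub>R x) = of_real (h ^ ?d) * (LINT y|lborel. u (h *\<^sub>R y) * pft a (h *\<^sub>R x) (y - x))"
      unfolding inner_def using integral_lborel_affine[of "\<lambda>y. u y * pft a (h *\<^sub>R x) ((y - h *\<^sub>R x) /\<^sub>R h)" h 0] h
      by (simp add: scaleR_diff_right[symmetric])
    then have "cnj (u (h *\<^sub>R x)) * inner (h *\<^sub>R x) = (of_real (sqrt (h ^ ?d)) * of_real (sqrt (h ^ ?d))) * cnj (u (h *\<^sub>R x)) * (LINT y|lborel. u (h *\<^sub>R y) * pft a (h *\<^sub>R x) (y - x))"
      unfolding sq by simp
    also have "\<dots> = (LINT y|lborel. ((of_real (sqrt (h ^ ?d)) * of_real (sqrt (h ^ ?d))) * cnj (u (h *\<^sub>R x))) * (u (h *\<^sub>R y) * pft a (h *\<^sub>R x) (y - x)))"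
      by (rule integral_mult_right_zero[symmetric])
    finally show "cnj (u (h *\<^sub>R x)) * inner (h *\<^sub>R x) = (LINT y|lborel. cnj (?U x) * ?U y * pft a (h *\<^sub>R x) (y - x))"
      by (simp add: micro_def mult_ac)
  qed
  also have "\<dots> = (LINT p|lborel. cnj (?U (fst p)) * ?U (snd p) * pft a (h *\<^sub>R fst p) (snd p - fst p))"
    using fin by (subst integral_prod_lborel(1)[OF wigner_kernel_integrable[OF a]]) (auto simp: l2_micro h)
  finally show ?thesis using h by (simp add: power_mult_distrib)
qed

section \<open>Husimi functions and their limits\<close>

text \<open>The square of the constant is the factor (2\<pi>)^(-d) in the Wigner distribution. With
  parameter sqrt h the window has width h^(-1/2).\<close>

definition hus :: "real \<Rightarrow> ('a::euclidean_space \<Rightarrow> complex) \<Rightarrow> 'a \<times> 'a \<Rightarrow> complex" where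
  "hus h U z = of_real (1 / sqrt ((2 * pi) ^ DIM('a))) * stft (win (sqrt h)) U z"

text \<open>Only positions are rescaled: the Wigner distribution at scale h already reads the
  frequency \<xi>/h, which is \<xi> in microscopic variables.\<close>

definition macro :: "real \<Rightarrow> 'a::euclidean_space \<times> 'a \<Rightarrow> 'a \<times> 'a" where
  "macro h z = (h *\<^sub>R fst z, snd z)"

lemma macro_measurable [measurable]: "macro h \<in> measurable borel borel"
  unfolding macro_def[abs_def] by measurable

lemma hus_measurable [measurable]: "U \<in> borel_measurable borel \<Longrightarrow> hus h U \<in> borel_measurable borel"
  unfolding hus_def[abs_def] by (intro borel_measurable_times borel_measurable_const stft_measurable win_measurable) auto

lemma l2_cmult: "f \<in> borel_measurable borel \<Longrightarrow> l2 (\<lambda>x. c * f x) = ennreal ((norm c)\<^sup>2) * l2 f"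
  unfolding l2_def by (simp add: norm_mult power_mult_distrib ennreal_mult nn_integral_cmult)

lemma l2_mult_le:
  assumes [measurable]: "f \<in> borel_measurable borel" and "\<And>x. norm (g x) \<le> C"
  shows "l2 (\<lambda>x. g x * f x) \<le> ennreal (C\<^sup>2) * l2 f"
proof -
  have "l2 (\<lambda>x. g x * f x) \<le> (\<integral>\<^sup>+x. ennreal (C\<^sup>2) * ennreal ((norm (f x))\<^sup>2) \<partial>lborel)"
    unfolding l2_def using assms(2)
    by (intro nn_integral_mono) (auto simp: norm_mult power_mult_distrib ennreal_mult[symmetric] intro!: ennreal_leI mult_right_mono power_mono)
  then show ?thesis unfolding l2_def by (simp add: nn_integral_cmult)
qed

lemma hus_l2_bound:
  "\<exists>Q\<ge>0. \<forall>h U. 0 < h \<longrightarrow> U \<in> borel_measurable borel \<longrightarrow> l2 (U :: 'a::euclidean_space \<Rightarrow> complex) < \<infinity> \<longrightarrow> l2 (hus h U) \<le> ennreal Q * l2 U"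
proof -
  obtain Q where Q: "0 \<le> Q"
    "\<And>(\<gamma>::'a \<Rightarrow> real) U. \<gamma> \<in> borel_measurable borel \<Longrightarrow> U \<in> borel_measurable borel \<Longrightarrow>
      l2 U < \<infinity> \<Longrightarrow> (\<integral>\<^sup>+y. ennreal ((\<gamma> y)\<^sup>2) \<partial>lborel) < \<infinity> \<Longrightarrow>
       l2 (stft \<gamma> U) \<le> ennreal Q * (\<integral>\<^sup>+y. ennreal ((\<gamma> y)\<^sup>2) \<partial>lborel) * l2 U"
    using stft_l2_bound[where 'a='a] by (elim exE conjE) blast
  let ?c = "(norm (complex_of_real (1 / sqrt ((2 * pi) ^ DIM('a)))))\<^sup>2"
  have "l2 (hus h U) \<le> ennreal (?c * Q) * l2 U" if h: "0 < h" and U: "U \<in> borel_measurable borel" "l2 U < \<infinity>" for h and U :: "'a \<Rightarrow> complex"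
  proof -
    have w: "(\<integral>\<^sup>+(y::'a). ennreal ((win (sqrt h) y)\<^sup>2) \<partial>lborel) = 1" using h by (intro win_l2) simp
    have "l2 (hus h U) = ennreal ?c * l2 (stft (win (sqrt h)) U)"
      unfolding hus_def[abs_def] by (rule l2_cmult, rule stft_measurable) (use U in auto)
    also have "\<dots> \<le> ennreal ?c * (ennreal Q * 1 * l2 U)"
      using Q(2)[OF win_measurable U(1,2), of "sqrt h"] w by (intro mult_left_mono) auto
    also have "\<dots> = ennreal (?c * Q) * l2 U" using Q(1) by (simp only: ennreal_mult zero_le_power2 mult_1_right mult.assoc)
    finally show ?thesis .
  qed
  then show ?thesis using Q(1) by (intro exI[of _ "?c * Q"]) auto
qed

text \<open>The comparison of quadratic forms with s = sqrt h, valid once h is below 1. The error is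
  of order h^(1/4), uniformly over the bounded sequence.\<close>

lemma husimi_wigner:
  fixes u :: "nat \<Rightarrow> 'a::euclidean_space \<Rightarrow> complex" and a :: "'a \<times> 'a \<Rightarrow> complex"
  assumes a: "schwartz a" and h: "is_scale h"
    and u[measurable]: "\<And>k. u k \<in> borel_measurable borel" and B: "\<And>k. l2 (u k) \<le> ennreal B" "0 \<le> B"
  shows "(\<lambda>k. (LINT z|lborel. a (macro (h k) z) * of_real ((norm (hus (h k) (micro (h k) (u k)) z))\<^sup>2))
    - wigner_dist (h k) (distribution_of (u k)) a) \<longlonglongrightarrow> 0"
proof -
  have h0: "0 < h k" for k using h by (simp add: is_scale_def)
  have hl: "h \<longlonglongrightarrow> 0" using h by (simp add: is_scale_def)
  let ?c = "1 / (2 * pi) ^ DIM('a)"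
  obtain C where C: "0 \<le> C" "\<And>s U. 0 < s \<Longrightarrow> s \<le> 1 \<Longrightarrow> U \<in> borel_measurable borel \<Longrightarrow> l2 U < \<infinity> \<Longrightarrow>
    norm ((LINT z|lborel. a (s\<^sup>2 *\<^sub>R fst z, snd z) * of_real ((norm (stft (win s) U z))\<^sup>2))
       - (LINT p|lborel. cnj (U (fst p)) * U (snd p) * pft a (s\<^sup>2 *\<^sub>R fst p) (snd p - fst p)))
      \<le> C * sqrt s * enn2real (l2 U)"
    by (rule anti_wick[OF a]) blast
  have fin: "l2 (u k) < \<infinity>" for k using B(1)[of k] by (auto intro: order_le_less_trans)
  show ?thesis
  proof (rule Lim_null_comparison)
    have "eventually (\<lambda>k. h k < 1) sequentially" using hl by (intro order_tendstoD) auto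
    then show "eventually (\<lambda>k. norm ((LINT z|lborel. a (macro (h k) z) * of_real ((norm (hus (h k) (micro (h k) (u k)) z))\<^sup>2))
      - wigner_dist (h k) (distribution_of (u k)) a) \<le> ?c * (C * sqrt (sqrt (h k)) * B)) sequentially"
    proof eventually_elim
      fix k assume k: "h k < 1"
      let ?U = "micro (h k) (u k)" and ?s = "sqrt (h k)"
      have s: "0 < ?s" "?s \<le> 1" "?s\<^sup>2 = h k" using h0[of k] k by auto
      have lU: "l2 ?U = l2 (u k)" by (rule l2_micro[OF u h0])
      have "enn2real (l2 ?U) \<le> B" unfolding lU using B(1)[of k] B(2) by (simp add: enn2real_leI)
      then have Cb: "C * sqrt ?s * enn2real (l2 ?U) \<le> C * sqrt ?s * B"
        using C(1) s by (intro mult_left_mono) auto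
      have "(LINT z|lborel. a (macro (h k) z) * of_real ((norm (hus (h k) ?U z))\<^sup>2))
         = (LINT z|lborel. of_real ?c * (a (?s\<^sup>2 *\<^sub>R fst z, snd z) * of_real ((norm (stft (win ?s) ?U z))\<^sup>2)))"
        unfolding hus_def macro_def s(3) by (simp add: norm_mult norm_divide power_mult_distrib power_divide mult_ac)
      also have "\<dots> = of_real ?c * (LINT z|lborel. a (?s\<^sup>2 *\<^sub>R fst z, snd z) * of_real ((norm (stft (win ?s) ?U z))\<^sup>2))"
        by (rule integral_mult_right_zero)
      finally have "(LINT z|lborel. a (macro (h k) z) * of_real ((norm (hus (h k) ?U z))\<^sup>2)) - wigner_dist (h k) (distribution_of (u k)) a
        = of_real ?c * ((LINT z|lborel. a (?s\<^sup>2 *\<^sub>R fst z, snd z) * of_real ((norm (stft (win ?s) ?U z))\<^sup>2))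
          - (LINT p|lborel. cnj (?U (fst p)) * ?U (snd p) * pft a (?s\<^sup>2 *\<^sub>R fst p) (snd p - fst p)))"
        unfolding wigner_dist_eq[OF a u fin h0] s(3) by (simp only: right_diff_distrib)
      then have "norm ((LINT z|lborel. a (macro (h k) z) * of_real ((norm (hus (h k) ?U z))\<^sup>2)) - wigner_dist (h k) (distribution_of (u k)) a)
        = ?c * norm ((LINT z|lborel. a (?s\<^sup>2 *\<^sub>R fst z, snd z) * of_real ((norm (stft (win ?s) ?U z))\<^sup>2))
          - (LINT p|lborel. cnj (?U (fst p)) * ?U (snd p) * pft a (?s\<^sup>2 *\<^sub>R fst p) (snd p - fst p)))"
        by (simp only: norm_mult norm_of_real) simp
      also have "\<dots> \<le> ?c * (C * sqrt ?s * B)"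
        using fin[of k] by (intro mult_left_mono order_trans[OF C(2) Cb] s) (auto simp: lU)
      finally show "norm ((LINT z|lborel. a (macro (h k) z) * of_real ((norm (hus (h k) ?U z))\<^sup>2)) - wigner_dist (h k) (distribution_of (u k)) a)
        \<le> ?c * (C * sqrt ?s * B)" .
    qed
    have "(\<lambda>k. ?c * (C * sqrt (sqrt (h k)) * B)) \<longlonglongrightarrow> ?c * (C * sqrt (sqrt 0) * B)"
      by (intro tendsto_intros hl)
    then show "(\<lambda>k. ?c * (C * sqrt (sqrt (h k)) * B)) \<longlonglongrightarrow> 0" by simp
  qed
qed

text \<open>The squared moduli define positive measures, pushed forward to phase space by
  \<open>macro\<close>, with masses bounded by Q B. They have the same limits as the Wigner
  distributions on Schwartz functions, so \<open>vague_extension\<close> applies; in particular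
  \<mu> is finite, although a Wigner measure is only assumed to be Radon.\<close>

lemma husimi_vague:
  fixes u :: "nat \<Rightarrow> 'a::euclidean_space \<Rightarrow> complex"
  assumes h: "is_scale h" and u[measurable]: "\<And>k. u k \<in> borel_measurable borel" and B: "\<And>k. l2 (u k) \<le> ennreal B" "0 \<le> B"
    and \<mu>: "sets \<mu> = sets borel"
    and conv: "\<And>a. schwartz a \<Longrightarrow> integrable \<mu> a \<and> (\<lambda>k. wigner_dist (h k) (distribution_of (u k)) a) \<longlonglongrightarrow> (LINT z|\<mu>. a z)"
  shows "finite_measure \<mu>"
    and "vanishing b \<Longrightarrow> (\<lambda>k. LINT z|lborel. b (macro (h k) z) * of_real ((norm (hus (h k) (micro (h k) (u k)) z))\<^sup>2)) \<longlonglongrightarrow> (LINT z|\<mu>. b z)"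
proof -
  have h0: "0 < h k" for k using h by (simp add: is_scale_def)
  obtain Q where Q: "0 \<le> Q" "\<And>h U. 0 < h \<Longrightarrow> U \<in> borel_measurable borel \<Longrightarrow> l2 (U :: 'a \<Rightarrow> complex) < \<infinity> \<Longrightarrow> l2 (hus h U) \<le> ennreal Q * l2 U"
    using hus_l2_bound[where 'a='a] by blast
  let ?F = "\<lambda>k. hus (h k) (micro (h k) (u k))"
  define \<nu> where "\<nu> k = distr (density lborel (\<lambda>z. ennreal ((norm (?F k z))\<^sup>2))) borel (macro (h k))" for k
  have fin: "l2 (u k) < \<infinity>" for k using B(1)[of k] by (auto intro: order_le_less_trans)
  have \<nu>s: "sets (\<nu> k) = sets borel" for k by (simp add: \<nu>_def)
  have \<nu>m: "emeasure (\<nu> k) UNIV \<le> ennreal (Q * B)" for k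
  proof -
    have "emeasure (\<nu> k) UNIV = l2 (?F k)"
      unfolding \<nu>_def l2_def by (subst emeasure_distr) (auto simp: emeasure_density)
    also have "\<dots> \<le> ennreal Q * l2 (micro (h k) (u k))"
      using fin[of k] by (intro Q(2) h0) (auto simp: l2_micro h0)
    also have "\<dots> \<le> ennreal Q * ennreal B" using B(1)[of k] by (simp add: l2_micro h0 mult_left_mono)
    finally show ?thesis using Q(1) B(2) by (simp add: ennreal_mult)
  qed
  have \<nu>i: "(LINT z|\<nu> k. b z) = (LINT z|lborel. b (macro (h k) z) * of_real ((norm (?F k z))\<^sup>2))"
    if [measurable]: "b \<in> borel_measurable borel" for k and b :: "'a \<times> 'a \<Rightarrow> complex"
    unfolding \<nu>_def by (simp add: integral_distr integral_density scaleR_conv_of_real mult.commute)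
  have c: "integrable \<mu> g \<and> (\<lambda>k. LINT z|\<nu> k. g z) \<longlonglongrightarrow> (LINT z|\<mu>. g z)" if g: "schwartz g" for g
  proof -
    have "(\<lambda>k. (LINT z|lborel. g (macro (h k) z) * of_real ((norm (?F k z))\<^sup>2)) - wigner_dist (h k) (distribution_of (u k)) g + wigner_dist (h k) (distribution_of (u k)) g) \<longlonglongrightarrow> 0 + (LINT z|\<mu>. g z)"
      using conv[OF g] by (intro tendsto_add husimi_wigner[OF g h u B]) auto
    then show ?thesis using conv[OF g] by (simp add: \<nu>i[OF schwartz_measurable[OF g]])
  qed
  have QB: "0 \<le> Q * B" using Q(1) B(2) by simp
  note ve = vague_extension[OF \<nu>s \<nu>m QB \<mu> c]
  show "finite_measure \<mu>" by (rule finite_measureI_le[OF \<mu> ve(1)])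
  assume b: "vanishing b"
  show "(\<lambda>k. LINT z|lborel. b (macro (h k) z) * of_real ((norm (hus (h k) (micro (h k) (u k)) z))\<^sup>2)) \<longlonglongrightarrow> (LINT z|\<mu>. b z)"
    using ve(2)[OF _ b] by (simp add: \<nu>i[OF vanishing_measurable[OF b]])
qed

section \<open>Fourier transforms of integrable functions\<close>

lemma ft_bounded:
  assumes "integrable lborel f"
  shows "norm (ft f \<xi>) \<le> (LINT x|lborel. norm (f x))"
  unfolding ft_def by (rule order_trans[OF integral_norm_bound]) (simp add: norm_mult)

lemma ft_continuous:
  fixes f :: "'a::euclidean_space \<Rightarrow> complex"
  assumes f: "integrable lborel f"
  shows "continuous_on UNIV (ft f)"
proof (rule continuous_at_imp_continuous_on, rule ballI)
  fix \<xi> :: 'a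
  have [measurable]: "f \<in> borel_measurable borel" using f by (auto simp: borel_measurable_integrable)
  show "isCont (ft f) \<xi>"
    unfolding continuous_at_sequentially comp_def
  proof (intro allI impI)
    fix x assume x: "x \<longlonglongrightarrow> \<xi>"
    show "(\<lambda>n. ft f (x n)) \<longlonglongrightarrow> ft f \<xi>"
      unfolding ft_def
    proof (rule integral_dominated_convergence[where w = "\<lambda>y. norm (f y)"])
      show "AE y in lborel. (\<lambda>n. f y * cis (- (y \<bullet> x n))) \<longlonglongrightarrow> f y * cis (- (y \<bullet> \<xi>))"
      proof (intro AE_I2 tendsto_mult_left)
        fix y
        have "(\<lambda>n. cis (- (y \<bullet> x n))) \<longlonglongrightarrow> cis (- (y \<bullet> \<xi>))"
          unfolding cis_conv_exp by (intro tendsto_intros x)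
        then show "(\<lambda>n. cis (- (y \<bullet> x n))) \<longlonglongrightarrow> cis (- (y \<bullet> \<xi>))" .
      qed
    qed (use f in \<open>auto simp: norm_mult\<close>)
  qed
qed

lemma ft_flip:
  assumes [measurable]: "\<phi> \<in> borel_measurable borel"
  shows "ft (flip \<phi>) \<xi> = cnj (ft \<phi> \<xi>)"
proof -
  have "cnj (ft \<phi> \<xi>) = (LINT x|lborel. cnj (\<phi> x * cis (- (x \<bullet> \<xi>))))"
    unfolding ft_def by (rule Bochner_Integration.integral_cnj[symmetric])
  also have "\<dots> = (LINT x|lborel. (\<lambda>x. cnj (\<phi> (- x)) * cis (- (x \<bullet> \<xi>))) (0 - x))"
    by (simp add: cis_cnj)
  also have "\<dots> = (LINT x|lborel. cnj (\<phi> (- x)) * cis (- (x \<bullet> \<xi>)))"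
    by (rule integral_lborel_shift(3)) measurable
  finally show ?thesis unfolding ft_def flip_def by simp
qed

lemma vanishing_translate:
  assumes "vanishing b"
  shows "vanishing (\<lambda>z. b (z - v))"
proof -
  have "filterlim (\<lambda>z. - v + z) at_infinity at_infinity"
    by (rule tendsto_add_filterlim_at_infinity[OF tendsto_const filterlim_ident])
  then have "((\<lambda>z. b (- v + z)) \<longlongrightarrow> 0) at_infinity"
    using assms unfolding vanishing_def by (auto intro: filterlim_compose)
  moreover have "continuous_on UNIV (\<lambda>z. b (z - v))"
    using assms unfolding vanishing_def by (auto intro!: continuous_on_compose2[of UNIV b] continuous_intros)
  ultimately show ?thesis unfolding vanishing_def by (simp add: add.commute)
qed

section \<open>The frequency-shifted components\<close>

abbreviation freq :: "int ^ 'n \<Rightarrow> real ^ 'n" where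
  "freq n \<equiv> (2 * pi) *\<^sub>R of_ivec n"

text \<open>The n-th alias: the part of \<open>U\<close> at frequency \<xi> + 2\<pi>n that sampling
  makes appear at \<xi>.\<close>

definition component :: "(real ^ 'n \<Rightarrow> complex) \<Rightarrow> real \<Rightarrow> (real ^ 'n \<Rightarrow> complex) \<Rightarrow> int ^ 'n \<Rightarrow> (real ^ 'n) \<times> (real ^ 'n) \<Rightarrow> complex" where
  "component \<phi> h U n z = cnj (ft \<phi> (snd z + freq n)) * hus h U (fst z, snd z + freq n)"

lemma component_measurable [measurable]:
  assumes [measurable]: "\<phi> \<in> borel_measurable borel" "U \<in> borel_measurable borel"
  shows "component \<phi> h U n \<in> borel_measurable borel"
  unfolding component_def[abs_def] hus_def by measurable

lemma component_shift: "component \<phi> h U n z = (\<lambda>z. cnj (ft \<phi> (snd z)) * hus h U z) (z + (0, freq n))"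
  by (cases z) (simp add: component_def)

lemma component_l2:
  assumes [measurable]: "\<phi> \<in> borel_measurable borel" "U \<in> borel_measurable borel" and K: "\<And>\<xi>. norm (ft \<phi> \<xi>) \<le> K"
  shows "l2 (component \<phi> h U n) \<le> ennreal (K\<^sup>2) * l2 (hus h U)"
proof -
  have "l2 (component \<phi> h U n) = l2 (\<lambda>z. cnj (ft \<phi> (snd z)) * hus h U z)"
    unfolding l2_def component_shift
    by (rule nn_integral_lborel_shift(1)[of "\<lambda>z. ennreal ((norm (cnj (ft \<phi> (snd z)) * hus h U z))\<^sup>2)"]) measurable
  also have "\<dots> \<le> ennreal (K\<^sup>2) * l2 (hus h U)"
    using K by (intro l2_mult_le) auto
  finally show ?thesis .
qed

lemma weighted_shift_integral:
  fixes b :: "(real ^ 'n) \<times> (real ^ 'n) \<Rightarrow> complex"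
  assumes [measurable]: "\<phi> \<in> borel_measurable borel" "b \<in> borel_measurable borel" and \<mu>[measurable_cong]: "sets \<mu> = sets borel"
  shows "(LINT z|weighted_shift \<phi> \<mu> n. b z) = (LINT z|\<mu>. b (z - (0, freq n)) * of_real ((norm (ft \<phi> (snd z)))\<^sup>2))"
  unfolding weighted_shift_def shift_measure_def fourier_eq_ft[OF assms(1)] split_beta'
  by (subst integral_density) (auto simp: integral_distr scaleR_conv_of_real mult.commute minus_prod_def)

text \<open>\<open>macro\<close> leaves frequencies alone, so the frequency shift can be moved from
  the component to the test function by translation of the integral. The weight from \<phi> is
  bounded and continuous, hence the new test function still vanishes at infinity.\<close>

lemma component_limit:
  fixes u :: "nat \<Rightarrow> real ^ 'n \<Rightarrow> complex"
  assumes \<phi>: "integrable lborel \<phi>" and u: "\<And>k. u k \<in> borel_measurable borel" and \<mu>: "sets \<mu> = sets borel"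
    and lim: "\<And>b. vanishing b \<Longrightarrow> (\<lambda>k. LINT z|lborel. b (macro (h k) z) * of_real ((norm (hus (h k) (micro (h k) (u k)) z))\<^sup>2)) \<longlonglongrightarrow> (LINT z|\<mu>. b z)"
    and b: "vanishing b"
  shows "(\<lambda>k. LINT z|lborel. b (macro (h k) z) * of_real ((norm (component \<phi> (h k) (micro (h k) (u k)) n z))\<^sup>2)) \<longlonglongrightarrow> (LINT z|weighted_shift \<phi> \<mu> n. b z)"
proof -
  have [measurable]: "\<phi> \<in> borel_measurable borel" using \<phi> by (auto simp: borel_measurable_integrable)
  note [measurable] = u vanishing_measurable[OF b]
  let ?b = "\<lambda>z. b (z - (0, freq n)) * of_real ((norm (ft \<phi> (snd z)))\<^sup>2)"
  have vb: "vanishing ?b"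
  proof (rule vanishing_mult[OF vanishing_translate[OF b]])
    show "continuous_on UNIV (\<lambda>z::(real ^ 'n) \<times> (real ^ 'n). complex_of_real ((norm (ft \<phi> (snd z)))\<^sup>2))"
      by (intro continuous_intros continuous_on_compose2[OF ft_continuous[OF \<phi>]]) auto
    show "norm (complex_of_real ((norm (ft \<phi> (snd z)))\<^sup>2)) \<le> (LINT x|lborel. norm (\<phi> x))\<^sup>2" for z :: "(real ^ 'n) \<times> (real ^ 'n)"
      using ft_bounded[OF \<phi>, of "snd z"] by (simp add: power_mono norm_power)
  qed
  have "(LINT z|lborel. ?b (macro (h k) z) * of_real ((norm (hus (h k) (micro (h k) (u k)) z))\<^sup>2))
      = (LINT z|lborel. b (macro (h k) z) * of_real ((norm (component \<phi> (h k) (micro (h k) (u k)) n z))\<^sup>2))" for k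
  proof -
    let ?g = "\<lambda>z. ?b (macro (h k) z) * of_real ((norm (hus (h k) (micro (h k) (u k)) z))\<^sup>2)"
    have gm: "?g \<in> borel_measurable borel" by measurable
    have "(LINT z|lborel. ?g z) = (LINT z|lborel. ?g (z + (0, freq n)))"
      by (rule integral_lborel_shift(1)[OF gm, symmetric])
    also have "\<dots> = (LINT z|lborel. b (macro (h k) z) * of_real ((norm (component \<phi> (h k) (micro (h k) (u k)) n z))\<^sup>2))"
      unfolding component_shift by (intro Bochner_Integration.integral_cong refl) (simp add: macro_def norm_mult power_mult_distrib split: prod.split)
    finally show ?thesis .
  qed
  then show ?thesis
    using lim[OF vb] unfolding weighted_shift_integral[OF \<open>\<phi> \<in> borel_measurable borel\<close> vanishing_measurable[OF b] \<mu>] by simp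
qed

section \<open>Husimi functions of the averaged sampling operators\<close>

lemma stft_sum:
  fixes f :: "'i \<Rightarrow> 'a::euclidean_space \<Rightarrow> complex"
  assumes "\<And>i. i \<in> I \<Longrightarrow> f i \<in> borel_measurable borel" "\<And>i. i \<in> I \<Longrightarrow> l2 (f i) < \<infinity>"
    and "\<gamma> \<in> borel_measurable borel" "(\<integral>\<^sup>+y. ennreal ((\<gamma> y)\<^sup>2) \<partial>lborel) < \<infinity>"
  shows "stft \<gamma> (\<lambda>y. \<Sum>i\<in>I. c i * f i y) z = (\<Sum>i\<in>I. c i * stft \<gamma> (f i) z)"
proof -
  have "stft \<gamma> (\<lambda>y. \<Sum>i\<in>I. c i * f i y) z = (LINT y|lborel. (\<Sum>i\<in>I. c i * (f i y * of_real (\<gamma> (y - fst z)) * cis (- (y \<bullet> snd z)))))"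
    unfolding stft_def by (simp add: sum_distrib_right mult.assoc)
  also have "\<dots> = (\<Sum>i\<in>I. LINT y|lborel. c i * (f i y * of_real (\<gamma> (y - fst z)) * cis (- (y \<bullet> snd z))))"
    using assms by (intro Bochner_Integration.integral_sum integrable_mult_right stft_integrable)
  finally show ?thesis unfolding stft_def integral_mult_right_zero .
qed

lemma hus_diff:
  fixes U V :: "'a::euclidean_space \<Rightarrow> complex"
  assumes "U \<in> borel_measurable borel" "V \<in> borel_measurable borel" "l2 U < \<infinity>" "l2 V < \<infinity>" "0 < h"
  shows "hus h (\<lambda>x. U x - V x) z = hus h U z - hus h V z"
proof -
  \<comment> \<open>The difference is written as a sum over two indices with coefficients 1 and -1,
    so that \<open>stft_sum\<close> covers it.\<close>
  have "stft (win (sqrt h)) (\<lambda>y. \<Sum>b\<in>(UNIV :: bool set). (if b then 1 else -1) * (if b then U else V) y) z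
    = (\<Sum>b\<in>(UNIV :: bool set). (if b then 1 else -1) * stft (win (sqrt h)) (if b then U else V) z)"
    using assms by (intro stft_sum win_measurable) (auto simp: win_l2)
  then have "stft (win (sqrt h)) (\<lambda>y. U y - V y) z = stft (win (sqrt h)) U z - stft (win (sqrt h)) V z"
    by (simp add: UNIV_bool algebra_simps)
  then show ?thesis unfolding hus_def by (simp only: right_diff_distrib)
qed

lemma l2_sum_le:
  fixes f :: "'i \<Rightarrow> 'a::euclidean_space \<Rightarrow> complex"
  assumes I: "finite I" and [measurable]: "\<And>i. f i \<in> borel_measurable borel" and D: "\<And>i. l2 (f i) \<le> D"
  shows "l2 (\<lambda>x. \<Sum>i\<in>I. f i x) \<le> ennreal ((real (card I))\<^sup>2) * D"
proof -
  have "l2 (\<lambda>x. \<Sum>i\<in>I. f i x) \<le> (\<integral>\<^sup>+x. ennreal (real (card I)) * (\<Sum>i\<in>I. ennreal ((norm (f i x))\<^sup>2)) \<partial>lborel)"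
    unfolding l2_def
  proof (rule nn_integral_mono)
    fix x
    have "(norm (\<Sum>i\<in>I. f i x))\<^sup>2 \<le> (\<Sum>i\<in>I. norm (f i x))\<^sup>2" by (intro power_mono norm_sum) auto
    also have "\<dots> \<le> (\<Sum>i\<in>I. (norm (f i x))\<^sup>2) * real (card I)" by (rule sum_squared_le_sum_of_squares)
    finally have "ennreal ((norm (\<Sum>i\<in>I. f i x))\<^sup>2) \<le> ennreal (real (card I) * (\<Sum>i\<in>I. (norm (f i x))\<^sup>2))"
      by (intro ennreal_leI) (simp add: mult.commute)
    also have "\<dots> = ennreal (real (card I)) * (\<Sum>i\<in>I. ennreal ((norm (f i x))\<^sup>2))"
      by (subst ennreal_mult) (auto simp: sum_nonneg sum_ennreal)
    finally show "ennreal ((norm (\<Sum>i\<in>I. f i x))\<^sup>2) \<le> ennreal (real (card I)) * (\<Sum>i\<in>I. ennreal ((norm (f i x))\<^sup>2))" .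
  qed
  also have "\<dots> = ennreal (real (card I)) * (\<Sum>i\<in>I. l2 (f i))"
    unfolding l2_def by (subst nn_integral_cmult, measurable) (subst nn_integral_sum, measurable)
  also have "\<dots> \<le> ennreal (real (card I)) * (\<Sum>i\<in>I. D)" by (intro mult_left_mono sum_mono D) auto
  also have "\<dots> = ennreal ((real (card I))\<^sup>2) * D"
    by (simp add: power2_eq_square ennreal_mult mult.assoc flip: ennreal_of_nat_eq_real_of_nat)
  finally show ?thesis .
qed

text \<open>Commuting the transform past \<psi> leaves \<open>D1\<close>, past \<phi> leaves
  \<open>D2\<close>. The trigonometric polynomial is handled exactly and produces copies of
  \<open>D2\<close> shifted in frequency, all of the same norm. The error bound depends on
  \<open>M\<close>, which is harmless because \<open>M\<close> is fixed while \<open>k\<close> tends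
  to infinity.\<close>

lemma hus_fejer_op:
  fixes \<phi> \<psi> :: "real ^ 'n \<Rightarrow> complex"
  assumes \<phi>: "integrable lborel \<phi>" and \<psi>: "integrable lborel \<psi>" and h: "is_scale h"
  shows "\<exists>E. (\<forall>k. 0 \<le> E k) \<and> E \<longlonglongrightarrow> (0::real) \<and> (\<forall>k U. U \<in> borel_measurable borel \<longrightarrow> l2 U < \<infinity> \<longrightarrow>
    l2 (\<lambda>z. hus (h k) (fejer_op M \<phi> \<psi> U) z - ft \<psi> (snd z) * (\<Sum>n\<in>fejer_freqs M. of_real (fejer_coeff M n) * component \<phi> (h k) U n z))
      \<le> ennreal (E k) * l2 U)"
proof -
  have \<phi>m[measurable]: "\<phi> \<in> borel_measurable borel" and \<psi>m[measurable]: "\<psi> \<in> borel_measurable borel"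
    using \<phi> \<psi> by (auto simp: borel_measurable_integrable)
  have h0: "0 < h k" for k using h by (simp add: is_scale_def)
  define s where "s k = sqrt (h k)" for k
  have s0: "0 < s k" for k using h0[of k] by (simp add: s_def)
  have "s \<longlonglongrightarrow> sqrt 0" unfolding s_def[abs_def] using h by (intro tendsto_intros) (simp add: is_scale_def)
  then have sl: "s \<longlonglongrightarrow> 0" by simp
  define R where "R = (LINT x|lborel. norm (\<phi> x))"
  have R0: "0 \<le> R" unfolding R_def by simp
  have fl: "(\<integral>\<^sup>+x. ennreal (norm (flip \<phi> x)) \<partial>lborel) = ennreal R"
  proof -
    have "(\<integral>\<^sup>+x. ennreal (norm (flip \<phi> x)) \<partial>lborel) = (\<integral>\<^sup>+x. ennreal (norm (\<phi> (0 - x))) \<partial>lborel)"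
      by (simp add: flip_def)
    also have "\<dots> = (\<integral>\<^sup>+x. ennreal (norm (\<phi> x)) \<partial>lborel)" by (rule nn_integral_lborel_shift(3)) measurable
    also have "\<dots> = ennreal R" unfolding R_def using \<phi> by (intro nn_integral_eq_integral) auto
    finally show ?thesis .
  qed
  have fli: "integrable lborel (flip \<phi>)" by (rule integrableI_bounded) (auto simp: fl)
  obtain E1 where E1: "\<And>k. 0 \<le> E1 k" "E1 \<longlonglongrightarrow> (0::real)"
    "\<And>k U. U \<in> borel_measurable borel \<Longrightarrow> l2 U < \<infinity> \<Longrightarrow>
      l2 (\<lambda>z. stft (win (s k)) (conv \<psi> U) z - ft \<psi> (snd z) * stft (win (s k)) U z) \<le> ennreal (E1 k) * l2 U"
    by (rule stft_conv_error[OF \<psi> s0 sl]) blast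
  obtain E2 where E2: "\<And>k. 0 \<le> E2 k" "E2 \<longlonglongrightarrow> (0::real)"
    "\<And>k U. U \<in> borel_measurable borel \<Longrightarrow> l2 U < \<infinity> \<Longrightarrow>
      l2 (\<lambda>z. stft (win (s k)) (conv (flip \<phi>) U) z - ft (flip \<phi>) (snd z) * stft (win (s k)) U z) \<le> ennreal (E2 k) * l2 U"
    by (rule stft_conv_error[OF fli s0 sl]) blast
  obtain C where C: "\<And>t::real ^ 'n. fejer M t \<le> C" by (rule fejer_bounded) blast
  have C0: "0 \<le> C" using C[of 0] fejer_nonneg[of M "0 :: real ^ 'n"] by linarith
  define K where "K = (LINT x|lborel. norm (\<psi> x))"
  have K: "norm (ft \<psi> \<xi>) \<le> K" for \<xi> unfolding K_def by (rule ft_bounded[OF \<psi>])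
  let ?I = "fejer_freqs M :: (int ^ 'n) set"
  define q where "q = (norm (complex_of_real (1 / sqrt ((2 * pi) ^ DIM(real ^ 'n)))))\<^sup>2"
  \<comment> \<open>The first commutator acts after the Fejer multiplication and the convolution
    with \<phi>, hence C^2 R^2. The second occurs once per frequency, hence the squared cardinality,
    and is multiplied by the transform of \<psi>, hence K^2.\<close>
  define E where "E k = q * (2 * (E1 k * (C\<^sup>2 * R\<^sup>2)) + 2 * (K\<^sup>2 * ((real (card ?I))\<^sup>2 * E2 k)))" for k
  have q0: "0 \<le> q" by (simp add: q_def)
  have "E \<longlonglongrightarrow> q * (2 * (0 * (C\<^sup>2 * R\<^sup>2)) + 2 * (K\<^sup>2 * ((real (card ?I))\<^sup>2 * 0)))"
    unfolding E_def[abs_def] by (intro tendsto_intros E1 E2)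
  then have El: "E \<longlonglongrightarrow> 0" by simp
  have E0: "0 \<le> E k" for k using E1(1)[of k] E2(1)[of k] q0 by (simp add: E_def)
  have "l2 (\<lambda>z. hus (h k) (fejer_op M \<phi> \<psi> U) z - ft \<psi> (snd z) * (\<Sum>n\<in>?I. of_real (fejer_coeff M n) * component \<phi> (h k) U n z))
      \<le> ennreal (E k) * l2 U" if U[measurable]: "U \<in> borel_measurable borel" and fin: "l2 U < \<infinity>" for k U
  proof -
    define W where "W = conv (flip \<phi>) U"
    have Wm[measurable]: "W \<in> borel_measurable borel" unfolding W_def by measurable
    have lW: "l2 W \<le> ennreal (R\<^sup>2) * l2 U"
      using l2_conv[of "flip \<phi>" U] R0 unfolding W_def fl by (simp add: ennreal_power)
    define G where "G t = of_real (fejer M t) * W t" for t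
    have Gm[measurable]: "G \<in> borel_measurable borel" unfolding G_def[abs_def] by measurable
    have "l2 G \<le> ennreal (C\<^sup>2) * l2 W"
      unfolding G_def[abs_def] using C by (intro l2_mult_le Wm) (simp add: fejer_nonneg)
    also have "\<dots> \<le> ennreal (C\<^sup>2) * (ennreal (R\<^sup>2) * l2 U)" by (intro mult_left_mono lW) auto
    finally have lG: "l2 G \<le> ennreal (C\<^sup>2 * R\<^sup>2) * l2 U" by (simp add: ennreal_mult mult.assoc)
    have finW: "l2 W < \<infinity>" using order_le_less_trans[OF lW, of \<infinity>] fin by (simp add: ennreal_mult_less_top)
    have finG: "l2 G < \<infinity>" using order_le_less_trans[OF lG, of \<infinity>] fin by (simp add: ennreal_mult_less_top)
    define S where "S = stft (win (s k) :: real ^ 'n \<Rightarrow> real)"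
    have Sm[measurable]: "S V \<in> borel_measurable borel" if "V \<in> borel_measurable borel" for V
      unfolding S_def using that by (intro stft_measurable win_measurable) auto
    have G: "G = (\<lambda>y. \<Sum>n\<in>?I. of_real (fejer_coeff M n) * (cis (- (y \<bullet> freq n)) * W y))"
    proof
      fix y :: "real ^ 'n"
      have "cnj (char_ivec n y) = cis (- (y \<bullet> freq n))" for n
        unfolding char_ivec_def by (simp add: cis_cnj inner_commute)
      then show "G y = (\<Sum>n\<in>?I. of_real (fejer_coeff M n) * (cis (- (y \<bullet> freq n)) * W y))"
        unfolding G_def fejer_expand by (simp add: sum_distrib_right mult.assoc)
    qed
    have SG: "S G z = (\<Sum>n\<in>?I. of_real (fejer_coeff M n) * S W (fst z, snd z + freq n))" for z
    proof -
      have "S G z = (\<Sum>n\<in>?I. of_real (fejer_coeff M n) * S (\<lambda>y. cis (- (y \<bullet> freq n)) * W y) z)"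
        unfolding G S_def
      proof (rule stft_sum)
        fix n :: "int ^ 'n"
        show "(\<lambda>y. cis (- (y \<bullet> freq n)) * W y) \<in> borel_measurable borel" by measurable
        show "l2 (\<lambda>y. cis (- (y \<bullet> freq n)) * W y) < \<infinity>" using finW by (simp add: l2_def norm_mult)
      qed (auto simp: win_l2 s0)
      then show ?thesis unfolding S_def stft_modulate .
    qed
    define D1 where "D1 z = S (conv \<psi> G) z - ft \<psi> (snd z) * S G z" for z
    define D2 where "D2 z = S W z - ft (flip \<phi>) (snd z) * S U z" for z
    have D1m[measurable]: "D1 \<in> borel_measurable borel" unfolding D1_def[abs_def] by measurable
    have D2m[measurable]: "D2 \<in> borel_measurable borel" unfolding D2_def[abs_def] by measurable
    let ?D3 = "\<lambda>z. \<Sum>n\<in>?I. of_real (fejer_coeff M n) * D2 (z + (0, freq n))"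
    have l1: "l2 D1 \<le> ennreal (E1 k * (C\<^sup>2 * R\<^sup>2)) * l2 U"
    proof -
      have "l2 D1 \<le> ennreal (E1 k) * l2 G" unfolding D1_def[abs_def] S_def by (rule E1(3)[OF Gm finG])
      also have "\<dots> \<le> ennreal (E1 k) * (ennreal (C\<^sup>2 * R\<^sup>2) * l2 U)" by (intro mult_left_mono lG) auto
      finally show ?thesis using E1(1)[of k] by (simp add: ennreal_mult mult.assoc)
    qed
    have l2D: "l2 D2 \<le> ennreal (E2 k) * l2 U"
      unfolding D2_def[abs_def] S_def W_def by (rule E2(3)[OF U fin])
    have l3: "l2 (\<lambda>z. ft \<psi> (snd z) * ?D3 z) \<le> ennreal (K\<^sup>2 * ((real (card ?I))\<^sup>2 * E2 k)) * l2 U"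
    proof -
      have "l2 ?D3 \<le> ennreal ((real (card ?I))\<^sup>2) * (ennreal (E2 k) * l2 U)"
      proof (rule l2_sum_le[OF fejer_freqs_finite])
        fix n :: "int ^ 'n"
        have "l2 (\<lambda>z. of_real (fejer_coeff M n) * D2 (z + (0, freq n))) \<le> ennreal (1\<^sup>2) * l2 (\<lambda>z. D2 (z + (0, freq n)))"
          using fejer_coeff_bounds[of M n] by (intro l2_mult_le) auto
        also have "l2 (\<lambda>z. D2 (z + (0, freq n))) = l2 D2"
          unfolding l2_def by (rule nn_integral_lborel_shift(1)) measurable
        finally show "l2 (\<lambda>z. of_real (fejer_coeff M n) * D2 (z + (0, freq n))) \<le> ennreal (E2 k) * l2 U" using l2D by simp
        show "(\<lambda>z. of_real (fejer_coeff M n) * D2 (z + (0, freq n))) \<in> borel_measurable borel" by measurable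
      qed
      moreover have "l2 (\<lambda>z. ft \<psi> (snd z) * ?D3 z) \<le> ennreal (K\<^sup>2) * l2 ?D3"
        by (intro l2_mult_le K) measurable
      ultimately have "l2 (\<lambda>z. ft \<psi> (snd z) * ?D3 z) \<le> ennreal (K\<^sup>2) * (ennreal ((real (card ?I))\<^sup>2) * (ennreal (E2 k) * l2 U))"
        by (meson mult_left_mono order_trans zero_le)
      then show ?thesis using E2(1)[of k] by (simp add: ennreal_mult mult.assoc)
    qed
    have "hus (h k) (fejer_op M \<phi> \<psi> U) z - ft \<psi> (snd z) * (\<Sum>n\<in>?I. of_real (fejer_coeff M n) * component \<phi> (h k) U n z)
      = of_real (1 / sqrt ((2 * pi) ^ DIM(real ^ 'n))) * (D1 z + ft \<psi> (snd z) * ?D3 z)" for z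
    proof -
      let ?c = "complex_of_real (1 / sqrt ((2 * pi) ^ DIM(real ^ 'n)))"
      have f: "fejer_op M \<phi> \<psi> U = conv \<psi> G" unfolding fejer_op_def G_def[abs_def] W_def ..
      have c: "component \<phi> (h k) U n z = ?c * (S W (fst z, snd z + freq n) - D2 (z + (0, freq n)))" for n
        unfolding component_def hus_def D2_def S_def s_def ft_flip[OF \<phi>m] by (cases z) (simp add: mult.left_commute)
      have "D1 z + ft \<psi> (snd z) * ?D3 z = S (conv \<psi> G) z - ft \<psi> (snd z) * (\<Sum>n\<in>?I. of_real (fejer_coeff M n) * (S W (fst z, snd z + freq n) - D2 (z + (0, freq n))))"
        unfolding D1_def SG by (simp add: right_diff_distrib sum_subtractf)
      moreover have "(\<Sum>n\<in>?I. of_real (fejer_coeff M n) * component \<phi> (h k) U n z) = ?c * (\<Sum>n\<in>?I. of_real (fejer_coeff M n) * (S W (fst z, snd z + freq n) - D2 (z + (0, freq n))))"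
        unfolding c sum_distrib_left by (intro sum.cong refl mult.left_commute)
      ultimately show ?thesis
        unfolding f hus_def S_def s_def by (simp only: right_diff_distrib mult.left_commute)
    qed
    then have "l2 (\<lambda>z. hus (h k) (fejer_op M \<phi> \<psi> U) z - ft \<psi> (snd z) * (\<Sum>n\<in>?I. of_real (fejer_coeff M n) * component \<phi> (h k) U n z))
      = ennreal q * l2 (\<lambda>z. D1 z + ft \<psi> (snd z) * ?D3 z)"
      unfolding q_def by (simp only:) (rule l2_cmult, measurable)
    also have "\<dots> \<le> ennreal q * (2 * l2 D1 + 2 * l2 (\<lambda>z. ft \<psi> (snd z) * ?D3 z))"
    proof -
      have "(\<lambda>z. ft \<psi> (snd z) * ?D3 z) \<in> borel_measurable borel" by measurable
      then have "l2 (\<lambda>z. D1 z + ft \<psi> (snd z) * ?D3 z) \<le> 2 * l2 D1 + 2 * l2 (\<lambda>z. ft \<psi> (snd z) * ?D3 z)"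
        unfolding l2_def using D1m by (intro nn_integral_norm_add_square_le) simp_all
      then show ?thesis by (rule mult_left_mono) simp
    qed
    also have "\<dots> \<le> ennreal q * (2 * (ennreal (E1 k * (C\<^sup>2 * R\<^sup>2)) * l2 U) + 2 * (ennreal (K\<^sup>2 * ((real (card ?I))\<^sup>2 * E2 k)) * l2 U))"
      by (intro mult_left_mono add_mono l1 l3) auto
    also have "\<dots> = ennreal (E k) * l2 U"
    proof -
      have e: "0 \<le> E1 k * (C\<^sup>2 * R\<^sup>2)" "0 \<le> K\<^sup>2 * ((real (card ?I))\<^sup>2 * E2 k)" using E1(1)[of k] E2(1)[of k] by auto
      have "ennreal (q * (2 * x + 2 * y)) = ennreal q * (2 * ennreal x + 2 * ennreal y)" if "0 \<le> x" "0 \<le> y" for x y :: real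
        using that q0 by (simp add: ennreal_mult)
      note * = this[OF e]
      show ?thesis unfolding E_def * by (simp only: distrib_right distrib_left mult.assoc)
    qed
    finally show ?thesis .
  qed
  then show ?thesis using E0 El by (intro exI[of _ E]) blast
qed

section \<open>Quadratic limits of orthogonal components\<close>

text \<open>With d = |F - Z|, the difference of squares is at most 2 |F| d + d^2, and the mixed term
  is split by the arithmetic-geometric mean with free parameter e.\<close>

lemma norm_square_diff_le:
  fixes F Z :: complex
  assumes "0 < e"
  shows "\<bar>(norm F)\<^sup>2 - (norm Z)\<^sup>2\<bar> \<le> e * (norm F)\<^sup>2 + (1 + 1 / e) * (norm (F - Z))\<^sup>2"
proof -
  let ?d = "norm (F - Z)"
  have "\<bar>norm F - norm Z\<bar> \<le> ?d" by (rule norm_triangle_ineq3)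
  moreover have "norm Z \<le> norm F + ?d" using norm_triangle_ineq4[of F "F - Z"] by simp
  ultimately have "\<bar>norm F - norm Z\<bar> * (norm F + norm Z) \<le> ?d * (2 * norm F + ?d)" by (intro mult_mono) auto
  moreover have "\<bar>(norm F)\<^sup>2 - (norm Z)\<^sup>2\<bar> = \<bar>norm F - norm Z\<bar> * (norm F + norm Z)"
    by (simp add: power2_eq_square abs_mult[symmetric] square_diff_square_factored mult.commute flip: abs_mult)
      (simp add: abs_mult)
  moreover have "2 * norm F * ?d \<le> e * (norm F)\<^sup>2 + (1 / e) * ?d\<^sup>2"
  proof -
    have "0 \<le> (sqrt e * norm F - ?d / sqrt e)\<^sup>2" by simp
    also have "\<dots> = e * (norm F)\<^sup>2 + (1 / e) * ?d\<^sup>2 - 2 * norm F * ?d"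
      using assms by (simp add: power2_diff power_mult_distrib power_divide)
    finally show ?thesis by simp
  qed
  ultimately show ?thesis by (simp add: algebra_simps power2_eq_square)
qed

lemma integral_square_diff_le:
  fixes F Z a :: "'a::euclidean_space \<Rightarrow> complex"
  assumes [measurable]: "F \<in> borel_measurable borel" "Z \<in> borel_measurable borel" "a \<in> borel_measurable borel"
    and F: "l2 F \<le> ennreal L" "0 \<le> L" and D: "l2 (\<lambda>z. F z - Z z) \<le> ennreal \<delta>" "0 < \<delta>"
    and a: "\<And>z. norm (a z) \<le> A" and Z: "l2 Z < \<infinity>"
  shows "norm ((LINT z|lborel. a z * of_real ((norm (F z))\<^sup>2)) - (LINT z|lborel. a z * of_real ((norm (Z z))\<^sup>2)))
    \<le> A * (sqrt \<delta> * (L + 1) + \<delta>)"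
proof -
  have A: "0 \<le> A" using a[of 0] by (meson norm_ge_zero order_trans)
  have i: "integrable lborel (\<lambda>z. a z * of_real ((norm (f z))\<^sup>2))" if [measurable]: "f \<in> borel_measurable borel" and "l2 f < \<infinity>" for f
  proof (rule integrableI_bounded)
    have "(\<integral>\<^sup>+z. ennreal (norm (a z * of_real ((norm (f z))\<^sup>2))) \<partial>lborel) \<le> (\<integral>\<^sup>+z. ennreal A * ennreal ((norm (f z))\<^sup>2) \<partial>lborel)"
      using a A by (intro nn_integral_mono) (simp add: norm_mult norm_power ennreal_mult[symmetric] ennreal_leI mult_right_mono)
    also have "\<dots> < \<infinity>" using that(2) unfolding l2_def by (simp add: nn_integral_cmult ennreal_mult_less_top)
    finally show "(\<integral>\<^sup>+z. ennreal (norm (a z * of_real ((norm (f z))\<^sup>2))) \<partial>lborel) < \<infinity>" .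
  qed measurable
  have finF: "l2 F < \<infinity>" using F(1) by (auto intro: order_le_less_trans)
  \<comment> \<open>This choice balances the two parts: e L and \<delta>/e are both of order sqrt
    \<delta>.\<close>
  let ?e = "sqrt \<delta>"
  have e: "0 < ?e" using D by simp
  have "(LINT z|lborel. a z * of_real ((norm (F z))\<^sup>2)) - (LINT z|lborel. a z * of_real ((norm (Z z))\<^sup>2))
    = (LINT z|lborel. a z * of_real ((norm (F z))\<^sup>2) - a z * of_real ((norm (Z z))\<^sup>2))"
    using finF Z by (intro Bochner_Integration.integral_diff[symmetric] i) auto
  then have "ennreal (norm ((LINT z|lborel. a z * of_real ((norm (F z))\<^sup>2)) - (LINT z|lborel. a z * of_real ((norm (Z z))\<^sup>2))))
    \<le> (\<integral>\<^sup>+z. ennreal (norm (a z * of_real ((norm (F z))\<^sup>2) - a z * of_real ((norm (Z z))\<^sup>2))) \<partial>lborel)"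
    by (simp only: norm_integral_le_nn_integral)
  also have "\<dots> \<le> (\<integral>\<^sup>+z. ennreal A * (ennreal ?e * ennreal ((norm (F z))\<^sup>2) + ennreal (1 + 1 / ?e) * ennreal ((norm (F z - Z z))\<^sup>2)) \<partial>lborel)"
  proof (rule nn_integral_mono)
    fix z
    have "norm (a z * of_real ((norm (F z))\<^sup>2) - a z * of_real ((norm (Z z))\<^sup>2)) = norm (a z) * \<bar>(norm (F z))\<^sup>2 - (norm (Z z))\<^sup>2\<bar>"
      by (simp only: right_diff_distrib[symmetric] of_real_diff[symmetric] norm_mult norm_of_real)
    also have "\<dots> \<le> A * (?e * (norm (F z))\<^sup>2 + (1 + 1 / ?e) * (norm (F z - Z z))\<^sup>2)"
      using a[of z] A norm_square_diff_le[OF e, of "F z" "Z z"] by (intro mult_mono) auto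
    finally have "ennreal (norm (a z * of_real ((norm (F z))\<^sup>2) - a z * of_real ((norm (Z z))\<^sup>2))) \<le> ennreal (A * (?e * (norm (F z))\<^sup>2 + (1 + 1 / ?e) * (norm (F z - Z z))\<^sup>2))"
      by (rule ennreal_leI)
    also have "\<dots> = ennreal A * (ennreal ?e * ennreal ((norm (F z))\<^sup>2) + ennreal (1 + 1 / ?e) * ennreal ((norm (F z - Z z))\<^sup>2))"
      using A e by (simp only: ennreal_mult ennreal_plus zero_le_power2 mult_nonneg_nonneg add_nonneg_nonneg less_imp_le zero_le_one zero_le_divide_1_iff)
    finally show "ennreal (norm (a z * of_real ((norm (F z))\<^sup>2) - a z * of_real ((norm (Z z))\<^sup>2))) \<le> ennreal A * (ennreal ?e * ennreal ((norm (F z))\<^sup>2) + ennreal (1 + 1 / ?e) * ennreal ((norm (F z - Z z))\<^sup>2))" .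
  qed
  also have "\<dots> = ennreal A * (ennreal ?e * l2 F + ennreal (1 + 1 / ?e) * l2 (\<lambda>z. F z - Z z))"
    unfolding l2_def by (subst nn_integral_cmult, measurable) (subst nn_integral_add, measurable, simp add: nn_integral_cmult)
  also have "\<dots> \<le> ennreal A * (ennreal ?e * ennreal L + ennreal (1 + 1 / ?e) * ennreal \<delta>)"
    by (intro mult_left_mono add_mono F D) auto
  also have "\<dots> = ennreal (A * (?e * L + (1 + 1 / ?e) * \<delta>))"
    using A e F(2) D(2) by (simp only: ennreal_mult ennreal_plus mult_nonneg_nonneg add_nonneg_nonneg less_imp_le zero_le_one zero_le_divide_1_iff)
  also have "?e * L + (1 + 1 / ?e) * \<delta> = ?e * (L + 1) + \<delta>"
    using D(2) by (simp add: algebra_simps real_div_sqrt)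
  finally show ?thesis using A F(2) D(2) by (subst (asm) ennreal_le_iff) auto
qed

lemma weighted_shift_finite:
  assumes \<phi>: "integrable lborel \<phi>" and \<mu>: "sets \<mu> = sets borel" "finite_measure \<mu>"
  shows "sets (weighted_shift \<phi> \<mu> n) = sets borel" and "finite_measure (weighted_shift \<phi> \<mu> n)"
proof -
  have [measurable]: "\<phi> \<in> borel_measurable borel" using \<phi> by (auto simp: borel_measurable_integrable)
  note [measurable_cong] = \<mu>(1)
  interpret finite_measure \<mu> by fact
  let ?K = "LINT x|lborel. norm (\<phi> x)"
  show s: "sets (weighted_shift \<phi> \<mu> n) = sets borel" by (simp add: weighted_shift_def shift_measure_def)
  have "emeasure (weighted_shift \<phi> \<mu> n) UNIV = (\<integral>\<^sup>+z. ennreal ((norm (ft \<phi> (snd z)))\<^sup>2) \<partial>\<mu>)"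
    unfolding weighted_shift_def shift_measure_def fourier_eq_ft[OF \<open>\<phi> \<in> borel_measurable borel\<close>] split_beta'
    by (subst emeasure_density) (auto simp: nn_integral_distr)
  also have "\<dots> \<le> (\<integral>\<^sup>+z. ennreal (?K\<^sup>2) \<partial>\<mu>)"
    using ft_bounded[OF \<phi>] by (intro nn_integral_mono ennreal_leI power_mono) auto
  also have "\<dots> = ennreal (?K\<^sup>2) * emeasure \<mu> (space \<mu>)" by simp
  also have "\<dots> = ennreal (?K\<^sup>2 * measure \<mu> (space \<mu>))" by (simp add: emeasure_eq_measure ennreal_mult)
  finally show "finite_measure (weighted_shift \<phi> \<mu> n)" by (rule finite_measureI_le[OF s])
qed

lemma norm_square_sum:
  fixes f :: "'i \<Rightarrow> complex"
  shows "complex_of_real ((norm (\<Sum>i\<in>I. f i))\<^sup>2) = (\<Sum>i\<in>I. \<Sum>j\<in>I. cnj (f i) * f j)"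
  unfolding complex_norm_square cnj_sum sum_product by (subst sum.swap) (simp only: mult.commute)

text \<open>The square is expanded into finitely many pairs, the diagonal ones converging by
  \<open>component_limit\<close>. This is the only point at which mutual singularity enters;
  finiteness of \<open>I\<close> is what allows the pairs to be treated one at a time.\<close>

lemma combination_limit:
  fixes u :: "nat \<Rightarrow> real ^ 'n \<Rightarrow> complex"
  assumes \<phi>: "integrable lborel \<phi>" and h: "is_scale h"
    and u: "\<And>k. u k \<in> borel_measurable borel" and B: "\<And>k. l2 (u k) \<le> ennreal B" "0 \<le> B"
    and \<mu>: "sets \<mu> = sets borel" "finite_measure \<mu>"
    and lim: "\<And>b. vanishing b \<Longrightarrow> (\<lambda>k. LINT z|lborel. b (macro (h k) z) * of_real ((norm (hus (h k) (micro (h k) (u k)) z))\<^sup>2)) \<longlonglongrightarrow> (LINT z|\<mu>. b z)"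
    and sing: "\<And>m n. m \<noteq> n \<Longrightarrow> mutually_singular (weighted_shift \<phi> \<mu> m) (weighted_shift \<phi> \<mu> n)"
    and b: "vanishing b" and I: "finite I"
  shows "(\<lambda>k. LINT z|lborel. b (macro (h k) z) * of_real ((norm (\<Sum>n\<in>I. of_real (c n) * component \<phi> (h k) (micro (h k) (u k)) n z))\<^sup>2))
    \<longlonglongrightarrow> (\<Sum>n\<in>I. of_real ((c n)\<^sup>2) * (LINT z|weighted_shift \<phi> \<mu> n. b z))"
proof -
  have \<phi>m[measurable]: "\<phi> \<in> borel_measurable borel" using \<phi> by (auto simp: borel_measurable_integrable)
  note [measurable] = u vanishing_measurable[OF b]
  have h0: "0 < h k" for k using h by (simp add: is_scale_def)
  let ?f = "\<lambda>k. component \<phi> (h k) (micro (h k) (u k))"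
  obtain Q where Q: "0 \<le> Q" "\<And>h U. 0 < h \<Longrightarrow> U \<in> borel_measurable borel \<Longrightarrow> l2 (U :: real ^ 'n \<Rightarrow> complex) < \<infinity> \<Longrightarrow> l2 (hus h U) \<le> ennreal Q * l2 U"
    using hus_l2_bound[where 'a="real ^ 'n"] by blast
  define K where "K = (LINT x|lborel. norm (\<phi> x))"
  have fin: "l2 (u k) < \<infinity>" for k using B(1)[of k] by (auto intro: order_le_less_trans)
  have bd: "l2 (?f k n) \<le> ennreal (K\<^sup>2 * (Q * B))" for k n
  proof -
    have "l2 (?f k n) \<le> ennreal (K\<^sup>2) * l2 (hus (h k) (micro (h k) (u k)))"
      unfolding K_def by (intro component_l2 ft_bounded[OF \<phi>]) measurable
    also have "\<dots> \<le> ennreal (K\<^sup>2) * (ennreal Q * l2 (micro (h k) (u k)))"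
      using fin[of k] by (intro mult_left_mono Q(2) h0) (auto simp: l2_micro h0)
    also have "\<dots> \<le> ennreal (K\<^sup>2) * (ennreal Q * ennreal B)"
      using B(1)[of k] by (intro mult_left_mono) (auto simp: l2_micro h0)
    finally show ?thesis using Q(1) B(2) by (simp add: ennreal_mult)
  qed
  have bd0: "0 \<le> K\<^sup>2 * (Q * B)" using Q(1) B(2) by simp
  have bdf: "l2 (?f k n) < \<infinity>" for k n using bd[of k n] by (auto intro: order_le_less_trans)
  obtain A where A: "0 < A" "\<And>z. norm (b z) \<le> A" by (rule vanishing_bounded[OF b]) blast
  have fm[measurable]: "?f k n \<in> borel_measurable borel" for k n by measurable
  have int: "integrable lborel (\<lambda>z. b (macro (h k) z) * (cnj (?f k m z) * ?f k n z))" for k m n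
  proof -
    have "integrable lborel (\<lambda>z. (b (macro (h k) z) * cnj (?f k m z)) * ?f k n z)"
    proof (rule nn_integral_mult_integrable)
      have "l2 (\<lambda>z. b (macro (h k) z) * cnj (?f k m z)) \<le> ennreal (A\<^sup>2) * l2 (\<lambda>z. cnj (?f k m z))"
        by (rule l2_mult_le[OF _ A(2)]) measurable
      also have "\<dots> < \<infinity>" using bdf[of k m] by (simp add: l2_def ennreal_mult_less_top)
      finally show "(\<integral>\<^sup>+z. ennreal ((norm (b (macro (h k) z) * cnj (?f k m z)))\<^sup>2) \<partial>lborel) < \<infinity>" unfolding l2_def .
      show "(\<integral>\<^sup>+z. ennreal ((norm (?f k n z))\<^sup>2) \<partial>lborel) < \<infinity>" using bdf[of k n] unfolding l2_def .
    qed measurable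
    then show ?thesis by (simp only: mult.assoc)
  qed
  have eq: "(LINT z|lborel. b (macro (h k) z) * of_real ((norm (\<Sum>n\<in>I. of_real (c n) * ?f k n z))\<^sup>2))
    = (\<Sum>m\<in>I. \<Sum>n\<in>I. of_real (c m * c n) * (LINT z|lborel. b (macro (h k) z) * (cnj (?f k m z) * ?f k n z)))" for k
  proof -
    have "(LINT z|lborel. b (macro (h k) z) * of_real ((norm (\<Sum>n\<in>I. of_real (c n) * ?f k n z))\<^sup>2))
      = (LINT z|lborel. (\<Sum>m\<in>I. \<Sum>n\<in>I. of_real (c m * c n) * (b (macro (h k) z) * (cnj (?f k m z) * ?f k n z))))"
      unfolding norm_square_sum sum_distrib_left by (intro Bochner_Integration.integral_cong refl sum.cong) (simp add: mult_ac)
    also have "\<dots> = (\<Sum>m\<in>I. \<Sum>n\<in>I. LINT z|lborel. of_real (c m * c n) * (b (macro (h k) z) * (cnj (?f k m z) * ?f k n z)))"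
      by (subst Bochner_Integration.integral_sum, intro Bochner_Integration.integrable_sum integrable_mult_right int)
        (intro sum.cong refl Bochner_Integration.integral_sum integrable_mult_right int)
    finally show ?thesis unfolding integral_mult_right_zero .
  qed
  have cl: "(\<lambda>k. LINT z|lborel. b (macro (h k) z) * of_real ((norm (?f k n z))\<^sup>2)) \<longlonglongrightarrow> (LINT z|weighted_shift \<phi> \<mu> n. b z)"
    if "vanishing b" for n b
    by (rule component_limit[OF \<phi> u \<mu>(1) lim that])
  have "(\<lambda>k. LINT z|lborel. b (macro (h k) z) * (cnj (?f k m z) * ?f k n z)) \<longlonglongrightarrow> (if n = m then LINT z|weighted_shift \<phi> \<mu> n. b z else 0)" for m n
  proof (cases "n = m")
    case True
    have "cnj (?f k n z) * ?f k n z = of_real ((norm (?f k n z))\<^sup>2)" for k z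
      unfolding complex_norm_square by (rule mult.commute)
    then show ?thesis using cl[OF b, of n] unfolding True by simp
  next
    case False
    have "(\<lambda>k. LINT z|lborel. b (macro (h k) z) * (cnj (?f k m z) * ?f k n z)) \<longlonglongrightarrow> 0"
      by (rule singular_cross_term[OF fm fm macro_measurable bd bd bd0 weighted_shift_finite[OF \<phi> \<mu>] weighted_shift_finite[OF \<phi> \<mu>] cl cl sing b])
        (use False in auto)
    then show ?thesis using False by simp
  qed
  then have "(\<lambda>k. \<Sum>m\<in>I. \<Sum>n\<in>I. of_real (c m * c n) * (LINT z|lborel. b (macro (h k) z) * (cnj (?f k m z) * ?f k n z)))
     \<longlonglongrightarrow> (\<Sum>m\<in>I. \<Sum>n\<in>I. of_real (c m * c n) * (if n = m then LINT z|weighted_shift \<phi> \<mu> n. b z else 0))"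
    by (intro tendsto_sum tendsto_mult_left)
  moreover have "(\<Sum>m\<in>I. \<Sum>n\<in>I. complex_of_real (c m * c n) * (if n = m then LINT z|weighted_shift \<phi> \<mu> n. b z else 0))
    = (\<Sum>n\<in>I. of_real ((c n)\<^sup>2) * (LINT z|weighted_shift \<phi> \<mu> n. b z))"
    using I by (intro sum.cong refl) (simp add: if_distrib[of "(*) _"] sum.delta power2_eq_square cong: if_cong)
  ultimately show ?thesis unfolding eq by simp
qed

section \<open>Integration against the sampled measure\<close>

text \<open>Induction over nonnegative Borel functions. The sum over the index is itself an
  integral, so additivity and monotone convergence are available on both sides for an index type of
  any cardinality.\<close>

lemma nn_integral_sum_measure:
  fixes M :: "'i \<Rightarrow> 'a::topological_space measure"
  assumes M: "\<And>i. sets (M i) = sets borel" and f: "f \<in> borel_measurable borel"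
  shows "(\<integral>\<^sup>+x. f x \<partial>sum_measure M) = (\<integral>\<^sup>+i. (\<integral>\<^sup>+x. f x \<partial>M i) \<partial>count_space UNIV)"
  using f
proof (induction rule: borel_measurable_induct)
  case (cong f g)
  then show ?case by (simp add: fun_eq_iff)
next
  case (set A)
  then show ?case using M by (simp add: emeasure_sum_measure)
next
  case (mult f c)
  have "(\<integral>\<^sup>+x. c * f x \<partial>N) = c * (\<integral>\<^sup>+x. f x \<partial>N)" if "sets N = sets borel" for N :: "'a measure"
    using mult.hyps that by (intro nn_integral_cmult) (simp add: measurable_cong_sets[OF that refl])
  then show ?case using mult.IH M by (simp add: nn_integral_cmult)
next
  case (add g f)
  have "(\<integral>\<^sup>+x. f x + g x \<partial>N) = (\<integral>\<^sup>+x. f x \<partial>N) + (\<integral>\<^sup>+x. g x \<partial>N)" if "sets N = sets borel" for N :: "'a measure"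
    using add.hyps that by (intro nn_integral_add) (simp_all add: measurable_cong_sets[OF that refl])
  then show ?case using add.IH M by (simp add: nn_integral_add)
next
  case (seq U)
  have s: "(\<integral>\<^sup>+x. (SUP i. U i) x \<partial>N) = (SUP i. \<integral>\<^sup>+x. U i x \<partial>N)" if "sets N = sets borel" for N :: "'a measure"
    unfolding SUP_apply using seq.hyps that by (intro nn_integral_monotone_convergence_SUP) (simp_all add: measurable_cong_sets[OF that refl])
  have "(SUP i. \<integral>\<^sup>+j. (\<integral>\<^sup>+x. U i x \<partial>M j) \<partial>count_space UNIV) = (\<integral>\<^sup>+j. (SUP i. \<integral>\<^sup>+x. U i x \<partial>M j) \<partial>count_space UNIV)"
    using seq.hyps by (intro nn_integral_monotone_convergence_SUP[symmetric]) (auto intro!: incseq_SucI le_funI nn_integral_mono simp: incseq_Suc_iff le_fun_def)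
  then show ?case using seq.IH s M by simp
qed

lemma integral_sum_measure_real:
  fixes M :: "'i \<Rightarrow> 'a::topological_space measure" and g :: "'a \<Rightarrow> real"
  assumes M: "\<And>i. sets (M i) = sets borel" and g: "g \<in> borel_measurable borel"
    and fin: "(\<integral>\<^sup>+x. ennreal (norm (g x)) \<partial>sum_measure M) < \<infinity>"
  shows "integrable (sum_measure M) g" and "integrable (M i) g"
    and "integrable (count_space UNIV) (\<lambda>i. LINT x|M i. g x)"
    and "(LINT x|sum_measure M. g x) = (LINT i|count_space UNIV. LINT x|M i. g x)"
proof -
  have gm[measurable]: "g \<in> borel_measurable (M i)" "g \<in> borel_measurable (sum_measure M)" for i
    using g by (simp_all add: measurable_cong_sets[OF M refl] measurable_cong_sets[OF sets_sum_measure refl])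
  have fin': "(\<integral>\<^sup>+i. (\<integral>\<^sup>+x. ennreal (norm (g x)) \<partial>M i) \<partial>count_space UNIV) < \<infinity>"
    using fin g by (subst (asm) nn_integral_sum_measure[OF M]) auto
  have le: "(\<integral>\<^sup>+x. ennreal (norm (g x)) \<partial>M i) < \<infinity>" for i
    using nn_integral_ge_point[of i UNIV "\<lambda>i. \<integral>\<^sup>+x. ennreal (norm (g x)) \<partial>M i"] fin' by simp
  show iS: "integrable (sum_measure M) g" using fin by (intro integrableI_bounded) auto
  show iM: "integrable (M i) g" for i using le by (intro integrableI_bounded) auto
  have b: "(\<integral>\<^sup>+i. ennreal (norm (LINT x|M i. g x)) \<partial>count_space UNIV) < \<infinity>"
    by (rule order_le_less_trans[OF nn_integral_mono fin']) (rule norm_integral_le_nn_integral)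
  show "integrable (count_space UNIV) (\<lambda>i. LINT x|M i. g x)" using b by (intro integrableI_bounded) auto
  \<comment> \<open>To be used for \<open>g\<close> and for \<open>- g\<close>: as
    \<open>ennreal\<close> sends negative numbers to 0, these are the positive and the negative
    part.\<close>
  have part: "integrable (count_space UNIV) (\<lambda>i. enn2real (\<integral>\<^sup>+x. ennreal (f x) \<partial>M i))"
    "(LINT i|count_space UNIV. enn2real (\<integral>\<^sup>+x. ennreal (f x) \<partial>M i)) = enn2real (\<integral>\<^sup>+x. ennreal (f x) \<partial>sum_measure M)"
    if f: "f \<in> borel_measurable borel" "\<And>x. f x \<le> norm (g x)" for f
  proof -
    have lf: "(\<integral>\<^sup>+x. ennreal (f x) \<partial>M i) \<le> (\<integral>\<^sup>+x. ennreal (norm (g x)) \<partial>M i)" for i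
      using f(2) by (intro nn_integral_mono ennreal_leI)
    then have e: "ennreal (enn2real (\<integral>\<^sup>+x. ennreal (f x) \<partial>M i)) = (\<integral>\<^sup>+x. ennreal (f x) \<partial>M i)" for i
      using le[of i] by (intro ennreal_enn2real) (auto intro: order_le_less_trans)
    have S: "(\<integral>\<^sup>+x. ennreal (f x) \<partial>sum_measure M) = (\<integral>\<^sup>+i. (\<integral>\<^sup>+x. ennreal (f x) \<partial>M i) \<partial>count_space UNIV)"
      using f(1) by (intro nn_integral_sum_measure[OF M]) auto
    have "(\<integral>\<^sup>+i. (\<integral>\<^sup>+x. ennreal (f x) \<partial>M i) \<partial>count_space UNIV) < \<infinity>"
      by (rule order_le_less_trans[OF nn_integral_mono fin']) (rule lf)
    then show "integrable (count_space UNIV) (\<lambda>i. enn2real (\<integral>\<^sup>+x. ennreal (f x) \<partial>M i))"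
      by (intro integrableI_bounded) (auto simp: e)
    show "(LINT i|count_space UNIV. enn2real (\<integral>\<^sup>+x. ennreal (f x) \<partial>M i)) = enn2real (\<integral>\<^sup>+x. ennreal (f x) \<partial>sum_measure M)"
      unfolding S by (subst integral_eq_nn_integral) (auto simp: e)
  qed
  show "(LINT x|sum_measure M. g x) = (LINT i|count_space UNIV. LINT x|M i. g x)"
    unfolding real_lebesgue_integral_def[OF iS] real_lebesgue_integral_def[OF iM]
    using g by (subst Bochner_Integration.integral_diff) (auto intro!: part simp: part)
qed

lemma integral_sum_measure:
  fixes M :: "'i \<Rightarrow> 'a::topological_space measure" and f :: "'a \<Rightarrow> complex"
  assumes M: "\<And>i. sets (M i) = sets borel" and f: "f \<in> borel_measurable borel"
    and fin: "(\<integral>\<^sup>+x. ennreal (norm (f x)) \<partial>sum_measure M) < \<infinity>"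
  shows "integrable (sum_measure M) f" and "integrable (count_space UNIV) (\<lambda>i. LINT x|M i. f x)"
    and "(LINT x|sum_measure M. f x) = (LINT i|count_space UNIV. LINT x|M i. f x)"
proof -
  have part: "(\<integral>\<^sup>+x. ennreal (norm (Re (f x))) \<partial>sum_measure M) < \<infinity>" "(\<integral>\<^sup>+x. ennreal (norm (Im (f x))) \<partial>sum_measure M) < \<infinity>"
    by (rule order_le_less_trans[OF nn_integral_mono fin], simp add: ennreal_leI abs_Re_le_cmod abs_Im_le_cmod)+
  have m: "(\<lambda>x. Re (f x)) \<in> borel_measurable borel" "(\<lambda>x. Im (f x)) \<in> borel_measurable borel" using f by auto
  note R = integral_sum_measure_real[OF M m(1) part(1)]
  note I = integral_sum_measure_real[OF M m(2) part(2)]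
  have c: "f = (\<lambda>x. of_real (Re (f x)) + \<i> * of_real (Im (f x)))" by (simp add: complex_eq[symmetric])
  show iS: "integrable (sum_measure M) f"
    by (subst c) (intro Bochner_Integration.integrable_add integrable_mult_right integrable_of_real R(1) I(1))
  have iM: "integrable (M i) f" for i
    by (subst c) (intro Bochner_Integration.integrable_add integrable_mult_right integrable_of_real R(2) I(2))
  have "(\<lambda>i. LINT x|M i. f x) = (\<lambda>i. of_real (LINT x|M i. Re (f x)) + \<i> * of_real (LINT x|M i. Im (f x)))"
    using iM by (intro ext complex_eqI) simp_all
  then show iC: "integrable (count_space UNIV) (\<lambda>i. LINT x|M i. f x)"
    by (simp only:) (intro Bochner_Integration.integrable_add integrable_mult_right integrable_of_real R(3) I(3))
  show "(LINT x|sum_measure M. f x) = (LINT i|count_space UNIV. LINT x|M i. f x)"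
    using R(4) I(4) iS iM iC by (intro complex_eqI) simp_all
qed

lemma nn_integral_weighted_shift:
  assumes [measurable]: "\<phi> \<in> borel_measurable borel" "f \<in> borel_measurable borel" and \<mu>[measurable_cong]: "sets \<mu> = sets borel"
  shows "(\<integral>\<^sup>+z. f z \<partial>weighted_shift \<phi> \<mu> n) = (\<integral>\<^sup>+z. ennreal ((norm (ft \<phi> (snd z)))\<^sup>2) * f (fst z, snd z - freq n) \<partial>\<mu>)"
  unfolding weighted_shift_def shift_measure_def fourier_eq_ft[OF assms(1)] split_beta'
  by (subst nn_integral_density) (auto simp: nn_integral_distr)

text \<open>Every summand has the same mass, the integral of the squared transform of \<phi> against
  \<mu>, so the sum has infinite mass unless it is zero. A decaying weight in frequency repairs
  this: after Tonelli's theorem the shifts act on the weight, whose lattice sums are uniformly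
  bounded.\<close>

lemma sum_weighted_shift_finite:
  fixes \<phi> :: "real ^ 'n \<Rightarrow> complex"
  assumes \<phi>: "integrable lborel \<phi>" and \<mu>: "sets \<mu> = sets borel" "finite_measure \<mu>" and p: "real CARD('n) < p"
  shows "(\<integral>\<^sup>+z. ennreal (wt p (snd z)) \<partial>sum_measure (weighted_shift \<phi> \<mu>)) < \<infinity>"
proof -
  have [measurable]: "\<phi> \<in> borel_measurable borel" using \<phi> by (auto simp: borel_measurable_integrable)
  note [measurable_cong] = \<mu>(1)
  interpret \<mu>: finite_measure \<mu> by fact
  interpret C: sigma_finite_measure "count_space (UNIV :: (int ^ 'n) set)" by (rule sigma_finite_count_space)
  interpret pair_sigma_finite "count_space (UNIV :: (int ^ 'n) set)" \<mu> ..
  let ?K = "LINT x|lborel. norm (\<phi> x)"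
  obtain C where C: "0 \<le> C" "\<And>x::real ^ 'n. (\<integral>\<^sup>+n. ennreal (wt p (x - of_ivec n)) \<partial>count_space UNIV) \<le> ennreal C"
    using lattice_sum_bound[OF p] by blast
  \<comment> \<open>The frequency lattice has spacing 2\<pi>. Dividing by 2\<pi>, which is at least
    1, shortens vectors and thus enlarges the weight, so integer lattice sums dominate.\<close>
  have w: "wt p (x - freq n) \<le> wt p (x /\<^sub>R (2 * pi) - of_ivec n)" for x :: "real ^ 'n" and n
  proof -
    have "x - freq n = (2 * pi) *\<^sub>R (x /\<^sub>R (2 * pi) - of_ivec n)" by (simp add: scaleR_diff_right)
    then have "norm (x - freq n) = 2 * pi * norm (x /\<^sub>R (2 * pi) - of_ivec n)" by simp
    moreover have "1 * norm (x /\<^sub>R (2 * pi) - of_ivec n) \<le> 2 * pi * norm (x /\<^sub>R (2 * pi) - of_ivec n)"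
      using pi_ge_two by (intro mult_right_mono) auto
    ultimately have "norm (x /\<^sub>R (2 * pi) - of_ivec n) \<le> norm (x - freq n)" by simp
    then show ?thesis unfolding wt_def using p by (intro powr_mono2') (auto intro: add_pos_nonneg)
  qed
  have "(\<integral>\<^sup>+z. ennreal (wt p (snd z)) \<partial>sum_measure (weighted_shift \<phi> \<mu>))
    = (\<integral>\<^sup>+n. (\<integral>\<^sup>+z. ennreal ((norm (ft \<phi> (snd z)))\<^sup>2) * ennreal (wt p (snd z - freq n)) \<partial>\<mu>) \<partial>count_space UNIV)"
    using nn_integral_weighted_shift[of \<phi> "\<lambda>z. ennreal (wt p (snd z))" \<mu>] \<mu>(1)
    by (subst nn_integral_sum_measure[OF weighted_shift_finite(1)[OF \<phi> \<mu>]]) simp_all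
  also have "\<dots> = (\<integral>\<^sup>+z. (\<integral>\<^sup>+n. ennreal ((norm (ft \<phi> (snd z)))\<^sup>2) * ennreal (wt p (snd z - freq n)) \<partial>count_space UNIV) \<partial>\<mu>)"
    by (rule Fubini'[symmetric], rule lborel_count_measurable(2)[of "\<lambda>z n. ennreal ((norm (ft \<phi> (snd z)))\<^sup>2) * ennreal (wt p (snd z - freq n))"]) measurable
  also have "\<dots> \<le> (\<integral>\<^sup>+z. ennreal (?K\<^sup>2) * ennreal C \<partial>\<mu>)"
  proof (rule nn_integral_mono)
    fix z :: "(real ^ 'n) \<times> (real ^ 'n)"
    have "(\<integral>\<^sup>+n. ennreal ((norm (ft \<phi> (snd z)))\<^sup>2) * ennreal (wt p (snd z - freq n)) \<partial>count_space UNIV)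
      \<le> (\<integral>\<^sup>+n. ennreal (?K\<^sup>2) * ennreal (wt p (snd z /\<^sub>R (2 * pi) - of_ivec n)) \<partial>count_space UNIV)"
      using ft_bounded[OF \<phi>, of "snd z"] by (intro nn_integral_mono mult_mono ennreal_leI power_mono w) auto
    also have "\<dots> \<le> ennreal (?K\<^sup>2) * ennreal C"
      by (subst nn_integral_cmult) (auto intro!: mult_left_mono C)
    finally show "(\<integral>\<^sup>+n. ennreal ((norm (ft \<phi> (snd z)))\<^sup>2) * ennreal (wt p (snd z - freq n)) \<partial>count_space UNIV) \<le> ennreal (?K\<^sup>2) * ennreal C" .
  qed
  also have "\<dots> < \<infinity>" by (simp add: ennreal_mult_less_top \<mu>.emeasure_eq_measure)
  finally show ?thesis .
qed

lemma sampled_wigner_measure_sets [simp]: "sets (sampled_wigner_measure \<phi> \<psi> \<mu>) = sets borel"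
  by (simp add: sampled_wigner_measure_def)

lemma sampled_wigner_measure_weight:
  fixes \<phi> \<psi> :: "real ^ 'n \<Rightarrow> complex"
  assumes \<phi>: "integrable lborel \<phi>" and \<psi>: "integrable lborel \<psi>" and \<mu>: "sets \<mu> = sets borel" "finite_measure \<mu>" and p: "real CARD('n) < p"
  shows "(\<integral>\<^sup>+z. ennreal (wt p (snd z)) \<partial>sampled_wigner_measure \<phi> \<psi> \<mu>) < \<infinity>"
proof -
  have \<psi>m[measurable]: "\<psi> \<in> borel_measurable borel" using \<psi> by (auto simp: borel_measurable_integrable)
  let ?K = "LINT x|lborel. norm (\<psi> x)"
  have "(\<integral>\<^sup>+z. ennreal (wt p (snd z)) \<partial>sampled_wigner_measure \<phi> \<psi> \<mu>)
    = (\<integral>\<^sup>+z. ennreal ((norm (ft \<psi> (snd z)))\<^sup>2) * ennreal (wt p (snd z)) \<partial>sum_measure (weighted_shift \<phi> \<mu>))"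
    unfolding sampled_wigner_measure_def fourier_eq_ft[OF \<psi>m] split_beta' by (rule nn_integral_density) measurable
  also have "\<dots> \<le> (\<integral>\<^sup>+z. ennreal (?K\<^sup>2) * ennreal (wt p (snd z)) \<partial>sum_measure (weighted_shift \<phi> \<mu>))"
    using ft_bounded[OF \<psi>] by (intro nn_integral_mono mult_right_mono ennreal_leI power_mono) auto
  also have "\<dots> = ennreal (?K\<^sup>2) * (\<integral>\<^sup>+z. ennreal (wt p (snd z)) \<partial>sum_measure (weighted_shift \<phi> \<mu>))"
    by (rule nn_integral_cmult) measurable
  also have "\<dots> < \<infinity>" using sum_weighted_shift_finite[OF \<phi> \<mu> p] by (simp add: ennreal_mult_less_top)
  finally show ?thesis .
qed

section \<open>Schwartz functions and compact sets against a frequency weight\<close>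

lemma schwartz_weight:
  fixes a :: "'a::euclidean_space \<times> 'a \<Rightarrow> complex"
  assumes "schwartz a"
  shows "\<exists>C\<ge>0. \<forall>z. norm (a z) \<le> C * wt (real N) (snd z)"
proof -
  obtain C where C: "0 \<le> C" "\<And>x. norm (a x) \<le> C * wt (real N) x" by (rule schwartz_decay[OF assms]) blast
  have "wt (real N) z \<le> wt (real N) (snd z)" for z :: "'a \<times> 'a"
    unfolding wt_def using norm_snd_le[of "snd z" "fst z"] by (intro powr_mono2') (auto intro: add_pos_nonneg)
  then have "norm (a z) \<le> C * wt (real N) (snd z)" for z
    using C(2)[of z] C(1) by (meson mult_left_mono order_trans)
  with C(1) show ?thesis by blast
qed

lemma schwartz_integrable_weight:
  fixes a :: "'a::euclidean_space \<times> 'a \<Rightarrow> complex"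
  assumes a: "schwartz a" and M[measurable_cong]: "sets M = sets borel" and w: "(\<integral>\<^sup>+z. ennreal (wt (real N) (snd z)) \<partial>M) < \<infinity>"
  shows "integrable M a"
proof (rule integrableI_bounded)
  note [measurable] = schwartz_measurable[OF a]
  obtain C where C: "0 \<le> C" "\<And>z. norm (a z) \<le> C * wt (real N) (snd z)" using schwartz_weight[OF a] by blast
  have "(\<integral>\<^sup>+z. ennreal (norm (a z)) \<partial>M) \<le> (\<integral>\<^sup>+z. ennreal C * ennreal (wt (real N) (snd z)) \<partial>M)"
    using C by (intro nn_integral_mono) (simp add: ennreal_mult[symmetric] ennreal_leI)
  also have "\<dots> = ennreal C * (\<integral>\<^sup>+z. ennreal (wt (real N) (snd z)) \<partial>M)" by (rule nn_integral_cmult) measurable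
  also have "\<dots> < \<infinity>" using w by (simp add: ennreal_mult_less_top)
  finally show "(\<integral>\<^sup>+z. ennreal (norm (a z)) \<partial>M) < \<infinity>" .
  show "a \<in> borel_measurable M" by measurable
qed

text \<open>On a compact set the weight is bounded below, so the indicator is at most a constant
  times the weight.\<close>

lemma radon_measure_weight:
  fixes M :: "('a::euclidean_space \<times> 'a) measure"
  assumes M: "sets M = sets borel" and w: "(\<integral>\<^sup>+z. ennreal (wt (real N) (snd z)) \<partial>M) < \<infinity>"
  shows "radon_measure M"
  unfolding radon_measure_def
proof (intro conjI M allI impI)
  note [measurable_cong] = M
  fix K :: "('a \<times> 'a) set" assume K: "compact K"
  obtain R where R: "\<And>z. z \<in> K \<Longrightarrow> norm z \<le> R" using compact_imp_bounded[OF K] unfolding bounded_iff by blast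
  let ?c = "(1 + \<bar>R\<bar>) ^ N"
  have Km[measurable]: "K \<in> sets borel" using K by (intro borel_closed compact_imp_closed)
  have "emeasure M K = (\<integral>\<^sup>+z. indicator K z \<partial>M)" using Km M by simp
  also have "\<dots> \<le> (\<integral>\<^sup>+z. ennreal ?c * ennreal (wt (real N) (snd z)) \<partial>M)"
  proof (rule nn_integral_mono)
    fix z :: "'a \<times> 'a"
    have "1 \<le> ?c * wt (real N) (snd z)" if "z \<in> K"
    proof -
      have "norm (snd z) \<le> \<bar>R\<bar>" using R[OF that] norm_snd_le[of "snd z" "fst z"] by simp
      then have "(1 + norm (snd z)) ^ N \<le> ?c" by (intro power_mono) auto
      moreover have "0 < (1 + norm (snd z)) ^ N" by (simp add: add_pos_nonneg)
      ultimately show ?thesis unfolding wt_nat by (simp add: divide_inverse[symmetric])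
    qed
    then show "indicator K z \<le> ennreal ?c * ennreal (wt (real N) (snd z))"
      by (auto simp: indicator_def ennreal_mult[symmetric] simp flip: ennreal_1 intro!: ennreal_leI)
  qed
  also have "\<dots> = ennreal ?c * (\<integral>\<^sup>+z. ennreal (wt (real N) (snd z)) \<partial>M)" by (rule nn_integral_cmult) measurable
  also have "\<dots> < \<infinity>" using w by (simp add: ennreal_mult_less_top)
  finally show "emeasure M K < \<infinity>" .
qed

section \<open>The limit of the Husimi functions after sampling\<close>

text \<open>Decay of \<open>a\<close> in frequency makes the series over the shifts absolutely
  convergent, the form in which the Fejer coefficients can be inserted and removed.\<close>

lemma sampled_wigner_measure_integral:
  fixes \<phi> \<psi> :: "real ^ 'n \<Rightarrow> complex"
  assumes \<phi>: "integrable lborel \<phi>" and \<psi>: "integrable lborel \<psi>" and \<mu>: "sets \<mu> = sets borel" "finite_measure \<mu>" and a: "schwartz a"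
  defines "b \<equiv> \<lambda>z. a z * of_real ((norm (ft \<psi> (snd z)))\<^sup>2)"
  shows "integrable (count_space UNIV) (\<lambda>n. LINT z|weighted_shift \<phi> \<mu> n. b z)"
    and "(LINT z|sampled_wigner_measure \<phi> \<psi> \<mu>. a z) = (LINT n|count_space UNIV. LINT z|weighted_shift \<phi> \<mu> n. b z)"
proof -
  have \<psi>m[measurable]: "\<psi> \<in> borel_measurable borel" using \<psi> by (auto simp: borel_measurable_integrable)
  note am[measurable] = schwartz_measurable[OF a]
  have bm: "b \<in> borel_measurable borel" unfolding b_def by measurable
  let ?N = "Suc CARD('n)"
  have "integrable (sampled_wigner_measure \<phi> \<psi> \<mu>) a"
    by (rule schwartz_integrable_weight[OF a _ sampled_wigner_measure_weight[OF \<phi> \<psi> \<mu>, of "real ?N"]]) auto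
  then have "integrable (sum_measure (weighted_shift \<phi> \<mu>)) (\<lambda>z. (norm (ft \<psi> (snd z)))\<^sup>2 *\<^sub>R a z)"
    unfolding sampled_wigner_measure_def fourier_eq_ft[OF \<psi>m] split_beta' by (subst (asm) integrable_density) auto
  then have "integrable (sum_measure (weighted_shift \<phi> \<mu>)) b" unfolding b_def by (simp add: scaleR_conv_of_real mult.commute)
  then have "(\<integral>\<^sup>+z. ennreal (norm (b z)) \<partial>sum_measure (weighted_shift \<phi> \<mu>)) < \<infinity>" by (simp add: integrable_iff_bounded)
  note * = integral_sum_measure[OF weighted_shift_finite(1)[OF \<phi> \<mu>] bm this]
  show "integrable (count_space UNIV) (\<lambda>n. LINT z|weighted_shift \<phi> \<mu> n. b z)" by (rule *(2))
  have "(LINT z|sampled_wigner_measure \<phi> \<psi> \<mu>. a z) = (LINT z|sum_measure (weighted_shift \<phi> \<mu>). (norm (ft \<psi> (snd z)))\<^sup>2 *\<^sub>R a z)"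
    unfolding sampled_wigner_measure_def fourier_eq_ft[OF \<psi>m] split_beta' by (subst integral_density) auto
  also have "\<dots> = (LINT z|sum_measure (weighted_shift \<phi> \<mu>). b z)" unfolding b_def by (simp add: scaleR_conv_of_real mult.commute)
  finally show "(LINT z|sampled_wigner_measure \<phi> \<psi> \<mu>. a z) = (LINT n|count_space UNIV. LINT z|weighted_shift \<phi> \<mu> n. b z)"
    using *(3) by simp
qed

text \<open>The coefficients vanish outside \<open>fejer_freqs\<close>, so the finite sum is an
  integral over the whole lattice, dominated by the norm of \<open>g\<close>. They appear squared
  because they come from a squared modulus.\<close>

lemma fejer_coeff_sum_tendsto:
  fixes g :: "int ^ 'n \<Rightarrow> complex"
  assumes g: "integrable (count_space UNIV) g"
  shows "(\<lambda>M. \<Sum>n\<in>fejer_freqs M. of_real ((fejer_coeff M n)\<^sup>2) * g n) \<longlonglongrightarrow> (LINT n|count_space UNIV. g n)"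
proof -
  have "(\<lambda>M. LINT n|count_space UNIV. of_real ((fejer_coeff M n)\<^sup>2) * g n) \<longlonglongrightarrow> (LINT n|count_space UNIV. g n)"
  proof (rule integral_dominated_convergence[where w = "\<lambda>n. norm (g n)"])
    show "integrable (count_space UNIV) (\<lambda>n. norm (g n))" using g by simp
    show "AE n in count_space UNIV. (\<lambda>M. of_real ((fejer_coeff M n)\<^sup>2) * g n) \<longlonglongrightarrow> g n"
    proof (intro AE_I2)
      fix n :: "int ^ 'n"
      have "(\<lambda>M. of_real ((fejer_coeff M n)\<^sup>2) * g n) \<longlonglongrightarrow> of_real (1\<^sup>2) * g n"
        by (intro tendsto_intros fejer_coeff_tendsto)
      then show "(\<lambda>M. of_real ((fejer_coeff M n)\<^sup>2) * g n) \<longlonglongrightarrow> g n" by simp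
    qed
    show "AE n in count_space UNIV. norm (of_real ((fejer_coeff M n)\<^sup>2) * g n) \<le> norm (g n)" for M
    proof (intro AE_I2)
      fix n :: "int ^ 'n"
      have "(fejer_coeff M n)\<^sup>2 \<le> 1" using fejer_coeff_bounds[of M n] by (simp add: power_le_one)
      then show "norm (of_real ((fejer_coeff M n)\<^sup>2) * g n) \<le> norm (g n)"
        unfolding norm_mult norm_of_real by (simp add: mult_left_le_one_le)
    qed
  qed auto
  moreover have "(LINT n|count_space UNIV. of_real ((fejer_coeff M n)\<^sup>2) * g n) = (\<Sum>n\<in>fejer_freqs M. of_real ((fejer_coeff M n)\<^sup>2) * g n)" for M
  proof -
    have sub: "{n \<in> UNIV. of_real ((fejer_coeff M n)\<^sup>2) * g n \<noteq> 0} \<subseteq> fejer_freqs M"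
      using fejer_coeff_outside[of _ M] by force
    have "(LINT n|count_space UNIV. of_real ((fejer_coeff M n)\<^sup>2) * g n) = (\<Sum>n | n \<in> UNIV \<and> of_real ((fejer_coeff M n)\<^sup>2) * g n \<noteq> 0. of_real ((fejer_coeff M n)\<^sup>2) * g n)"
      by (rule lebesgue_integral_count_space_finite_support[OF finite_subset[OF sub fejer_freqs_finite]])
    also have "\<dots> = (\<Sum>n\<in>fejer_freqs M. of_real ((fejer_coeff M n)\<^sup>2) * g n)"
      by (rule sum.mono_neutral_left[OF fejer_freqs_finite sub]) auto
    finally show ?thesis .
  qed
  ultimately show ?thesis by simp
qed

text \<open>The order of the quantifiers matters: \<open>M\<close> is chosen first, from an operator
  norm bound that is uniform in h, and only then \<open>k\<close>, since the commutation error at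
  fixed \<open>M\<close> tends to 0 without uniformity in \<open>M\<close>. Each error receives half
  of \<delta>.\<close>

lemma fejer_approximation:
  fixes \<phi> \<psi> :: "real ^ 'n \<Rightarrow> complex"
  assumes d: "decaying C p \<phi>" "decaying C p \<psi>" and C: "0 < C" and p: "real CARD('n) < p" and h: "is_scale h"
    and \<delta>: "0 < \<delta>" and B: "0 \<le> B"
  shows "\<exists>M0. \<forall>M\<ge>M0. \<exists>k0. \<forall>k\<ge>k0. \<forall>U. U \<in> borel_measurable borel \<longrightarrow> l2 U \<le> ennreal B \<longrightarrow>
    l2 (\<lambda>z. hus (h k) (samp_op \<phi> \<psi> U) z - ft \<psi> (snd z) * (\<Sum>n\<in>fejer_freqs M. of_real (fejer_coeff M n) * component \<phi> (h k) U n z)) \<le> ennreal \<delta>"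
proof -
  obtain K where K: "0 < K" "\<And>\<gamma>::real ^ 'n \<Rightarrow> complex. decaying C p \<gamma> \<Longrightarrow> lattice_bounded K \<gamma>"
    using decaying_lattice_bounded[OF p C] by blast
  note \<phi> = lattice_boundedD[OF K(2)[OF d(1)]] and \<psi> = lattice_boundedD[OF K(2)[OF d(2)]]
  note [measurable] = \<phi>(1) \<psi>(1)
  have h0: "0 < h k" for k using h by (simp add: is_scale_def)
  obtain Q where Q: "0 \<le> Q" "\<And>h U. 0 < h \<Longrightarrow> U \<in> borel_measurable borel \<Longrightarrow> l2 (U :: real ^ 'n \<Rightarrow> complex) < \<infinity> \<Longrightarrow> l2 (hus h U) \<le> ennreal Q * l2 U"
    using hus_l2_bound[where 'a="real ^ 'n"] by blast
  \<comment> \<open>Makes 2 Q \<eta> B at most \<delta>/2; adding 1 to Q B covers the case that it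
    is 0.\<close>
  define \<eta> where "\<eta> = \<delta> / (4 * (Q * B + 1))"
  have QB: "0 < Q * B + 1" using Q(1) B by (simp add: add_nonneg_pos)
  have \<eta>: "0 < \<eta>" unfolding \<eta>_def using \<delta> QB by simp
  have \<eta>Q: "2 * (Q * (\<eta> * B)) \<le> \<delta> / 2"
  proof -
    have "2 * (Q * (\<eta> * B)) = \<delta> / 2 * (Q * B / (Q * B + 1))" unfolding \<eta>_def using QB by (simp add: field_simps)
    also have "\<dots> \<le> \<delta> / 2 * 1" using \<delta> QB by (intro mult_left_mono) auto
    finally show ?thesis by simp
  qed
  obtain M0 where M0: "\<And>M U. M0 \<le> M \<Longrightarrow> U \<in> borel_measurable borel \<Longrightarrow> l2 U < \<infinity> \<Longrightarrow>
    l2 (\<lambda>x. samp_op \<phi> \<psi> U x - fejer_op M \<phi> \<psi> U x) \<le> ennreal \<eta> * l2 U"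
    using fejer_op_close[OF d C p \<eta>] by (elim exE conjE) blast
  have "\<exists>k0. \<forall>k\<ge>k0. \<forall>U. U \<in> borel_measurable borel \<longrightarrow> l2 U \<le> ennreal B \<longrightarrow>
    l2 (\<lambda>z. hus (h k) (samp_op \<phi> \<psi> U) z - ft \<psi> (snd z) * (\<Sum>n\<in>fejer_freqs M. of_real (fejer_coeff M n) * component \<phi> (h k) U n z)) \<le> ennreal \<delta>"
    if M: "M0 \<le> M" for M
  proof -
    obtain E where E: "\<And>k. 0 \<le> E k" "E \<longlonglongrightarrow> (0::real)" "\<And>k U. U \<in> borel_measurable borel \<Longrightarrow> l2 U < \<infinity> \<Longrightarrow>
      l2 (\<lambda>z. hus (h k) (fejer_op M \<phi> \<psi> U) z - ft \<psi> (snd z) * (\<Sum>n\<in>fejer_freqs M. of_real (fejer_coeff M n) * component \<phi> (h k) U n z))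
        \<le> ennreal (E k) * l2 U"
      using hus_fejer_op[OF \<phi>(6) \<psi>(6) h, of M] by (elim exE conjE) blast
    have "(\<lambda>k. 2 * (E k * B)) \<longlonglongrightarrow> 2 * (0 * B)" by (intro tendsto_intros E)
    then have "eventually (\<lambda>k. 2 * (E k * B) < \<delta> / 2) sequentially" by (rule order_tendstoD(2)) (use \<delta> in simp)
    then obtain k0 where k0: "\<And>k. k0 \<le> k \<Longrightarrow> 2 * (E k * B) < \<delta> / 2" by (auto simp: eventually_sequentially)
    have "l2 (\<lambda>z. hus (h k) (samp_op \<phi> \<psi> U) z - ft \<psi> (snd z) * (\<Sum>n\<in>fejer_freqs M. of_real (fejer_coeff M n) * component \<phi> (h k) U n z)) \<le> ennreal \<delta>"
      if k: "k0 \<le> k" and U[measurable]: "U \<in> borel_measurable borel" and lU: "l2 U \<le> ennreal B" for k U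
    proof -
      have fin: "l2 U < \<infinity>" using lU by (auto intro: order_le_less_trans)
      let ?S = "samp_op \<phi> \<psi> U" and ?F = "fejer_op M \<phi> \<psi> U"
      let ?Z = "\<lambda>z. ft \<psi> (snd z) * (\<Sum>n\<in>fejer_freqs M. of_real (fejer_coeff M n) * component \<phi> (h k) U n z)"
      have Sm[measurable]: "?S \<in> borel_measurable borel" by measurable
      have Fm[measurable]: "?F \<in> borel_measurable borel" unfolding fejer_op_def by measurable
      have Zm[measurable]: "?Z \<in> borel_measurable borel" by measurable
      have Sf: "l2 ?S < \<infinity>"
      proof -
        have "l2 ?S \<le> ennreal K * ennreal K * (ennreal K * ennreal K * l2 U)"
          using \<phi> \<psi> by (intro samp_op_l2) auto
        also have "\<dots> < \<infinity>" using fin by (simp add: ennreal_mult_less_top)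
        finally show ?thesis .
      qed
      have SF: "l2 (\<lambda>x. ?S x - ?F x) \<le> ennreal (\<eta> * B)"
        using order_trans[OF M0[OF M U fin] mult_left_mono[OF lU]] \<eta> B by (simp add: ennreal_mult)
      have Ff: "l2 ?F < \<infinity>"
      proof -
        \<comment> \<open>The averaged operator is written as S - (S - F), so its finiteness follows
          from the two bounds already at hand.\<close>
        have "l2 (\<lambda>x. ?S x + - (?S x - ?F x)) \<le> 2 * l2 ?S + 2 * l2 (\<lambda>x. - (?S x - ?F x))"
          unfolding l2_def by (rule nn_integral_norm_add_square_le) measurable
        also have "\<dots> = 2 * l2 ?S + 2 * l2 (\<lambda>x. ?S x - ?F x)" unfolding l2_def norm_minus_cancel ..
        also have "\<dots> < \<infinity>" using Sf order_le_less_trans[OF SF, of \<infinity>] by (simp add: ennreal_mult_less_top)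
        finally show ?thesis by simp
      qed
      have h1: "l2 (\<lambda>z. hus (h k) ?S z - hus (h k) ?F z) \<le> ennreal (Q * (\<eta> * B))"
      proof -
        have "l2 (\<lambda>z. hus (h k) ?S z - hus (h k) ?F z) = l2 (hus (h k) (\<lambda>x. ?S x - ?F x))"
          by (intro arg_cong[of _ _ l2] ext hus_diff[OF Sm Fm Sf Ff h0, symmetric])
        also have "\<dots> \<le> ennreal Q * l2 (\<lambda>x. ?S x - ?F x)"
          using order_le_less_trans[OF SF, of \<infinity>] by (intro Q(2) h0) auto
        also have "\<dots> \<le> ennreal Q * ennreal (\<eta> * B)" by (rule mult_left_mono[OF SF]) simp
        also have "\<dots> = ennreal (Q * (\<eta> * B))" using Q(1) \<eta> B by (simp add: ennreal_mult)
        finally show ?thesis .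
      qed
      have h2: "l2 (\<lambda>z. hus (h k) ?F z - ?Z z) \<le> ennreal (E k * B)"
        using order_trans[OF E(3)[OF U fin] mult_left_mono[OF lU]] E(1)[of k] B by (simp add: ennreal_mult)
      have "l2 (\<lambda>z. (hus (h k) ?S z - hus (h k) ?F z) + (hus (h k) ?F z - ?Z z))
        \<le> 2 * l2 (\<lambda>z. hus (h k) ?S z - hus (h k) ?F z) + 2 * l2 (\<lambda>z. hus (h k) ?F z - ?Z z)"
        unfolding l2_def by (rule nn_integral_norm_add_square_le) measurable
      also have "\<dots> \<le> 2 * ennreal (Q * (\<eta> * B)) + 2 * ennreal (E k * B)"
        by (intro add_mono mult_left_mono h1 h2) auto
      also have "\<dots> = ennreal (2 * (Q * (\<eta> * B)) + 2 * (E k * B))"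
        using Q(1) \<eta> B E(1)[of k] by (simp add: ennreal_mult)
      also have "\<dots> \<le> ennreal \<delta>" using \<eta>Q k0[OF k] by (intro ennreal_leI) linarith
      finally show ?thesis by simp
    qed
    then show ?thesis by blast
  qed
  then show ?thesis by blast
qed

text \<open>Three errors of r/3, fixed in this order: \<delta> controls the effect of an L2 error on
  the quadratic integral, \<open>M\<close> then brings the Fejer-weighted series close to its sum,
  and finally \<open>k\<close> is taken large for this \<open>M\<close>. The weight from \<psi> is
  moved from the approximant into the test function \<open>b\<close>.\<close>

lemma husimi_samp_limit:
  fixes \<phi> \<psi> :: "real ^ 'n \<Rightarrow> complex" and u :: "nat \<Rightarrow> real ^ 'n \<Rightarrow> complex"
  assumes d: "decaying C p \<phi>" "decaying C p \<psi>" and C: "0 < C" and p: "real CARD('n) < p" and h: "is_scale h"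
    and u: "\<And>k. u k \<in> borel_measurable borel" and B: "\<And>k. l2 (u k) \<le> ennreal B" "0 \<le> B"
    and \<mu>: "sets \<mu> = sets borel" "finite_measure \<mu>"
    and lim: "\<And>b. vanishing b \<Longrightarrow> (\<lambda>k. LINT z|lborel. b (macro (h k) z) * of_real ((norm (hus (h k) (micro (h k) (u k)) z))\<^sup>2)) \<longlonglongrightarrow> (LINT z|\<mu>. b z)"
    and sing: "\<And>m n. m \<noteq> n \<Longrightarrow> mutually_singular (weighted_shift \<phi> \<mu> m) (weighted_shift \<phi> \<mu> n)"
    and a: "schwartz a"
  shows "(\<lambda>k. LINT z|lborel. a (macro (h k) z) * of_real ((norm (hus (h k) (samp_op \<phi> \<psi> (micro (h k) (u k))) z))\<^sup>2))
    \<longlonglongrightarrow> (LINT z|sampled_wigner_measure \<phi> \<psi> \<mu>. a z)"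
proof -
  obtain K where K: "0 < K" "\<And>\<gamma>::real ^ 'n \<Rightarrow> complex. decaying C p \<gamma> \<Longrightarrow> lattice_bounded K \<gamma>"
    using decaying_lattice_bounded[OF p C] by blast
  note \<phi> = lattice_boundedD[OF K(2)[OF d(1)]] and \<psi> = lattice_boundedD[OF K(2)[OF d(2)]]
  note [measurable] = \<phi>(1) \<psi>(1) u
  have h0: "0 < h k" for k using h by (simp add: is_scale_def)
  obtain Q where Q: "0 \<le> Q" "\<And>h U. 0 < h \<Longrightarrow> U \<in> borel_measurable borel \<Longrightarrow> l2 (U :: real ^ 'n \<Rightarrow> complex) < \<infinity> \<Longrightarrow> l2 (hus h U) \<le> ennreal Q * l2 U"
    using hus_l2_bound[where 'a="real ^ 'n"] by blast
  define U where "U k = micro (h k) (u k)" for k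
  have Um[measurable]: "U k \<in> borel_measurable borel" for k unfolding U_def by measurable
  have lU: "l2 (U k) \<le> ennreal B" for k unfolding U_def l2_micro[OF u h0] by (rule B)
  define F where "F k = hus (h k) (samp_op \<phi> \<psi> (U k))" for k
  have Fm[measurable]: "F k \<in> borel_measurable borel" for k unfolding F_def by measurable
  define L where "L = Q * (K * K * (K * K * B))"
  have L0: "0 \<le> L" unfolding L_def using Q(1) K(1) B(2) by simp
  have lF: "l2 (F k) \<le> ennreal L" for k
  proof -
    have s: "l2 (samp_op \<phi> \<psi> (U k)) \<le> ennreal (K * K * (K * K * B))"
    proof -
      have "l2 (samp_op \<phi> \<psi> (U k)) \<le> ennreal K * ennreal K * (ennreal K * ennreal K * l2 (U k))"
        using \<phi> \<psi> by (intro samp_op_l2) auto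
      also have "\<dots> \<le> ennreal K * ennreal K * (ennreal K * ennreal K * ennreal B)" by (intro mult_left_mono lU) auto
      finally show ?thesis using K(1) B(2) by (simp add: ennreal_mult)
    qed
    have "l2 (F k) \<le> ennreal Q * l2 (samp_op \<phi> \<psi> (U k))"
      unfolding F_def using order_le_less_trans[OF s, of \<infinity>] by (intro Q(2) h0) auto
    also have "\<dots> \<le> ennreal Q * ennreal (K * K * (K * K * B))" by (rule mult_left_mono[OF s]) simp
    finally show ?thesis unfolding L_def using Q(1) K(1) B(2) by (simp only: ennreal_mult mult_nonneg_nonneg less_imp_le)
  qed
  define b where "b z = a z * of_real ((norm (ft \<psi> (snd z)))\<^sup>2)" for z
  define G where "G M k z = (\<Sum>n\<in>fejer_freqs M. of_real (fejer_coeff M n) * component \<phi> (h k) (U k) n z)" for M k z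
  have Gm[measurable]: "G M k \<in> borel_measurable borel" for M k unfolding G_def[abs_def] by measurable
  have va: "vanishing a" by (rule schwartz_vanishing[OF a])
  note am[measurable] = vanishing_measurable[OF va]
  have vb: "vanishing b"
    unfolding b_def[abs_def]
  proof (rule vanishing_mult[OF va])
    show "continuous_on UNIV (\<lambda>z::(real ^ 'n) \<times> (real ^ 'n). complex_of_real ((norm (ft \<psi> (snd z)))\<^sup>2))"
      by (intro continuous_intros continuous_on_compose2[OF ft_continuous[OF \<psi>(6)]]) auto
    show "norm (complex_of_real ((norm (ft \<psi> (snd z)))\<^sup>2)) \<le> (LINT x|lborel. norm (\<psi> x))\<^sup>2" for z :: "(real ^ 'n) \<times> (real ^ 'n)"
      using ft_bounded[OF \<psi>(6), of "snd z"] by (simp add: power_mono norm_power)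
  qed
  obtain A where A: "0 < A" "\<And>z. norm (a z) \<le> A" by (rule vanishing_bounded[OF va]) blast
  let ?H = "\<lambda>k. LINT z|lborel. a (macro (h k) z) * of_real ((norm (F k z))\<^sup>2)"
  let ?J = "\<lambda>M k. LINT z|lborel. a (macro (h k) z) * of_real ((norm (ft \<psi> (snd z) * G M k z))\<^sup>2)"
  let ?g = "\<lambda>n. LINT z|weighted_shift \<phi> \<mu> n. b z"
  let ?I = "\<lambda>M. \<Sum>n\<in>fejer_freqs M. of_real ((fejer_coeff M n)\<^sup>2) * ?g n"
  have J: "?J M \<longlonglongrightarrow> ?I M" for M
  proof -
    have "?J M k = (LINT z|lborel. b (macro (h k) z) * of_real ((norm (G M k z))\<^sup>2))" for k
      unfolding b_def by (simp add: macro_def norm_mult power_mult_distrib mult.assoc)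
    then show ?thesis
      unfolding G_def U_def
      using combination_limit[OF \<phi>(6) h u B \<mu> lim sing vb fejer_freqs_finite[of M], of "fejer_coeff M"] by simp
  qed
  note si = sampled_wigner_measure_integral[OF \<phi>(6) \<psi>(6) \<mu> a]
  have I: "?I \<longlonglongrightarrow> (LINT z|sampled_wigner_measure \<phi> \<psi> \<mu>. a z)"
    using fejer_coeff_sum_tendsto[OF si(1)] unfolding si(2) b_def[abs_def] .
  have "(?H \<longlongrightarrow> (LINT z|sampled_wigner_measure \<phi> \<psi> \<mu>. a z)) sequentially"
  proof (rule tendstoI)
    fix r :: real assume r: "0 < r"
    \<comment> \<open>The bound of \<open>integral_square_diff_le\<close> tends to 0 with \<delta>,
      while \<open>A\<close> and \<open>L\<close> do not depend on \<open>k\<close>.\<close>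
    have "((\<lambda>\<delta>. A * (sqrt \<delta> * (L + 1) + \<delta>)) \<longlongrightarrow> A * (sqrt 0 * (L + 1) + 0)) (at_right 0)"
      by (intro tendsto_intros)
    then have "eventually (\<lambda>\<delta>. A * (sqrt \<delta> * (L + 1) + \<delta>) < r / 3) (at_right 0)"
      using r by (intro order_tendstoD) auto
    then have "eventually (\<lambda>\<delta>. 0 < \<delta> \<and> A * (sqrt \<delta> * (L + 1) + \<delta>) < r / 3) (at_right 0)"
      using eventually_at_right_less[of "0::real"] by eventually_elim auto
    then obtain \<delta> where \<delta>: "0 < \<delta>" "A * (sqrt \<delta> * (L + 1) + \<delta>) < r / 3"
      using eventually_happens'[OF trivial_limit_at_right_real] by blast
    obtain M0 where M0: "\<And>M. M0 \<le> M \<Longrightarrow> \<exists>k0. \<forall>k\<ge>k0. \<forall>U. U \<in> borel_measurable borel \<longrightarrow> l2 U \<le> ennreal B \<longrightarrow>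
      l2 (\<lambda>z. hus (h k) (samp_op \<phi> \<psi> U) z - ft \<psi> (snd z) * (\<Sum>n\<in>fejer_freqs M. of_real (fejer_coeff M n) * component \<phi> (h k) U n z)) \<le> ennreal \<delta>"
      using fejer_approximation[OF d C p h \<delta>(1) B(2)] by blast
    have "eventually (\<lambda>M. dist (?I M) (LINT z|sampled_wigner_measure \<phi> \<psi> \<mu>. a z) < r / 3) sequentially"
      by (rule tendstoD[OF I]) (use r in simp)
    then have "eventually (\<lambda>M. M0 \<le> M \<and> dist (?I M) (LINT z|sampled_wigner_measure \<phi> \<psi> \<mu>. a z) < r / 3) sequentially"
      using eventually_ge_at_top[of M0] by (rule eventually_conj[rotated])
    then obtain M where M: "M0 \<le> M" "dist (?I M) (LINT z|sampled_wigner_measure \<phi> \<psi> \<mu>. a z) < r / 3"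
      using eventually_happens'[OF sequentially_bot] by blast
    obtain k0 where k0: "\<And>k. k0 \<le> k \<Longrightarrow> l2 (\<lambda>z. F k z - ft \<psi> (snd z) * G M k z) \<le> ennreal \<delta>"
      using M0[OF M(1)] lU Um unfolding F_def G_def by blast
    have "eventually (\<lambda>k. dist (?J M k) (?I M) < r / 3) sequentially" by (rule tendstoD[OF J]) (use r in simp)
    then show "eventually (\<lambda>k. dist (?H k) (LINT z|sampled_wigner_measure \<phi> \<psi> \<mu>. a z) < r) sequentially"
      using eventually_ge_at_top[of k0]
    proof eventually_elim
      case (elim k)
      have Zm: "(\<lambda>z. ft \<psi> (snd z) * G M k z) \<in> borel_measurable borel" by measurable
      have "l2 (\<lambda>z. F k z + - (F k z - ft \<psi> (snd z) * G M k z)) \<le> 2 * l2 (F k) + 2 * l2 (\<lambda>z. - (F k z - ft \<psi> (snd z) * G M k z))"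
        unfolding l2_def by (rule nn_integral_norm_add_square_le) measurable
      also have "\<dots> = 2 * l2 (F k) + 2 * l2 (\<lambda>z. F k z - ft \<psi> (snd z) * G M k z)" unfolding l2_def norm_minus_cancel ..
      also have "\<dots> < \<infinity>"
        using order_le_less_trans[OF lF[of k], of \<infinity>] order_le_less_trans[OF k0[OF elim(2)], of \<infinity>] by (simp add: ennreal_mult_less_top)
      finally have Zf: "l2 (\<lambda>z. ft \<psi> (snd z) * G M k z) < \<infinity>" by simp
      have "dist (?H k) (?J M k) \<le> A * (sqrt \<delta> * (L + 1) + \<delta>)"
        unfolding dist_norm
        by (rule integral_square_diff_le[OF Fm Zm _ lF L0 k0[OF elim(2)] \<delta>(1) A(2) Zf]) measurable
      then have "dist (?H k) (?J M k) < r / 3" using \<delta>(2) by simp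
      then show ?case
        using elim(1) M(2) dist_triangle[of "?H k" "LINT z|sampled_wigner_measure \<phi> \<psi> \<mu>. a z" "?J M k"]
          dist_triangle[of "?J M k" "LINT z|sampled_wigner_measure \<phi> \<psi> \<mu>. a z" "?I M"] by linarith
    qed
  qed
  then show ?thesis unfolding F_def U_def .
qed

section \<open>Square-integrable functions as tempered distributions\<close>

lemma schwartz_seminorm_decay:
  fixes a :: "'a::euclidean_space \<Rightarrow> complex"
  assumes a: "schwartz a"
  shows "norm (a x) \<le> schwartz_seminorm N a * wt (real N) x" and "0 \<le> schwartz_seminorm N a"
proof -
  let ?L = "{vs. set vs \<subseteq> (Basis :: 'a set) \<and> length vs \<le> N}"
  let ?f = "\<lambda>vs x. (1 + norm x) ^ N * norm (iterated_deriv a vs x)"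
  have le: "?f vs x \<le> (SUP x. ?f vs x)" if "vs \<in> ?L" for vs x
  proof (rule cSUP_upper)
    have "bounded (range (\<lambda>x. (1 + norm x) ^ N *\<^sub>R iterated_deriv a vs x))" using a that unfolding schwartz_def by blast
    then show "bdd_above (range (?f vs))" by (auto simp: bounded_iff bdd_above_def)
  qed simp
  have nn: "0 \<le> (SUP x. ?f vs x)" if "vs \<in> ?L" for vs
    using le[OF that, of 0] by (rule order_trans[rotated]) simp
  show "0 \<le> schwartz_seminorm N a" unfolding schwartz_seminorm_def by (intro sum_nonneg nn)
  have "?f [] x \<le> (SUP x. ?f [] x)" by (rule le) simp
  also have "\<dots> \<le> schwartz_seminorm N a"
    unfolding schwartz_seminorm_def by (rule member_le_sum[OF _ nn finite_lists_length_le[OF finite_Basis]]) auto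
  finally have "(1 + norm x) ^ N * norm (a x) \<le> schwartz_seminorm N a" by simp
  then show "norm (a x) \<le> schwartz_seminorm N a * wt (real N) x"
    unfolding wt_nat by (simp add: divide_inverse[symmetric] pos_le_divide_eq add_pos_nonneg mult.commute)
qed

text \<open>Cauchy-Schwarz against the L2 norm of the Schwartz function. The seminorm of order d + 1
  controls that norm, because the corresponding weight is integrable and dominates its own
  square.\<close>

lemma tempered_l2:
  fixes v :: "'a::euclidean_space \<Rightarrow> complex"
  assumes v[measurable]: "v \<in> borel_measurable borel" and fin: "l2 v < \<infinity>"
  shows "tempered_function v"
proof -
  let ?N = "Suc DIM('a)"
  define L where "L = enn2real (l2 v)"
  have L: "l2 v = ennreal L" "0 \<le> L" unfolding L_def using fin by auto
  define W where "W = enn2real (\<integral>\<^sup>+(x::'a). ennreal (wt (real ?N) x) \<partial>lborel)"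
  have W: "(\<integral>\<^sup>+(x::'a). ennreal (wt (real ?N) x) \<partial>lborel) = ennreal W" "0 \<le> W"
    unfolding W_def using wt_integrable[where 'a='a, of "real ?N"] by auto
  have la: "l2 a \<le> ennreal ((schwartz_seminorm ?N a)\<^sup>2 * W)" if a: "schwartz a" for a :: "'a \<Rightarrow> complex"
  proof -
    let ?S = "schwartz_seminorm ?N a"
    have "l2 a \<le> (\<integral>\<^sup>+(x::'a). ennreal (?S\<^sup>2) * ennreal (wt (real ?N) x) \<partial>lborel)"
      unfolding l2_def
    proof (rule nn_integral_mono)
      fix x :: 'a
      have "(norm (a x))\<^sup>2 \<le> (?S * wt (real ?N) x)\<^sup>2" by (intro power_mono schwartz_seminorm_decay(1)[OF a]) auto
      also have "\<dots> = ?S\<^sup>2 * (wt (real ?N) x * wt (real ?N) x)" by (simp add: power2_eq_square)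
      also have "\<dots> \<le> ?S\<^sup>2 * (wt (real ?N) x * 1)" by (intro mult_left_mono wt_le_1 wt_nonneg) auto
      finally show "ennreal ((norm (a x))\<^sup>2) \<le> ennreal (?S\<^sup>2) * ennreal (wt (real ?N) x)"
        by (simp add: ennreal_mult[symmetric] ennreal_leI)
    qed
    also have "\<dots> = ennreal (?S\<^sup>2) * ennreal W" unfolding W(1)[symmetric] by (rule nn_integral_cmult) measurable
    finally show ?thesis using W(2) by (simp add: ennreal_mult)
  qed
  have i: "integrable lborel (\<lambda>x. v x * a x)" if a: "schwartz a" for a
    using fin order_le_less_trans[OF la[OF a], of \<infinity>] schwartz_measurable[OF a]
    by (intro nn_integral_mult_integrable) (auto simp: l2_def)
  have d: "distribution_of v a = (LINT x|lborel. v x * a x)" if "schwartz a" for a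
    unfolding distribution_of_def using schwartz_measurable[OF that] by (intro integral_lebesgue_borel) auto
  have "distribution_of v (\<lambda>x. a x + b x) = distribution_of v a + distribution_of v b" if "schwartz a" "schwartz b" for a b
  proof -
    note [measurable] = schwartz_measurable[OF that(1)] schwartz_measurable[OF that(2)]
    have "distribution_of v (\<lambda>x. a x + b x) = (LINT x|lborel. v x * a x + v x * b x)"
      unfolding distribution_of_def by (subst integral_lebesgue_borel) (measurable, simp add: distrib_left)
    then show ?thesis using i[OF that(1)] i[OF that(2)] by (simp add: d that)
  qed
  moreover have "distribution_of v (\<lambda>x. c * a x) = c * distribution_of v a" for a c
    unfolding distribution_of_def mult.left_commute[of _ c] by (rule integral_mult_right_zero)
  moreover have "norm (distribution_of v a) \<le> sqrt (L * W) * schwartz_seminorm ?N a" if a: "schwartz a" for a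
  proof -
    have "norm (LINT x|lborel. v x * a x) \<le> sqrt (L * ((schwartz_seminorm ?N a)\<^sup>2 * W))"
      using L W by (intro norm_integral_product_le v schwartz_measurable[OF a] la[OF a]) auto
    also have "\<dots> = sqrt (L * W) * schwartz_seminorm ?N a"
      using schwartz_seminorm_decay(2)[OF a, of ?N] by (simp add: real_sqrt_mult)
    finally show ?thesis unfolding d[OF a] .
  qed
  ultimately have "tempered_distribution (distribution_of v)" unfolding tempered_distribution_def by blast
  moreover have "integrable lebesgue (\<lambda>x. v x * a x)" if a: "schwartz a" for a
    using i[OF a] schwartz_measurable[OF a] by (subst integrable_completion) auto
  ultimately show ?thesis unfolding tempered_function_def by blast
qed

section \<open>Borel representatives\<close>

text \<open>No measurability is assumed. Completeness transfers it between the two functions, and if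
  both fail to be measurable, both integrals take the default value 0. So functionals built from
  integrals agree on all arguments, not only on Schwartz functions.\<close>

lemma lebesgue_cong_AE:
  fixes f g :: "'a::euclidean_space \<Rightarrow> complex"
  assumes ae: "AE x in lborel. f x = g x"
  shows "f \<in> borel_measurable lebesgue \<longleftrightarrow> g \<in> borel_measurable lebesgue"
    and "(LINT x|lebesgue. f x) = (LINT x|lebesgue. g x)"
    and "integrable lebesgue f \<longleftrightarrow> integrable lebesgue g"
proof -
  have aeL: "AE x in lebesgue. f x = g x" using ae by (rule AE_completion)
  have imp: "q \<in> borel_measurable lebesgue" if p: "p \<in> borel_measurable lebesgue" and pq: "AE x in lebesgue. p x = q x" for p q :: "'a \<Rightarrow> complex"
  proof (rule measurableI)
    fix A :: "complex set" assume A: "A \<in> sets borel"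
    obtain N where N: "N \<in> null_sets lebesgue" "\<And>x. x \<notin> N \<Longrightarrow> p x = q x"
      by (rule AE_E3[OF pq]) simp
    have eq: "q -` A = (p -` A - N) \<union> (q -` A \<inter> N)" by (auto simp: N(2))
    have 1: "p -` A - N \<in> sets lebesgue" using measurable_sets[OF p A] N(1) by (auto intro: sets.Diff)
    have 2: "q -` A \<inter> N \<in> sets lebesgue" by (rule completion.complete[OF _ N(1)]) auto
    show "q -` A \<inter> space lebesgue \<in> sets lebesgue" using sets.Un[OF 1 2] unfolding eq[symmetric] by simp
  qed simp
  have aeL': "AE x in lebesgue. g x = f x" using aeL by eventually_elim simp
  show m: "f \<in> borel_measurable lebesgue \<longleftrightarrow> g \<in> borel_measurable lebesgue" by (rule iffI, erule imp[OF _ aeL], erule imp[OF _ aeL'])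
  show i: "integrable lebesgue f \<longleftrightarrow> integrable lebesgue g"
  proof (cases "f \<in> borel_measurable lebesgue")
    case True
    then show ?thesis using m by (intro integrable_cong_AE aeL) auto
  qed (use m in \<open>auto dest: borel_measurable_integrable\<close>)
  show "(LINT x|lebesgue. f x) = (LINT x|lebesgue. g x)"
  proof (cases "f \<in> borel_measurable lebesgue")
    case True
    then show ?thesis using m by (intro Bochner_Integration.integral_cong_AE aeL) auto
  next
    case False
    then have "\<not> integrable lebesgue f" by (auto dest: borel_measurable_integrable)
    then show ?thesis using i by (simp add: not_integrable_integral_eq)
  qed
qed

lemma AE_lborel_affine:
  fixes t :: "'a::euclidean_space"
  assumes ae: "AE x in lborel. P x" and c: "c \<noteq> 0"
  shows "AE x in lborel. P (t + c *\<^sub>R x)"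
proof -
  obtain N where N: "N \<in> null_sets lborel" "\<And>x. x \<notin> N \<Longrightarrow> P x" by (rule AE_E3[OF ae]) simp
  have Nb[measurable]: "N \<in> sets borel" using N(1) by auto
  have "0 = (\<integral>\<^sup>+x. indicator N x \<partial>lborel)" using N(1) by (simp add: null_sets_def)
  also have "\<dots> = ennreal (\<bar>c\<bar> ^ DIM('a)) * (\<integral>\<^sup>+x. indicator N (t + c *\<^sub>R x) \<partial>lborel)"
    by (rule nn_integral_lborel_affine[OF _ c]) measurable
  finally have "(\<integral>\<^sup>+x. indicator N (t + c *\<^sub>R x) \<partial>lborel) = 0" using c by (auto simp: zero_ennreal_def[symmetric])
  then have "AE x in lborel. indicator N (t + c *\<^sub>R x) = (0 :: ennreal)" by (subst (asm) nn_integral_0_iff_AE) auto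
  then show ?thesis
  proof eventually_elim
    case (elim x)
    then have "t + c *\<^sub>R x \<notin> N" by (simp add: indicator_eq_0_iff)
    then show ?case by (rule N(2))
  qed
qed

lemma borel_representative:
  fixes f :: "'a::euclidean_space \<Rightarrow> complex"
  assumes f: "f \<in> borel_measurable lebesgue"
  shows "\<exists>g\<in>borel_measurable borel. AE x in lborel. f x = g x"
proof -
  have "(\<lambda>x. Re (f x)) \<in> borel_measurable lebesgue" "(\<lambda>x. Im (f x)) \<in> borel_measurable lebesgue"
    using f by measurable
  from this[THEN completion_ex_borel_measurable_real]
  obtain r i where r: "r \<in> borel_measurable lborel" "AE x in lborel. Re (f x) = r x"
    and i: "i \<in> borel_measurable lborel" "AE x in lborel. Im (f x) = i x" by blast
  show ?thesis
  proof (rule bexI)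
    show "AE x in lborel. f x = of_real (r x) + \<i> * of_real (i x)"
      using r(2) i(2) by eventually_elim (simp add: complex_eq_iff)
    show "(\<lambda>x. of_real (r x) + \<i> * of_real (i x)) \<in> borel_measurable borel" using r(1) i(1) by simp
  qed
qed

text \<open>A Borel representative may break the pointwise bound on a null set; setting it to 0
  there restores the bound everywhere, as lattice sums at individual points require.\<close>

lemma decaying_representative:
  fixes f :: "'a::euclidean_space \<Rightarrow> complex"
  assumes f: "f \<in> borel_measurable lebesgue" "\<And>x. norm (f x) \<le> C * wt p x" and C: "0 \<le> C"
  shows "\<exists>g. decaying C p g \<and> (AE x in lborel. f x = g x)"
proof -
  obtain g where g[measurable]: "g \<in> borel_measurable borel" and ae: "AE x in lborel. f x = g x"
    using borel_representative[OF f(1)] by blast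
  let ?g = "\<lambda>x. if norm (g x) \<le> C * wt p x then g x else 0"
  have "decaying C p ?g" unfolding decaying_def
  proof
    show "?g \<in> borel_measurable borel" by measurable
  qed (use C in auto)
  moreover have "AE x in lborel. f x = ?g x" using ae
  proof eventually_elim
    case (elim x)
    then show ?case using f(2)[of x] by simp
  qed
  ultimately show ?thesis by blast
qed

section \<open>Invariance under changes on null sets\<close>

lemma distribution_of_cong_AE:
  assumes "AE x in lborel. f x = g x"
  shows "distribution_of f = distribution_of g"
proof
  fix a
  have "AE x in lborel. f x * a x = g x * a x" using assms by eventually_elim simp
  then show "distribution_of f a = distribution_of g a" unfolding distribution_of_def by (rule lebesgue_cong_AE(2))
qed

lemma tempered_function_cong_AE:
  assumes "AE x in lborel. f x = g x" and "tempered_function g"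
  shows "tempered_function f"
proof -
  have "integrable lebesgue (\<lambda>x. f x * a x)" if "schwartz a" for a
  proof -
    have "AE x in lborel. f x * a x = g x * a x" using assms(1) by eventually_elim simp
    moreover have "integrable lebesgue (\<lambda>x. g x * a x)" using assms(2) that unfolding tempered_function_def by blast
    ultimately show ?thesis by (rule lebesgue_cong_AE(3)[THEN iffD2])
  qed
  then show ?thesis using assms unfolding tempered_function_def distribution_of_cong_AE[OF assms(1)] by blast
qed

lemma fourier_cong_AE:
  assumes "AE x in lborel. f x = g x"
  shows "fourier f = fourier g"
proof
  fix \<xi>
  have "AE x in lborel. f x * cis (- (x \<bullet> \<xi>)) = g x * cis (- (x \<bullet> \<xi>))" using assms by eventually_elim simp
  then show "fourier f \<xi> = fourier g \<xi>" unfolding fourier_def by (rule lebesgue_cong_AE(2))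
qed

text \<open>All lattice translates are needed at the same x; the exceptional sets form a countable
  union.\<close>

lemma AE_lattice:
  fixes f g :: "real ^ 'n \<Rightarrow> complex"
  assumes ae: "AE x in lborel. f x = g x" and h: "0 < h"
  shows "AE x in lborel. \<forall>n. f (x /\<^sub>R h - of_ivec n) = g (x /\<^sub>R h - of_ivec n)"
proof -
  have "AE x in lborel. f (- of_ivec n + inverse h *\<^sub>R x) = g (- of_ivec n + inverse h *\<^sub>R x)" for n
    using h by (intro AE_lborel_affine[OF ae]) auto
  then show ?thesis by (subst AE_all_countable) simp
qed

lemma sampling_cong_AE:
  fixes \<phi> \<phi>' u u' :: "real ^ 'n \<Rightarrow> complex"
  assumes \<phi>: "AE x in lborel. \<phi> x = \<phi>' x" and u: "AE x in lborel. u x = u' x" and h: "0 < h"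
  shows "sampling \<phi> h u = sampling \<phi>' h u'"
proof
  fix n
  have "AE x in lborel. u x * cnj (\<phi> (x /\<^sub>R h - of_ivec n)) = u' x * cnj (\<phi>' (x /\<^sub>R h - of_ivec n))"
    using AE_lattice[OF \<phi> h] u by eventually_elim simp
  then show "sampling \<phi> h u n = sampling \<phi>' h u' n" unfolding sampling_def by (simp add: lebesgue_cong_AE(2))
qed

lemma reconstruction_cong_AE:
  fixes \<psi> \<psi>' :: "real ^ 'n \<Rightarrow> complex"
  assumes \<psi>: "AE x in lborel. \<psi> x = \<psi>' x" and h: "0 < h"
  shows "AE x in lborel. reconstruction \<psi> h U x = reconstruction \<psi>' h U x"
  using AE_lattice[OF \<psi> h] by eventually_elim (simp add: reconstruction_def)

lemma bounded_in_L2_l2: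
  fixes u u' :: "nat \<Rightarrow> 'a::euclidean_space \<Rightarrow> complex"
  assumes b: "bounded_in_L2 u" and ae: "\<And>k. AE x in lborel. u k x = u' k x"
  shows "\<exists>B\<ge>0. \<forall>k. l2 (u' k) \<le> ennreal B"
proof -
  obtain B where B: "\<And>k. L2_norm (u k) \<le> B" and si: "\<And>k. square_integrable (u k)"
    using b unfolding bounded_in_L2_def by blast
  have "l2 (u' k) \<le> ennreal (B\<^sup>2)" for k
  proof -
    have "l2 (u' k) = (\<integral>\<^sup>+x. ennreal ((norm (u k x))\<^sup>2) \<partial>lborel)"
      unfolding l2_def by (rule nn_integral_cong_AE) (use ae[of k] in eventually_elim, simp)
    also have "\<dots> = (\<integral>\<^sup>+x. ennreal ((norm (u k x))\<^sup>2) \<partial>lebesgue)" by (rule nn_integral_completion[symmetric])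
    also have "\<dots> = ennreal (LINT x|lebesgue. (norm (u k x))\<^sup>2)"
      using si[of k] unfolding square_integrable_def by (intro nn_integral_eq_integral) auto
    also have "\<dots> = ennreal ((L2_norm (u k))\<^sup>2)"
      unfolding L2_norm_def by (subst real_sqrt_pow2) (auto intro!: Bochner_Integration.integral_nonneg)
    also have "\<dots> \<le> ennreal (B\<^sup>2)"
      using B[of k] unfolding L2_norm_def by (intro ennreal_leI power_mono) (auto intro!: Bochner_Integration.integral_nonneg)
    finally show ?thesis .
  qed
  then show ?thesis by (intro exI[of _ "B\<^sup>2"]) auto
qed

section \<open>Sampling and reconstruction in microscopic variables\<close>

lemma sampling_micro:
  fixes \<phi> u :: "real ^ 'n \<Rightarrow> complex"
  assumes [measurable]: "\<phi> \<in> borel_measurable borel" "u \<in> borel_measurable borel" and h: "0 < h"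
  shows "of_real (sqrt (h ^ CARD('n))) * sampling \<phi> h u n = conv (flip \<phi>) (micro h u) (of_ivec n)"
proof -
  have "(LINT x|lebesgue. u x * cnj (\<phi> (x /\<^sub>R h - of_ivec n))) = (LINT x|lborel. u x * cnj (\<phi> (x /\<^sub>R h - of_ivec n)))"
    by (rule integral_lebesgue_borel) measurable
  also have "\<dots> = of_real (h ^ CARD('n)) * (LINT x|lborel. u (h *\<^sub>R x) * cnj (\<phi> (x - of_ivec n)))"
    using integral_lborel_affine[of "\<lambda>x. u x * cnj (\<phi> (x /\<^sub>R h - of_ivec n))" h 0] h by simp
  finally have "sampling \<phi> h u n = (LINT x|lborel. u (h *\<^sub>R x) * cnj (\<phi> (x - of_ivec n)))"
    using h unfolding sampling_def by simp
  then have "of_real (sqrt (h ^ CARD('n))) * sampling \<phi> h u n = (LINT x|lborel. of_real (sqrt (h ^ CARD('n))) * (u (h *\<^sub>R x) * cnj (\<phi> (x - of_ivec n))))"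
    by (simp only: integral_mult_right_zero)
  then show ?thesis unfolding conv_flip micro_def by (simp add: mult_ac)
qed

text \<open>Holds at every point, since the lattice sums of \<psi> are bounded everywhere and the
  samples are bounded. Absolute summability identifies the unordered sum in
  \<open>reconstruction\<close> with the counting measure integral in
  \<open>samp_op\<close>.\<close>

lemma micro_reconstruction:
  fixes \<phi> \<psi> u :: "real ^ 'n \<Rightarrow> complex"
  assumes \<phi>: "lattice_bounded K \<phi>" and \<psi>: "lattice_bounded K \<psi>" and u[measurable]: "u \<in> borel_measurable borel" and fin: "l2 u < \<infinity>" and h: "0 < h"
  shows "micro h (reconstruction \<psi> h (sampling \<phi> h u)) = samp_op \<phi> \<psi> (micro h u)"
proof
  fix x
  note D = lattice_boundedD[OF \<phi>] and D' = lattice_boundedD[OF \<psi>]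
  let ?f = "\<lambda>n. \<psi> (x - of_ivec n) * conv (flip \<phi>) (micro h u) (of_ivec n)"
  have i: "integrable (count_space UNIV) ?f"
    using D'(3)[of x] fin by (intro samp_op_summable D(1,5) micro_measurable u) (auto simp: l2_micro h intro: order_le_less_trans)
  have "micro h (reconstruction \<psi> h (sampling \<phi> h u)) x = (\<Sum>\<^sub>\<infinity>n. of_real (sqrt (h ^ CARD('n))) * (sampling \<phi> h u n * \<psi> (x - of_ivec n)))"
    using h unfolding micro_def reconstruction_def by (simp add: infsum_cmult_right')
  also have "\<dots> = (\<Sum>\<^sub>\<infinity>n. ?f n)"
    unfolding mult.assoc[symmetric] sampling_micro[OF D(1) u h] by (simp only: mult.commute)
  also have "\<dots> = infsetsum ?f UNIV" using i by (intro infsetsum_infsum[symmetric]) (simp add: abs_summable_on_def)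
  also have "\<dots> = samp_op \<phi> \<psi> (micro h u) x" unfolding infsetsum_def samp_op_def ..
  finally show "micro h (reconstruction \<psi> h (sampling \<phi> h u)) x = samp_op \<phi> \<psi> (micro h u) x" .
qed

text \<open>Allows Borel measurability of the reconstruction to be read off from that of
  \<open>samp_op\<close>.\<close>

lemma micro_inverse:
  fixes u :: "'a::euclidean_space \<Rightarrow> complex"
  assumes h: "0 < h"
  shows "micro (inverse h) (micro h u) = u"
proof -
  have "sqrt (inverse h ^ DIM('a)) * sqrt (h ^ DIM('a)) = 1"
    using h by (simp add: real_sqrt_mult[symmetric] power_mult_distrib[symmetric])
  then have "complex_of_real (sqrt (inverse h ^ DIM('a))) * of_real (sqrt (h ^ DIM('a))) = 1"
    by (metis of_real_1 of_real_mult)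
  then show ?thesis using h unfolding micro_def[abs_def] by (simp add: mult.assoc[symmetric])
qed

theorem theorem1p3:
  fixes \<phi> \<psi> :: "real ^ 'n \<Rightarrow> complex"
    and C \<epsilon> :: real
    and h :: "nat \<Rightarrow> real"
    and u :: "nat \<Rightarrow> real ^ 'n \<Rightarrow> complex"
    and \<mu> :: "((real ^ 'n) \<times> (real ^ 'n)) measure"
  assumes "\<phi> \<in> borel_measurable lebesgue" and "\<psi> \<in> borel_measurable lebesgue"
    and "C > 0" and "\<epsilon> > 0"
    and "\<And>x. norm (\<phi> x) \<le> C * (1 + norm x) powr (- real CARD('n) - \<epsilon>)"
    and "\<And>x. norm (\<psi> x) \<le> C * (1 + norm x) powr (- real CARD('n) - \<epsilon>)"
    and "is_scale h"
    and "bounded_in_L2 u"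
    and "is_wigner_measure h u \<mu>"
    and "\<And>m n. m \<noteq> n \<Longrightarrow> mutually_singular (weighted_shift \<phi> \<mu> m) (weighted_shift \<phi> \<mu> n)"
  shows "is_wigner_measure h
    (\<lambda>k. reconstruction \<psi> (h k) (sampling \<phi> (h k) (u k))) (sampled_wigner_measure \<phi> \<psi> \<mu>)"
proof -
  define p where "p = real CARD('n) + \<epsilon>"
  have p: "real CARD('n) < p" using \<open>\<epsilon> > 0\<close> by (simp add: p_def)
  have w: "(1 + norm x) powr (- real CARD('n) - \<epsilon>) = wt p x" for x :: "real ^ 'n"
    unfolding wt_def p_def by simp
  have h0: "0 < h k" for k using \<open>is_scale h\<close> by (simp add: is_scale_def)
  \<comment> \<open>The data are only Lebesgue measurable. Borel representatives make product
    measurability available, and the steps below check that nothing in the statement sees the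
    change.\<close>
  obtain \<phi>' where \<phi>': "decaying C p \<phi>'" "AE x in lborel. \<phi> x = \<phi>' x"
    using decaying_representative[OF assms(1) assms(5)[unfolded w]] \<open>C > 0\<close> by auto
  obtain \<psi>' where \<psi>': "decaying C p \<psi>'" "AE x in lborel. \<psi> x = \<psi>' x"
    using decaying_representative[OF assms(2) assms(6)[unfolded w]] \<open>C > 0\<close> by auto
  have "\<exists>u'. \<forall>k. u' k \<in> borel_measurable borel \<and> (AE x in lborel. u k x = u' k x)"
    using \<open>bounded_in_L2 u\<close> borel_representative
    unfolding bounded_in_L2_def square_integrable_def by (intro choice) blast
  then obtain u' where u': "\<And>k. u' k \<in> borel_measurable borel" "\<And>k. AE x in lborel. u k x = u' k x" by blast
  note [measurable] = u'(1)
  obtain B where B: "0 \<le> B" "\<And>k. l2 (u' k) \<le> ennreal B"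
    using bounded_in_L2_l2[OF \<open>bounded_in_L2 u\<close> u'(2)] by blast
  have fin: "l2 (u' k) < \<infinity>" for k using B(2)[of k] by (auto intro: order_le_less_trans)
  \<comment> \<open>Fourier transforms ignore null sets, so the shifted measures are equal, and the
    singularity hypothesis carries over verbatim.\<close>
  have ws: "weighted_shift \<phi> \<mu> = weighted_shift \<phi>' \<mu>"
    unfolding weighted_shift_def[abs_def] fourier_cong_AE[OF \<phi>'(2)] ..
  have sm: "sampled_wigner_measure \<phi> \<psi> \<mu> = sampled_wigner_measure \<phi>' \<psi>' \<mu>"
    unfolding sampled_wigner_measure_def ws fourier_cong_AE[OF \<psi>'(2)] ..
  have \<mu>: "sets \<mu> = sets borel" using assms(9) by (simp add: is_wigner_measure_def radon_measure_def)
  have conv: "integrable \<mu> a \<and> (\<lambda>k. wigner_dist (h k) (distribution_of (u' k)) a) \<longlonglongrightarrow> (LINT z|\<mu>. a z)" if "schwartz a" for a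
    using assms(9) that unfolding is_wigner_measure_def distribution_of_cong_AE[OF u'(2)] by blast
  \<comment> \<open>The L2 bound on the sequence forces its Wigner measure to be finite.\<close>
  have fm: "finite_measure \<mu>" by (rule husimi_vague(1)[OF \<open>is_scale h\<close> u'(1) B(2,1) \<mu> conv])
  have lim: "(\<lambda>k. LINT z|lborel. b (macro (h k) z) * of_real ((norm (hus (h k) (micro (h k) (u' k)) z))\<^sup>2)) \<longlonglongrightarrow> (LINT z|\<mu>. b z)"
    if "vanishing b" for b
    by (rule husimi_vague(2)[OF \<open>is_scale h\<close> u'(1) B(2,1) \<mu> conv that])
  obtain K where K: "0 < K" "\<And>\<gamma>::real ^ 'n \<Rightarrow> complex. decaying C p \<gamma> \<Longrightarrow> lattice_bounded K \<gamma>"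
    using decaying_lattice_bounded[OF p \<open>C > 0\<close>] by blast
  note K\<phi> = K(2)[OF \<phi>'(1)] and K\<psi> = K(2)[OF \<psi>'(1)]
  note D\<phi> = lattice_boundedD[OF K\<phi>] and D\<psi> = lattice_boundedD[OF K\<psi>]
  note [measurable] = D\<phi>(1) D\<psi>(1)
  define v where "v k = reconstruction \<psi>' (h k) (sampling \<phi>' (h k) (u' k))" for k
  have mv: "micro (h k) (v k) = samp_op \<phi>' \<psi>' (micro (h k) (u' k))" for k
    unfolding v_def by (rule micro_reconstruction[OF K\<phi> K\<psi> u'(1) fin h0])
  have vm[measurable]: "v k \<in> borel_measurable borel" for k
  proof -
    have "micro (inverse (h k)) (samp_op \<phi>' \<psi>' (micro (h k) (u' k))) \<in> borel_measurable borel" by measurable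
    then show ?thesis unfolding mv[symmetric] micro_inverse[OF h0] .
  qed
  have lv: "l2 (v k) \<le> ennreal (K * K * (K * K * B))" for k
  proof -
    have "l2 (v k) = l2 (samp_op \<phi>' \<psi>' (micro (h k) (u' k)))"
      unfolding mv[symmetric] by (rule l2_micro[OF vm h0, symmetric])
    also have "\<dots> \<le> ennreal K * ennreal K * (ennreal K * ennreal K * l2 (micro (h k) (u' k)))"
      using D\<phi> D\<psi> by (intro samp_op_l2) auto
    also have "\<dots> \<le> ennreal K * ennreal K * (ennreal K * ennreal K * ennreal B)"
      unfolding l2_micro[OF u'(1) h0] by (intro mult_left_mono B) auto
    finally show ?thesis using K(1) B(1) by (simp add: ennreal_mult)
  qed
  have L0: "0 \<le> K * K * (K * K * B)" using K(1) B(1) by simp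
  \<comment> \<open>The samples agree exactly, being integrals; the reconstructed functions agree
    only almost everywhere, which suffices for the distributions they define.\<close>
  have ae: "AE x in lborel. reconstruction \<psi> (h k) (sampling \<phi> (h k) (u k)) x = v k x" for k
    unfolding v_def sampling_cong_AE[OF \<phi>'(2) u'(2) h0] by (rule reconstruction_cong_AE[OF \<psi>'(2) h0])
  have weight: "(\<integral>\<^sup>+z. ennreal (wt (real (Suc CARD('n))) (snd z)) \<partial>sampled_wigner_measure \<phi>' \<psi>' \<mu>) < \<infinity>"
    by (rule sampled_wigner_measure_weight[OF D\<phi>(6) D\<psi>(6) \<mu> fm]) simp
  show ?thesis
    unfolding is_wigner_measure_def sm
  proof (intro conjI allI impI)
    show "radon_measure (sampled_wigner_measure \<phi>' \<psi>' \<mu>)"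
      by (rule radon_measure_weight[OF _ weight]) simp
    show "tempered_function (reconstruction \<psi> (h k) (sampling \<phi> (h k) (u k)))" for k
      using lv[of k] by (intro tempered_function_cong_AE[OF ae] tempered_l2 vm) (auto intro: order_le_less_trans)
    fix a :: "(real ^ 'n) \<times> (real ^ 'n) \<Rightarrow> complex" assume a: "schwartz a"
    show "integrable (sampled_wigner_measure \<phi>' \<psi>' \<mu>) a"
      by (rule schwartz_integrable_weight[OF a _ weight]) simp
    let ?H = "\<lambda>k. LINT z|lborel. a (macro (h k) z) * of_real ((norm (hus (h k) (micro (h k) (v k)) z))\<^sup>2)"
    have "?H \<longlonglongrightarrow> (LINT z|sampled_wigner_measure \<phi>' \<psi>' \<mu>. a z)"
      unfolding mv
      by (rule husimi_samp_limit[OF \<phi>'(1) \<psi>'(1) \<open>C > 0\<close> p \<open>is_scale h\<close> u'(1) B(2,1) \<mu> fm lim assms(10)[unfolded ws] a])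
    moreover have "(\<lambda>k. ?H k - wigner_dist (h k) (distribution_of (v k)) a) \<longlonglongrightarrow> 0"
      by (rule husimi_wigner[OF a \<open>is_scale h\<close> vm lv L0])
    ultimately have "(\<lambda>k. ?H k - (?H k - wigner_dist (h k) (distribution_of (v k)) a)) \<longlonglongrightarrow> (LINT z|sampled_wigner_measure \<phi>' \<psi>' \<mu>. a z) - 0"
      by (rule tendsto_diff)
    then show "(\<lambda>k. wigner_dist (h k) (distribution_of (reconstruction \<psi> (h k) (sampling \<phi> (h k) (u k)))) a)
      \<longlonglongrightarrow> (LINT z|sampled_wigner_measure \<phi>' \<psi>' \<mu>. a z)"
      unfolding distribution_of_cong_AE[OF ae] by simp
  qed
qed

end
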